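(* Let $I=[-a,b]$ be a finite segment and let $h$ satisfy conditions (i) and (ii) stated in the context. Put $\alpha=\frac{2}{m+2}$. Then $$\left\|\mathfrak A_\varepsilon^{-1}-\mathbf Q_\varepsilon^{-1}\oplus\mathbf 0_{\mathcal L^\varepsilon}\right\|=O(\varepsilon^{3\alpha}),\qquad \varepsilon\to0,$$ where $\mathfrak A_\varepsilon$ is either of the operators $\mathfrak A_{\varepsilon,D}$ and $\mathfrak A_{\varepsilon,DN}$, and $\mathbf Q_\varepsilon=\mathbf Q_{\varepsilon,D}$ in the $D$-case and $\mathbf Q_\varepsilon=\mathbf Q_{\varepsilon,N}$ in the $DN$-case.
   Context: Let $I=[-a,b]$ be a finite segment with $a,b>0$ and $h:I\to(0,\infty)$ a continuous function. Conditions: (i) $x=0$ is the only point of global maximum of $h$ on $I$. (ii) $h$ is $C^1$ on $I\setminus\{0\}$, and in a neighborhood of $x=0$ it admits the expansion $h(x)=M-c_+x^m+O(x^{m+1})$ for $x>0$ and $h(x)=M-c_-|x|^m+O(|x|^{m+1})$ for $x<0$, where $M,c_+,c_->0$ and $m\ge1$ (so $M=h(0)$). For $\varepsilon>0$ let $\Omega_\varepsilon=\{(x,y): x\in I,\ 0<y<\varepsilon h(x)\}$. All function spaces are real. Let $H^{1,d}(\Omega_\varepsilon)=\{\psi\in H^1(\Omega_\varepsilon):\psi(x,0)=\psi(x,\varepsilon h(x))=0\}$ and $$\mathfrak a_\varepsilon[\psi]=\int_{\Omega_\varepsilon}\Bigl(|\nabla\psi|^2-\frac{\pi^2}{M^2\varepsilon^2}\psi^2\Bigr)dx\,dy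 .$$ $\mathfrak A_{\varepsilon,DN}$ is the self-adjoint operator on $L^2(\Omega_\varepsilon)$ generated by $\mathfrak a_\varepsilon$ on $H^{1,d}(\Omega_\varepsilon)$ (Dirichlet conditions at $y=0$ and $y=\varepsilon h(x)$, Neumann conditions at $x=-a$ and $x=b$), and $\mathfrak A_{\varepsilon,D}$ is the one generated by the restriction of $\mathfrak a_\varepsilon$ to functions vanishing also at $x=-a$ and $x=b$ (Dirichlet conditions on all of $\partial\Omega_\varepsilon$). Both act as $\psi\mapsto-\psi''_{xx}-\psi''_{yy}-\frac{\pi^2}{M^2\varepsilon^2}\psi$. $\mathcal L_\varepsilon\subset L^2(\Omega_\varepsilon)$ is the subspace of functions $$\psi_{\varepsilon,\chi}(x,y)=\chi(x)\sqrt{\frac{2}{\varepsilon h(x)}}\,\sin\frac{\pi y}{\varepsilon h(x)},\qquad \chi\in L^2(I),$$ and $\mathcal L^\varepsilon$ is its orthogonal complement in $L^2(\Omega_\varepsilon)$. The map $\Pi_\varepsilon:\chi\mapsto\psi_{\varepsilon,\chi}$ is an isometric isomorphism of $L^2(I)$ onto $\mathcal L_\varepsilon$, and any operator $\mathbf T$ on $\mathcal L_\varepsilon$ is identified with $\Pi_\varepsilon^{-1}\mathbf T\Pi_\varepsilon$ acting on $L^2(I)$. Thus $\mathbf Q_\varepsilon^{-1}\oplus\mathbf 0_{\mathcal L^\varepsilon}$ denotes the operator on $L^2(\Omega_\varepsilon)=\mathcal L_\varepsilon\oplus\mathcal L^\varepsilon$ equal to $\Pi_\varepsilon\mathbf Q_\varepsilon^{-1}\Pi_\varepsilon^{-1}$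 on $\mathcal L_\varepsilon$ and to zero on $\mathcal L^\varepsilon$. Let $$W_\varepsilon(x)=\frac{\pi^2}{\varepsilon^2}\Bigl(\frac1{h^2(x)}-\frac1{M^2}\Bigr)+\Bigl(\frac{\pi^2}{3}+\frac14\Bigr)\frac{h'(x)^2}{h^2(x)},\qquad \mathbf q_\varepsilon[\chi]=\int_I\bigl(\chi'(x)^2+W_\varepsilon(x)\chi^2(x)\bigr)dx .$$ The form $\mathbf q_\varepsilon$ is considered on $H^1(I)$, where it is positive definite and closed in $L^2(I)$, or on $H^{1,0}(I)=H^1_0(I)$, with the same properties. The corresponding self-adjoint operators on $L^2(I)$, acting as $\mathbf Q_\varepsilon\chi=-\chi''+W_\varepsilon\chi$, are denoted by $\mathbf Q_{\varepsilon,N}$ (form domain $H^1(I)$, Neumann conditions) and $\mathbf Q_{\varepsilon,D}$ (form domain $H^{1,0}(I)$, Dirichlet conditions).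
   Formalization: Conditions (i), (ii) alone do not make q_ε finite on H^1(I) (e.g. h=1-x²+|x|³sin(|x|^{-100}) near 0, where h' is not in L²); the formal statement adds the context's claim that q_ε is a finite form on H^1(I), i.e. that h' is in L²(I). *)

theory Defs
  imports "HOL-Analysis.Analysis" "HOL-Library.Landau_Symbols"
begin

section \<open>Square-integrable functions\<close>

text \<open>Elements of an $L^2$ space are represented by functions; two representatives are
  identified when they agree almost everywhere.\<close>

abbreviation leb :: "'a::euclidean_space set \<Rightarrow> 'a measure" where
  "leb S \<equiv> restrict_space lborel S"

definition L2 :: "'a measure \<Rightarrow> ('a \<Rightarrow> 'b::euclidean_space) set" where
  "L2 N = {f \<in> borel_measurable N. integrable N (\<lambda>x. (norm (f x))\<^sup>2)}"

definition l2_inner :: "'a measure \<Rightarrow> ('a \<Rightarrow> 'b::euclidean_space) \<Rightarrow> ('a \<Rightarrow> 'b) \<Rightarrow> real" where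
  "l2_inner N f g = (LINT x|N. f x \<bullet> g x)"

definition l2_norm :: "'a measure \<Rightarrow> ('a \<Rightarrow> 'b::euclidean_space) \<Rightarrow> real" where
  "l2_norm N f = sqrt (l2_inner N f f)"

definition orth_compl :: "'a measure \<Rightarrow> ('a \<Rightarrow> real) set \<Rightarrow> ('a \<Rightarrow> real) set" where
  "orth_compl N L = {g \<in> L2 N. \<forall>f\<in>L. l2_inner N g f = 0}"

text \<open>The operator norm on $L^2$; meaningful for bounded operators only.\<close>

definition op_norm :: "'a measure \<Rightarrow> (('a \<Rightarrow> real) \<Rightarrow> 'a \<Rightarrow> real) \<Rightarrow> real" where
  "op_norm N T = (SUP f\<in>{f \<in> L2 N. l2_norm N f \<le> 1}. l2_norm N (T f))"

section \<open>Sobolev spaces\<close>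

text \<open>Test functions are of class $C^1$ with compact support; they determine the same weak
  derivatives as $C^\infty$ ones. The set \<open>S\<close> need not be open: supports lie in its interior.\<close>

definition test_functions :: "'a::euclidean_space set \<Rightarrow> ('a \<Rightarrow> real) set" where
  "test_functions S = {\<phi>. (\<forall>x. \<phi> differentiable (at x)) \<and>
     (\<forall>v. continuous_on UNIV (\<lambda>x. frechet_derivative \<phi> (at x) v)) \<and>
     compact (closure {x. \<phi> x \<noteq> 0}) \<and> closure {x. \<phi> x \<noteq> 0} \<subseteq> interior S}"

definition is_weak_grad ::
    "'a::euclidean_space set \<Rightarrow> ('a \<Rightarrow> real) \<Rightarrow> ('a \<Rightarrow> 'a) \<Rightarrow> bool" where
  "is_weak_grad S u G \<longleftrightarrow> G \<in> L2 (leb S) \<and>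
     (\<forall>\<phi>\<in>test_functions S. \<forall>i\<in>Basis.
        (LINT x|leb S. u x * frechet_derivative \<phi> (at x) i) = - (LINT x|leb S. (G x \<bullet> i) * \<phi> x))"

definition H1 :: "'a::euclidean_space set \<Rightarrow> ('a \<Rightarrow> real) set" where
  "H1 S = {u \<in> L2 (leb S). \<exists>G. is_weak_grad S u G}"

definition weak_grad :: "'a::euclidean_space set \<Rightarrow> ('a \<Rightarrow> real) \<Rightarrow> 'a \<Rightarrow> 'a" where
  "weak_grad S u = (SOME G. is_weak_grad S u G)"

section \<open>Operators generated by quadratic forms\<close>

text \<open>The operator on $L^2$ associated with the symmetric bilinear form \<open>B\<close> on the
  form domain \<open>D\<close>, given by its graph: \<open>u\<close> lies in the operator domain and is mapped
  to \<open>f\<close> iff $B(u,v) = (f,v)$ for all $v$ in \<open>D\<close>.\<close>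

definition form_operator :: "'a measure \<Rightarrow> ('a \<Rightarrow> real) set \<Rightarrow>
    (('a \<Rightarrow> real) \<Rightarrow> ('a \<Rightarrow> real) \<Rightarrow> real) \<Rightarrow> (('a \<Rightarrow> real) \<times> ('a \<Rightarrow> real)) set" where
  "form_operator N D B = {(u, f). u \<in> D \<and> f \<in> L2 N \<and> (\<forall>v\<in>D. B u v = l2_inner N f v)}"

text \<open>For the graph \<open>A\<close> of a linear operator: it has an everywhere defined bounded inverse
  (the estimate forces injectivity up to null sets).\<close>

definition boundedly_invertible ::
    "'a measure \<Rightarrow> (('a \<Rightarrow> real) \<times> ('a \<Rightarrow> real)) set \<Rightarrow> bool" where
  "boundedly_invertible N A \<longleftrightarrow> (\<forall>f\<in>L2 N. \<exists>u. (u, f) \<in> A) \<and>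
     (\<exists>C. \<forall>(u, f)\<in>A. l2_norm N u \<le> C * l2_norm N f)"

definition op_inverse ::
    "(('a \<Rightarrow> real) \<times> ('a \<Rightarrow> real)) set \<Rightarrow> ('a \<Rightarrow> real) \<Rightarrow> 'a \<Rightarrow> real" where
  "op_inverse A f = (SOME u. (u, f) \<in> A)"

section \<open>The narrow strip\<close>

text \<open>\<open>Dir\<close>: Dirichlet conditions on the whole boundary; \<open>DirNeu\<close>: Dirichlet conditions at
  $y = 0$ and $y = \varepsilon h(x)$, Neumann conditions at $x = -a$ and $x = b$.\<close>

datatype bdry_cond = Dir | DirNeu

definition strip :: "real \<Rightarrow> real \<Rightarrow> (real \<Rightarrow> real) \<Rightarrow> real \<Rightarrow> (real \<times> real) set" where
  "strip a b h \<epsilon> = {(x, y). x \<in> {-a..b} \<and> 0 < y \<and> y < \<epsilon> * h x}"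

text \<open>Boundary values of $H^1$ functions are taken as limits along almost every line transversal
  to the boundary, for a suitable representative. On almost every such line an $H^1$ function agrees
  almost everywhere with an absolutely continuous one, so the limit does not depend on the
  representative for which it exists.\<close>

definition vanishes_bottom_top ::
    "real \<Rightarrow> real \<Rightarrow> (real \<Rightarrow> real) \<Rightarrow> real \<Rightarrow> (real \<times> real \<Rightarrow> real) \<Rightarrow> bool" where
  "vanishes_bottom_top a b h \<epsilon> \<psi> \<longleftrightarrow>
     (\<exists>\<psi>'. (AE p in leb (strip a b h \<epsilon>). \<psi>' p = \<psi> p) \<and>
        (AE x in leb {-a..b}. ((\<lambda>y. \<psi>' (x, y)) \<longlongrightarrow> 0) (at_right 0) \<and>
                              ((\<lambda>y. \<psi>' (x, y)) \<longlongrightarrow> 0) (at_left (\<epsilon> * h x))))"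

definition vanishes_sides ::
    "real \<Rightarrow> real \<Rightarrow> (real \<Rightarrow> real) \<Rightarrow> real \<Rightarrow> (real \<times> real \<Rightarrow> real) \<Rightarrow> bool" where
  "vanishes_sides a b h \<epsilon> \<psi> \<longleftrightarrow>
     (\<exists>\<psi>'. (AE p in leb (strip a b h \<epsilon>). \<psi>' p = \<psi> p) \<and>
        (AE y in leb {0<..<\<epsilon> * h (-a)}. ((\<lambda>x. \<psi>' (x, y)) \<longlongrightarrow> 0) (at_right (-a))) \<and>
        (AE y in leb {0<..<\<epsilon> * h b}. ((\<lambda>x. \<psi>' (x, y)) \<longlongrightarrow> 0) (at_left b)))"

fun strip_domain ::
    "bdry_cond \<Rightarrow> real \<Rightarrow> real \<Rightarrow> (real \<Rightarrow> real) \<Rightarrow> real \<Rightarrow> (real \<times> real \<Rightarrow> real) set" where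
  "strip_domain DirNeu a b h \<epsilon> = {\<psi> \<in> H1 (strip a b h \<epsilon>). vanishes_bottom_top a b h \<epsilon> \<psi>}"
| "strip_domain Dir a b h \<epsilon> =
     {\<psi> \<in> H1 (strip a b h \<epsilon>). vanishes_bottom_top a b h \<epsilon> \<psi> \<and> vanishes_sides a b h \<epsilon> \<psi>}"

definition strip_form :: "real \<Rightarrow> real \<Rightarrow> (real \<Rightarrow> real) \<Rightarrow> real \<Rightarrow> real \<Rightarrow>
    (real \<times> real \<Rightarrow> real) \<Rightarrow> (real \<times> real \<Rightarrow> real) \<Rightarrow> real" where
  "strip_form a b h M \<epsilon> u v = (LINT p|leb (strip a b h \<epsilon>).
     weak_grad (strip a b h \<epsilon>) u p \<bullet> weak_grad (strip a b h \<epsilon>) v p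
       - pi\<^sup>2 / (M\<^sup>2 * \<epsilon>\<^sup>2) * (u p * v p))"

definition strip_operator :: "bdry_cond \<Rightarrow> real \<Rightarrow> real \<Rightarrow> (real \<Rightarrow> real) \<Rightarrow> real \<Rightarrow> real \<Rightarrow>
    ((real \<times> real \<Rightarrow> real) \<times> (real \<times> real \<Rightarrow> real)) set" where
  "strip_operator bc a b h M \<epsilon> =
     form_operator (leb (strip a b h \<epsilon>)) (strip_domain bc a b h \<epsilon>) (strip_form a b h M \<epsilon>)"

section \<open>The one-dimensional operators\<close>

definition potential ::
    "(real \<Rightarrow> real) \<Rightarrow> (real \<Rightarrow> real) \<Rightarrow> real \<Rightarrow> real \<Rightarrow> real \<Rightarrow> real" where
  "potential h h' M \<epsilon> x =
     pi\<^sup>2 / \<epsilon>\<^sup>2 * (1 / (h x)\<^sup>2 - 1 / M\<^sup>2) + (pi\<^sup>2 / 3 + 1 / 4) * ((h' x)\<^sup>2 / (h x)\<^sup>2)"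

fun interval_domain :: "bdry_cond \<Rightarrow> real \<Rightarrow> real \<Rightarrow> (real \<Rightarrow> real) set" where
  "interval_domain DirNeu a b = H1 {-a..b}"
| "interval_domain Dir a b = {\<xi> \<in> H1 {-a..b}. \<exists>\<xi>'. (AE x in leb {-a..b}. \<xi>' x = \<xi> x) \<and>
     continuous_on {-a..b} \<xi>' \<and> \<xi>' (-a) = 0 \<and> \<xi>' b = 0}"

definition interval_form :: "real \<Rightarrow> real \<Rightarrow> (real \<Rightarrow> real) \<Rightarrow> (real \<Rightarrow> real) \<Rightarrow> real \<Rightarrow> real \<Rightarrow>
    (real \<Rightarrow> real) \<Rightarrow> (real \<Rightarrow> real) \<Rightarrow> real" where
  "interval_form a b h h' M \<epsilon> u v = (LINT x|leb {-a..b}.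
     weak_grad {-a..b} u x * weak_grad {-a..b} v x + potential h h' M \<epsilon> x * (u x * v x))"

definition interval_operator :: "bdry_cond \<Rightarrow> real \<Rightarrow> real \<Rightarrow> (real \<Rightarrow> real) \<Rightarrow> (real \<Rightarrow> real) \<Rightarrow>
    real \<Rightarrow> real \<Rightarrow> ((real \<Rightarrow> real) \<times> (real \<Rightarrow> real)) set" where
  "interval_operator bc a b h h' M \<epsilon> =
     form_operator (leb {-a..b}) (interval_domain bc a b) (interval_form a b h h' M \<epsilon>)"

section \<open>The identification of the subspace of first transversal modes with \<open>L2\<close> of the interval\<close>

definition mode_lift :: "(real \<Rightarrow> real) \<Rightarrow> real \<Rightarrow> (real \<Rightarrow> real) \<Rightarrow> real \<times> real \<Rightarrow> real" where
  "mode_lift h \<epsilon> \<xi> = (\<lambda>(x, y). \<xi> x * sqrt (2 / (\<epsilon> * h x)) * sin (pi * y / (\<epsilon> * h x)))"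

definition mode_space ::
    "real \<Rightarrow> real \<Rightarrow> (real \<Rightarrow> real) \<Rightarrow> real \<Rightarrow> (real \<times> real \<Rightarrow> real) set" where
  "mode_space a b h \<epsilon> = mode_lift h \<epsilon> ` L2 (leb {-a..b})"

text \<open>The function \<open>\<xi>\<close> in the orthogonal decomposition of \<open>f\<close> into \<open>mode_lift h \<epsilon> \<xi>\<close> and
  an element of the orthogonal complement of the mode space.\<close>

definition mode_component ::
    "real \<Rightarrow> real \<Rightarrow> (real \<Rightarrow> real) \<Rightarrow> real \<Rightarrow> (real \<times> real \<Rightarrow> real) \<Rightarrow> real \<Rightarrow> real" where
  "mode_component a b h \<epsilon> f = (SOME \<xi>. \<xi> \<in> L2 (leb {-a..b}) \<and>
     (\<lambda>p. f p - mode_lift h \<epsilon> \<xi> p) \<in> orth_compl (leb (strip a b h \<epsilon>)) (mode_space a b h \<epsilon>))"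

text \<open>The direct sum of \<open>T\<close>, transplanted to the mode space, and of zero on its orthogonal
  complement.\<close>

definition oplus_zero :: "real \<Rightarrow> real \<Rightarrow> (real \<Rightarrow> real) \<Rightarrow> real \<Rightarrow>
    ((real \<Rightarrow> real) \<Rightarrow> real \<Rightarrow> real) \<Rightarrow> (real \<times> real \<Rightarrow> real) \<Rightarrow> real \<times> real \<Rightarrow> real" where
  "oplus_zero a b h \<epsilon> T f = mode_lift h \<epsilon> (T (mode_component a b h \<epsilon> f))"

end

theory Submission
 imports Defs
begin

text \<open>
Write $\rho = \varepsilon^\alpha$, so that $\rho^2\rho^m = \varepsilon^2$. This is the length on which the kinetic
energy $\rho^{-2}$ and the potential $\varepsilon^{-2}|x|^m$ balance.

A function in the form domain of the strip is split, section by section, into a multiple $\xi(x)$ of the first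
transversal mode and a remainder \<open>u\<close> orthogonal to the mode. Three facts about this splitting give the rate.
\<^item> On the mode space the form of the strip is exactly the one-dimensional form
 (\<open>strip_form_lift_lift\<close>), and this form is at least $c\rho^{-2}\|\xi\|^2$
 (\<open>interval_form_scaled_lower_bound\<close>).
\<^item> On the complement the second transversal eigenvalue, four times the first, leaves the energy at
 least $c\varepsilon^{-2}\|u\|^2$ (\<open>complement_gap\<close>); as $m\ge1$ one has $\varepsilon\le\rho^{3/2}$.
\<^item> The coupling of the two parts is at most $C\rho^{1/2}$ times the square roots of the two energies
 (\<open>cross_le\<close>). Every term of it contains $h'/h$, which is only known to be square integrable, and a
 factor without derivative along the strip. A one-dimensional Sobolev inequality bounds that factor
 pointwise by the geometric mean of its norm and the norm of its derivative, and the norm is by the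
 first two facts smaller than the root of the energy by the factor $\rho$.

Let \<open>q\<close> and \<open>A\<close> be the forms on the interval and on the strip. If \<open>w\<close> solves the problem in the strip with right-hand side \<open>F\<close>, the energies of its two parts have roots
$O(\rho)\|F\|$ and $O(\rho^{3/2})\|F\|$. The difference \<open>e\<close> of $\xi$ and the one-dimensional solution for the mode
component of \<open>F\<close> satisfies $q(e,e) = -A(u,e)$: the sources cancel and only the coupling remains. Hence the root
of its energy is $O(\rho^2)\|F\|$ and its norm $O(\rho^3)\|F\|$, while the norm of \<open>u\<close> is
$O(\varepsilon\rho^{3/2})\|F\| = O(\rho^3)\|F\|$ (\<open>resolvent_difference\<close>). The same facts make the form of
the strip coercive, so that its operator is invertible.

What remains is analytic groundwork. Boundary values are prescribed as limits along almost every line,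
which is not visibly a closed condition. It is equivalent to the weak differentiability of the extension by
zero in the direction of the line, which passes to limits (\<open>weak_dy\<close>, \<open>dirichlet_identities_iff\<close>).
Differentiating the mode component needs more: the extension by zero across the curved boundary must be
weakly differentiable along the strip as well, although \<open>h\<close> need be neither Lipschitz nor differentiable at its
maximum (\<open>weak_dx_zero_extension\<close>). The passage between weak derivatives and sections rests on
\<open>weak_derivative_imp_ac_on_lines\<close>. Square integrability of $h'$ is what finiteness of the
one-dimensional form says for the constant function.
\<close>

type_synonym line_fun = "real \<Rightarrow> real"
type_synonym plane_fun = "real \<times> real \<Rightarrow> real"
abbreviation tens :: "line_fun => line_fun => plane_fun" where
 "tens f g z \<equiv> f (fst z) * g (snd z)"

text \<open>The unqualified names of these two facts belong to the Henstock--Kurzweil integral.\<close>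

lemmas integral_cong_fun = Bochner_Integration.integral_cong
lemmas integrable_dominated = Bochner_Integration.integrable_bound

section \<open>The space \<open>L2\<close>\<close>

lemma L2_D: "f \<in> L2 N ==> f \<in> borel_measurable N" "f \<in> L2 N ==> integrable N (%x. (norm (f x))^2)"
 by (auto simp: L2_def)

lemma integrable_inner_L2:
 fixes f g :: "'a => 'b::euclidean_space"
 assumes "f \<in> L2 N" "g \<in> L2 N"
 shows "integrable N (%x. f x \<bullet> g x)"
proof (rule integrable_dominated)
 show "integrable N (%x. (norm (f x))^2 + (norm (g x))^2)"
  using assms by (auto simp: L2_def)
 show "(%x. f x \<bullet> g x) \<in> borel_measurable N"
  using assms by (auto simp: L2_def)
 have "\<bar>f x \<bullet> g x\<bar> \<le> (norm (f x))^2 + (norm (g x))^2" for x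
 proof -
  have "\<bar>f x \<bullet> g x\<bar> \<le> norm (f x) * norm (g x)" by (rule Cauchy_Schwarz_ineq2)
  also have "... \<le> (norm (f x))^2 + (norm (g x))^2"
   using sum_squares_bound[of "norm (f x)" "norm (g x)"]
   mult_nonneg_nonneg[OF norm_ge_zero[of "f x"] norm_ge_zero[of "g x"]] by linarith
  finally show ?thesis .
 qed
 then show "AE x in N. norm (f x \<bullet> g x) \<le> norm ((norm (f x))^2 + (norm (g x))^2)"
  by auto
qed

lemma integrable_mult_L2:
 fixes f g :: "'a => real"
 assumes "f \<in> L2 N" "g \<in> L2 N"
 shows "integrable N (%x. f x * g x)"
 using integrable_inner_L2[OF assms] by simp

lemma L2_add:
 assumes "f \<in> L2 N" "g \<in> L2 N"
 shows "(%x. f x + g x) \<in> L2 N"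
proof -
 have "integrable N (%x. (norm (f x))^2 + 2 * (f x \<bullet> g x) + (norm (g x))^2)"
  using assms integrable_inner_L2[OF assms] by (auto simp: L2_def)
 moreover have "(%x. (norm (f x))^2 + 2 * (f x \<bullet> g x) + (norm (g x))^2)
   = (%x. (norm (f x + g x))^2)"
  by (auto simp: power2_norm_eq_inner algebra_simps inner_commute)
 ultimately show ?thesis using assms by (auto simp: L2_def)
qed

lemma L2_scale: "f \<in> L2 N ==> (%x. c *\<^sub>R f x) \<in> L2 N"
 by (auto simp: L2_def power_mult_distrib)

lemma L2_scale_real: "f \<in> L2 N ==> (%x. c * f x) \<in> L2 N" for f :: "'a => real"
 using L2_scale[of f N c] by simp

lemma L2_diff: "f \<in> L2 N ==> g \<in> L2 N ==> (%x. f x - g x) \<in> L2 N"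
 using L2_add[of f N "%x. (-1) *\<^sub>R g x"] L2_scale[of g N "-1"] by simp

lemma L2_zero: "(%x. 0) \<in> L2 N"
 by (auto simp: L2_def)

lemma L2_dominated:
 assumes "f \<in> L2 N" "g \<in> borel_measurable N" "AE x in N. norm (g x) \<le> norm (f x)"
 shows "g \<in> L2 N"
proof -
 have "AE x in N. norm ((norm (g x))^2) \<le> norm ((norm (f x))^2)"
  using assms(3) by (rule eventually_mono) (auto intro!: power_mono)
 then have "integrable N (%x. (norm (g x))^2)"
  by (rule integrable_dominated[rotated 2]) (use assms in \<open>auto simp: L2_def\<close>)
 with assms show ?thesis by (auto simp: L2_def)
qed

lemma L2_cong_AE:
 assumes "f \<in> L2 N" "g \<in> borel_measurable N" "AE x in N. g x = f x"
 shows "g \<in> L2 N"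
 by (rule L2_dominated[OF assms(1,2)], rule eventually_mono[OF assms(3)]) simp

lemma l2_inner_commute: "l2_inner N f g = l2_inner N g f"
 by (simp add: l2_inner_def inner_commute)

lemma l2_inner_add_left:
 "f \<in> L2 N ==> g \<in> L2 N ==> k \<in> L2 N ==>
  l2_inner N (%x. f x + g x) k = l2_inner N f k + l2_inner N g k"
 by (simp add: l2_inner_def inner_add_left integrable_inner_L2)

lemma l2_inner_diff_left:
 "f \<in> L2 N ==> g \<in> L2 N ==> k \<in> L2 N ==>
  l2_inner N (%x. f x - g x) k = l2_inner N f k - l2_inner N g k"
 by (simp add: l2_inner_def inner_diff_left integrable_inner_L2)

lemma l2_inner_add_right:
 "f \<in> L2 N ==> g \<in> L2 N ==> k \<in> L2 N ==>
  l2_inner N k (%x. f x + g x) = l2_inner N k f + l2_inner N k g"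
 by (simp add: l2_inner_def inner_add_right integrable_inner_L2)

lemma l2_inner_scale_right:
 "l2_inner N f (%x. c *\<^sub>R g x) = c * l2_inner N f g"
 by (simp add: l2_inner_def)

lemma l2_inner_scale_real_right:
 fixes f g :: "'a => real"
 shows "l2_inner N f (%x. c * g x) = c * l2_inner N f g"
 using l2_inner_scale_right[of N f c g] by simp

lemma l2_inner_self: "l2_inner N f f = (LINT x|N. (norm (f x))^2)"
 by (simp add: l2_inner_def power2_norm_eq_inner)

lemma l2_inner_self_nonneg: "0 \<le> l2_inner N f f"
 by (simp add: l2_inner_self)

lemma l2_norm_nonneg: "0 \<le> l2_norm N f"
 by (simp add: l2_norm_def l2_inner_self_nonneg)

lemma l2_norm_power2: "(l2_norm N f)^2 = l2_inner N f f"
 by (simp add: l2_norm_def l2_inner_self_nonneg)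

text \<open>A quadratic polynomial that is nonnegative on the line has nonpositive discriminant.
 This turns positivity of a form into its Cauchy--Schwarz inequality.\<close>

lemma discriminant_le:
 fixes p q r :: real
 assumes "\<And>t. 0 \<le> p + 2 * t * q + t^2 * r"
 shows "q^2 \<le> p * r"
proof (cases "r = 0")
 case True
 show ?thesis
 proof (cases "q = 0")
  case False
  have "0 \<le> p + 2 * (-(p + 1) / (2 * q)) * q" using assms[of "-(p + 1) / (2 * q)"] True by simp
  with False show ?thesis by (simp add: field_simps)
 qed (simp add: True)
next
 case False
 have "r \<ge> 0"
 proof (rule ccontr)
  assume "\<not> r \<ge> 0"
  then have "r < 0" by simp
  define t where "t = \<bar>p / r\<bar> + 2 * \<bar>q / r\<bar> + 1"
  have t1: "t \<ge> 1" "t > \<bar>p / r\<bar> + 2 * \<bar>q / r\<bar>" by (auto simp: t_def)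
  have "p + 2 * t * q + t^2 * r = r * (p / r + 2 * t * (q / r) + t^2)"
   using \<open>r < 0\<close> by (simp add: field_simps)
  moreover have "p / r + 2 * t * (q / r) + t^2 > 0"
  proof -
   have "2 * t * (q / r) \<ge> - (2 * t * \<bar>q / r\<bar>)"
    using t1 by (smt (verit) abs_le_iff mult_left_mono mult_minus_right abs_ge_minus_self)
   moreover have "p / r \<ge> - (t * \<bar>p / r\<bar>)"
    using t1 by (smt (verit) abs_ge_minus_self mult_right_mono mult_cancel_right1 abs_ge_zero)
   moreover have "t^2 > t * (\<bar>p / r\<bar> + 2 * \<bar>q / r\<bar>)"
    using t1 by (auto simp: power2_eq_square)
   ultimately show ?thesis by (simp add: algebra_simps)
  qed
  ultimately have "p + 2 * t * q + t^2 * r < 0" using \<open>r < 0\<close> by (simp add: mult_neg_pos)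
  with assms[of t] show False by simp
 qed
 with False have "r > 0" by simp
 have "0 \<le> p + 2 * (-q / r) * q + (-q / r)^2 * r" by (rule assms)
 also have "... = p - q^2 / r" using \<open>r > 0\<close> by (simp add: field_simps power2_eq_square)
 finally show ?thesis using \<open>r > 0\<close> by (simp add: field_simps)
qed

text \<open>Estimates from Cauchy--Schwarz bound squares; this form is convenient for passing to limits.\<close>

lemma tendsto_zero_of_square_le:
 fixes x y :: "nat => real"
 assumes "\<And>n. (x n)^2 \<le> y n" "y \<longlonglongrightarrow> 0"
 shows "x \<longlonglongrightarrow> 0"
proof (rule Lim_null_comparison)
 show "\<forall>\<^sub>F n in sequentially. norm (x n) \<le> sqrt (y n)"
  using real_sqrt_le_mono[OF assms(1)] by simp
 show "(%n. sqrt (y n)) \<longlonglongrightarrow> 0" using tendsto_real_sqrt[OF assms(2)] by simp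
qed

lemma l2_Cauchy_Schwarz:
 assumes "f \<in> L2 N" "g \<in> L2 N"
 shows "\<bar>l2_inner N f g\<bar> \<le> l2_norm N f * l2_norm N g"
proof -
 have "(l2_inner N f g)^2 \<le> l2_inner N f f * l2_inner N g g"
 proof (rule discriminant_le)
  fix t
  let ?k = "%x. f x + t *\<^sub>R g x"
  note S = L2_scale[OF assms(2), of t]
  have k: "?k \<in> L2 N" by (rule L2_add[OF assms(1) S])
  have "0 \<le> l2_inner N ?k ?k" by (rule l2_inner_self_nonneg)
  also have "l2_inner N ?k ?k = l2_inner N f ?k + l2_inner N (%x. t *\<^sub>R g x) ?k"
   by (rule l2_inner_add_left[OF assms(1) S k])
  also have "... = l2_inner N f f + l2_inner N f (%x. t *\<^sub>R g x)
    + (l2_inner N (%x. t *\<^sub>R g x) f + l2_inner N (%x. t *\<^sub>R g x) (%x. t *\<^sub>R g x))"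
   by (simp only: l2_inner_add_right[OF assms(1) S assms(1)] l2_inner_add_right[OF assms(1) S S])
  also have "... = l2_inner N f f + 2 * t * l2_inner N f g + t^2 * l2_inner N g g"
   by (simp add: l2_inner_scale_right l2_inner_commute[of N "%x. t *\<^sub>R g x"] power2_eq_square
     l2_inner_commute[of N g f])
  finally show "0 \<le> l2_inner N f f + 2 * t * l2_inner N f g + t^2 * l2_inner N g g" .
 qed
 then have "sqrt ((l2_inner N f g)^2) \<le> sqrt (l2_inner N f f * l2_inner N g g)"
  by (rule real_sqrt_le_mono)
 then show ?thesis by (simp add: l2_norm_def real_sqrt_mult)
qed

lemma l2_norm_add:
 assumes "f \<in> L2 N" "g \<in> L2 N"
 shows "l2_norm N (%x. f x + g x) \<le> l2_norm N f + l2_norm N g"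
proof (rule power2_le_imp_le)
 have "(l2_norm N (%x. f x + g x))^2
   = (l2_norm N f)^2 + 2 * l2_inner N f g + (l2_norm N g)^2"
  using assms L2_add[OF assms] unfolding l2_norm_power2
  by (simp add: l2_inner_add_left l2_inner_add_right l2_inner_commute[of N g f])
 also have "... \<le> (l2_norm N f + l2_norm N g)^2"
  using l2_Cauchy_Schwarz[OF assms] by (simp add: power2_sum)
 finally show "(l2_norm N (%x. f x + g x))^2 \<le> (l2_norm N f + l2_norm N g)^2" .
qed (simp add: l2_norm_nonneg)

lemma l2_norm_cong_AE:
 assumes "AE x in N. f x = g x" "f \<in> borel_measurable N" "g \<in> borel_measurable N"
 shows "l2_norm N f = l2_norm N g"
 unfolding l2_norm_def l2_inner_self
 by (rule arg_cong[where f = sqrt], rule integral_cong_AE)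
   (use assms(2,3) in \<open>simp_all add: eventually_mono[OF assms(1)]\<close>)

lemma integral_mult_le_l2:
 fixes f g :: "'a => real"
 assumes "f \<in> L2 N" "g \<in> L2 N"
 shows "(LINT x|N. \<bar>f x * g x\<bar>) \<le> sqrt (LINT x|N. (f x)^2) * sqrt (LINT x|N. (g x)^2)"
proof -
 have "(%x. \<bar>f x\<bar>) \<in> L2 N" "(%x. \<bar>g x\<bar>) \<in> L2 N" using assms by (auto simp: L2_def)
 from l2_Cauchy_Schwarz[OF this] show ?thesis
  by (simp add: l2_norm_def l2_inner_self l2_inner_def abs_mult)
qed

text \<open>The Riesz--Fischer theorem. A subsequence with increments below $4^{-k}$ in the square of
 the norm has almost everywhere summable increments, because the series of the squared
 increments, weighted with $2^k$, is integrable.\<close>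

lemma L2_complete:
 fixes f :: "nat => 'a => 'b::euclidean_space"
 assumes L2: "\<And>n. f n \<in> L2 N"
  and Cauchy: "\<And>e. e > 0 ==> \<exists>n0. \<forall>m\<ge>n0. \<forall>n\<ge>n0. l2_norm N (%x. f m x - f n x) < e"
 shows "\<exists>g\<in>L2 N. (%n. l2_norm N (%x. f n x - g x)) \<longlonglongrightarrow> 0"
proof -
 have nn: "(\<integral>\<^sup>+x. ennreal ((norm (f m x - f n x))^2) \<partial>N) = ennreal ((l2_norm N (%x. f m x - f n x))^2)"
  for m n
  unfolding l2_norm_power2 l2_inner_self
  by (rule nn_integral_eq_integral) (use L2_diff[OF L2[of m] L2[of n]] in \<open>auto simp: L2_def\<close>)
 have "\<exists>n0. \<forall>m\<ge>n0. \<forall>n\<ge>n0. l2_norm N (%x. f m x - f n x) < (1/2) ^ k" for k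
  by (rule Cauchy) simp
 then obtain r0 where r0: "\<And>k m n. m \<ge> r0 k ==> n \<ge> r0 k ==> l2_norm N (%x. f m x - f n x) < (1/2) ^ k"
  by metis
 \<comment> \<open>beyond \<open>r k\<close> the thresholds of all \<open>j \<le> k\<close> are passed\<close>
 define r where "r k = Max (r0 ` {..k}) + k" for k
 have rr0: "r0 j \<le> r k" if "j \<le> k" for j k
 proof -
  have "r0 j \<le> Max (r0 ` {..k})" by (rule Max_ge) (use that in auto)
  then show ?thesis by (simp add: r_def)
 qed
 have rk: "k \<le> r k" for k by (simp add: r_def)
 define g where "g k = f (r k)" for k
 define d where "d k x = (norm (g (Suc k) x - g k x))^2" for k x
 have [measurable]: "f n \<in> borel_measurable N" for n using L2[of n] by (rule L2_D)
 have [measurable]: "g n \<in> borel_measurable N" for n by (simp add: g_def)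
 have [measurable]: "d n \<in> borel_measurable N" for n unfolding d_def by measurable
 have dint: "(\<integral>\<^sup>+x. ennreal (2 ^ k * d k x) \<partial>N) \<le> ennreal ((1/2) ^ k)" for k
 proof -
  have "(\<integral>\<^sup>+x. ennreal (2 ^ k * d k x) \<partial>N) = ennreal (2 ^ k) * (\<integral>\<^sup>+x. ennreal (d k x) \<partial>N)"
   by (simp add: ennreal_mult d_def nn_integral_cmult)
  also have "(\<integral>\<^sup>+x. ennreal (d k x) \<partial>N) = ennreal ((l2_norm N (%x. g (Suc k) x - g k x))^2)"
   unfolding d_def g_def by (rule nn)
  also have "... \<le> ennreal (((1/2) ^ k)^2)"
  proof (rule ennreal_leI, rule power_mono)
   have "l2_norm N (%x. f (r (Suc k)) x - f (r k) x) < (1/2) ^ k"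
    by (rule r0) (simp_all add: rr0)
   then show "l2_norm N (%x. g (Suc k) x - g k x) \<le> (1/2) ^ k" by (simp add: g_def)
  qed (rule l2_norm_nonneg)
  finally have "(\<integral>\<^sup>+x. ennreal (2 ^ k * d k x) \<partial>N) \<le> ennreal (2 ^ k) * ennreal (((1/2) ^ k)^2)"
   by (simp add: mult_left_mono)
  also have "... = ennreal ((1/2) ^ k)"
   by (simp add: ennreal_mult[symmetric] power2_eq_square power_one_over)
  finally show ?thesis .
 qed
 have "(\<integral>\<^sup>+x. (\<Sum>k. ennreal (2 ^ k * d k x)) \<partial>N) = (\<Sum>k. \<integral>\<^sup>+x. ennreal (2 ^ k * d k x) \<partial>N)"
  by (rule nn_integral_suminf) measurable
 also have "... \<le> (\<Sum>k. ennreal ((1/2) ^ k))"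
  by (rule suminf_le) (auto intro: dint)
 also have "... = ennreal (\<Sum>k. (1/2) ^ k)"
  by (rule suminf_ennreal2) (auto intro: summable_geometric)
 finally have "(\<integral>\<^sup>+x. (\<Sum>k. ennreal (2 ^ k * d k x)) \<partial>N) \<noteq> \<infinity>"
  by (auto simp: top_unique)
 then have "AE x in N. (\<Sum>k. ennreal (2 ^ k * d k x)) \<noteq> \<infinity>"
  by (intro nn_integral_PInf_AE) auto
 then have conv: "AE x in N. convergent (%k. g k x)"
 proof (rule eventually_mono)
  fix x assume "(\<Sum>k. ennreal (2 ^ k * d k x)) \<noteq> \<infinity>"
  then have "summable (%k. 2 ^ k * d k x)"
   by (intro summable_suminf_not_top) (auto simp: d_def)
  then have "Bseq (%k. 2 ^ k * d k x)"
   by (intro convergent_imp_Bseq convergentI[of _ 0] summable_LIMSEQ_zero)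
  then obtain C where C: "C > 0" "\<And>k. \<bar>2 ^ k * d k x\<bar> \<le> C" by (auto simp: Bseq_def)
  have "norm (g (Suc k) x - g k x) \<le> sqrt C * (1 / sqrt 2) ^ k" for k
  proof -
   have "d k x \<le> C * (1/2) ^ k" using C(2)[of k] by (simp add: d_def field_simps power_one_over)
   then have "sqrt (d k x) \<le> sqrt (C * (1/2) ^ k)" by (rule real_sqrt_le_mono)
   then show ?thesis by (simp add: d_def real_sqrt_mult real_sqrt_power real_sqrt_divide)
  qed
  then have "summable (%k. g (Suc k) x - g k x)"
   by (rule summable_comparison_test'[rotated, where N = 0])
     (auto intro!: summable_mult summable_geometric)
  then have "convergent (%n. \<Sum>k<n. g (Suc k) x - g k x)"
   by (simp add: summable_iff_convergent)
  then have "convergent (%n. g n x - g 0 x)"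
   unfolding sum_lessThan_telescope[of "%k. g k x"] .
  then have "convergent (%n. g n x - g 0 x + g 0 x)" by (intro convergent_add convergent_const)
  then show "convergent (%k. g k x)" by simp
 qed
 define G where "G x = lim (%k. g k x)" for x
 have [measurable]: "G \<in> borel_measurable N" unfolding G_def by (rule borel_measurable_lim_metric) auto
 have tail: "(\<integral>\<^sup>+x. ennreal ((norm (f n x - G x))^2) \<partial>N) \<le> ennreal (e^2)"
  if e: "e > 0" and n0: "\<And>m n. m \<ge> n0 ==> n \<ge> n0 ==> l2_norm N (%x. f m x - f n x) < e" and "n \<ge> n0"
  for e n0 n
 proof -
  have "(\<integral>\<^sup>+x. ennreal ((norm (f n x - G x))^2) \<partial>N)
    = (\<integral>\<^sup>+x. liminf (%k. ennreal ((norm (f n x - g k x))^2)) \<partial>N)"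
  proof (rule nn_integral_cong_AE, use conv in \<open>rule eventually_mono\<close>)
   fix x assume "convergent (%k. g k x)"
   then have "(%k. g k x) \<longlonglongrightarrow> G x" by (simp add: G_def convergent_LIMSEQ_iff)
   then have "(%k. ennreal ((norm (f n x - g k x))^2)) \<longlonglongrightarrow> ennreal ((norm (f n x - G x))^2)"
    by (intro tendsto_intros tendsto_ennrealI)
   then show "ennreal ((norm (f n x - G x))^2) = liminf (%k. ennreal ((norm (f n x - g k x))^2))"
    by (intro lim_imp_Liminf[symmetric]) auto
  qed
  also have "... \<le> liminf (%k. \<integral>\<^sup>+x. ennreal ((norm (f n x - g k x))^2) \<partial>N)"
   by (rule nn_integral_liminf) measurable
  also have "... \<le> liminf (%k. ennreal (e^2))"
  proof (rule Liminf_mono, rule eventually_sequentiallyI[of n0])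
   fix k assume "n0 \<le> k"
   then have "r k \<ge> n0" using rk[of k] by simp
   then have "l2_norm N (%x. f n x - f (r k) x) \<le> e" using n0[OF \<open>n \<ge> n0\<close>] by (simp add: less_imp_le)
   then show "(\<integral>\<^sup>+x. ennreal ((norm (f n x - g k x))^2) \<partial>N) \<le> ennreal (e^2)"
    unfolding g_def nn by (intro ennreal_leI power_mono l2_norm_nonneg)
  qed
  finally show ?thesis by (simp add: Liminf_const)
 qed
 obtain n1 where n1: "\<And>m n. m \<ge> n1 ==> n \<ge> n1 ==> l2_norm N (%x. f m x - f n x) < 1"
  using Cauchy[OF zero_less_one] by blast
 have diffL2: "(%x. f n1 x - G x) \<in> L2 N"
 proof -
  have "integrable N (%x. (norm (f n1 x - G x))^2)"
  proof (rule integrableI_bounded)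
   have "(\<integral>\<^sup>+x. ennreal (norm ((norm (f n1 x - G x))^2)) \<partial>N) \<le> ennreal (1^2)"
    using tail[OF zero_less_one n1 order_refl] by simp
   also have "ennreal (1^2) < \<infinity>" by simp
   finally show "(\<integral>\<^sup>+x. ennreal (norm ((norm (f n1 x - G x))^2)) \<partial>N) < \<infinity>" .
  qed measurable
  then show ?thesis by (auto simp: L2_def)
 qed
 have GL2: "G \<in> L2 N" using L2_diff[OF L2[of n1] diffL2] by simp
 have "(%n. l2_norm N (%x. f n x - G x)) \<longlonglongrightarrow> 0"
 proof (rule LIMSEQ_I)
  fix e :: real assume "e > 0"
  then obtain n0 where n0: "\<And>m n. m \<ge> n0 ==> n \<ge> n0 ==> l2_norm N (%x. f m x - f n x) < e/2"
   using Cauchy[of "e/2"] by auto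
  have "l2_norm N (%x. f n x - G x) < e" if "n \<ge> n0" for n
  proof -
   have D: "(%x. f n x - G x) \<in> L2 N" by (rule L2_diff[OF L2 GL2])
   have "ennreal ((l2_norm N (%x. f n x - G x))^2) = (\<integral>\<^sup>+x. ennreal ((norm (f n x - G x))^2) \<partial>N)"
    unfolding l2_norm_power2 l2_inner_self
    by (rule nn_integral_eq_integral[symmetric]) (use D in \<open>auto simp: L2_def\<close>)
   also have "... \<le> ennreal ((e/2)^2)" by (rule tail[OF _ n0 that]) (use \<open>e > 0\<close> in auto)
   finally have "(l2_norm N (%x. f n x - G x))^2 \<le> (e/2)^2" by simp
   then have "l2_norm N (%x. f n x - G x) \<le> e/2" by (rule power2_le_imp_le) (use \<open>e > 0\<close> in auto)
   with \<open>e > 0\<close> show ?thesis by simp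
  qed
  then show "\<exists>no. \<forall>n\<ge>no. norm (l2_norm N (%x. f n x - G x) - 0) < e"
   by (auto simp: l2_norm_nonneg)
 qed
 with GL2 show ?thesis by auto
qed

section \<open>Operators generated by coercive closed forms\<close>

text \<open>Closedness is stated for the form alone: Cauchy sequences converge in the norm of the form. Convergence
 in $L^2$ is then a consequence of coercivity.\<close>

locale coercive_form =
 fixes N :: "'a measure" and D :: "('a => real) set" and B :: "('a => real) => ('a => real) => real"
  and \<kappa> :: real
 assumes D_L2: "D \<subseteq> L2 N"
  and D_zero: "(%x. 0) \<in> D"
  and D_lincomb: "u \<in> D ==> v \<in> D ==> (%x. u x + t * v x) \<in> D"
  and B_commute: "u \<in> D ==> v \<in> D ==> B u v = B v u"
  and B_lincomb: "u \<in> D ==> v \<in> D ==> w \<in> D ==> B (%x. u x + t * v x) w = B u w + t * B v w"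
  and kappa: "\<kappa> > 0"
  and coercive: "u \<in> D ==> \<kappa> * (l2_norm N u)^2 \<le> B u u"
  and closed: "(\<And>n::nat. U n \<in> D) ==>
   (\<And>e. e > 0 ==> \<exists>n0. \<forall>i\<ge>n0. \<forall>j\<ge>n0. B (%x. U i x - U j x) (%x. U i x - U j x) < e) ==>
   \<exists>v\<in>D. (%n. B (%x. U n x - v x) (%x. U n x - v x)) \<longlonglongrightarrow> 0"
begin

lemma D_diff: "u \<in> D ==> v \<in> D ==> (%x. u x - v x) \<in> D"
 using D_lincomb[of u v "-1"] by simp

lemma B_nonneg: "u \<in> D ==> 0 \<le> B u u"
 using coercive[of u] kappa by (smt (verit) mult_nonneg_nonneg zero_le_power2)

lemma B_expand:
 assumes u: "u \<in> D" and v: "v \<in> D"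
 shows "B (%x. u x + t * v x) (%x. u x + t * v x) = B u u + 2 * t * B u v + t^2 * B v v"
proof -
 let ?w = "%x. u x + t * v x"
 have w: "?w \<in> D" by (rule D_lincomb[OF u v])
 have "B ?w ?w = B u ?w + t * B v ?w" by (rule B_lincomb[OF u v w])
 also have "B u ?w = B u u + t * B v u" unfolding B_commute[OF u w] by (rule B_lincomb[OF u v u])
 also have "B v ?w = B u v + t * B v v" unfolding B_commute[OF v w] by (rule B_lincomb[OF u v v])
 also have "B v u = B u v" by (rule B_commute[OF v u])
 finally show ?thesis by (simp add: power2_eq_square algebra_simps)
qed

lemma B_Cauchy_Schwarz: "u \<in> D ==> v \<in> D ==> (B u v)^2 \<le> B u u * B v v"
 using B_nonneg[OF D_lincomb] by (intro discriminant_le) (simp add: B_expand)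

text \<open>The Riesz representation theorem in the Hilbert space of a closed form: a minimizing sequence of
 $B(v,v) - 2(f,v)$ is Cauchy for \<open>B\<close> by the parallelogram identity. Perturbing it in the direction \<open>w\<close> gives a
 nonnegative quadratic polynomial, whose discriminant bounds the residual of the equation.\<close>

lemma form_solution_exists:
 assumes f: "f \<in> L2 N"
 shows "\<exists>u. (u, f) \<in> form_operator N D B"
proof -
 define J where "J v = B v v - 2 * l2_inner N f v" for v
 have DL2: "v \<in> L2 N" if "v \<in> D" for v using D_L2 that by auto
 have inner: "l2_inner N f (%x. u x + t * v x) = l2_inner N f u + t * l2_inner N f v"
  if "u \<in> D" "v \<in> D" for u v t
  using l2_inner_add_right[OF DL2[OF that(1)] L2_scale_real[OF DL2[OF that(2)], of t] f]
  by (simp add: l2_inner_scale_real_right)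
 have lower: "J v \<ge> - ((l2_norm N f)^2) / \<kappa>" if "v \<in> D" for v
 proof -
  let ?n = "l2_norm N v" and ?F = "l2_norm N f"
  have "0 \<le> (\<kappa> * ?n - ?F)^2 / \<kappa>" using kappa by simp
  also have "... = \<kappa> * ?n^2 - 2 * (?F * ?n) + ?F^2 / \<kappa>"
   using kappa by (simp add: power2_eq_square field_simps)
  also have "... \<le> B v v - 2 * l2_inner N f v + ?F^2 / \<kappa>"
   using coercive[OF that] l2_Cauchy_Schwarz[OF f DL2[OF that]] by simp
  finally show ?thesis by (simp add: J_def)
 qed
 define I where "I = Inf (J ` D)"
 have bdd: "bdd_below (J ` D)" by (rule bdd_belowI2[of _ "- ((l2_norm N f)^2) / \<kappa>"]) (rule lower)
 have I_le: "I \<le> J v" if "v \<in> D" for v unfolding I_def by (rule cInf_lower) (use that bdd in auto)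
 have "\<exists>v\<in>D. J v < I + 1 / real (Suc n)" for n
 proof -
  have "J ` D \<noteq> {}" using D_zero by auto
  from cInf_lessD[OF this, of "I + 1 / real (Suc n)"] show ?thesis unfolding I_def by auto
 qed
 then obtain u where u: "\<And>n. u n \<in> D" "\<And>n. J (u n) < I + 1 / real (Suc n)" by metis
 have par: "B (%x. u i x - u j x) (%x. u i x - u j x) \<le> 2 * (J (u i) - I) + 2 * (J (u j) - I)" for i j
 proof -
  let ?s = "%x. u i x + 1 * u j x" and ?m = "%x. 0 + (1/2) * (u i x + 1 * u j x)"
  have s: "?s \<in> D" by (rule D_lincomb[OF u(1) u(1)])
  have m: "?m \<in> D" by (rule D_lincomb[OF D_zero s])
  have B0: "B (%x. 0) w = 0" if "w \<in> D" for w
   using B_lincomb[OF D_zero D_zero that, of 1] by simp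
  have "B ?m ?m = (1/4) * B ?s ?s"
   using B_expand[OF D_zero s, of "1/2"] B0[OF D_zero] B0[OF s] by (simp add: power2_eq_square)
  also have "B ?s ?s = B (u i) (u i) + 2 * B (u i) (u j) + B (u j) (u j)"
   using B_expand[OF u(1) u(1), of i 1 j] by simp
  finally have Bm: "B ?m ?m = (1/4) * (B (u i) (u i) + 2 * B (u i) (u j) + B (u j) (u j))" .
  have lm: "l2_inner N f ?m = (1/2) * (l2_inner N f (u i) + l2_inner N f (u j))"
   using inner[OF D_zero s, of "1/2"] inner[OF u(1) u(1), of i 1 j] by (simp add: l2_inner_def)
  have "B (%x. u i x - u j x) (%x. u i x - u j x) = B (u i) (u i) - 2 * B (u i) (u j) + B (u j) (u j)"
   using B_expand[OF u(1) u(1), of i "-1" j] by simp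
  moreover have "4 * I \<le> 4 * J ?m" using I_le[OF m] by simp
  ultimately show ?thesis unfolding J_def Bm lm by argo
 qed
 have "\<exists>v\<in>D. (%n. B (%x. u n x - v x) (%x. u n x - v x)) \<longlonglongrightarrow> 0"
 proof (rule closed[OF u(1)])
  fix e :: real assume "e > 0"
  then obtain n0 where n0: "1 / real (Suc n0) < e / 4"
   using nat_approx_posE[of "e / 4"] by auto
  have "B (%x. u i x - u j x) (%x. u i x - u j x) < e" if "i \<ge> n0" "j \<ge> n0" for i j
  proof -
   have "1 / real (Suc i) \<le> 1 / real (Suc n0)" "1 / real (Suc j) \<le> 1 / real (Suc n0)"
    using that by (auto intro!: divide_left_mono)
   then have "J (u i) < I + e / 4" "J (u j) < I + e / 4"
    using u(2)[of i] u(2)[of j] n0 by linarith+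
   then show ?thesis using par[of i j] by argo
  qed
  then show "\<exists>n0. \<forall>i\<ge>n0. \<forall>j\<ge>n0. B (%x. u i x - u j x) (%x. u i x - u j x) < e" by blast
 qed
 then obtain v where v: "v \<in> D" and lim: "(%n. B (%x. u n x - v x) (%x. u n x - v x)) \<longlonglongrightarrow> 0" by auto
 have "B v w = l2_inner N f w" if w: "w \<in> D" for w
 proof -
  have est: "(B (u n) w - l2_inner N f w)^2 \<le> (1 / real (Suc n)) * B w w" for n
  proof (rule discriminant_le)
   fix t
   have "I \<le> J (%x. u n x + t * w x)" by (rule I_le[OF D_lincomb[OF u(1) w]])
   also have "... = J (u n) + 2 * t * (B (u n) w - l2_inner N f w) + t^2 * B w w"
    unfolding J_def B_expand[OF u(1) w] inner[OF u(1) w] by (simp add: algebra_simps)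
   finally show "0 \<le> 1 / real (Suc n) + 2 * t * (B (u n) w - l2_inner N f w) + t^2 * B w w"
    using u(2)[of n] by simp
  qed
  have "(%n. (1 / real (Suc n)) * B w w) \<longlonglongrightarrow> 0"
   using tendsto_mult_left_zero[OF LIMSEQ_Suc[OF lim_1_over_n]] .
  from tendsto_zero_of_square_le[OF est this]
  have 1: "(%n. B (u n) w - l2_inner N f w) \<longlonglongrightarrow> 0" .
  have "(%n. B (%x. u n x - v x) w) \<longlonglongrightarrow> 0"
   by (rule tendsto_zero_of_square_le[OF B_Cauchy_Schwarz[OF D_diff[OF u(1) v] w]
      tendsto_mult_left_zero[OF lim]])
  moreover have "B (%x. u n x - v x) w = B (u n) w - B v w" for n
   using B_lincomb[OF u(1) v w, of n "-1"] by simp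
  ultimately have 2: "(%n. B (u n) w - B v w) \<longlonglongrightarrow> 0" by simp
  from tendsto_diff[OF 1 2] have "(%n. B v w - l2_inner N f w) \<longlonglongrightarrow> 0" by simp
  then show ?thesis by (simp add: LIMSEQ_const_iff)
 qed
 with v f show ?thesis by (auto simp: form_operator_def)
qed

lemma boundedly_invertible: "boundedly_invertible N (form_operator N D B)"
 unfolding boundedly_invertible_def
proof (intro conjI)
 show "\<forall>f\<in>L2 N. \<exists>u. (u, f) \<in> form_operator N D B"
  using form_solution_exists by blast
 have "l2_norm N u \<le> (1 / \<kappa>) * l2_norm N f" if "(u, f) \<in> form_operator N D B" for u f
 proof -
  have u: "u \<in> D" "f \<in> L2 N" "B u u = l2_inner N f u" using that by (auto simp: form_operator_def)
  have "\<kappa> * (l2_norm N u)^2 \<le> l2_norm N f * l2_norm N u"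
   using coercive[OF u(1)] u l2_Cauchy_Schwarz[OF u(2), of u] D_L2 by force
  then have "\<kappa> * l2_norm N u \<le> l2_norm N f"
   using l2_norm_nonneg[of N u] l2_norm_nonneg[of N f]
   by (cases "l2_norm N u = 0") (auto simp: power2_eq_square)
  then show ?thesis using kappa by (simp add: field_simps)
 qed
 then show "\<exists>C. \<forall>(u, f)\<in>form_operator N D B. l2_norm N u \<le> C * l2_norm N f" by blast
qed

end

section \<open>Absolutely continuous functions on an interval\<close>

lemma set_integral_mono_set:
 fixes f :: "_ => real"
 assumes "set_integrable M B f" "A \<in> sets M" "A \<subseteq> B" "\<And>x. x \<in> B ==> 0 \<le> f x"
 shows "(LINT x:A|M. f x) \<le> (LINT x:B|M. f x)"
 unfolding set_lebesgue_integral_def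
proof (rule integral_mono)
 show "integrable M (%x. indicat_real A x *\<^sub>R f x)"
  using set_integrable_subset[OF assms(1-3)] by (simp add: set_integrable_def)
 show "integrable M (%x. indicat_real B x *\<^sub>R f x)"
  using assms(1) by (simp add: set_integrable_def)
qed (use assms(3,4) in \<open>auto simp: indicator_def\<close>)

definition ac_on :: "real => real => (real => real) => (real => real) => bool" where
 "ac_on a b f f' \<longleftrightarrow> set_integrable lborel {a..b} f' \<and>
   (\<forall>x\<in>{a..b}. f x = f a + (LINT t:{a..x}|lborel. f' t))"

lemma ac_onI:
 assumes "set_integrable lborel {a..b} f'"
  and "\<And>x. x \<in> {a..b} ==> f x = f a + (LINT t:{a..x}|lborel. f' t)"
 shows "ac_on a b f f'"
 unfolding ac_on_def using assms by blast

lemma ac_on_integrable: "ac_on a b f f' ==> set_integrable lborel {a..b} f'"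
 unfolding ac_on_def by (rule conjunct1)

lemma ac_on_eq: "ac_on a b f f' ==> x \<in> {a..b} ==> f x = f a + (LINT t:{a..x}|lborel. f' t)"
 unfolding ac_on_def by blast

lemma ac_on_cong:
 assumes "ac_on a b f f'" "\<And>x. x \<in> {a..b} ==> g x = f x" "\<And>x. x \<in> {a..b} ==> g' x = f' x"
 shows "ac_on a b g g'"
proof (rule ac_onI)
 have "set_integrable lborel {a..b} g' = set_integrable lborel {a..b} f'"
  by (rule set_integrable_cong) (use assms(3) in auto)
 then show "set_integrable lborel {a..b} g'" using ac_on_integrable[OF assms(1)] by simp
 fix x assume x: "x \<in> {a..b}"
 have "(LINT t:{a..x}|lborel. g' t) = (LINT t:{a..x}|lborel. f' t)"
  by (rule set_lebesgue_integral_cong) (use assms(3) x in auto)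
 moreover have "a \<in> {a..b}" using x by auto
 ultimately show "g x = g a + (LINT t:{a..x}|lborel. g' t)"
  using ac_on_eq[OF assms(1) x] assms(2)[OF x] assms(2)[of a] by simp
qed

lemma ac_on_increment:
 assumes f: "ac_on a b f f'" and "a \<le> c" "c \<le> d" "d \<le> b"
 shows "f d - f c = (LINT t:{c..d}|lborel. f' t)"
proof -
 note I = ac_on_integrable[OF f]
 have "set_integrable lborel {a..c} f'" "set_integrable lborel {c..d} f'"
  by (rule set_integrable_subset[OF I]; use assms(2-4) in auto)+
 then have "(LINT t:{a..c} \<union> {c..d}|lborel. f' t) = (LINT t:{a..c}|lborel. f' t) + (LINT t:{c..d}|lborel. f' t)"
  by (intro set_integral_Un_AE) (auto intro: eventually_mono[OF AE_lborel_singleton[of c]])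
 moreover have "{a..c} \<union> {c..d} = {a..d}" using assms(2-4) by auto
 ultimately show ?thesis using ac_on_eq[OF f, of c] ac_on_eq[OF f, of d] assms(2-4) by simp
qed

lemma ac_on_subinterval:
 assumes f: "ac_on a b f f'" and "a \<le> c" "d \<le> b"
 shows "ac_on c d f f'"
proof (rule ac_onI)
 show "set_integrable lborel {c..d} f'"
  by (rule set_integrable_subset[OF ac_on_integrable[OF f]]) (use assms(2,3) in auto)
 show "f x = f c + (LINT t:{c..x}|lborel. f' t)" if "x \<in> {c..d}" for x
  using ac_on_increment[OF f, of c x] assms(2,3) that by simp
qed

lemma ac_on_imp_continuous:
 assumes "ac_on a b f f'"
 shows "continuous_on {a..b} f"
proof -
 note I = ac_on_integrable[OF assms]
 have "continuous_on {a..b} (%x. f a + integral {a..x} f')"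
  by (intro continuous_intros indefinite_integral_continuous_1 set_borel_integral_eq_integral(1)[OF I])
 moreover have "f a + integral {a..x} f' = f x" if "x \<in> {a..b}" for x
 proof -
  have "set_integrable lborel {a..x} f'"
   by (rule set_integrable_subset[OF I]) (use that in auto)
  then show ?thesis using ac_on_eq[OF assms that] by (simp add: set_borel_integral_eq_integral(2))
 qed
 ultimately show ?thesis by (rule continuous_on_eq)
qed

lemma ac_on_derivative:
 fixes f f' :: line_fun
 assumes "finite S" "continuous_on {a..b} f"
  and d: "\<And>x. x \<in> {a<..<b} - S ==> (f has_real_derivative f' x) (at x)"
  and I: "set_integrable lborel {a..b} f'"
 shows "ac_on a b f f'"
proof (rule ac_onI[OF I])
 show "f x = f a + (LINT t:{a..x}|lborel. f' t)" if x: "x \<in> {a..b}" for x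
 proof -
  have Ix: "set_integrable lborel {a..x} f'"
   by (rule set_integrable_subset[OF I]) (use x in auto)
  have "(f' has_integral (f x - f a)) {a..x}"
  proof (rule fundamental_theorem_of_calculus_interior_strong[OF assms(1)])
   show "continuous_on {a..x} f" by (rule continuous_on_subset[OF assms(2)]) (use x in auto)
   show "(f has_vector_derivative f' y) (at y)" if "y \<in> {a<..<x} - S" for y
    using d[of y] x that by (auto simp: has_real_derivative_iff_has_vector_derivative)
  qed (use x in auto)
  then have "integral {a..x} f' = f x - f a" by (rule integral_unique)
  then show ?thesis using set_borel_integral_eq_integral(2)[OF Ix] by simp
 qed
qed

lemma integrable_tensor:
 fixes p q :: line_fun
 assumes [measurable]: "integrable lborel p" "integrable lborel q"
 shows "integrable (lborel \<Otimes>\<^sub>M lborel) (%(s, t). p s * q t)"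
proof (rule lborel_pair.Fubini_integrable)
 show "integrable lborel (%x. LBINT y. norm (case (x, y) of (s, t) => p s * q t))"
  using assms by (simp add: abs_mult)
 show "AE x in lborel. integrable lborel (%y. case (x, y) of (s, t) => p s * q t)"
  using assms by simp
qed measurable

text \<open>Integration by parts for absolutely continuous functions is Fubini's theorem for the tensor
 product of the derivatives: the two integrals cover the parts of the square on the two sides of
 the diagonal.\<close>

lemma ac_on_integral_by_parts:
 assumes f: "ac_on a b f f'" and g: "ac_on a b g g'" and ab: "a \<le> b"
 shows "set_integrable lborel {a..b} (%x. f x * g' x + f' x * g x)"
  and "(LINT x:{a..b}|lborel. f x * g' x + f' x * g x) = f b * g b - f a * g a"
proof -
 define p where "p s = indicator {a..b} s * f' s" for s
 define q where "q s = indicator {a..b} s * g' s" for s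
 have p: "integrable lborel p" and q: "integrable lborel q"
  using ac_on_integrable[OF f] ac_on_integrable[OF g] by (simp_all add: set_integrable_def p_def[abs_def] q_def[abs_def])
 note [measurable] = borel_measurable_integrable[OF p] borel_measurable_integrable[OF q]
 define P where "P x = (LBINT s. p s * indicator {..x} s)" for x
 define Q where "Q x = (LBINT s. q s * indicator {..x} s)" for x
 have fP: "f x = f a + P x" and gQ: "g x = g a + Q x" if "x \<in> {a..b}" for x
 proof -
  have "P x = (LINT t:{a..x}|lborel. f' t)" "Q x = (LINT t:{a..x}|lborel. g' t)"
   unfolding P_def Q_def p_def q_def set_lebesgue_integral_def
   by (rule integral_cong_fun; use that in \<open>auto simp: indicator_def\<close>)+
  then show "f x = f a + P x" "g x = g a + Q x" using ac_on_eq[OF f that] ac_on_eq[OF g that] by simp_all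
 qed
 have T: "integrable (lborel \<Otimes>\<^sub>M lborel) (%(s, t). p s * q t)" by (rule integrable_tensor[OF p q])
 have T1: "integrable (lborel \<Otimes>\<^sub>M lborel) (%(t, s). p s * indicator {..t} s * q t)"
 proof (rule integrable_dominated)
  show "integrable (lborel \<Otimes>\<^sub>M lborel) (%(t, s). p s * q t)"
   using integrable_tensor[OF q p] by (simp add: mult.commute)
  have "(%(t, s). p s * indicator {..t} s * q t) = (%(t, s). p s * (if s \<le> t then 1 else 0) * q t)"
   by (auto simp: fun_eq_iff indicator_def)
  then show "(%(t, s). p s * indicator {..t} s * q t) \<in> borel_measurable (lborel \<Otimes>\<^sub>M lborel)" by simp
 qed (auto simp: indicator_def)
 have T2: "integrable (lborel \<Otimes>\<^sub>M lborel) (%(t, s). p t * (q s * indicator {..t} s))"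
 proof (rule integrable_dominated[OF T])
  have "(%(t, s). p t * (q s * indicator {..t} s)) = (%(t, s). p t * (q s * (if s \<le> t then 1 else 0)))"
   by (auto simp: fun_eq_iff indicator_def)
  then show "(%(t, s). p t * (q s * indicator {..t} s)) \<in> borel_measurable (lborel \<Otimes>\<^sub>M lborel)" by simp
 qed (auto simp: indicator_def)
 have Pq: "integrable lborel (%t. P t * q t)"
  using lborel_pair.integrable_fst[OF T1] by (simp add: P_def)
 have pQ: "integrable lborel (%t. p t * Q t)"
  using lborel_pair.integrable_fst[OF T2] by (simp add: Q_def)
 have A: "(LBINT t. P t * q t) = (LBINT s. LBINT t. p s * indicator {..t} s * q t)"
  using lborel_pair.Fubini_integral[OF T1] by (simp add: P_def)
 have B: "(LBINT t. p t * Q t) = (LBINT s. LBINT t. p s * (q t * indicator {..s} t))"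
  by (simp add: Q_def)
 have i1: "integrable lborel (%t. p s * indicator {..t} s * q t)" for s
 proof -
  have "(%t. p s * indicator {..t} s * q t) = (%t. p s * (indicator {s..} t * q t))"
   by (auto simp: fun_eq_iff indicator_def)
  then show ?thesis using integrable_real_mult_indicator[of "{s..}" lborel q] q by (simp add: mult.commute)
 qed
 have i2: "integrable lborel (%t. p s * (q t * indicator {..s} t))" for s
  using integrable_real_mult_indicator[of "{..s}" lborel q] q by simp
 have AB: "(LBINT t. p s * indicator {..t} s * q t) + (LBINT t. p s * (q t * indicator {..s} t))
   = p s * (LBINT t. q t)" for s
 proof -
  have "(LBINT t. p s * indicator {..t} s * q t) + (LBINT t. p s * (q t * indicator {..s} t))
    = (LBINT t. p s * indicator {..t} s * q t + p s * (q t * indicator {..s} t))"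
   using i1 i2 by simp
  also have "... = (LBINT t. p s * q t)"
  proof (rule integral_cong_AE)
   show "AE t in lborel. p s * indicator {..t} s * q t + p s * (q t * indicator {..s} t) = p s * q t"
    by (rule eventually_mono[OF AE_lborel_singleton[of s]]) (auto simp: indicator_def)
  qed (use i1 i2 in \<open>auto intro!: borel_measurable_integrable\<close>)
  finally show ?thesis by simp
 qed
 have j1: "integrable lborel (%s. LBINT t. p s * indicator {..t} s * q t)"
  using lborel_pair.integrable_snd[OF T1] .
 have j2: "integrable lborel (%s. LBINT t. p s * (q t * indicator {..s} t))"
  using pQ by (simp add: Q_def)
 have sum: "(LBINT t. P t * q t) + (LBINT t. p t * Q t) = (LBINT t. p t) * (LBINT t. q t)"
  unfolding A B using j1 j2 AB by (simp flip: Bochner_Integration.integral_add)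
 have eq: "indicator {a..b} x *\<^sub>R (f x * g' x + f' x * g x)
   = f a * q x + P x * q x + (g a * p x + p x * Q x)" for x
  using fP[of x] gQ[of x] by (auto simp: p_def q_def indicator_def algebra_simps)
 show "set_integrable lborel {a..b} (%x. f x * g' x + f' x * g x)"
  unfolding set_integrable_def eq using p q Pq pQ by simp
 have Pb: "(LBINT t. p t) = f b - f a" and Qb: "(LBINT t. q t) = g b - g a"
  using ac_on_eq[OF f, of b] ac_on_eq[OF g, of b] ab
  by (simp_all add: p_def q_def set_lebesgue_integral_def)
 have "(LINT x:{a..b}|lborel. f x * g' x + f' x * g x)
   = f a * (LBINT t. q t) + (LBINT t. P t * q t) + (g a * (LBINT t. p t) + (LBINT t. p t * Q t))"
  unfolding set_lebesgue_integral_def eq using p q Pq pQ by simp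
 also have "... = f a * (LBINT t. q t) + g a * (LBINT t. p t) + (LBINT t. p t) * (LBINT t. q t)"
  using sum by simp
 also have "... = f b * g b - f a * g a" unfolding Pb Qb by (simp add: algebra_simps)
 finally show "(LINT x:{a..b}|lborel. f x * g' x + f' x * g x) = f b * g b - f a * g a" .
qed

lemma ac_on_mult:
 assumes f: "ac_on a b f f'" and g: "ac_on a b g g'"
 shows "ac_on a b (%x. f x * g x) (%x. f x * g' x + f' x * g x)"
proof (cases "a \<le> b")
 case True
 show ?thesis
 proof (rule ac_onI[OF ac_on_integral_by_parts(1)[OF f g True]])
  show "f x * g x = f a * g a + (LINT t:{a..x}|lborel. f t * g' t + f' t * g t)" if "x \<in> {a..b}" for x
   using ac_on_integral_by_parts(2)[OF ac_on_subinterval[OF f, of a x] ac_on_subinterval[OF g, of a x]] that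
   by simp
 qed
next
 case False then show ?thesis by (simp add: ac_on_def set_integrable_def)
qed

lemma ac_on_abs_integrable_mult:
 assumes f: "ac_on a b f f'" and g: "set_integrable lborel {a..b} g" 
 shows "set_integrable lborel {a..b} (%x. f x * g x)"
proof -
 have "bounded (f ` {a..b})"
  by (intro compact_imp_bounded compact_continuous_image ac_on_imp_continuous[OF f]) auto
 then obtain C where C: "\<And>x. x \<in> {a..b} ==> \<bar>f x\<bar> \<le> C" unfolding bounded_iff by fastforce
 have m: "(%x. indicator {a..b} x * f x) \<in> borel_measurable borel"
  using borel_measurable_continuous_on_indicator[OF _ ac_on_imp_continuous[OF f]] by simp
 have gi: "integrable lborel (%x. indicator {a..b} x * g x)" using g by (simp add: set_integrable_def)
 show ?thesis unfolding set_integrable_def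
 proof (rule integrable_dominated)
  show "integrable lborel (%x. C * (indicator {a..b} x * g x))" using gi by simp
  have "(%x. indicator {a..b} x *\<^sub>R (f x * g x)) = (%x. (indicator {a..b} x * f x) * (indicator {a..b} x * g x))"
   by (auto simp: fun_eq_iff indicator_def)
  then show "(%x. indicator {a..b} x *\<^sub>R (f x * g x)) \<in> borel_measurable lborel"
   using m borel_measurable_integrable[OF gi] by simp
  have "\<bar>f x\<bar> * \<bar>g x\<bar> \<le> \<bar>C\<bar> * \<bar>g x\<bar>" if "x \<in> {a..b}" for x
   using C[OF that] by (intro mult_right_mono) auto
  then show "AE x in lborel. norm (indicator {a..b} x *\<^sub>R (f x * g x)) \<le> norm (C * (indicator {a..b} x * g x))"
   by (auto simp: indicator_def abs_mult)
 qed
qed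

lemma set_integrable_continuous_square:
 assumes "ac_on a b f f'"
 shows "set_integrable lborel {a..b} (%x. (f x)^2)"
 by (intro borel_integrable_atLeastAtMost' continuous_intros ac_on_imp_continuous[OF assms])

text \<open>The one-dimensional Sobolev inequality: the increments of $f^2$ are controlled by
 $2 f f'$, and $f^2$ is compared with its mean.\<close>

lemma ac_on_sup_bound:
 assumes f: "ac_on a b f f'" and ab: "a < b" and x: "x \<in> {a..b}"
 shows "(f x)^2 \<le> (LINT t:{a..b}|lborel. (f t)^2) / (b - a) + 2 * (LINT t:{a..b}|lborel. \<bar>f t * f' t\<bar>)"
proof -
 define K where "K = 2 * (LINT t:{a..b}|lborel. \<bar>f t * f' t\<bar>)"
 have ff: "ac_on a b (%x. f x * f x) (%x. f x * f' x + f' x * f x)" by (rule ac_on_mult[OF f f])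
 have I: "set_integrable lborel {a..b} (%t. f t * f' t)"
  by (rule ac_on_abs_integrable_mult[OF f ac_on_integrable[OF f]])
 have Ia: "set_integrable lborel {a..b} (%t. \<bar>f t * f' t\<bar>)" by (rule set_integrable_abs[OF I])
 have inc: "\<bar>f d * f d - f c * f c\<bar> \<le> K" if "a \<le> c" "c \<le> d" "d \<le> b" for c d
 proof -
  have sub: "set_integrable lborel {c..d} (%t. f t * f' t)"
   by (rule set_integrable_subset[OF I]) (use that in auto)
  have "f d * f d - f c * f c = (LINT t:{c..d}|lborel. f t * f' t + f' t * f t)"
   by (rule ac_on_increment[OF ff that])
  also have "... = 2 * (LINT t:{c..d}|lborel. f t * f' t)"
   unfolding set_lebesgue_integral_def by (subst Bochner_Integration.integral_mult_right_zero[symmetric])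
    (rule integral_cong_fun, auto)
  finally have "\<bar>f d * f d - f c * f c\<bar> = 2 * \<bar>LINT t:{c..d}|lborel. f t * f' t\<bar>" by simp
  also have "\<bar>LINT t:{c..d}|lborel. f t * f' t\<bar> \<le> (LINT t:{c..d}|lborel. \<bar>f t * f' t\<bar>)"
   using set_integral_norm_bound[OF sub] by simp
  also have "... \<le> (LINT t:{a..b}|lborel. \<bar>f t * f' t\<bar>)"
   by (rule set_integral_mono_set[OF Ia]) (use that in auto)
  finally show ?thesis by (simp add: K_def)
 qed
 have pt: "(f x)^2 - K \<le> (f t)^2" if "t \<in> {a..b}" for t
  using inc[of x t] inc[of t x] x that unfolding power2_eq_square
  by (cases "x \<le> t") auto
 have "(b - a) * ((f x)^2 - K) = (LINT t:{a..b}|lborel. (f x)^2 - K)"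
  using ab by (simp add: set_lebesgue_integral_def)
 also have "... \<le> (LINT t:{a..b}|lborel. (f t)^2)"
  by (rule set_integral_mono[OF _ set_integrable_continuous_square[OF f] pt])
    (auto intro!: borel_integrable_atLeastAtMost')
 finally have "(f x)^2 - K \<le> (LINT t:{a..b}|lborel. (f t)^2) / (b - a)"
  using ab by (simp add: field_simps)
 then show ?thesis by (simp add: K_def)
qed

section \<open>The fundamental lemma of the calculus of variations\<close>

text \<open>Boxes are an intersection-stable generator of the Borel sets, so the integral vanishes over every Borel set, in
 particular over the set where \<open>f\<close> is positive and over its complement.\<close>

lemma AE_zero_if_box_integrals_zero:
 fixes f :: "'a::euclidean_space => real"
 assumes f: "integrable lborel f" and z: "\<And>c d. (LINT x:box c d|lborel. f x) = 0"
 shows "AE x in lborel. f x = 0"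
proof -
 have sI: "set_integrable lborel A f" if "A \<in> sets borel" for A
  unfolding set_integrable_def using integrable_real_mult_indicator[OF _ f, of A] that
  by (simp add: mult.commute)
 have tot: "(LBINT x. f x) = 0"
 proof -
  have "(%n. LINT x:box (- real n *\<^sub>R One) (real n *\<^sub>R One)|lborel. f x) \<longlonglongrightarrow> (LBINT x. f x)"
   unfolding set_lebesgue_integral_def
  proof (rule integral_dominated_convergence[where w = "%x. \<bar>f x\<bar>"])
   show "AE x in lborel. (%n. indicat_real (box (- real n *\<^sub>R One) (real n *\<^sub>R One)) x *\<^sub>R f x) \<longlonglongrightarrow> f x"
   proof (rule AE_I2)
    fix x :: 'a
    obtain n0 where n0: "norm x < real n0" using reals_Archimedean2 by blast
    have "x \<in> box (- real n *\<^sub>R One) (real n *\<^sub>R One)" if "n \<ge> n0" for n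
     unfolding mem_box
    proof (intro ballI)
     fix i :: 'a assume "i \<in> Basis"
     then have "\<bar>x \<bullet> i\<bar> \<le> norm x" by (rule Basis_le_norm)
     then have "\<bar>x \<bullet> i\<bar> < real n" using n0 that by linarith
     then show "- real n *\<^sub>R One \<bullet> i < x \<bullet> i \<and> x \<bullet> i < real n *\<^sub>R One \<bullet> i"
      using \<open>i \<in> Basis\<close> by (auto simp: abs_less_iff)
    qed
    then have "\<forall>\<^sub>F n in sequentially. indicat_real (box (- real n *\<^sub>R One) (real n *\<^sub>R One)) x *\<^sub>R f x = f x"
     by (intro eventually_sequentiallyI[of n0]) auto
    then show "(%n. indicat_real (box (- real n *\<^sub>R One) (real n *\<^sub>R One)) x *\<^sub>R f x) \<longlonglongrightarrow> f x"
     by (rule tendsto_eventually)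
   qed
  qed (use f in \<open>auto simp: indicator_def intro: borel_measurable_integrable\<close>)
  then show ?thesis using z by (simp add: LIMSEQ_const_iff)
 qed
 have stable: "Int_stable (range (%(a, b). box a b :: 'a set))"
  unfolding Int_stable_def by (auto simp: box_Int_box)
 have subset_Pow: "range (%(a, b). box a b :: 'a set) \<subseteq> Pow UNIV" by simp
 have all: "(LINT x:A|lborel. f x) = 0" if "A \<in> sets borel" for A
 proof -
  have "A \<in> sigma_sets UNIV (range (%(a, b). box a b :: 'a set))"
   using that unfolding borel_eq_box by simp
  then show ?thesis
  proof (induction rule: sigma_sets_induct_disjoint[OF stable subset_Pow, consumes 1,
     case_names basic empty compl union])
   case (basic A) then show ?case using z by auto
  next
   case empty show ?case by (simp add: set_lebesgue_integral_def)
  next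
   case (compl A)
   then have A: "A \<in> sets borel" unfolding borel_eq_box by simp
   have "(LINT x:A \<union> (UNIV - A)|lborel. f x) = (LINT x:A|lborel. f x) + (LINT x:UNIV - A|lborel. f x)"
    by (rule set_integral_Un) (use A in \<open>auto intro!: sI\<close>)
   moreover have "A \<union> (UNIV - A) = UNIV" by auto
   ultimately show ?case using compl tot by (simp add: set_lebesgue_integral_def)
  next
   case (union A)
   then have A: "A i \<in> sets borel" for i unfolding borel_eq_box by auto
   have "(LINT x:(\<Union>i. A i)|lborel. f x) = (\<Sum>i. (LINT x:(A i)|lborel. f x))"
    by (rule lebesgue_integral_countable_add)
      (use A union(1) in \<open>auto intro!: sI simp: disjoint_family_on_def\<close>)
   then show ?case using union by simp
  qed
 qed
 have m: "f \<in> borel_measurable borel" using borel_measurable_integrable[OF f] by simp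
 let ?A = "{x. f x > 0}"
 have A: "?A \<in> sets borel" "UNIV - ?A \<in> sets borel" using m by auto
 have "(LBINT x. \<bar>f x\<bar>) = (LBINT x. indicator ?A x *\<^sub>R f x - indicator (UNIV - ?A) x *\<^sub>R f x)"
  by (rule integral_cong_fun) (auto simp: indicator_def)
 also have "... = (LINT x:?A|lborel. f x) - (LINT x:UNIV - ?A|lborel. f x)"
  unfolding set_lebesgue_integral_def
  by (rule Bochner_Integration.integral_diff) (use sI[OF A(1)] sI[OF A(2)] in \<open>auto simp: set_integrable_def\<close>)
 also have "... = 0" by (simp only: all[OF A(1)] all[OF A(2)])
 finally have "AE x in lborel. \<bar>f x\<bar> = 0"
  by (subst (asm) integral_nonneg_eq_0_iff_AE) (use f in auto)
 then show ?thesis by simp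
qed

section \<open>Integrals over the plane\<close>

lemma plane_Fubini:
 fixes f :: plane_fun
 assumes "integrable lborel f"
 shows "(LBINT p. f p) = (LBINT x. LBINT y. f (x, y))"
  and "AE x in lborel. integrable lborel (%y. f (x, y))"
  and "integrable lborel (%x. LBINT y. f (x, y))"
proof -
 have *: "integrable (lborel \<Otimes>\<^sub>M lborel) (case_prod (%x y. f (x, y)))"
  using assms by (simp add: lborel_prod)
 show "(LBINT p. f p) = (LBINT x. LBINT y. f (x, y))"
  using lborel_pair.integral_fst[OF *] by (simp add: lborel_prod)
 show "AE x in lborel. integrable lborel (%y. f (x, y))"
  by (rule lborel_pair.AE_integrable_fst[OF *])
 show "integrable lborel (%x. LBINT y. f (x, y))"
  by (rule lborel_pair.integrable_fst[OF *])
qed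

lemma plane_AE_sections:
 assumes "AE p in (lborel :: (real \<times> real) measure). P p"
 shows "AE x in lborel. AE y in lborel. P (x, y)"
 using assms unfolding lborel_prod[symmetric] by (rule lborel_pair.AE_pair)

lemma plane_AE_of_sections:
 assumes "{p. P p} \<in> sets (borel :: (real \<times> real) measure)"
  and "AE x in lborel. AE y in lborel. P (x, y)"
 shows "AE p in (lborel :: (real \<times> real) measure). P p"
 unfolding lborel_prod[symmetric]
proof (rule lborel_pair.AE_pair_measure[OF _ assms(2)])
 show "{p \<in> space (lborel \<Otimes>\<^sub>M lborel). P p} \<in> sets (lborel \<Otimes>\<^sub>M lborel)"
  using assms(1) unfolding lborel_prod by simp
qed

lemma borel_measurable_swap:
 fixes f :: plane_fun
 assumes "f \<in> borel_measurable borel"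
 shows "(%p. f (snd p, fst p)) \<in> borel_measurable borel"
proof -
 have "(%p. (snd p, fst p)) \<in> borel_measurable (borel :: (real \<times> real) measure)"
  by (intro borel_measurable_continuous_onI continuous_intros)
 from measurable_compose[OF this assms] show ?thesis .
qed

lemma plane_swap:
 fixes f :: plane_fun
 shows integrable_plane_swap: "integrable lborel (%p. f (snd p, fst p)) \<longleftrightarrow> integrable lborel f"
  and integral_plane_swap: "f \<in> borel_measurable borel ==> (LBINT p. f (snd p, fst p)) = (LBINT p. f p)"
 using lborel_pair.integrable_product_swap_iff[where f = f]
  lborel_pair.integral_product_swap[where f = f]
 by (simp_all add: lborel_prod case_prod_beta')

lemma AE_plane_swap:
 assumes "AE p in (lborel :: (real \<times> real) measure). P p"
 shows "AE p in (lborel :: (real \<times> real) measure). P (snd p, fst p)"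
proof -
 have D: "distr lborel borel (%p :: real \<times> real. (snd p, fst p)) = (lborel :: (real \<times> real) measure)"
  using lborel_pair.distr_pair_swap[where ?'a = real and ?'b = real, symmetric]
  unfolding lborel_prod borel_prod case_prod_beta' by (simp cong: distr_cong)
 have m: "(%p. (snd p, fst p)) \<in> measurable lborel (borel :: (real \<times> real) measure)"
  by (simp, intro borel_measurable_continuous_onI continuous_intros)
 have "AE p in distr lborel borel (%p :: real \<times> real. (snd p, fst p)). P p" using assms by (simp only: D)
 from AE_distrD[OF m this] show ?thesis .
qed

lemma integrable_plane_tensor:
 fixes p q :: line_fun
 assumes "integrable lborel p" "integrable lborel q"
 shows "integrable lborel (tens p q)"
 using integrable_tensor[OF assms] by (simp add: lborel_prod case_prod_beta')

section \<open>Test functions of one variable\<close>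

text \<open>A step from 0 to 1 that is piecewise quadratic: its derivative is the tent of height 2 over the unit interval.\<close>

definition step :: line_fun where
 "step t = 2 * ((max 0 t)^2 - 2 * (max 0 (t - 1/2))^2 + (max 0 (t - 1))^2)"

definition step' :: line_fun where
 "step' t = 4 * (max 0 t - 2 * max 0 (t - 1/2) + max 0 (t - 1))"

lemma has_real_derivative_max0_square:
 "((%t. (max 0 (t - c))^2) has_real_derivative 2 * max 0 (t - c)) (at (t :: real))"
proof (cases t c rule: linorder_cases)
 case less
 have "((%t. 0) has_real_derivative 2 * max 0 (t - c)) (at t)" using less by simp
 then show ?thesis
  by (rule DERIV_cong_ev[OF refl _ refl, THEN iffD1, rotated])
    (use less in \<open>auto intro!: eventually_mono[OF order_tendstoD(2)[OF tendsto_ident_at less]] eventually_nhds_in_open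
     simp: eventually_nhds intro!: exI[of _ "{..<c}"]\<close>)
next
 case greater
 have "((%t. (t - c)^2) has_real_derivative 2 * max 0 (t - c)) (at t)"
  using greater by (auto intro!: derivative_eq_intros)
 then show ?thesis
  by (rule DERIV_cong_ev[OF refl _ refl, THEN iffD1, rotated])
    (use greater in \<open>auto simp: eventually_nhds intro!: exI[of _ "{c<..}"]\<close>)
next
 case equal
 have "((%h. (max 0 h)^2 / h) \<longlongrightarrow> 0) (at (0::real))"
 proof (rule Lim_null_comparison)
  show "\<forall>\<^sub>F h in at 0. norm ((max 0 h)^2 / h) \<le> \<bar>h :: real\<bar>"
   by (intro always_eventually) (auto simp: power2_eq_square max_def)
  show "((%h. \<bar>h\<bar>) \<longlongrightarrow> 0) (at (0::real))" by (auto intro!: tendsto_eq_intros)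
 qed
 then show ?thesis using equal by (simp add: DERIV_def)
qed

lemma step_derivative: "(step has_real_derivative step' t) (at t)"
proof -
 have "((%t. 2 * ((max 0 (t - 0))^2 - 2 * (max 0 (t - 1/2))^2 + (max 0 (t - 1))^2)) has_real_derivative step' t) (at t)"
  by (rule derivative_eq_intros has_real_derivative_max0_square refl)+ (simp add: step'_def)
 then show ?thesis unfolding step_def[abs_def] by simp
qed

lemma continuous_on_step': "continuous_on S step'"
 unfolding step'_def[abs_def] by (intro continuous_intros)

lemma step_eq_0: "t \<le> 0 ==> step t = 0" and step_eq_1: "1 \<le> t ==> step t = 1"
 and step'_eq_0: "t \<le> 0 \<or> 1 \<le> t ==> step' t = 0"
 by (auto simp: step_def step'_def max_def power2_eq_square field_simps)

lemma step'_bounds: "0 \<le> step' t" "step' t \<le> 2"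
 by (auto simp: step'_def max_def)

lemma step_bounds: "0 \<le> step t" "step t \<le> 1"
proof -
 have mono: "step s \<le> step t" if "s \<le> t" for s t
  by (rule DERIV_nonneg_imp_nondecreasing[OF that]) (use step_derivative step'_bounds in blast)
 show "0 \<le> step t" using mono[of "min t 0" t] step_eq_0[of "min t 0"] by simp
 show "step t \<le> 1" using mono[of t "max t 1"] step_eq_1[of "max t 1"] by simp
qed

text \<open>Test functions of one variable carry their derivative as a separate function, which keeps Frechet derivatives
 out of the computations on lines.\<close>

definition c1c :: "real set => (real => real) => (real => real) => bool" where
 "c1c X \<eta> \<eta>' \<longleftrightarrow> (\<forall>x. (\<eta> has_real_derivative \<eta>' x) (at x)) \<and> continuous_on UNIV \<eta>' \<and>
   (\<exists>c d. {c..d} \<subseteq> X \<and> (\<forall>x. x \<notin> {c..d} --> \<eta> x = 0))"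

lemma c1c_mono: "c1c X \<eta> \<eta>' ==> X \<subseteq> Y ==> c1c Y \<eta> \<eta>'"
 unfolding c1c_def by (meson order_trans)

lemma c1cD:
 assumes "c1c X \<eta> \<eta>'"
 shows "(\<eta> has_real_derivative \<eta>' x) (at x)" "continuous_on UNIV \<eta>" "continuous_on UNIV \<eta>'"
  "\<eta> \<in> borel_measurable borel" "\<eta>' \<in> borel_measurable borel"
proof -
 show d: "(\<eta> has_real_derivative \<eta>' x) (at x)" for x using assms by (auto simp: c1c_def)
 show "continuous_on UNIV \<eta>"
  using d by (intro continuous_at_imp_continuous_on) (auto intro: DERIV_isCont)
 then show "\<eta> \<in> borel_measurable borel" by (rule borel_measurable_continuous_onI)
 show "continuous_on UNIV \<eta>'" using assms by (auto simp: c1c_def)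
 then show "\<eta>' \<in> borel_measurable borel" by (rule borel_measurable_continuous_onI)
qed

lemma c1c_support:
 assumes "c1c X \<eta> \<eta>'"
 obtains c d where "{c..d} \<subseteq> X" "\<And>x. x \<notin> {c..d} ==> \<eta> x = 0" "\<And>x. x \<notin> {c..d} ==> \<eta>' x = 0"
proof -
 obtain c d where cd: "{c..d} \<subseteq> X" "\<And>x. x \<notin> {c..d} ==> \<eta> x = 0"
  using assms unfolding c1c_def by auto
 have "\<eta>' x = 0" if x: "x \<notin> {c..d}" for x
 proof -
  have op: "open (- {c..d})" by (simp add: open_Compl)
  have ev: "\<forall>\<^sub>F y in nhds x. \<eta> y = 0"
   unfolding eventually_nhds using op x cd(2) by (intro exI[of _ "- {c..d}"]) auto
  have "((%_. 0) has_real_derivative \<eta>' x) (at x)"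
   using DERIV_cong_ev[OF refl ev refl, of "\<eta>' x"] c1cD(1)[OF assms, of x] by simp
  then show ?thesis using DERIV_unique[OF DERIV_const] by metis
 qed
 with cd show thesis by (rule that)
qed

lemma c1c_zero_outside:
 assumes "c1c X \<eta> \<eta>'" "x \<notin> X"
 shows "\<eta> x = 0" "\<eta>' x = 0"
 using c1c_support[OF assms(1)] assms(2) by (metis subsetD)+

lemma continuous_compact_support_bounded:
 fixes \<eta> :: line_fun
 assumes "continuous_on UNIV \<eta>" "\<And>x. x \<notin> {c..d} ==> \<eta> x = 0"
 shows "\<exists>K. \<forall>x. \<bar>\<eta> x\<bar> \<le> K" and "integrable lborel \<eta>"
proof -
 have "bounded (\<eta> ` {c..d})"
  by (intro compact_imp_bounded compact_continuous_image continuous_on_subset[OF assms(1)]) auto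
 then obtain K where K: "\<And>x. x \<in> {c..d} ==> \<bar>\<eta> x\<bar> \<le> K" unfolding bounded_iff by fastforce
 have "\<bar>\<eta> x\<bar> \<le> max K 0" for x using K[of x] assms(2)[of x] by (cases "x \<in> {c..d}") auto
 then show "\<exists>K. \<forall>x. \<bar>\<eta> x\<bar> \<le> K" by blast
 have "set_integrable lborel {c..d} \<eta>"
  by (intro borel_integrable_atLeastAtMost' continuous_on_subset[OF assms(1)]) auto
 moreover have "(%x. indicator {c..d} x *\<^sub>R \<eta> x) = \<eta>"
  using assms(2) by (auto simp: fun_eq_iff indicator_def)
 ultimately show "integrable lborel \<eta>" by (simp only: set_integrable_def)
qed

lemma c1c_bounded:
 assumes "c1c X \<eta> \<eta>'"
 obtains K where "\<And>x. \<bar>\<eta> x\<bar> \<le> K" "\<And>x. \<bar>\<eta>' x\<bar> \<le> K" "K \<ge> 0"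
proof -
 obtain c d where cd: "\<And>x. x \<notin> {c..d} ==> \<eta> x = 0" "\<And>x. x \<notin> {c..d} ==> \<eta>' x = 0"
  using c1c_support[OF assms] by metis
 obtain K1 where "\<forall>x. \<bar>\<eta> x\<bar> \<le> K1"
  using continuous_compact_support_bounded(1)[OF c1cD(2)[OF assms], of c d] cd(1) by blast
 moreover obtain K2 where "\<forall>x. \<bar>\<eta>' x\<bar> \<le> K2"
  using continuous_compact_support_bounded(1)[OF c1cD(3)[OF assms], of c d] cd(2) by blast
 ultimately
show thesis by (intro that[of "max (max K1 K2) 0"]) (auto simp: le_max_iff_disj)
qed

lemma c1c_ac_on:
 assumes "c1c X \<eta> \<eta>'"
 shows "ac_on a b \<eta> \<eta>'"
 by (rule ac_on_derivative[of "{}"])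
   (use c1cD[OF assms] in \<open>auto intro: continuous_on_subset borel_integrable_atLeastAtMost'\<close>)

definition bump :: "real => real => nat => real => real" where
 "bump c d n x = step (real (Suc n) * (x - c) - 1) * step (real (Suc n) * (d - x) - 1)"

definition bump' :: "real => real => nat => real => real" where
 "bump' c d n x = real (Suc n) * step' (real (Suc n) * (x - c) - 1) * step (real (Suc n) * (d - x) - 1)
   - step (real (Suc n) * (x - c) - 1) * (real (Suc n) * step' (real (Suc n) * (d - x) - 1))"

lemma continuous_on_step: "continuous_on S step"
 using step_derivative by (intro continuous_at_imp_continuous_on) (auto intro: DERIV_isCont)

lemma c1c_bump: "c1c {c<..<d} (bump c d n) (bump' c d n)"
 unfolding c1c_def
proof (intro conjI allI exI)
 fix x
 have A: "((%x. step (real (Suc n) * (x - c) - 1)) has_real_derivative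
   step' (real (Suc n) * (x - c) - 1) * real (Suc n)) (at x)"
  by (rule DERIV_chain2[OF step_derivative]) (auto intro!: derivative_eq_intros)
 have B: "((%x. step (real (Suc n) * (d - x) - 1)) has_real_derivative
   step' (real (Suc n) * (d - x) - 1) * (- real (Suc n))) (at x)"
  by (rule DERIV_chain2[OF step_derivative]) (auto intro!: derivative_eq_intros)
 show "(bump c d n has_real_derivative bump' c d n x) (at x)"
  using DERIV_mult[OF A B] unfolding bump_def[abs_def] bump'_def by (simp add: algebra_simps)
next
 show "continuous_on UNIV (bump' c d n)"
  unfolding bump'_def[abs_def]
  by (intro continuous_intros continuous_on_compose2[OF continuous_on_step'[of UNIV]]
    continuous_on_compose2[OF continuous_on_step[of UNIV]]) auto
 have "0 < 1 / real (Suc n)" by simp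
 then show "{c + 1 / real (Suc n)..d - 1 / real (Suc n)} \<subseteq> {c<..<d}"
  unfolding subset_eq Ball_def atLeastAtMost_iff greaterThanLessThan_iff by linarith
 fix x
 have "step (real (Suc n) * (x - c) - 1) = 0" if "x < c + 1 / real (Suc n)"
 proof (rule step_eq_0)
  have "x - c < 1 / real (Suc n)" using that by simp
  then have "(x - c) * real (Suc n) < 1" by (simp only: less_divide_eq)
  then show "real (Suc n) * (x - c) - 1 \<le> 0" by (simp add: mult.commute)
 qed
 moreover have "step (real (Suc n) * (d - x) - 1) = 0" if "x > d - 1 / real (Suc n)"
 proof (rule step_eq_0)
  have "d - x < 1 / real (Suc n)" using that by simp
  then have "(d - x) * real (Suc n) < 1" by (simp only: less_divide_eq)
  then show "real (Suc n) * (d - x) - 1 \<le> 0" by (simp add: mult.commute)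
 qed
 ultimately show "x \<notin> {c + 1 / real (Suc n)..d - 1 / real (Suc n)} --> bump c d n x = 0"
  unfolding bump_def by (auto simp: not_le)
qed

lemma bump_bounds: "0 \<le> bump c d n x" "bump c d n x \<le> 1"
 unfolding bump_def using step_bounds by (auto intro: mult_le_one)

lemma bump_tendsto: "(%n. bump c d n x) \<longlonglongrightarrow> indicator {c<..<d} x"
proof (cases "x \<in> {c<..<d}")
 case True
 then have pos: "x - c > 0" "d - x > 0" by auto
 obtain n0 where n0: "2 / min (x - c) (d - x) < real n0" using reals_Archimedean2 by blast
 have "bump c d n x = 1" if "n \<ge> n0" for n
 proof -
  have m: "2 / min (x - c) (d - x) < real (Suc n)" using n0 that by linarith
  have "2 < real (Suc n) * min (x - c) (d - x)"
   using m pos by (simp only: divide_less_eq min_less_iff_conj)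
  moreover have "real (Suc n) * min (x - c) (d - x) \<le> real (Suc n) * (x - c)"
   "real (Suc n) * min (x - c) (d - x) \<le> real (Suc n) * (d - x)"
   by (rule mult_left_mono; simp)+
  ultimately have "2 < real (Suc n) * (x - c)" "2 < real (Suc n) * (d - x)" by linarith+
  then show ?thesis unfolding bump_def by (simp add: step_eq_1 del: of_nat_Suc)
 qed
 then have "\<forall>\<^sub>F n in sequentially. bump c d n x = indicator {c<..<d} x"
  using True by (intro eventually_sequentiallyI[of n0]) simp
 then show ?thesis by (rule tendsto_eventually)
next
 case False
 then have "bump c d n x = 0" for n using c1c_zero_outside(1)[OF c1c_bump] by blast
 then show ?thesis using False by simp
qed

lemma integrable_indicator_interval: "integrable lborel (indicator {c<..<d :: real} :: real => real)"
 by (cases "c \<le> d") (auto intro!: integrable_real_indicator)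

lemma integral_bump_tendsto: "(%n. LBINT x. bump c d n x) \<longlonglongrightarrow> (LBINT x. indicator {c<..<d} x)"
proof (rule integral_dominated_convergence[where w = "indicator {c<..<d}"])
 show "AE x in lborel. norm (bump c d n x) \<le> indicator {c<..<d} x" for n
  using bump_bounds[of c d n] c1c_zero_outside(1)[OF c1c_bump, of _ c d n]
  by (auto simp: indicator_def abs_of_nonneg)
qed (use c1cD(4)[OF c1c_bump] bump_tendsto integrable_indicator_interval in auto)

text \<open>A continuous function with compact support is the derivative of a test function as soon as
 its integral vanishes.\<close>

lemma c1c_antiderivative:
 fixes \<sigma> :: line_fun
 assumes cont: "continuous_on UNIV \<sigma>" and supp: "{c..d} \<subseteq> X" "\<And>x. x \<notin> {c..d} ==> \<sigma> x = 0"
  and zero: "(LBINT x. \<sigma> x) = 0"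
 obtains \<theta> where "c1c X \<theta> \<sigma>"
proof -
 have I: "integrable lborel \<sigma>" by (rule continuous_compact_support_bounded(2)[OF cont]) (rule supp(2))
 define \<theta> where "\<theta> y = (LBINT t. indicator {..y} t * \<sigma> t)" for y
 have eq: "\<theta> y = integral {A..y} \<sigma>" if "A < c" for y A
 proof -
  have "set_integrable lborel {A..y} \<sigma>"
   by (intro borel_integrable_atLeastAtMost' continuous_on_subset[OF cont]) auto
  then have "integral {A..y} \<sigma> = (LINT t:{A..y}|lborel. \<sigma> t)"
   by (simp add: set_borel_integral_eq_integral(2))
  also have "... = \<theta> y" unfolding \<theta>_def set_lebesgue_integral_def
   by (rule integral_cong_fun) (use supp(2) that in \<open>auto simp: indicator_def\<close>)
  finally show ?thesis by simp
 qed
 have "(\<theta> has_real_derivative \<sigma> x) (at x)" for x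
 proof -
  define A where "A = min c x - 1"
  have "((%y. integral {A..y} \<sigma>) has_real_derivative \<sigma> x) (at x within {A..x + 1})"
   by (rule integral_has_real_derivative) (auto simp: A_def intro: continuous_on_subset[OF cont])
  moreover have "x \<in> interior {A..x + 1}" by (auto simp: A_def)
  ultimately have "((%y. integral {A..y} \<sigma>) has_real_derivative \<sigma> x) (at x)"
   by (metis at_within_interior)
  moreover have "(%y. integral {A..y} \<sigma>) = \<theta>" using eq[of A] by (auto simp: A_def)
  ultimately show ?thesis by simp
 qed
 moreover have "\<theta> x = 0" if "x \<notin> {c..d}" for x
 proof (cases "x < c")
  case True
  then have "(%t. indicator {..x} t * \<sigma> t) = (%t. 0)"
   using supp(2) by (auto simp: fun_eq_iff indicator_def)
  then show ?thesis by (simp add: \<theta>_def)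
 next
  case False
  with that have "(%t. indicator {..x} t * \<sigma> t) = \<sigma>"
   using supp(2) by (auto simp: fun_eq_iff indicator_def)
  then show ?thesis using zero by (simp add: \<theta>_def)
 qed
 ultimately have "c1c X \<theta> \<sigma>" using cont supp(1) unfolding c1c_def by blast
 then show thesis by (rule that)
qed

lemma integrable_mult_bounded:
 fixes f g :: "'a => real"
 assumes "integrable N f" "g \<in> borel_measurable N" "\<And>x. \<bar>g x\<bar> \<le> K"
 shows "integrable N (%x. f x * g x)"
proof (rule integrable_dominated)
 show "integrable N (%x. K * f x)" using assms(1) by simp
 show "(%x. f x * g x) \<in> borel_measurable N" using assms(1,2) by auto
 have "\<bar>f x\<bar> * \<bar>g x\<bar> \<le> \<bar>K\<bar> * \<bar>f x\<bar>" for x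
  using mult_left_mono[OF order_trans[OF assms(3) abs_ge_self], of "\<bar>f x\<bar>" x] by (simp add: mult.commute)
 then show "AE x in N. norm (f x * g x) \<le> norm (K * f x)" by (simp add: abs_mult)
qed

lemma AE_zero_on_open:
 fixes f :: "'a::euclidean_space => real"
 assumes f: "integrable lborel f" and U: "open U"
  and z: "\<And>c d. box c d \<subseteq> U ==> (LINT x:box c d|lborel. f x) = 0"
 shows "AE x in lborel. x \<in> U --> f x = 0"
proof -
 have loc: "AE x in lborel. x \<in> box p q --> f x = 0" if "box p q \<subseteq> U" for p q
 proof -
  have "AE x in lborel. indicator (box p q) x * f x = 0"
  proof (rule AE_zero_if_box_integrals_zero)
   show "integrable lborel (%x. indicator (box p q) x * f x)"
    using integrable_real_mult_indicator[OF _ f, of "box p q"] by (simp add: mult.commute)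
   fix c d
   have "box c d \<inter> box p q \<subseteq> U" using that by auto
   moreover obtain c' d' where cd: "box c d \<inter> box p q = box c' d'" by (simp add: box_Int_box)
   ultimately have "(LINT x:box c' d'|lborel. f x) = 0" using z by simp
   then show "(LINT x:box c d|lborel. indicator (box p q) x * f x) = 0"
    unfolding cd[symmetric] by (simp add: set_lebesgue_integral_def indicator_inter_arith mult.assoc)
  qed
  then show ?thesis by (rule eventually_mono) (auto simp: indicator_def)
 qed
 define I where "I = {h\<in>Basis \<rightarrow>\<^sub>E \<rat> \<times> \<rat>. box (\<Sum>i\<in>Basis. fst (h i) *\<^sub>R i) (\<Sum>i\<in>Basis. snd (h i) *\<^sub>R i) \<subseteq> U}"
 have "countable (Basis \<rightarrow>\<^sub>E \<rat> \<times> (\<rat> :: real set) :: ('a => real \<times> real) set)"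
  by (intro countable_PiE) (auto intro: countable_rat)
 then have "countable I" unfolding I_def by (rule countable_subset[rotated]) auto
 then have "AE x in lborel. \<forall>h\<in>I. x \<in> box (\<Sum>i\<in>Basis. fst (h i) *\<^sub>R i) (\<Sum>i\<in>Basis. snd (h i) *\<^sub>R i) --> f x = 0"
  by (subst AE_ball_countable) (auto simp: I_def intro: loc)
 then show ?thesis
  by (rule eventually_mono) (use open_UNION_box[OF U] in \<open>auto simp: I_def\<close>)
qed

section \<open>Primitives\<close>

definition prim :: "(real => real) => real => real" where
 "prim g y = (LBINT t. indicator {..y} t * g t)"

lemma integrable_indicator_mult:
 fixes g :: "'a::euclidean_space => real"
 assumes "integrable lborel g" "A \<in> sets borel"
 shows "integrable lborel (%t. indicator A t * g t)"
 using integrable_real_mult_indicator[OF _ assms(1), of A] assms(2) by (simp add: mult.commute)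

lemma ac_on_prim:
 assumes g: "integrable lborel g"
 shows "ac_on A B (prim g) g"
proof (rule ac_onI)
 show "set_integrable lborel {A..B} g"
  using integrable_indicator_mult[OF g, of "{A..B}"] by (simp add: set_integrable_def)
 fix x assume x: "x \<in> {A..B}"
 have "prim g x = (LBINT t. indicator {..A} t * g t + indicator {A<..x} t * g t)"
  unfolding prim_def by (rule integral_cong_fun) (use x in \<open>auto simp: indicator_def\<close>)
 also have "... = prim g A + (LBINT t. indicator {A<..x} t * g t)"
  unfolding prim_def using integrable_indicator_mult[OF g] by simp
 also have "(LBINT t. indicator {A<..x} t * g t) = (LINT t:{A..x}|lborel. g t)"
  unfolding set_lebesgue_integral_def
 proof (rule integral_cong_AE)
  show "AE t in lborel. indicator {A<..x} t * g t = indicator {A..x} t *\<^sub>R g t"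
   by (rule eventually_mono[OF AE_lborel_singleton[of A]]) (auto simp: indicator_def)
 qed (use borel_measurable_integrable[OF g] in simp_all)
 finally show "prim g x = prim g A + (LINT t:{A..x}|lborel. g t)" .
qed

lemma isCont_prim:
 assumes "integrable lborel g"
 shows "isCont (prim g) y"
proof -
 have "continuous_on {y - 1..y + 1} (prim g)" by (rule ac_on_imp_continuous[OF ac_on_prim[OF assms]])
 then show ?thesis by (rule continuous_on_interior) simp
qed

lemma prim_eq_0: "(\<And>t. t \<le> y ==> g t = 0) ==> prim g y = 0"
 unfolding prim_def by (rule integral_eq_zero_AE) (auto simp: indicator_def)

lemma prim_eq_total: "(\<And>t. t > y ==> g t = 0) ==> prim g y = (LBINT t. g t)"
 unfolding prim_def by (rule integral_cong_fun) (auto simp: indicator_def not_le)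

lemma prim_abs_le: "integrable lborel g ==> \<bar>prim g y\<bar> \<le> (LBINT t. \<bar>g t\<bar>)"
proof -
 assume g: "integrable lborel g"
 have "\<bar>prim g y\<bar> \<le> (LBINT t. \<bar>indicator {..y} t * g t\<bar>)" unfolding prim_def using integral_abs_bound by blast
 also have "... \<le> (LBINT t. \<bar>g t\<bar>)"
  by (rule integral_mono') (use g in \<open>auto simp: indicator_def\<close>)
 finally show ?thesis .
qed

lemma integrable_mult_tensor:
 assumes f: "integrable lborel f" and m: "\<eta> \<in> borel_measurable borel" "\<theta> \<in> borel_measurable borel"
  and b: "\<And>x. \<bar>\<eta> x\<bar> \<le> K" "\<And>x. \<bar>\<theta> x\<bar> \<le> L"
 shows "integrable lborel (%z :: real \<times> real. f z * tens \<eta> \<theta> z :: real)"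
proof (rule integrable_mult_bounded[OF f, of _ "K * L"])
 note [measurable] = m
 have "(tens \<eta> \<theta>) \<in> borel_measurable (borel \<Otimes>\<^sub>M borel)" by measurable
 then show "(tens \<eta> \<theta>) \<in> borel_measurable lborel" by (simp add: borel_prod)
 show "\<bar>\<eta> (fst x) * \<theta> (snd x)\<bar> \<le> K * L" for x
  unfolding abs_mult by (intro mult_mono b abs_ge_zero order_trans[OF abs_ge_zero b(1)])
qed

lemma borel_measurable_prim_section:
 assumes "g \<in> borel_measurable (borel :: (real \<times> real) measure)"
 shows "(%z. prim (%t. g (fst z, t)) (snd z)) \<in> borel_measurable (borel :: (real \<times> real) measure)"
proof -
 have [measurable]: "g \<in> borel_measurable (borel \<Otimes>\<^sub>M borel)" using assms by (simp add: borel_prod)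
 have "(%z. LBINT t. (if t \<le> snd z then 1 else 0) * g (fst z, t)) \<in> borel_measurable (borel \<Otimes>\<^sub>M borel)"
  by measurable
 moreover have "(%z. LBINT t. (if t \<le> snd z then 1 else 0) * g (fst z, t)) = (%z. prim (%t. g (fst z, t)) (snd z))"
  unfolding prim_def by (intro ext integral_cong_fun) (auto simp: indicator_def)
 ultimately show ?thesis by (simp add: borel_prod)
qed

lemma integral_prim_by_parts:
 assumes g: "integrable lborel g" and \<theta>: "c1c UNIV \<theta> \<theta>'"
 shows "(LBINT y. prim g y * \<theta>' y) = - (LBINT y. g y * \<theta> y)"
proof -
 obtain c d where cd: "\<And>x. x \<notin> {c..d} ==> \<theta> x = 0" "\<And>x. x \<notin> {c..d} ==> \<theta>' x = 0"
  using c1c_support[OF \<theta>] by metis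
 obtain K where K: "\<And>x. \<bar>\<theta> x\<bar> \<le> K" using c1c_bounded[OF \<theta>] by metis
 define p q where "p = min c d - 1" and "q = max c d + 1"
 have pq: "p \<le> q" "p \<notin> {c..d}" "q \<notin> {c..d}" by (auto simp: p_def q_def)
 note bp = ac_on_integral_by_parts[OF ac_on_prim[OF g] c1c_ac_on[OF \<theta>] pq(1)]
 have i2: "integrable lborel (%y. g y * \<theta> y)"
  by (rule integrable_mult_bounded[OF g _ K]) (use c1cD(4)[OF \<theta>] in simp)
 have s2: "set_integrable lborel {p..q} (%y. g y * \<theta> y)"
  using integrable_indicator_mult[OF i2, of "{p..q}"] by (simp add: set_integrable_def)
 have s1: "set_integrable lborel {p..q} (%y. prim g y * \<theta>' y)"
  using set_integral_diff(1)[OF bp(1) s2] by simp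
 have e: "(LINT y:{p..q}|lborel. k y) = (LBINT y. k y)" if "\<And>y. y \<notin> {c..d} ==> k y = 0" for k :: line_fun
  unfolding set_lebesgue_integral_def
 proof (rule integral_cong_fun)
  show "indicator {p..q} y *\<^sub>R k y = k y" for y
  proof (cases "y \<in> {p..q}")
   case False
   then have "y \<notin> {c..d}" unfolding p_def q_def by (auto simp: min_def max_def split: if_splits)
   with that False show ?thesis by simp
  qed simp
 qed simp
 have "(LINT y:{p..q}|lborel. prim g y * \<theta>' y) + (LINT y:{p..q}|lborel. g y * \<theta> y) = 0"
  using bp(2) s1 s2 cd(1)[OF pq(2)] cd(1)[OF pq(3)] by (simp add: set_integral_add)
 moreover have "(LINT y:{p..q}|lborel. prim g y * \<theta>' y) = (LBINT y. prim g y * \<theta>' y)" by (rule e) (simp add: cd)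
 moreover have "(LINT y:{p..q}|lborel. g y * \<theta> y) = (LBINT y. g y * \<theta> y)" by (rule e) (simp add: cd)
 ultimately show ?thesis by simp
qed

text \<open>Fubini reduces the identity to integration by parts on vertical lines, with the primitive as
 one of the functions.\<close>

lemma prim_weak_derivative:
 assumes f: "integrable lborel f" and g: "integrable lborel g"
  and ae: "AE z in lborel. fst z \<in> X --> snd z \<in> Y --> f z = prim (%t. g (fst z, t)) (snd z)"
  and \<eta>: "c1c X \<eta> \<eta>'" and \<theta>: "c1c Y \<theta> \<theta>'"
 shows "(LBINT z. f z * tens \<eta> \<theta>' z) = - (LBINT z. g z * tens \<eta> \<theta> z)"
proof -
 obtain A where A: "\<And>x. \<bar>\<eta> x\<bar> \<le> A" using c1c_bounded[OF \<eta>] by metis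
 obtain B where B: "\<And>x. \<bar>\<theta> x\<bar> \<le> B" "\<And>x. \<bar>\<theta>' x\<bar> \<le> B" using c1c_bounded[OF \<theta>] by metis
 have \<theta>U: "c1c UNIV \<theta> \<theta>'" by (rule c1c_mono[OF \<theta>]) simp
 have i1: "integrable lborel (%z. f z * tens \<eta> \<theta>' z)"
  by (rule integrable_mult_tensor[OF f c1cD(4)[OF \<eta>] c1cD(5)[OF \<theta>] A B(2)])
 have i2: "integrable lborel (%z. g z * tens \<eta> \<theta> z)"
  by (rule integrable_mult_tensor[OF g c1cD(4)[OF \<eta>] c1cD(4)[OF \<theta>] A B(1)])
 have "AE x in lborel. (LBINT y. f (x, y) * (\<eta> x * \<theta>' y)) = - (LBINT y. g (x, y) * (\<eta> x * \<theta> y))"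
  using plane_AE_sections[OF ae] plane_Fubini(2)[OF g] plane_Fubini(2)[OF f]
 proof eventually_elim
  case (elim x)
  have "(LBINT y. f (x, y) * (\<eta> x * \<theta>' y)) = (LBINT y. \<eta> x * (prim (%t. g (x, t)) y * \<theta>' y))"
  proof (rule integral_cong_AE)
   show "AE y in lborel. f (x, y) * (\<eta> x * \<theta>' y) = \<eta> x * (prim (%t. g (x, t)) y * \<theta>' y)"
    using elim(1)
   proof (rule eventually_mono)
    fix y assume *: "fst (x, y) \<in> X --> snd (x, y) \<in> Y --> f (x, y) = prim (%t. g (fst (x, y), t)) (snd (x, y))"
    show "f (x, y) * (\<eta> x * \<theta>' y) = \<eta> x * (prim (%t. g (x, t)) y * \<theta>' y)"
     using * c1c_zero_outside(1)[OF \<eta>, of x] c1c_zero_outside(2)[OF \<theta>, of y] by (cases "x \<in> X"; cases "y \<in> Y") auto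
   qed
   show "(%y. f (x, y) * (\<eta> x * \<theta>' y)) \<in> borel_measurable lborel"
    using borel_measurable_integrable[OF elim(3)] c1cD(5)[OF \<theta>] by simp
   have "continuous_on UNIV (prim (%t. g (x, t)))"
    by (intro continuous_at_imp_continuous_on ballI isCont_prim elim(2))
   then show "(%y. \<eta> x * (prim (%t. g (x, t)) y * \<theta>' y)) \<in> borel_measurable lborel"
    using borel_measurable_continuous_onI[of "prim (%t. g (x, t))"] c1cD(5)[OF \<theta>] by simp
  qed
  also have "... = \<eta> x * (- (LBINT y. g (x, y) * \<theta> y))" using integral_prim_by_parts[OF elim(2) \<theta>U] by simp
  also have "... = - (LBINT y. \<eta> x * (g (x, y) * \<theta> y))" by simp
  also have "... = - (LBINT y. g (x, y) * (\<eta> x * \<theta> y))" by (simp add: algebra_simps)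
  finally show ?case .
 qed
 then have "(LBINT x. LBINT y. f (x, y) * (\<eta> x * \<theta>' y)) = (LBINT x. - (LBINT y. g (x, y) * (\<eta> x * \<theta> y)))"
  using plane_Fubini(3)[OF i1] plane_Fubini(3)[OF i2] by (intro integral_cong_AE) auto
 then show ?thesis using plane_Fubini(1)[OF i1] plane_Fubini(1)[OF i2] by simp
qed

section \<open>Weakly differentiable functions are absolutely continuous on lines\<close>

text \<open>Products of bumps approximate the indicator functions of boxes.\<close>

lemma AE_zero_if_orthogonal_to_tensors:
 fixes f :: plane_fun
 assumes f: "integrable lborel f" and U: "open U"
  and z: "\<And>X Y \<eta> \<eta>' \<theta> \<theta>'. c1c X \<eta> \<eta>' ==> c1c Y \<theta> \<theta>' ==> X \<times> Y \<subseteq> U ==> X \<noteq> {} ==> Y \<noteq> {} ==>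
   (LBINT z. f z * tens \<eta> \<theta> z) = 0"
 shows "AE z in lborel. z \<in> U --> f z = 0"
proof (rule AE_zero_on_open[OF f U])
 fix cc dd :: "real \<times> real" assume sub: "box cc dd \<subseteq> U"
 obtain c1 c2 d1 d2 where cd: "cc = (c1, c2)" "dd = (d1, d2)" by (cases cc; cases dd)
 show "(LINT z:box cc dd|lborel. f z) = 0"
 proof (cases "box cc dd = {}")
  case False
  have box: "box cc dd = {c1<..<d1} \<times> {c2<..<d2}" by (simp add: cd box_prod)
  have [measurable]: "f \<in> borel_measurable (borel \<Otimes>\<^sub>M borel)"
   using borel_measurable_integrable[OF f] by (simp add: borel_prod)
  have [measurable]: "bump c d n \<in> borel_measurable borel" for c d n by (rule c1cD(4)[OF c1c_bump])
  have "(%n. LBINT z. f z * (bump c1 d1 n (fst z) * bump c2 d2 n (snd z)))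
    \<longlonglongrightarrow> (LBINT z. f z * (indicator {c1<..<d1} (fst z) * indicator {c2<..<d2} (snd z)))"
  proof (rule integral_dominated_convergence[where w = "%z. \<bar>f z\<bar>"])
   have "(%z. f z * (bump c1 d1 n (fst z) * bump c2 d2 n (snd z))) \<in> borel_measurable (borel \<Otimes>\<^sub>M borel)"
    "(%z. f z * (indicator {c1<..<d1} (fst z) * indicator {c2<..<d2} (snd z))) \<in> borel_measurable (borel \<Otimes>\<^sub>M borel)" for n
    by measurable
   then show "(%z. f z * (bump c1 d1 n (fst z) * bump c2 d2 n (snd z))) \<in> borel_measurable lborel"
    "(%z. f z * (indicator {c1<..<d1} (fst z) * indicator {c2<..<d2} (snd z))) \<in> borel_measurable lborel" for n
    by (simp_all add: borel_prod)
   show "AE z in lborel. (%n. f z * (bump c1 d1 n (fst z) * bump c2 d2 n (snd z)))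
     \<longlonglongrightarrow> f z * (indicator {c1<..<d1} (fst z) * indicator {c2<..<d2} (snd z))"
    by (intro AE_I2 tendsto_intros bump_tendsto)
   have "\<bar>f z\<bar> * \<bar>bump c1 d1 n (fst z) * bump c2 d2 n (snd z)\<bar> \<le> \<bar>f z\<bar> * 1" for z n
    using bump_bounds by (intro mult_left_mono) (auto simp: abs_mult abs_of_nonneg intro: mult_le_one)
   then show "AE z in lborel. norm (f z * (bump c1 d1 n (fst z) * bump c2 d2 n (snd z))) \<le> \<bar>f z\<bar>" for n
    by (simp add: abs_mult)
  qed (use f in simp)
  moreover have "(LBINT z. f z * (bump c1 d1 n (fst z) * bump c2 d2 n (snd z))) = 0" for n
   by (rule z[OF c1c_bump c1c_bump]) (use sub False box in auto)
  ultimately have "(LBINT z. f z * (indicator {c1<..<d1} (fst z) * indicator {c2<..<d2} (snd z))) = 0"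
   by (simp add: LIMSEQ_const_iff)
  moreover have "indicator (box cc dd) z *\<^sub>R f z = f z * (indicator {c1<..<d1} (fst z) * indicator {c2<..<d2} (snd z))" for z
   unfolding box by (cases z) (simp add: indicator_times)
  ultimately show ?thesis unfolding set_lebesgue_integral_def by (simp only:)
 qed (simp add: set_lebesgue_integral_def)
qed

lemma c1c_support_interval:
 assumes "c1c {r<..<s} \<eta> \<eta>'" "r < s"
 obtains c d where "r < c" "d < s" "\<And>x. x \<notin> {c..d} ==> \<eta> x = 0"
proof -
 obtain c d where cd: "{c..d} \<subseteq> {r<..<s}" "\<And>x. x \<notin> {c..d} ==> \<eta> x = 0" using c1c_support[OF assms(1)] by metis
 show thesis
 proof (cases "c \<le> d")
  case True
  then have "r < c" "d < s" using cd(1) by auto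
  then show ?thesis by (rule that) (rule cd(2))
 next
  case False
  then show ?thesis using that[of "(r + s) / 2" "(r + s) / 2"] cd(2) assms(2) by auto
 qed
qed

text \<open>A function of zero integral is the derivative of a test function. Hence a function whose weak
 derivative in \<open>y\<close> vanishes is orthogonal to every $\eta(x)\sigma(y)$ with $\int\sigma = 0$; a fixed
 weight \<open>\<beta>\<close> with nonzero integral then identifies it with its weighted mean over vertical lines.\<close>

lemma weak_dy_zero_imp_constant_on_lines:
 fixes f :: plane_fun
 assumes f: "integrable lborel f" and rs: "r < s" and X: "open X"
  and weak: "\<And>\<eta> \<eta>' \<theta> \<theta>'. c1c X \<eta> \<eta>' ==> c1c {r<..<s} \<theta> \<theta>' ==> (LBINT z. f z * tens \<eta> \<theta>' z) = 0"
 obtains C :: line_fun where "AE z in lborel. fst z \<in> X --> snd z \<in> {r<..<s} --> f z = C (fst z)"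
proof -
 obtain n where n: "(LBINT y. bump r s n y) > 0"
 proof -
  have "(%n. LBINT y. bump r s n y) \<longlonglongrightarrow> s - r" using integral_bump_tendsto[of r s] rs by simp
  from order_tendstoD(1)[OF this, of 0] rs have "\<forall>\<^sub>F n in sequentially. (LBINT y. bump r s n y) > 0" by simp
  then show thesis using that by (auto simp: eventually_sequentially)
 qed
 define \<beta> J where "\<beta> = bump r s n" and "J = (LBINT y. bump r s n y)"
 have \<beta>: "c1c {r<..<s} \<beta> (bump' r s n)" unfolding \<beta>_def by (rule c1c_bump)
 have J: "J > 0" "J = (LBINT y. \<beta> y)" using n by (simp_all add: J_def \<beta>_def)
 obtain c0 d0 where cd0: "r < c0" "d0 < s" "\<And>x. x \<notin> {c0..d0} ==> \<beta> x = 0" using c1c_support_interval[OF \<beta> rs] by metis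
 have \<beta>I: "integrable lborel \<beta>" by (rule continuous_compact_support_bounded(2)[OF c1cD(2)[OF \<beta>]]) (rule cd0(3))
 obtain B where B: "\<And>x. \<bar>\<beta> x\<bar> \<le> B" using c1c_bounded[OF \<beta>] by metis
 define C where "C x = (LBINT t. f (x, t) * \<beta> t) / J" for x
 have CI: "integrable lborel C"
  unfolding C_def using plane_Fubini(3)[OF integrable_mult_tensor[OF f _ c1cD(4)[OF \<beta>] _ B, of "%_. 1" 1]] by simp
 define F where "F z = f z - C (fst z) * indicator {r<..<s} (snd z)" for z
 have FI: "integrable lborel F"
  unfolding F_def[abs_def] using f integrable_plane_tensor[OF CI integrable_indicator_interval] by simp
 have "AE z in lborel. z \<in> X \<times> {r<..<s} --> F z = 0"
 proof (rule AE_zero_if_orthogonal_to_tensors[OF FI open_Times[OF X open_greaterThanLessThan]])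
  fix X' Y \<eta> \<eta>' \<sigma> \<sigma>' assume c: "c1c X' \<eta> \<eta>'" "c1c Y \<sigma> \<sigma>'" "X' \<times> Y \<subseteq> X \<times> {r<..<s}" "X' \<noteq> {}" "Y \<noteq> {}"
  have \<eta>: "c1c X \<eta> \<eta>'" and \<sigma>: "c1c {r<..<s} \<sigma> \<sigma>'" using c1c_mono[OF c(1)] c1c_mono[OF c(2)] c(3-5) by (auto simp: times_subset_iff)
  obtain A where A: "\<And>x. \<bar>\<eta> x\<bar> \<le> A" using c1c_bounded[OF \<eta>] by metis
  obtain L where L: "\<And>x. \<bar>\<sigma> x\<bar> \<le> L" using c1c_bounded[OF \<sigma>] by metis
  obtain c d where cd: "r < c" "d < s" "\<And>x. x \<notin> {c..d} ==> \<sigma> x = 0" using c1c_support_interval[OF \<sigma> rs] by metis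
  have \<sigma>I: "integrable lborel \<sigma>" by (rule continuous_compact_support_bounded(2)[OF c1cD(2)[OF \<sigma>]]) (rule cd(3))
  define I where "I = (LBINT y. \<sigma> y)"
  obtain \<theta> where \<theta>: "c1c {r<..<s} \<theta> (%y. J * \<sigma> y - I * \<beta> y)"
  proof (rule c1c_antiderivative)
   show "continuous_on UNIV (%y. J * \<sigma> y - I * \<beta> y)" by (intro continuous_intros c1cD(2)[OF \<sigma>] c1cD(2)[OF \<beta>])
   show "{min c c0..max d d0} \<subseteq> {r<..<s}" using cd(1,2) cd0(1,2) by auto
   show "J * \<sigma> y - I * \<beta> y = 0" if "y \<notin> {min c c0..max d d0}" for y
   proof -
    have "y \<notin> {c..d}" "y \<notin> {c0..d0}" using that by auto
    then show ?thesis using cd(3) cd0(3) by simp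
   qed
   show "(LBINT y. J * \<sigma> y - I * \<beta> y) = 0" using \<sigma>I \<beta>I J by (simp add: I_def)
  qed
  have j: "integrable lborel (%z. f z * tens \<eta> \<sigma> z)" "integrable lborel (%z. f z * tens \<eta> \<beta> z)"
   by (rule integrable_mult_tensor[OF f c1cD(4)[OF \<eta>] c1cD(4)[OF \<sigma>] A L] integrable_mult_tensor[OF f c1cD(4)[OF \<eta>] c1cD(4)[OF \<beta>] A B])+
  have Ci: "integrable lborel (%x. C x * \<eta> x)" by (rule integrable_mult_bounded[OF CI _ A]) (use c1cD(4)[OF \<eta>] in simp)
  note k = integrable_plane_tensor[OF Ci \<sigma>I]
  have ind: "C (fst z) * indicator {r<..<s} (snd z) * tens \<eta> \<sigma> z = C (fst z) * \<eta> (fst z) * \<sigma> (snd z)" for z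
   using c1c_zero_outside(1)[OF \<sigma>, of "snd z"] by (auto simp: indicator_def)
  have "0 = (LBINT z. J * (f z * tens \<eta> \<sigma> z) - I * (f z * tens \<eta> \<beta> z))"
   using weak[OF \<eta> \<theta>] by (simp add: algebra_simps)
  then have A: "J * (LBINT z. f z * tens \<eta> \<sigma> z) = I * (LBINT z. f z * tens \<eta> \<beta> z)" using j by simp
  have "(LBINT z. f z * tens \<eta> \<beta> z) = (LBINT x. LBINT y. \<eta> x * (f (x, y) * \<beta> y))"
   using plane_Fubini(1)[OF j(2)] by (simp add: mult_ac)
  also have "... = (LBINT x. J * (C x * \<eta> x))" using J(1) by (simp add: C_def mult.commute)
  finally have B: "(LBINT z. f z * tens \<eta> \<beta> z) = J * (LBINT x. C x * \<eta> x)" by simp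
  have D: "(LBINT z. C (fst z) * \<eta> (fst z) * \<sigma> (snd z)) = (LBINT x. C x * \<eta> x) * I"
   using plane_Fubini(1)[OF k] by (simp add: I_def)
  have "(LBINT z. F z * tens \<eta> \<sigma> z) = (LBINT z. f z * tens \<eta> \<sigma> z - C (fst z) * \<eta> (fst z) * \<sigma> (snd z))"
   by (simp add: F_def left_diff_distrib ind)
  also have "... = 0" using j(1) k A B D J(1) by simp
  finally show "(LBINT z. F z * tens \<eta> \<sigma> z) = 0" .
 qed
 then have "AE z in lborel. fst z \<in> X --> snd z \<in> {r<..<s} --> f z = C (fst z)"
  by (rule eventually_mono) (auto simp: F_def mem_Times_iff)
 then show thesis by (rule that)
qed

text \<open>The primitive of \<open>g\<close> along vertical lines has the weak derivative \<open>g\<close>, so subtracting it from \<open>f\<close> leaves a function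
 whose weak derivative in \<open>y\<close> vanishes and which is therefore constant on vertical lines.\<close>

lemma weak_derivative_imp_ac_on_lines:
 fixes f g :: plane_fun
 assumes f: "integrable lborel f" and g: "integrable lborel g" and rs: "r < s" and X: "open X"
  and weak: "\<And>\<eta> \<eta>' \<theta> \<theta>'. c1c X \<eta> \<eta>' ==> c1c {r<..<s} \<theta> \<theta>' ==>
   (LBINT z. f z * tens \<eta> \<theta>' z) = - (LBINT z. g z * tens \<eta> \<theta> z)"
 obtains C :: line_fun where "AE z in lborel. fst z \<in> X --> snd z \<in> {r<..<s} -->
   f z = C (fst z) + prim (%t. g (fst z, t)) (snd z)"
proof -
 define P where "P z = prim (%t. g (fst z, t)) (snd z)" for z
 have [measurable]: "P \<in> borel_measurable (borel \<Otimes>\<^sub>M borel)"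
  using borel_measurable_prim_section[of g] borel_measurable_integrable[OF g] by (simp add: P_def[abs_def] borel_prod)
 define \<gamma> where "\<gamma> x = (LBINT y. \<bar>g (x, y)\<bar>)" for x
 have \<gamma>: "integrable lborel \<gamma>" unfolding \<gamma>_def using plane_Fubini(3)[OF integrable_abs[OF g]] .
 have le: "AE z in lborel. \<bar>P z\<bar> \<le> \<gamma> (fst z)"
 proof (rule plane_AE_of_sections)
  have [measurable]: "\<gamma> \<in> borel_measurable borel" using borel_measurable_integrable[OF \<gamma>] by simp
  have "{z \<in> space (borel \<Otimes>\<^sub>M borel). \<bar>P z\<bar> \<le> \<gamma> (fst z)} \<in> sets (borel \<Otimes>\<^sub>M borel)" by measurable
  then show "{z. \<bar>P z\<bar> \<le> \<gamma> (fst z)} \<in> sets borel" unfolding borel_prod by simp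
  show "AE x in lborel. AE y in lborel. \<bar>P (x, y)\<bar> \<le> \<gamma> (fst (x, y))"
   using plane_Fubini(2)[OF g] by (rule eventually_mono) (simp add: P_def \<gamma>_def prim_abs_le)
 qed
 define F where "F z = P z * indicator {r<..<s} (snd z)" for z
 have F: "integrable lborel F"
 proof (rule integrable_dominated)
  show "integrable lborel (%z. \<gamma> (fst z) * indicator {r<..<s} (snd z))"
   by (rule integrable_plane_tensor[OF \<gamma> integrable_indicator_interval])
  have "F \<in> borel_measurable (borel \<Otimes>\<^sub>M borel)" unfolding F_def[abs_def] by measurable
  then show "F \<in> borel_measurable lborel" by (simp add: borel_prod)
  show "AE z in lborel. norm (F z) \<le> norm (\<gamma> (fst z) * indicator {r<..<s} (snd z))"
   using le by (rule eventually_mono) (auto simp: F_def indicator_def)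
 qed
 obtain C where C: "AE z in lborel. fst z \<in> X --> snd z \<in> {r<..<s} --> f z - F z = C (fst z)"
 proof (rule weak_dy_zero_imp_constant_on_lines[OF _ rs X])
  show "integrable lborel (%z. f z - F z)" using f F by simp
  fix \<eta> \<eta>' \<theta> \<theta>' assume \<eta>: "c1c X \<eta> \<eta>'" and \<theta>: "c1c {r<..<s} \<theta> \<theta>'"
  obtain A where A: "\<And>x. \<bar>\<eta> x\<bar> \<le> A" using c1c_bounded[OF \<eta>] by metis
  obtain B where B: "\<And>x. \<bar>\<theta>' x\<bar> \<le> B" using c1c_bounded[OF \<theta>] by metis
  have "(LBINT z. F z * tens \<eta> \<theta>' z) = - (LBINT z. g z * tens \<eta> \<theta> z)"
   by (rule prim_weak_derivative[OF F g _ \<eta> \<theta>]) (simp add: F_def P_def)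
  then show "(LBINT z. (f z - F z) * tens \<eta> \<theta>' z) = 0"
   using weak[OF \<eta> \<theta>] integrable_mult_tensor[OF f c1cD(4)[OF \<eta>] c1cD(5)[OF \<theta>] A B]
    integrable_mult_tensor[OF F c1cD(4)[OF \<eta>] c1cD(5)[OF \<theta>] A B] by (simp add: left_diff_distrib)
 qed
 then have "AE z in lborel. fst z \<in> X --> snd z \<in> {r<..<s} --> f z = C (fst z) + prim (%t. g (fst z, t)) (snd z)"
  by (rule eventually_mono) (auto simp: F_def P_def)
 then show thesis by (rule that)
qed

section \<open>Zero extension and vanishing on open sets\<close>

lemma leb_integral:
 fixes f :: "'a::euclidean_space => 'b::euclidean_space"
 assumes "S \<in> sets borel"
 shows "(LINT x|leb S. f x) = (LBINT x. indicator S x *\<^sub>R f x)"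
  and "integrable (leb S) f \<longleftrightarrow> integrable lborel (%x. indicator S x *\<^sub>R f x)"
  and "f \<in> borel_measurable (leb S) \<longleftrightarrow> (%x. indicator S x *\<^sub>R f x) \<in> borel_measurable borel"
 using assms by (simp_all add: integral_restrict_space integrable_restrict_space borel_measurable_restrict_space_iff)

lemma AE_leb:
 assumes "S \<in> sets borel"
 shows "(AE x in leb S. P x) \<longleftrightarrow> (AE x in lborel. x \<in> S --> P x)"
 using assms by (subst AE_restrict_space_iff) auto

lemma L2_leb_iff:
 fixes f :: "'a::euclidean_space => 'b::euclidean_space"
 assumes "S \<in> sets borel"
 shows "f \<in> L2 (leb S) \<longleftrightarrow> (%x. indicator S x *\<^sub>R f x) \<in> L2 lborel"
proof -
 have "(norm (indicator S x *\<^sub>R f x))^2 = indicator S x *\<^sub>R (norm (f x))^2" for x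
  by (auto simp: indicator_def)
 then show ?thesis unfolding L2_def by (simp add: leb_integral(2,3)[OF assms])
qed

lemma integrable_leb_if_L2:
 fixes f :: "'a::euclidean_space => 'b::euclidean_space"
 assumes S: "S \<in> sets borel" "bounded S" and f: "f \<in> L2 (leb S)"
 shows "integrable (leb S) f"
proof (rule integrable_dominated)
 have "integrable (leb S) (%x. 1 :: real)"
  unfolding leb_integral(2)[OF S(1)]
  using integrable_real_indicator[of S lborel] S emeasure_bounded_finite[OF S(2)] by simp
 then show "integrable (leb S) (%x. 1 + (norm (f x))^2)" using f by (auto simp: L2_def)
 have "norm (f x) \<le> 1 + (norm (f x))^2" for x
 proof -
  have "0 \<le> (norm (f x) - 1)^2" by simp
  also have "... = (norm (f x))^2 - 2 * norm (f x) + 1" by (simp add: power2_diff)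
  finally show ?thesis using norm_ge_zero[of "f x"] by linarith
 qed
 then show "AE x in leb S. norm (f x) \<le> norm (1 + (norm (f x))^2)" by auto
qed (use f in \<open>simp add: L2_D\<close>)

lemma L2_bounded_on:
 fixes f :: "'a::euclidean_space => real"
 assumes S: "S \<in> sets borel" "bounded S" and f: "(%x. indicator S x *\<^sub>R f x) \<in> borel_measurable borel"
  and K: "\<And>x. x \<in> S ==> \<bar>f x\<bar> \<le> K"
 shows "f \<in> L2 (leb S)"
proof -
 have "(norm (indicator S x *\<^sub>R (1::real)))^2 = indicator S x" for x by (auto simp: indicator_def)
 then have "(%x. indicator S x *\<^sub>R (1::real)) \<in> L2 lborel"
  unfolding L2_def
  using integrable_real_indicator[of S lborel] S emeasure_bounded_finite[OF S(2)] by simp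
 then have "(%x. K *\<^sub>R (indicator S x *\<^sub>R (1::real))) \<in> L2 lborel" by (rule L2_scale)
 then show ?thesis unfolding L2_leb_iff[OF S(1)]
  by (rule L2_dominated) (use f K in \<open>auto simp: indicator_def intro: order_trans[OF K abs_ge_self]\<close>)
qed

section \<open>Weak gradients\<close>

lemma is_weak_gradD:
 assumes "is_weak_grad S u G"
 shows "G \<in> L2 (leb S)"
  and "\<phi> \<in> test_functions S ==> i \<in> Basis ==>
   (LINT x|leb S. u x * frechet_derivative \<phi> (at x) i) = - (LINT x|leb S. (G x \<bullet> i) * \<phi> x)"
 using assms unfolding is_weak_grad_def by auto

lemma H1_L2: "u \<in> H1 S ==> u \<in> L2 (leb S)"
 by (simp add: H1_def)

lemma H1_weak_grad: "u \<in> H1 S ==> is_weak_grad S u (weak_grad S u)"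
 unfolding H1_def weak_grad_def using someI_ex[of "is_weak_grad S u"] by blast

lemma H1I: "u \<in> L2 (leb S) ==> is_weak_grad S u G ==> u \<in> H1 S"
 by (auto simp: H1_def)

lemma continuous_compact_support_L2:
 fixes \<phi> :: "'a::euclidean_space => real"
 assumes S: "S \<in> sets borel" and c: "continuous_on UNIV \<phi>" and K: "compact K" "\<And>x. x \<notin> K ==> \<phi> x = 0"
 shows "\<phi> \<in> L2 (leb S)" "\<exists>C. \<forall>x. \<bar>\<phi> x\<bar> \<le> C"
proof -
 have m: "\<phi> \<in> borel_measurable borel" by (rule borel_measurable_continuous_onI[OF c])
 have "integrable lborel (%x. indicator K x *\<^sub>R (\<phi> x)^2)"
 proof (rule borel_integrable_compact[OF K(1)])
  show "continuous_on K (%x. (\<phi> x)^2)" by (intro continuous_intros continuous_on_subset[OF c]) auto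
 qed
 moreover have "(%x. indicator K x *\<^sub>R (\<phi> x)^2) = (%x. (\<phi> x)^2)"
  using K(2) by (auto simp: fun_eq_iff indicator_def)
 ultimately have L: "\<phi> \<in> L2 lborel" using m by (simp add: L2_def)
 show "\<phi> \<in> L2 (leb S)" unfolding L2_leb_iff[OF S]
  by (rule L2_dominated[OF L]) (use m S in \<open>auto simp: indicator_def\<close>)
 have "bounded (\<phi> ` K)" by (intro compact_imp_bounded compact_continuous_image continuous_on_subset[OF c] K) auto
 then obtain C where C: "\<And>x. x \<in> K ==> \<bar>\<phi> x\<bar> \<le> C" unfolding bounded_iff by fastforce
 have "\<bar>\<phi> x\<bar> \<le> max C 0" for x using C[of x] K(2)[of x] by (cases "x \<in> K") auto
 then show "\<exists>C. \<forall>x. \<bar>\<phi> x\<bar> \<le> C" by blast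
qed

lemma test_functions_L2:
 fixes \<phi> :: "'a::euclidean_space => real"
 assumes S: "S \<in> sets borel" and \<phi>: "\<phi> \<in> test_functions S"
 shows "\<phi> \<in> L2 (leb S)" "(%x. frechet_derivative \<phi> (at x) i) \<in> L2 (leb S)"
proof -
 let ?K = "closure {x. \<phi> x \<noteq> 0}"
 have K: "compact ?K" using \<phi> by (simp add: test_functions_def)
 have d: "\<phi> differentiable at x" for x using \<phi> by (simp add: test_functions_def)
 have c: "continuous_on UNIV \<phi>"
  using d by (intro continuous_at_imp_continuous_on) (auto intro: differentiable_imp_continuous_within)
 have c': "continuous_on UNIV (%x. frechet_derivative \<phi> (at x) i)" using \<phi> by (simp add: test_functions_def)
 have z: "\<phi> x = 0" if "x \<notin> ?K" for x
  using that subsetD[OF closure_subset, of x "{x. \<phi> x \<noteq> 0}"] by blast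
 have z': "frechet_derivative \<phi> (at x) i = 0" if x: "x \<notin> ?K" for x
 proof -
  have "(\<phi> has_derivative (%_. 0)) (at x)"
  proof (rule has_derivative_transform_within_open[of "%_. 0"])
   show "open (- ?K)" by (simp add: open_Compl)
   show "x \<in> - ?K" using x by simp
   show "0 = \<phi> y" if "y \<in> - ?K" for y using z[of y] that by (metis ComplD)
  qed simp
  then have "(%_. 0) = frechet_derivative \<phi> (at x)" by (rule frechet_derivative_at)
  then show ?thesis by metis
 qed
 show "\<phi> \<in> L2 (leb S)" by (rule continuous_compact_support_L2(1)[OF S c K], rule z)
 show "(%x. frechet_derivative \<phi> (at x) i) \<in> L2 (leb S)"
  by (rule continuous_compact_support_L2(1)[OF S c' K], rule z')
qed

lemma L2_component:
 assumes "G \<in> L2 N" and "i \<in> Basis"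
 shows "(%x. G x \<bullet> i) \<in> L2 N"
 by (rule L2_dominated[OF assms(1)]) (use assms L2_D(1)[OF assms(1)] in \<open>auto simp: Basis_le_norm\<close>)

lemma is_weak_grad_lincomb:
 assumes S: "S \<in> sets borel" and u: "u \<in> L2 (leb S)" "v \<in> L2 (leb S)"
  and G: "is_weak_grad S u G" "is_weak_grad S v H"
 shows "is_weak_grad S (%x. u x + t * v x) (%x. G x + t *\<^sub>R H x)"
 unfolding is_weak_grad_def
proof (intro conjI ballI)
 note GL = is_weak_gradD(1)[OF G(1)] and HL = is_weak_gradD(1)[OF G(2)]
 show "(%x. G x + t *\<^sub>R H x) \<in> L2 (leb S)" by (intro L2_add L2_scale GL HL)
 fix \<phi> i assume \<phi>: "\<phi> \<in> test_functions S" and i: "i \<in> (Basis :: 'a set)"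
 note T = test_functions_L2[OF S \<phi>]
 have "(LINT x|leb S. (u x + t * v x) * frechet_derivative \<phi> (at x) i)
   = (LINT x|leb S. u x * frechet_derivative \<phi> (at x) i + t * (v x * frechet_derivative \<phi> (at x) i))"
  by (simp add: algebra_simps)
 also have "... = (LINT x|leb S. u x * frechet_derivative \<phi> (at x) i) + t * (LINT x|leb S. v x * frechet_derivative \<phi> (at x) i)"
  using integrable_mult_L2[OF u(1) T(2)] integrable_mult_L2[OF u(2) T(2)] by simp
 also have "... = - ((LINT x|leb S. (G x \<bullet> i) * \<phi> x) + t * (LINT x|leb S. (H x \<bullet> i) * \<phi> x))"
  by (simp add: is_weak_gradD(2)[OF G(1) \<phi> i] is_weak_gradD(2)[OF G(2) \<phi> i])
 also have "... = - (LINT x|leb S. (G x \<bullet> i) * \<phi> x + t * ((H x \<bullet> i) * \<phi> x))"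
  using integrable_mult_L2[OF L2_component[OF GL i] T(1)] integrable_mult_L2[OF L2_component[OF HL i] T(1)] by simp
 also have "... = - (LINT x|leb S. ((G x + t *\<^sub>R H x) \<bullet> i) * \<phi> x)"
  by (simp add: algebra_simps)
 finally show "(LINT x|leb S. (u x + t * v x) * frechet_derivative \<phi> (at x) i)
   = - (LINT x|leb S. ((G x + t *\<^sub>R H x) \<bullet> i) * \<phi> x)" .
qed

lemma is_weak_grad_zero: "is_weak_grad S (%_. 0) (%_. 0)"
 by (simp add: is_weak_grad_def L2_zero)

lemma l2_inner_tendsto:
 fixes f :: "nat => 'a => 'b::euclidean_space"
 assumes "\<And>n. f n \<in> L2 N" "f0 \<in> L2 N" "g \<in> L2 N" and lim: "(%n. l2_norm N (%x. f n x - f0 x)) \<longlonglongrightarrow> 0"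
 shows "(%n. l2_inner N (f n) g) \<longlonglongrightarrow> l2_inner N f0 g"
proof -
 have "(%n. l2_inner N (f n) g - l2_inner N f0 g) \<longlonglongrightarrow> 0"
 proof (rule Lim_null_comparison)
  show "\<forall>\<^sub>F n in sequentially. norm (l2_inner N (f n) g - l2_inner N f0 g) \<le> l2_norm N (%x. f n x - f0 x) * l2_norm N g"
   using l2_Cauchy_Schwarz[OF L2_diff[OF assms(1,2)] assms(3)] assms(1-3)
   by (auto simp: l2_inner_diff_left)
  show "(%n. l2_norm N (%x. f n x - f0 x) * l2_norm N g) \<longlonglongrightarrow> 0"
   by (rule tendsto_mult_left_zero[OF lim])
 qed
 then show ?thesis by (rule LIM_zero_cancel)
qed

lemma l2_norm_component_le:
 assumes "G \<in> L2 N" "i \<in> Basis"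
 shows "l2_norm N (%x. G x \<bullet> i) \<le> l2_norm N G"
 unfolding l2_norm_def l2_inner_self
proof (rule real_sqrt_le_mono, rule integral_mono)
 show "integrable N (%x. (norm (G x \<bullet> i))^2)" by (rule L2_D(2)[OF L2_component[OF assms]])
 show "integrable N (%x. (norm (G x))^2)" by (rule L2_D(2)[OF assms(1)])
 show "(norm (G x \<bullet> i))^2 \<le> (norm (G x))^2" for x
  using Basis_le_norm[OF assms(2)] by (intro power_mono) auto
qed

lemma l2_norm_component_tendsto:
 assumes "\<And>n. G n \<in> L2 N" "G0 \<in> L2 N" "i \<in> Basis" "(%n. l2_norm N (%x. G n x - G0 x)) \<longlonglongrightarrow> 0"
 shows "(%n. l2_norm N (%x. G n x \<bullet> i - G0 x \<bullet> i)) \<longlonglongrightarrow> 0"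
proof (rule Lim_null_comparison[OF _ assms(4)])
 have "l2_norm N (%x. G n x \<bullet> i - G0 x \<bullet> i) \<le> l2_norm N (%x. G n x - G0 x)" for n
  using l2_norm_component_le[OF L2_diff[OF assms(1)[of n] assms(2)] assms(3)] by (simp add: inner_diff_left)
 then show "\<forall>\<^sub>F n in sequentially. norm (l2_norm N (%x. G n x \<bullet> i - G0 x \<bullet> i)) \<le> l2_norm N (%x. G n x - G0 x)"
  by (simp add: l2_norm_nonneg)
qed

text \<open>Both sides of the defining identity are inner products with a fixed test function, hence continuous.\<close>

lemma is_weak_grad_limit:
 fixes u :: "nat => 'a::euclidean_space => real"
 assumes S: "S \<in> sets borel" and u: "\<And>n. u n \<in> L2 (leb S)" "v \<in> L2 (leb S)"
  and G: "\<And>n. is_weak_grad S (u n) (G n)" and H: "H \<in> L2 (leb S)"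
  and lim: "(%n. l2_norm (leb S) (%x. u n x - v x)) \<longlonglongrightarrow> 0" "(%n. l2_norm (leb S) (%x. G n x - H x)) \<longlonglongrightarrow> 0"
 shows "is_weak_grad S v H"
 unfolding is_weak_grad_def
proof (intro conjI ballI H)
 fix \<phi> i assume \<phi>: "\<phi> \<in> test_functions S" and i: "i \<in> (Basis :: 'a set)"
 note T = test_functions_L2[OF S \<phi>] and GL = is_weak_gradD(1)[OF G]
 have "(%n. l2_inner (leb S) (u n) (%x. frechet_derivative \<phi> (at x) i))
   \<longlonglongrightarrow> l2_inner (leb S) v (%x. frechet_derivative \<phi> (at x) i)"
  by (rule l2_inner_tendsto[OF u T(2) lim(1)])
 moreover have "(%n. - l2_inner (leb S) (%x. G n x \<bullet> i) \<phi>) \<longlonglongrightarrow> - l2_inner (leb S) (%x. H x \<bullet> i) \<phi>"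
  by (intro tendsto_minus l2_inner_tendsto L2_component GL H i T(1) l2_norm_component_tendsto[OF GL H i lim(2)])
 moreover have "l2_inner (leb S) (u n) (%x. frechet_derivative \<phi> (at x) i) = - l2_inner (leb S) (%x. G n x \<bullet> i) \<phi>" for n
  using is_weak_gradD(2)[OF G \<phi> i] by (simp add: l2_inner_def)
 ultimately have "l2_inner (leb S) v (%x. frechet_derivative \<phi> (at x) i) = - l2_inner (leb S) (%x. H x \<bullet> i) \<phi>"
  using LIMSEQ_unique by simp
 then show "(LINT x|leb S. v x * frechet_derivative \<phi> (at x) i) = - (LINT x|leb S. (H x \<bullet> i) * \<phi> x)"
  by (simp add: l2_inner_def)
qed

section \<open>Weak derivatives on an interval\<close>

lemma test_functions_interval_iff:
 fixes a b :: real
 shows "\<phi> \<in> test_functions {a..b} \<longleftrightarrow> c1c {a<..<b} \<phi> (%x. frechet_derivative \<phi> (at x) 1)"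
  (is "?L \<longleftrightarrow> ?R")
proof
 assume L: ?L
 let ?K = "closure {x. \<phi> x \<noteq> 0}"
 have K: "compact ?K" "?K \<subseteq> {a<..<b}" using L by (auto simp: test_functions_def interior_atLeastAtMost_real)
 have d: "(\<phi> has_real_derivative frechet_derivative \<phi> (at x) 1) (at x)" for x
 proof -
  have f: "(\<phi> has_derivative frechet_derivative \<phi> (at x)) (at x)"
   using L by (simp add: test_functions_def frechet_derivative_works[symmetric])
  then obtain c where c: "frechet_derivative \<phi> (at x) = (%t. t * c)"
   by (metis has_derivative_linear real_linearD mult.commute)
  have "(%t. t * c) = (*) c" by (auto simp: mult.commute)
  with f c show ?thesis by (simp add: has_field_derivative_def)
 qed
 have "\<exists>c d. {c..d} \<subseteq> {a<..<b} \<and> (\<forall>x. x \<notin> {c..d} --> \<phi> x = 0)"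
 proof (cases "?K = {}")
  case True
  then have "\<phi> x = 0" for x using closure_subset[of "{x. \<phi> x \<noteq> 0}"] by auto
  then show ?thesis by (intro exI[of _ 1] exI[of _ 0]) auto
 next
  case False
  obtain c where c: "c \<in> ?K" "\<And>x. x \<in> ?K ==> c \<le> x" using compact_attains_inf[OF K(1) False] by auto
  obtain e where e: "e \<in> ?K" "\<And>x. x \<in> ?K ==> x \<le> e" using compact_attains_sup[OF K(1) False] by auto
  have "c \<in> {a<..<b}" "e \<in> {a<..<b}" using c e K(2) by auto
  then have "{c..e} \<subseteq> {a<..<b}" by auto
  moreover have "\<phi> x = 0" if "x \<notin> {c..e}" for x
  proof (rule ccontr)
   assume "\<phi> x \<noteq> 0"
   then have "x \<in> ?K" using closure_subset by fastforce
   with c e that show False by auto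
  qed
  ultimately show ?thesis by blast
 qed
 with d L show ?R by (auto simp: c1c_def test_functions_def)
next
 assume R: ?R
 obtain c d where cd: "{c..d} \<subseteq> {a<..<b}" "\<And>x. x \<notin> {c..d} ==> \<phi> x = 0" using c1c_support[OF R] by metis
 have "{x. \<phi> x \<noteq> 0} \<subseteq> {c..d}" using cd(2) by blast
 then have K: "closure {x. \<phi> x \<noteq> 0} \<subseteq> {c..d}" by (rule closure_minimal) simp
 then have "compact (closure {x. \<phi> x \<noteq> 0})"
  by (metis compact_Icc closed_closure compact_Int_closed inf.absorb_iff2)
 moreover have "\<phi> differentiable at x" for x using c1cD(1)[OF R, of x] unfolding has_field_derivative_def by (rule differentiableI)
 moreover have "continuous_on UNIV (%x. frechet_derivative \<phi> (at x) v)" for v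
 proof -
  have "frechet_derivative \<phi> (at x) v = v * frechet_derivative \<phi> (at x) 1" for x
  proof -
   have "frechet_derivative \<phi> (at x) = (*) (frechet_derivative \<phi> (at x) 1)"
    using c1cD(1)[OF R, of x] unfolding has_field_derivative_def by (rule frechet_derivative_at[symmetric])
   then show ?thesis by (metis mult.commute)
  qed
  then show ?thesis using c1cD(3)[OF R] by (auto intro!: continuous_intros)
 qed
 ultimately show ?L using K cd(1) by (auto simp: test_functions_def interior_atLeastAtMost_real)
qed

lemma frechet_derivative_c1c:
 "c1c X \<eta> \<eta>' ==> frechet_derivative \<eta> (at x) 1 = \<eta>' x"
 using c1cD(1)[of X \<eta> \<eta>' x] unfolding has_field_derivative_def
 by (metis frechet_derivative_at mult.right_neutral)

lemma is_weak_grad_interval_iff: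
 fixes a b :: real
 shows "is_weak_grad {a..b} u G \<longleftrightarrow> G \<in> L2 (leb {a..b}) \<and> (\<forall>\<eta> \<eta>'. c1c {a<..<b} \<eta> \<eta>' -->
   (LINT x|leb {a..b}. u x * \<eta>' x) = - (LINT x|leb {a..b}. G x * \<eta> x))"
proof -
 have *: "c1c {a<..<b} \<eta> \<eta>' \<longleftrightarrow> \<eta> \<in> test_functions {a..b} \<and> \<eta>' = (%x. frechet_derivative \<eta> (at x) 1)" for \<eta> \<eta>'
 proof
  assume c: "c1c {a<..<b} \<eta> \<eta>'"
  then have "\<eta>' = (%x. frechet_derivative \<eta> (at x) 1)" using frechet_derivative_c1c by force
  with c show "\<eta> \<in> test_functions {a..b} \<and> \<eta>' = (%x. frechet_derivative \<eta> (at x) 1)"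
   by (simp add: test_functions_interval_iff)
 qed (simp add: test_functions_interval_iff)
 show ?thesis unfolding is_weak_grad_def * by auto
qed

text \<open>The one-dimensional case of absolute continuity on lines, read off from functions on the
 plane that do not depend on the first coordinate.\<close>

lemma weak_derivative_imp_ac:
 fixes u g :: line_fun
 assumes u: "integrable lborel u" and g: "integrable lborel g" and rs: "r < s"
  and weak: "\<And>\<theta> \<theta>'. c1c {r<..<s} \<theta> \<theta>' ==> (LBINT y. u y * \<theta>' y) = - (LBINT y. g y * \<theta> y)"
 shows "\<exists>c. AE y in lborel. y \<in> {r<..<s} --> u y = c + prim g y"
proof -
 let ?f = "%z. indicator {0<..<1::real} (fst z) * u (snd z)"
 let ?g = "%z. indicator {0<..<1::real} (fst z) * g (snd z)"
 have f: "integrable lborel ?f" and gg: "integrable lborel ?g"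
  by (rule integrable_plane_tensor[OF integrable_indicator_interval u])
    (rule integrable_plane_tensor[OF integrable_indicator_interval g])
 obtain C where C: "AE z in lborel. fst z \<in> {0<..<1} --> snd z \<in> {r<..<s} -->
   ?f z = C (fst z) + prim (%t. ?g (fst z, t)) (snd z)"
 proof (rule weak_derivative_imp_ac_on_lines[OF f gg rs open_greaterThanLessThan])
  fix \<eta> \<eta>' \<theta> \<theta>' assume \<eta>: "c1c {0<..<1} \<eta> \<eta>'" and \<theta>: "c1c {r<..<s} \<theta> \<theta>'"
  have m: "\<eta> \<in> borel_measurable borel" "\<theta> \<in> borel_measurable borel" "\<theta>' \<in> borel_measurable borel"
   using c1cD[OF \<eta>] c1cD[OF \<theta>] by auto
  obtain K where K: "\<And>x. \<bar>\<eta> x\<bar> \<le> K" using c1c_bounded[OF \<eta>] by metis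
  obtain L where L: "\<And>x. \<bar>\<theta> x\<bar> \<le> L" "\<And>x. \<bar>\<theta>' x\<bar> \<le> L" using c1c_bounded[OF \<theta>] by metis
  have i0: "integrable lborel (%x. indicator {0<..<1::real} x * \<eta> x)"
   by (rule integrable_mult_bounded[OF integrable_indicator_interval _ K]) (use m in simp)
  have i1: "integrable lborel (%y. u y * \<theta>' y)"
   by (rule integrable_mult_bounded[OF u _ L(2)]) (use m in simp)
  have i2: "integrable lborel (%y. g y * \<theta> y)"
   by (rule integrable_mult_bounded[OF g _ L(1)]) (use m in simp)
  have e: "(LBINT z. p (fst z) * q (snd z)) = (LBINT x. p x) * (LBINT y. q y)"
   if "integrable lborel p" "integrable lborel q" for p q :: line_fun
   using plane_Fubini(1)[OF integrable_plane_tensor[OF that]] by simp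
  show "(LBINT z. ?f z * tens \<eta> \<theta>' z) = - (LBINT z. ?g z * tens \<eta> \<theta> z)"
   using e[OF i0 i1] e[OF i0 i2] weak[OF \<theta>] by (simp add: algebra_simps)
 qed auto
 let ?P = "%c. AE y in lborel. y \<in> {r<..<s} --> u y = c + prim g y"
 have P: "AE x in lborel. x \<in> {0<..<1::real} --> ?P (C x)"
  using plane_AE_sections[OF C]
 proof (rule eventually_mono, intro impI)
  fix x assume x: "x \<in> {0<..<1::real}"
  assume "AE y in lborel. fst (x, y) \<in> {0<..<1} --> snd (x, y) \<in> {r<..<s} -->
   ?f (x, y) = C (fst (x, y)) + prim (%t. ?g (fst (x, y), t)) (snd (x, y))"
  then show "?P (C x)" using x by simp
 qed
 show ?thesis
 proof (rule ccontr)
  assume "\<nexists>c. ?P c"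
  with P have "AE x in lborel. x \<notin> {0<..<1::real}" by simp
  then have "emeasure lborel {0<..<1::real} = 0"
   by (subst (asm) AE_iff_measurable[of "{0<..<1::real}"]) auto
  then show False by simp
 qed
qed

lemma weak_grad_interval_imp_ac:
 fixes a b :: real
 assumes ab: "a < b" and u: "u \<in> L2 (leb {a..b})" and G: "is_weak_grad {a..b} u G"
 obtains f where "ac_on a b f G" "AE x in leb {a..b}. u x = f x"
proof -
 have S: "{a..b} \<in> sets borel" "bounded {a..b}" by auto
 note GL = is_weak_gradD(1)[OF G]
 let ?u = "%x. indicator {a..b} x * u x" and ?G = "%x. indicator {a..b} x * G x"
 have i: "integrable lborel ?u" "integrable lborel ?G"
  using integrable_leb_if_L2[OF S u] integrable_leb_if_L2[OF S GL] by (simp_all add: leb_integral(2)[OF S(1)])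
 have "\<exists>c. AE y in lborel. y \<in> {a<..<b} --> ?u y = c + prim ?G y"
 proof (rule weak_derivative_imp_ac[OF i ab])
  fix \<theta> \<theta>' assume "c1c {a<..<b} \<theta> \<theta>'"
  then have "(LINT x|leb {a..b}. u x * \<theta>' x) = - (LINT x|leb {a..b}. G x * \<theta> x)"
   using G by (simp add: is_weak_grad_interval_iff)
  then show "(LBINT y. ?u y * \<theta>' y) = - (LBINT y. ?G y * \<theta> y)"
   by (simp add: leb_integral(1)[OF S(1)] mult.assoc)
 qed
 then obtain c where c: "AE y in lborel. y \<in> {a<..<b} --> ?u y = c + prim ?G y" by auto
 have "ac_on a b (%y. c + prim ?G y) ?G"
  by (rule ac_onI[OF ac_on_integrable[OF ac_on_prim[OF i(2)]]]) (use ac_on_eq[OF ac_on_prim[OF i(2)]] in simp)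
 then have "ac_on a b (%y. c + prim ?G y) G" by (rule ac_on_cong) auto
 moreover have "AE x in leb {a..b}. u x = c + prim ?G x"
  unfolding AE_leb[OF S(1)]
  using c AE_lborel_singleton[of a] AE_lborel_singleton[of b] by eventually_elim auto
 ultimately show thesis by (rule that)
qed

lemma L2_interval_bounded_measurable:
 fixes f :: line_fun
 assumes "continuous_on {a..b} f"
 shows "f \<in> L2 (leb {a..b})"
proof -
 have "bounded (f ` {a..b})" by (intro compact_imp_bounded compact_continuous_image assms) auto
 then obtain K where "\<And>x. x \<in> {a..b} ==> \<bar>f x\<bar> \<le> K" unfolding bounded_iff by fastforce
 then show ?thesis
  by (intro L2_bounded_on[of _ _ K] borel_measurable_continuous_on_indicator assms) auto
qed

lemma ac_on_imp_weak_grad: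
 fixes a b :: real
 assumes ab: "a < b" and f: "ac_on a b f G" and G: "G \<in> L2 (leb {a..b})"
 shows "f \<in> L2 (leb {a..b})" "is_weak_grad {a..b} f G"
proof -
 show "f \<in> L2 (leb {a..b})" by (rule L2_interval_bounded_measurable[OF ac_on_imp_continuous[OF f]])
 have S: "{a..b} \<in> sets borel" by simp
 show "is_weak_grad {a..b} f G" unfolding is_weak_grad_interval_iff
 proof (intro conjI allI impI G)
  fix \<eta> \<eta>' assume \<eta>: "c1c {a<..<b} \<eta> \<eta>'"
  note bp = ac_on_integral_by_parts[OF f c1c_ac_on[OF \<eta>] less_imp_le[OF ab]]
  have L: "\<eta> \<in> L2 (leb {a..b})" "\<eta>' \<in> L2 (leb {a..b})"
   by (rule L2_interval_bounded_measurable, rule continuous_on_subset[OF c1cD(2)[OF \<eta>]], simp)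
     (rule L2_interval_bounded_measurable, rule continuous_on_subset[OF c1cD(3)[OF \<eta>]], simp)
  have "(LINT x|leb {a..b}. f x * \<eta>' x + G x * \<eta> x) = 0"
   using bp(2) c1c_zero_outside(1)[OF \<eta>, of a] c1c_zero_outside(1)[OF \<eta>, of b]
   by (simp add: leb_integral(1)[OF S] set_lebesgue_integral_def)
  then show "(LINT x|leb {a..b}. f x * \<eta>' x) = - (LINT x|leb {a..b}. G x * \<eta> x)"
   using integrable_mult_L2[OF \<open>f \<in> L2 (leb {a..b})\<close> L(2)] integrable_mult_L2[OF G L(1)] by simp
 qed
qed

lemma weak_grad_unique_interval:
 fixes a b :: real
 assumes G: "is_weak_grad {a..b} u G" "is_weak_grad {a..b} u H"
 shows "AE x in leb {a..b}. G x = H x"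
proof -
 have S: "{a..b} \<in> sets borel" "bounded {a..b}" by auto
 define D where "D x = G x - H x" for x
 have GL: "G \<in> L2 (leb {a..b})" "H \<in> L2 (leb {a..b})" using is_weak_gradD(1)[OF G(1)] is_weak_gradD(1)[OF G(2)] .
 have DL: "D \<in> L2 (leb {a..b})" unfolding D_def[abs_def] by (rule L2_diff[OF GL])
 have I: "integrable lborel (%x. indicator {a..b} x * D x)"
  using integrable_leb_if_L2[OF S DL] by (simp add: leb_integral(2)[OF S(1)])
 have z: "(LBINT x. (indicator {a..b} x * D x) * \<eta> x) = 0" if \<eta>: "c1c {a<..<b} \<eta> \<eta>'" for \<eta> \<eta>'
 proof -
  have "\<eta> \<in> L2 (leb {a..b})"
   by (rule L2_interval_bounded_measurable, rule continuous_on_subset[OF c1cD(2)[OF \<eta>]], simp)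
  note i1 = integrable_mult_L2[OF GL(1) this] and i2 = integrable_mult_L2[OF GL(2) this]
  have "(LINT x|leb {a..b}. D x * \<eta> x) = 0"
  proof -
   have "(LINT x|leb {a..b}. G x * \<eta> x) = (LINT x|leb {a..b}. H x * \<eta> x)"
   proof -
    have "(LINT x|leb {a..b}. u x * \<eta>' x) = - (LINT x|leb {a..b}. G x * \<eta> x)"
     "(LINT x|leb {a..b}. u x * \<eta>' x) = - (LINT x|leb {a..b}. H x * \<eta> x)"
     using G \<eta> unfolding is_weak_grad_interval_iff by blast+
    then show ?thesis by simp
   qed
   with i1 i2 show ?thesis by (simp add: D_def left_diff_distrib)
  qed
  then show ?thesis by (simp add: leb_integral(1)[OF S(1)] mult.assoc)
 qed
 have "AE x in lborel. x \<in> {a<..<b} --> indicator {a..b} x * D x = 0"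
 proof (rule AE_zero_on_open[OF I])
  fix c d :: real assume sub: "box c d \<subseteq> {a<..<b}"
  have "(%n. LBINT x. (indicator {a..b} x * D x) * bump c d n x)
    \<longlonglongrightarrow> (LBINT x. (indicator {a..b} x * D x) * indicator {c<..<d} x)"
  proof (rule integral_dominated_convergence[where w = "%x. \<bar>indicator {a..b} x * D x\<bar>"])
   show "AE x in lborel. (%n. (indicator {a..b} x * D x) * bump c d n x) \<longlonglongrightarrow> (indicator {a..b} x * D x) * indicator {c<..<d} x"
    by (intro AE_I2 tendsto_intros bump_tendsto)
   have "\<bar>indicator {a..b} x * D x\<bar> * \<bar>bump c d n x\<bar> \<le> \<bar>indicator {a..b} x * D x\<bar> * 1" for x n
    using bump_bounds[of c d n x] by (intro mult_left_mono) auto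
   then show "AE x in lborel. norm ((indicator {a..b} x * D x) * bump c d n x) \<le> \<bar>indicator {a..b} x * D x\<bar>" for n
    by (simp add: abs_mult)
  qed (use I borel_measurable_integrable[OF I] c1cD(4)[OF c1c_bump] in simp_all)
  moreover have "(LBINT x. (indicator {a..b} x * D x) * bump c d n x) = 0" for n
   by (rule z[OF c1c_mono[OF c1c_bump]]) (use sub in simp)
  ultimately show "(LINT x:box c d|lborel. indicator {a..b} x * D x) = 0"
   by (simp add: LIMSEQ_const_iff set_lebesgue_integral_def mult.commute)
 qed simp
 then show ?thesis unfolding AE_leb[OF S(1)]
  using AE_lborel_singleton[of a] AE_lborel_singleton[of b]
  by eventually_elim (auto simp: D_def indicator_def)
qed

section \<open>Test functions of two variables\<close>

lemma plane_test_functionI: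
 fixes T Tx Ty :: plane_fun
 assumes U: "open U" and d: "\<And>z. z \<in> U ==> (T has_derivative (%v. fst v * Tx z + snd v * Ty z)) (at z)"
  and c: "continuous_on U Tx" "continuous_on U Ty"
  and K: "compact K" "K \<subseteq> U" "K \<subseteq> interior S"
  and zero: "\<And>z. z \<notin> K ==> T z = 0" "\<And>z. z \<notin> K ==> Tx z = 0" "\<And>z. z \<notin> K ==> Ty z = 0"
 shows "T \<in> test_functions S" "frechet_derivative T (at z) (1, 0) = Tx z" "frechet_derivative T (at z) (0, 1) = Ty z"
proof -
 have oK: "open (- K)" using compact_imp_closed[OF K(1)] by (simp add: open_Compl)
 have D: "(T has_derivative (%v. fst v * Tx z + snd v * Ty z)) (at z)" for z
 proof (cases "z \<in> U")
  case False
  then have z: "z \<in> - K" using K(2) by auto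
  have "(T has_derivative (%_. 0)) (at z)"
   by (rule has_derivative_transform_within_open[of "%_. 0", OF _ oK z]) (simp_all add: zero(1))
  then show ?thesis using zero(2,3)[of z] z by simp
 qed (rule d)
 have fd: "frechet_derivative T (at z) = (%v. fst v * Tx z + snd v * Ty z)" for z
  by (rule frechet_derivative_at[OF D, symmetric])
 then show "frechet_derivative T (at z) (1, 0) = Tx z" "frechet_derivative T (at z) (0, 1) = Ty z" by simp_all
 have "continuous_on (- K) Tx" "continuous_on (- K) Ty"
  by (rule continuous_on_eq[OF continuous_on_const[of _ 0]]; simp add: zero)+
 then have "continuous_on (U \<union> - K) Tx" "continuous_on (U \<union> - K) Ty"
  using c U oK by (auto intro: continuous_on_open_Un)
 moreover have "U \<union> - K = UNIV" using K(2) by auto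
 ultimately have cont: "continuous_on UNIV Tx" "continuous_on UNIV Ty" by auto
 have sub: "closure {z. T z \<noteq> 0} \<subseteq> K"
  by (rule closure_minimal) (use zero(1) compact_imp_closed[OF K(1)] in auto)
 have "compact (K \<inter> closure {z. T z \<noteq> 0})" by (rule compact_Int_closed[OF K(1)]) simp
 then have "compact (closure {z. T z \<noteq> 0})" using sub by (simp add: Int_absorb1)
 moreover have "T differentiable (at z)" for z using D by (rule differentiableI)
 moreover have "continuous_on UNIV (%z. frechet_derivative T (at z) v)" for v
  unfolding fd by (intro continuous_intros cont)
 ultimately show "T \<in> test_functions S" using sub K(3) by (auto simp: test_functions_def)
qed

lemma plane_test_functionD:
 fixes T :: plane_fun
 assumes T: "T \<in> test_functions S"
 defines "Tx \<equiv> %z. frechet_derivative T (at z) (1, 0)" and "Ty \<equiv> %z. frechet_derivative T (at z) (0, 1)"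
 obtains R where
  "\<And>x y. ((%x. T (x, y)) has_real_derivative Tx (x, y)) (at x)"
  "\<And>x y. ((%y. T (x, y)) has_real_derivative Ty (x, y)) (at y)"
  "continuous_on UNIV T" "continuous_on UNIV Tx" "continuous_on UNIV Ty"
  "\<And>z. z \<notin> interior S ==> T z = 0 \<and> Tx z = 0 \<and> Ty z = 0"
  "\<And>z. \<bar>T z\<bar> \<le> R" "\<And>z. \<bar>Tx z\<bar> \<le> R" "\<And>z. \<bar>Ty z\<bar> \<le> R"
  "\<And>x y. \<bar>x\<bar> > R \<or> \<bar>y\<bar> > R ==> T (x, y) = 0 \<and> Tx (x, y) = 0 \<and> Ty (x, y) = 0"
proof -
 let ?K = "closure {z. T z \<noteq> 0}"
 have K: "compact ?K" "?K \<subseteq> interior S" using T by (auto simp: test_functions_def)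
 have df: "(T has_derivative frechet_derivative T (at z)) (at z)" for z
 proof -
  have "T differentiable at z" using T unfolding test_functions_def by blast
  then show ?thesis by (simp add: frechet_derivative_works)
 qed
 have px: "((%x. (x, y)) has_derivative (%t. (t, 0))) (at x)" for x y :: real
  by (intro has_derivative_Pair has_derivative_ident has_derivative_const)
 have py: "((%y. (x, y)) has_derivative (%t. (0, t))) (at y)" for x y :: real
  by (intro has_derivative_Pair has_derivative_ident has_derivative_const)
 have "((%x. T (x, y)) has_derivative (%t. frechet_derivative T (at (x, y)) (t, 0))) (at x)" for x y
  by (rule has_derivative_compose[OF px df])
 moreover have "frechet_derivative T (at z) (t, 0) = t * Tx z" for z t
  using linear_scale[OF has_derivative_linear[OF df[of z]], of t "(1, 0)"] by (simp add: Tx_def)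
 ultimately have dx: "((%x. T (x, y)) has_real_derivative Tx (x, y)) (at x)" for x y
  by (simp add: has_field_derivative_def mult.commute[of _ "Tx _"] cong: )
 have "((%y. T (x, y)) has_derivative (%t. frechet_derivative T (at (x, y)) (0, t))) (at y)" for x y
  by (rule has_derivative_compose[OF py df])
 moreover have "frechet_derivative T (at z) (0, t) = t * Ty z" for z t
  using linear_scale[OF has_derivative_linear[OF df[of z]], of t "(0, 1)"] by (simp add: Ty_def)
 ultimately have dy: "((%y. T (x, y)) has_real_derivative Ty (x, y)) (at y)" for x y
  by (simp add: has_field_derivative_def mult.commute[of _ "Ty _"] cong: )
 have c: "continuous_on UNIV T"
  by (intro continuous_at_imp_continuous_on ballI has_derivative_continuous[OF df])
 have cx: "continuous_on UNIV Tx" and cy: "continuous_on UNIV Ty"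
  using T by (auto simp: test_functions_def Tx_def Ty_def)
 have zT: "T z = 0" if "z \<notin> ?K" for z using that subsetD[OF closure_subset, of z "{z. T z \<noteq> 0}"] by blast
 have fz: "frechet_derivative T (at z) = (%_. 0)" if z: "z \<notin> ?K" for z
 proof -
  have "(T has_derivative (%_. 0)) (at z)"
  proof (rule has_derivative_transform_within_open[of "%_. 0"])
   show "open (- ?K)" by (simp add: open_Compl)
   show "z \<in> - ?K" using z by simp
   show "0 = T y" if "y \<in> - ?K" for y using zT[of y] that by (metis ComplD)
  qed simp
  then have "(%_. 0) = frechet_derivative T (at z)" by (rule frechet_derivative_at)
  then show ?thesis by simp
 qed
 have z: "T z = 0 \<and> Tx z = 0 \<and> Ty z = 0" if "z \<notin> ?K" for z
  using zT[OF that] fz[OF that] by (simp add: Tx_def Ty_def)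
 have bnd: "\<exists>C. \<forall>z. \<bar>F z\<bar> \<le> C" if "continuous_on UNIV F" "\<And>z. z \<notin> ?K ==> F z = 0" for F :: plane_fun
  by (rule continuous_compact_support_L2(2)[OF _ that(1) K(1), of UNIV]) (simp_all add: that(2))
 obtain C1 where C1: "\<And>z. \<bar>T z\<bar> \<le> C1" using bnd[OF c] z by blast
 obtain C2 where C2: "\<And>z. \<bar>Tx z\<bar> \<le> C2" using bnd[OF cx] z by blast
 obtain C3 where C3: "\<And>z. \<bar>Ty z\<bar> \<le> C3" using bnd[OF cy] z by blast
 obtain C4 where C4: "\<And>z. z \<in> ?K ==> norm z \<le> C4"
  using compact_imp_bounded[OF K(1)] unfolding bounded_iff by blast
 define R where "R = max (max C1 C2) (max C3 C4)"
 show thesis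
 proof (rule that[OF dx dy c cx cy, of R])
  show "T z = 0 \<and> Tx z = 0 \<and> Ty z = 0" if "z \<notin> interior S" for z using z K(2) that by blast
  show "\<bar>T z\<bar> \<le> R" "\<bar>Tx z\<bar> \<le> R" "\<bar>Ty z\<bar> \<le> R" for z
   using C1[of z] C2[of z] C3[of z] by (auto simp: R_def)
  show "T (x, y) = 0 \<and> Tx (x, y) = 0 \<and> Ty (x, y) = 0" if "\<bar>x\<bar> > R \<or> \<bar>y\<bar> > R" for x y
  proof (rule z)
   have "norm (x, y) > C4"
    using that norm_fst_le[of x y] norm_snd_le[of y x] by (auto simp: R_def)
   then show "(x, y) \<notin> ?K" using C4[of "(x, y)"] by auto
  qed
 qed
qed

lemma plane_test_function_tensor:
 assumes \<eta>: "c1c X \<eta> \<eta>'" and \<theta>: "c1c Y \<theta> \<theta>'" and sub: "X \<times> Y \<subseteq> interior S"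
 shows "(tens \<eta> \<theta>) \<in> test_functions S"
  "frechet_derivative (tens \<eta> \<theta>) (at z) (1, 0) = \<eta>' (fst z) * \<theta> (snd z)"
  "frechet_derivative (tens \<eta> \<theta>) (at z) (0, 1) = \<eta> (fst z) * \<theta>' (snd z)"
proof -
 obtain c d where cd: "{c..d} \<subseteq> X" "\<And>x. x \<notin> {c..d} ==> \<eta> x = 0" "\<And>x. x \<notin> {c..d} ==> \<eta>' x = 0"
  using c1c_support[OF \<eta>] by metis
 obtain e f where ef: "{e..f} \<subseteq> Y" "\<And>x. x \<notin> {e..f} ==> \<theta> x = 0" "\<And>x. x \<notin> {e..f} ==> \<theta>' x = 0"
  using c1c_support[OF \<theta>] by metis
 have D: "((tens \<eta> \<theta>) has_derivative
   (%v. fst v * tens \<eta>' \<theta> z + snd v * tens \<eta> \<theta>' z)) (at z)" for z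
 proof -
  have 1: "((%z. \<eta> (fst z)) has_derivative (%v. \<eta>' (fst z) * fst v)) (at z)"
   using has_derivative_compose[OF has_derivative_fst[OF has_derivative_ident], of \<eta> "(*) (\<eta>' (fst z))" z UNIV]
    c1cD(1)[OF \<eta>, of "fst z"] by (simp add: has_field_derivative_def)
  have 2: "((%z. \<theta> (snd z)) has_derivative (%v. \<theta>' (snd z) * snd v)) (at z)"
   using has_derivative_compose[OF has_derivative_snd[OF has_derivative_ident], of \<theta> "(*) (\<theta>' (snd z))" z UNIV]
    c1cD(1)[OF \<theta>, of "snd z"] by (simp add: has_field_derivative_def)
  show ?thesis by (rule has_derivative_eq_rhs[OF has_derivative_mult[OF 1 2]]) (auto simp: algebra_simps)
 qed
 have cc: "continuous_on UNIV (%z :: real \<times> real. \<eta>' (fst z) * \<theta> (snd z))" "continuous_on UNIV (%z :: real \<times> real. \<eta> (fst z) * \<theta>' (snd z))"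
  by (intro continuous_intros continuous_on_compose2[OF c1cD(2)[OF \<eta>]] continuous_on_compose2[OF c1cD(3)[OF \<eta>]]
    continuous_on_compose2[OF c1cD(2)[OF \<theta>]] continuous_on_compose2[OF c1cD(3)[OF \<theta>]]; simp)+
 have z: "tens \<eta> \<theta> z = 0" "tens \<eta>' \<theta> z = 0" "tens \<eta> \<theta>' z = 0"
  if "z \<notin> {c..d} \<times> {e..f}" for z
 proof -
  have "fst z \<notin> {c..d} \<or> snd z \<notin> {e..f}" using that by (cases z) auto
  then show "tens \<eta> \<theta> z = 0" "tens \<eta>' \<theta> z = 0" "tens \<eta> \<theta>' z = 0"
   using cd(2,3) ef(2,3) by auto
 qed
 have K: "compact ({c..d} \<times> {e..f})" "{c..d} \<times> {e..f} \<subseteq> UNIV" "{c..d} \<times> {e..f} \<subseteq> interior S"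
  using cd(1) ef(1) sub by (auto intro: compact_Times)
 show "(tens \<eta> \<theta>) \<in> test_functions S"
  "frechet_derivative (tens \<eta> \<theta>) (at z) (1, 0) = \<eta>' (fst z) * \<theta> (snd z)"
  "frechet_derivative (tens \<eta> \<theta>) (at z) (0, 1) = \<eta> (fst z) * \<theta>' (snd z)"
  by (rule plane_test_functionI[OF open_UNIV D cc K]; (rule z)?; assumption)+
qed

lemma is_weak_grad_plane_iff:
 fixes S :: "(real \<times> real) set"
 shows "is_weak_grad S u G \<longleftrightarrow> G \<in> L2 (leb S) \<and> (\<forall>T\<in>test_functions S.
   (LINT z|leb S. u z * frechet_derivative T (at z) (1, 0)) = - (LINT z|leb S. fst (G z) * T z) \<and>
   (LINT z|leb S. u z * frechet_derivative T (at z) (0, 1)) = - (LINT z|leb S. snd (G z) * T z))"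
proof -
 have B: "(\<forall>i\<in>Basis. P i) \<longleftrightarrow> P (1, 0) \<and> P (0, 1)" for P :: "real \<times> real => bool"
  by (auto simp: Basis_prod_def)
 show ?thesis unfolding is_weak_grad_def B by (simp add: inner_prod_def)
qed

lemma AE_interval_nonempty:
 fixes c d :: real
 assumes "AE y in lborel. P y" "c < d"
 shows "\<exists>y\<in>{c<..<d}. P y"
proof (rule ccontr)
 assume "\<not> ?thesis"
 with assms(1) have "AE y in lborel. y \<notin> {c<..<d}" by (auto elim!: eventually_mono)
 then have "emeasure lborel {c<..<d} = 0"
  by (subst (asm) AE_iff_measurable[of "{c<..<d}"]) auto
 with assms(2) show False by simp
qed

text \<open>Equality almost everywhere suffices to compare one-sided limits, since every neighbourhood contains
 points of equality.\<close>

lemma AE_limits_agree: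
 fixes u F :: line_fun
 assumes ae: "AE y in lborel. y \<in> X --> u y = F y" and X: "open X" and c: "at c within X \<noteq> bot"
  and lim: "(u \<longlongrightarrow> A) (at c within X)" "(F \<longlongrightarrow> B) (at c within X)"
 shows "A = B"
proof (rule ccontr)
 assume "A \<noteq> B"
 have "((%y. u y - F y) \<longlongrightarrow> A - B) (at c within X)" by (intro tendsto_intros lim)
 then have "\<forall>\<^sub>F y in at c within X. u y - F y \<noteq> 0"
  by (rule tendsto_imp_eventually_ne) (use \<open>A \<noteq> B\<close> in simp)
 then obtain W where W: "open W" "c \<in> W" "\<And>y. y \<in> W ==> y \<noteq> c ==> y \<in> X ==> u y - F y \<noteq> 0"
  unfolding eventually_at_topological by blast
 obtain y0 where "y0 \<in> W \<inter> X - {c}" using c W(1,2) unfolding trivial_limit_within islimpt_def by blast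
 moreover have "open (W \<inter> X - {c})" by (intro open_Diff open_Int W(1) X) simp
 ultimately obtain e where e: "e > 0" "\<And>y. dist y y0 < e ==> y \<in> W \<inter> X - {c}" unfolding open_dist by blast
 obtain y where "y \<in> {y0 - e<..<y0 + e}" "y \<in> X --> u y = F y"
  using AE_interval_nonempty[OF ae, of "y0 - e" "y0 + e"] e(1) by auto
 moreover from this(1) have "y \<in> W \<inter> X - {c}" by (intro e(2)) (auto simp: dist_real_def)
 ultimately show False using W(3) by auto
qed

lemma at_within_open_interval:
 fixes c d :: real
 assumes "c < d"
 shows "at c within {c<..<d} = at_right c" "at d within {c<..<d} = at_left d"
proof -
 show "at c within {c<..<d} = at_right c" by (rule at_within_nhd[of c "{..<d}"]) (use assms in force)+
 show "at d within {c<..<d} = at_left d" by (rule at_within_nhd[of d "{c<..}"]) (use assms in force)+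
qed

lemma AE_one_sided_limits_agree:
 fixes u F :: line_fun
 assumes ae: "AE y in lborel. y \<in> {c<..<d} --> u y = F y" and cd: "c < d"
 shows AE_limits_agree_right: "(u \<longlongrightarrow> A) (at_right c) ==> (F \<longlongrightarrow> B) (at_right c) ==> A = B"
  and AE_limits_agree_left: "(u \<longlongrightarrow> A) (at_left d) ==> (F \<longlongrightarrow> B) (at_left d) ==> A = B"
 using AE_limits_agree[OF ae open_greaterThanLessThan, of c] AE_limits_agree[OF ae open_greaterThanLessThan, of d]
 by (simp_all add: at_within_open_interval[OF cd])

text \<open>Local absolute continuity on the compact subintervals of $(0,L)$, together with vanishing
 limits at both ends, determines the function as the primitive that starts from zero.\<close>

lemma locally_ac_vanishing_eq_prim:
 assumes g: "integrable lborel g" and L: "0 < L"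
  and out: "\<And>y. y \<notin> {0<..<L} ==> u y = 0" "\<And>y. y \<notin> {0<..<L} ==> g y = 0"
  and loc: "\<And>r s. r \<in> \<rat> ==> s \<in> \<rat> ==> 0 < r ==> r < s ==> s < L ==>
   \<exists>c. AE y in lborel. y \<in> {r<..<s} --> u y = c + prim g y"
  and rep: "AE y in lborel. y \<in> {0<..<L} --> u' y = u y"
  and lim: "(u' \<longlongrightarrow> 0) (at_right 0)" "(u' \<longlongrightarrow> 0) (at_left L)"
 shows "AE y in lborel. u y = prim g y"
proof -
 obtain r0 where r0: "r0 \<in> \<rat>" "0 < r0" "r0 < L / 2" using Rats_dense_in_real[of 0 "L / 2"] L by auto
 obtain s0 where s0: "s0 \<in> \<rat>" "L / 2 < s0" "s0 < L" using Rats_dense_in_real[of "L / 2" L] L by auto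
 obtain d where d: "AE y in lborel. y \<in> {r0<..<s0} --> u y = d + prim g y"
  using loc[of r0 s0] r0 s0 by auto
 have all: "AE y in lborel. y \<in> {r<..<s} --> u y = d + prim g y"
  if "r \<in> \<rat>" "s \<in> \<rat>" "0 < r" "r < s" "s < L" for r s
 proof -
  have "min r r0 \<in> \<rat>" "max s s0 \<in> \<rat>" "0 < min r r0" "min r r0 < max s s0" "max s s0 < L"
   using that r0 s0 by (auto simp: min_def max_def)
  then obtain c where c: "AE y in lborel. y \<in> {min r r0<..<max s s0} --> u y = c + prim g y" using loc by blast
  have "r0 < s0" using r0 s0 by simp
  from AE_interval_nonempty[OF eventually_conj[OF c d] this]
  obtain y where "y \<in> {r0<..<s0}" "y \<in> {min r r0<..<max s s0} --> u y = c + prim g y"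
   "y \<in> {r0<..<s0} --> u y = d + prim g y" by auto
  then have "c = d" by auto
  show ?thesis using c by (rule eventually_mono) (auto simp: \<open>c = d\<close>)
 qed
 define I where "I = {p \<in> \<rat> \<times> \<rat>. 0 < fst p \<and> fst p < snd p \<and> snd p < L}"
 have "countable I" unfolding I_def by (intro countable_Collect countable_SIGMA countable_rat)
 then have "AE y in lborel. \<forall>p\<in>I. y \<in> {fst p<..<snd p} --> u y = d + prim g y"
 proof (subst AE_ball_countable, assumption, intro ballI)
  fix p assume "p \<in> I"
  then show "AE y in lborel. y \<in> {fst p<..<snd p} --> u y = d + prim g y"
   using all[of "fst p" "snd p"] by (auto simp: I_def)
 qed
 then have eq: "AE y in lborel. y \<in> {0<..<L} --> u y = d + prim g y"
 proof (rule eventually_mono, intro impI)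
  fix y assume *: "\<forall>p\<in>I. y \<in> {fst p<..<snd p} --> u y = d + prim g y" and y: "y \<in> {0<..<L}"
  obtain r where r: "r \<in> \<rat>" "0 < r" "r < y" using Rats_dense_in_real[of 0 y] y by auto
  obtain s where s: "s \<in> \<rat>" "y < s" "s < L" using Rats_dense_in_real[of y L] y by auto
  have "(r, s) \<in> I" using r s by (auto simp: I_def)
  from *[rule_format, OF this] r s show "u y = d + prim g y" by simp
 qed
 have eq': "AE y in lborel. y \<in> {0<..<L} --> u' y = d + prim g y"
  using eq rep by eventually_elim auto
 have P: "((%y. d + prim g y) \<longlongrightarrow> d + prim g y0) (at y0 within A)" for y0 A
  by (intro tendsto_intros tendsto_within_subset[OF isCont_prim[OF g, unfolded isCont_def]]) simp
 have p0: "prim g 0 = 0" by (rule prim_eq_0) (use out(2) in auto)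
 have "0 = d + prim g 0" by (rule AE_limits_agree_right[OF eq' L lim(1) P])
 then have d0: "d = 0" using p0 by simp
 have "0 = d + prim g L" by (rule AE_limits_agree_left[OF eq' L lim(2) P])
 then have pL: "prim g L = 0" using d0 by simp
 show ?thesis using eq
 proof (rule eventually_mono)
  fix y assume *: "y \<in> {0<..<L} --> u y = d + prim g y"
  consider "y \<in> {0<..<L}" | "y \<le> 0" | "y \<ge> L" by fastforce
  then show "u y = prim g y"
  proof cases
   case 1 then show ?thesis using * d0 by simp
  next
   case 2
   then have "prim g y = 0" by (intro prim_eq_0) (use out(2) in auto)
   then show ?thesis using 2 out(1)[of y] by simp
  next
   case 3
   have "prim g y = (LBINT t. g t)" "prim g L = (LBINT t. g t)"
    by (intro prim_eq_total; use 3 out(2) in auto)+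
   then show ?thesis using 3 out(1)[of y] pL by simp
  qed
 qed
qed

section \<open>Weak derivatives on the whole plane\<close>

text \<open>The weak form of $\partial_y f = g$ on the plane. For functions with bounded support it says
 that almost every vertical section of \<open>f\<close> is the primitive of the section of \<open>g\<close> that starts from
 zero; in contrast to that pointwise statement it obviously passes to limits. Applied to
 extensions by zero it encodes homogeneous Dirichlet conditions.\<close>

definition weak_dy :: "(real \<times> real => real) => (real \<times> real => real) => bool" where
 "weak_dy f g \<longleftrightarrow> (\<forall>\<eta> \<eta>' \<theta> \<theta>'. c1c UNIV \<eta> \<eta>' --> c1c UNIV \<theta> \<theta>' -->
   (LBINT z. f z * tens \<eta> \<theta>' z) = - (LBINT z. g z * tens \<eta> \<theta> z))"

lemma AE_prim_sections:
 fixes f g :: plane_fun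
 assumes f: "integrable lborel f" and g: "integrable lborel g"
  and ae: "AE x in lborel. AE y in lborel. f (x, y) = prim (%t. g (x, t)) y"
 shows "AE z in lborel. f z = prim (%t. g (fst z, t)) (snd z)"
proof (rule plane_AE_of_sections[where P = "%z. f z = prim (%t. g (fst z, t)) (snd z)"])
 have "f \<in> borel_measurable borel" "g \<in> borel_measurable borel"
  using borel_measurable_integrable[OF f] borel_measurable_integrable[OF g] by simp_all
 from this(1) borel_measurable_prim_section[OF this(2)]
 have "{z \<in> space borel. f z = prim (%t. g (fst z, t)) (snd z)} \<in> sets borel"
  by (rule borel_measurable_eq)
 then show "{z. f z = prim (%t. g (fst z, t)) (snd z)} \<in> sets borel" by simp
qed (use ae in simp)

text \<open>On a rectangle larger than the supports, \<open>f\<close> is a primitive of \<open>g\<close> up to a constant on each vertical line.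
 Below the support both are zero, which fixes the constant; above it, the total integral of \<open>g\<close> must vanish.\<close>

lemma weak_dy_iff_prim:
 assumes f: "integrable lborel f" and g: "integrable lborel g"
  and supp: "\<And>x y. R < \<bar>x\<bar> \<or> R < \<bar>y\<bar> ==> f (x, y) = 0 \<and> g (x, y) = 0"
 shows "weak_dy f g \<longleftrightarrow> (AE z in lborel. f z = prim (%t. g (fst z, t)) (snd z))"
proof
 assume "AE z in lborel. f z = prim (%t. g (fst z, t)) (snd z)"
 then show "weak_dy f g" unfolding weak_dy_def
  by (intro allI impI prim_weak_derivative[OF f g]) (auto elim: eventually_mono)
next
 assume w: "weak_dy f g"
 define N where "N = max R 0 + 1"
 have N: "R < N" "0 < N" by (auto simp: N_def)
 obtain C where C: "AE z in lborel. fst z \<in> UNIV --> snd z \<in> {-N<..<N} --> f z = C (fst z) + prim (%t. g (fst z, t)) (snd z)"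
 proof (rule weak_derivative_imp_ac_on_lines[OF f g _ open_UNIV])
  show "-N < N" using N by simp
  fix \<eta> \<eta>' \<theta> \<theta>' assume \<eta>: "c1c UNIV \<eta> \<eta>'" and \<theta>: "c1c {-N<..<N} \<theta> \<theta>'"
  have "c1c UNIV \<theta> \<theta>'" by (rule c1c_mono[OF \<theta>]) simp
  with w \<eta> show "(LBINT z. f z * tens \<eta> \<theta>' z) = - (LBINT z. g z * tens \<eta> \<theta> z)"
   unfolding weak_dy_def by blast
 qed
 have "AE x in lborel. AE y in lborel. f (x, y) = prim (%t. g (x, t)) y"
  using plane_AE_sections[OF C]
 proof (rule eventually_mono)
  fix x
  let ?P = "prim (%t. g (x, t))"
  assume "AE y in lborel. fst (x, y) \<in> UNIV --> snd (x, y) \<in> {-N<..<N} --> f (x, y) = C (fst (x, y)) + prim (%t. g (fst (x, y), t)) (snd (x, y))"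
  then have ae: "AE y in lborel. y \<in> {-N<..<N} --> f (x, y) = C x + ?P y" by simp
  have far: "f (x, y) = 0" "g (x, y) = 0" if "y < - max R 0 \<or> max R 0 < y" for y
  proof -
   have "R < \<bar>y\<bar>" using that by (cases "y < 0") auto
   then show "f (x, y) = 0" "g (x, y) = 0" using supp[of x y] by auto
  qed
  have low: "?P y = 0" if "y < - max R 0" for y by (rule prim_eq_0, rule far(2)) (use that in linarith)
  have up: "?P y = (LBINT t. g (x, t))" if "y > max R 0" for y by (rule prim_eq_total, rule far(2)) (use that in linarith)
  have N': "-N < - max R 0" "max R 0 < N" by (auto simp: N_def)
  obtain y where y: "y \<in> {-N<..<- max R 0}" "y \<in> {-N<..<N} --> f (x, y) = C x + ?P y"
   using AE_interval_nonempty[OF ae N'(1)] by blast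
  have C0: "C x = 0" using y far(1)[of y] low[of y] N by auto
  obtain y' where y': "y' \<in> {max R 0<..<N}" "y' \<in> {-N<..<N} --> f (x, y') = C x + ?P y'"
   using AE_interval_nonempty[OF ae N'(2)] by blast
  have tot: "(LBINT t. g (x, t)) = 0" using y' far(1)[of y'] up[of y'] C0 N by auto
  show "AE y in lborel. f (x, y) = ?P y" using ae
  proof (rule eventually_mono)
   fix y assume *: "y \<in> {-N<..<N} --> f (x, y) = C x + ?P y"
   consider "y \<in> {-N<..<N}" | "y \<le> -N" | "y \<ge> N" by fastforce
   then show "f (x, y) = ?P y"
    by cases (use * C0 tot low[of y] up[of y] far(1)[of y] N' in auto)
  qed
 qed
 then show "AE z in lborel. f z = prim (%t. g (fst z, t)) (snd z)" by (rule AE_prim_sections[OF f g])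
qed

section \<open>The strip\<close>

text \<open>The profile is extended to the line as a continuous function, and \<open>h'\<close> is only known to be square
 integrable near the maximum. The last assumption makes the potential grow like $\varepsilon^{-2}|x|^m$; it can hold
 on the whole interval because the maximum is attained at one point only.\<close>

locale profile =
 fixes a b M l m c0 :: real and h h' :: line_fun
 assumes a_pos: "0 < a" and b_pos: "0 < b"
  and h_cont: "continuous_on UNIV h"
  and l_pos: "0 < l" and h_ge: "\<And>x. l \<le> h x" and h_le: "\<And>x. h x \<le> M" and h_0: "h 0 = M"
  and h_deriv: "\<And>x. x \<in> {-a<..<b} ==> x \<noteq> 0 ==> (h has_real_derivative h' x) (at x)"
  and h'_cont: "continuous_on ({-a<..<b} - {0}) h'"
  and h'_meas: "h' \<in> borel_measurable borel"
  and h'_sq: "set_integrable lborel {-a..b} (%x. (h' x)^2)"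
  and m_ge_1: "1 \<le> m" and c0_pos: "0 < c0"
  and growth: "\<And>x. x \<in> {-a..b} ==> c0 * \<bar>x\<bar> powr m \<le> 1 / (h x)^2 - 1 / M^2"

locale narrow_strip = profile +
 fixes eps :: real
 assumes eps_pos: "0 < eps"
begin

abbreviation "S \<equiv> strip a b h eps"
abbreviation "normS \<equiv> l2_norm (leb S)"
abbreviation "innerS \<equiv> l2_inner (leb S)"
abbreviation "L2S \<equiv> L2 (leb S)"
abbreviation "lift \<equiv> mode_lift h eps"
abbreviation "gx G \<equiv> (%z :: real \<times> real. fst (G z :: real \<times> real) :: real)"
abbreviation "gy G \<equiv> (%z :: real \<times> real. snd (G z :: real \<times> real) :: real)"
abbreviation "U \<equiv> {z :: real \<times> real. -a < fst z \<and> fst z < b \<and> 0 < snd z \<and> snd z < eps * h (fst z)}"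
abbreviation hat :: "(real \<times> real => real) => real \<times> real => real" where
 "hat f \<equiv> (%z. indicator S z * f z)"
abbreviation swap :: "(real \<times> real => real) => real \<times> real => real" where
 "swap f \<equiv> (%z. f (snd z, fst z))"
definition radius :: real where "radius = a + b + eps * M"

lemma h_pos: "0 < h x" using l_pos h_ge[of x] by linarith
lemma M_pos: "0 < M" using h_pos[of 0] h_0 by simp
lemma width_pos: "0 < eps * h x" using h_pos eps_pos by simp
lemma width_le: "eps * h x \<le> eps * M" using h_le eps_pos by simp

lemma mem_S: "z \<in> S \<longleftrightarrow> -a \<le> fst z \<and> fst z \<le> b \<and> 0 < snd z \<and> snd z < eps * h (fst z)"
 by (cases z) (auto simp: strip_def)

lemma h_fst_cont: "continuous_on UNIV (%z :: real \<times> real. h (fst z))"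
 by (rule continuous_on_compose2[OF h_cont continuous_on_fst[OF continuous_on_id]]) simp

lemma h_measurable: "h \<in> borel_measurable borel"
 by (rule borel_measurable_continuous_onI[OF h_cont])

lemma open_U: "open U"
proof -
 have "open {z :: real \<times> real. -a < fst z}" "open {z :: real \<times> real. fst z < b}"
  "open {z :: real \<times> real. 0 < snd z}" "open {z :: real \<times> real. snd z < eps * h (fst z)}"
  by (intro open_Collect_less continuous_intros h_fst_cont)+
 then show ?thesis by (auto simp: Collect_conj_eq intro!: open_Int)
qed

lemma U_subset: "U \<subseteq> interior S"
 by (rule interior_maximal[OF _ open_U]) (auto simp: mem_S)

lemma S_borel: "S \<in> sets borel"
proof -
 have "open {z :: real \<times> real. 0 < snd z}" "open {z :: real \<times> real. snd z < eps * h (fst z)}"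
  by (intro open_Collect_less continuous_intros h_fst_cont)+
 moreover have "closed {z :: real \<times> real. -a \<le> fst z}" "closed {z :: real \<times> real. fst z \<le> b}"
  by (intro closed_Collect_le continuous_intros)+
 moreover have "S = {z. -a \<le> fst z} \<inter> {z. fst z \<le> b} \<inter> {z. 0 < snd z} \<inter> {z. snd z < eps * h (fst z)}"
  using mem_S by auto
 ultimately show ?thesis by (simp only:) (intro sets.Int borel_closed borel_open; assumption)
qed

lemma S_subset_cbox: "S \<subseteq> cbox (-a, 0) (b, eps * M)"
 unfolding subset_eq
proof
 fix z assume "z \<in> S"
 then show "z \<in> cbox (-a, 0) (b, eps * M)"
  using width_le[of "fst z"] by (cases z) (auto simp: mem_S cbox_Pair_iff)
qed

lemma S_bounded: "bounded S"
 by (rule bounded_subset[OF bounded_cbox S_subset_cbox])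

lemma not_in_S_far: "radius < \<bar>x\<bar> \<or> radius < \<bar>y\<bar> ==> (x, y) \<notin> S"
proof
 assume far: "radius < \<bar>x\<bar> \<or> radius < \<bar>y\<bar>" and "(x, y) \<in> S"
 then have "-a \<le> x" "x \<le> b" "0 < y" "y < eps * M" using width_le[of x] by (auto simp: mem_S)
 then show False using far a_pos b_pos unfolding radius_def by arith
qed

lemma AE_x_inside: "AE x in lborel. x \<in> {-a..b} --> x \<in> {-a<..<b}"
 using AE_lborel_singleton[of "-a"] AE_lborel_singleton[of b] by eventually_elim auto

lemma AE_S_imp_U: "AE z in lborel. z \<in> S --> z \<in> U"
proof (rule plane_AE_of_sections)
 have "{z. z \<in> S --> z \<in> U} = - S \<union> U" by auto
 then show "{z. z \<in> S --> z \<in> U} \<in> sets borel"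
  by (simp only:) (intro sets.Un borel_comp S_borel borel_open open_U)
 show "AE x in lborel. AE y in lborel. (x, y) \<in> S --> (x, y) \<in> U"
  using AE_x_inside by (rule eventually_mono) (auto simp: mem_S)
qed

lemma hat_L2: "f \<in> L2S \<longleftrightarrow> hat f \<in> L2 lborel"
 using L2_leb_iff[OF S_borel, of f] by simp

lemma hat_integrable: "f \<in> L2S ==> integrable lborel (hat f)"
 using integrable_leb_if_L2[OF S_borel S_bounded, of f] leb_integral(2)[OF S_borel, of f] by simp

lemma hat_measurable: "f \<in> L2S ==> hat f \<in> borel_measurable borel"
 using borel_measurable_integrable[OF hat_integrable] by simp

lemma LINT_S: "(LINT z|leb S. f z) = (LBINT z. hat f z)" for f :: plane_fun
 using leb_integral(1)[OF S_borel, of f] by simp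

lemma swap_integrable: "f \<in> L2S ==> integrable lborel (swap (hat f))"
 using integrable_plane_swap[of "hat f"] hat_integrable[of f] by blast

lemma L2_fst: "G \<in> L2S ==> (gx G) \<in> L2S" for G :: "real \<times> real => real \<times> real"
 using L2_component[of G "leb S" "(1, 0)"] by (simp add: Basis_prod_def inner_prod_def)

lemma L2_snd: "G \<in> L2S ==> (gy G) \<in> L2S" for G :: "real \<times> real => real \<times> real"
 using L2_component[of G "leb S" "(0, 1)"] by (simp add: Basis_prod_def inner_prod_def)

lemma bounded_cont_L2:
 fixes F :: plane_fun
 assumes "continuous_on UNIV F" "\<And>z. \<bar>F z\<bar> \<le> K"
 shows "F \<in> L2S"
 by (rule L2_bounded_on[OF S_borel S_bounded])
   (use borel_measurable_continuous_onI[OF assms(1)] S_borel assms(2) in simp_all)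

lemma weak_grad_test:
 assumes "is_weak_grad S u G" "T \<in> test_functions S"
 shows "(LBINT z. hat u z * frechet_derivative T (at z) (1, 0)) = - (LBINT z. hat (gx G) z * T z)"
  and "(LBINT z. hat u z * frechet_derivative T (at z) (0, 1)) = - (LBINT z. hat (gy G) z * T z)"
 using assms unfolding is_weak_grad_plane_iff LINT_S by (simp_all add: mult.assoc)

lemma AE_zero_if_orthogonal_to_tests:
 assumes F: "F \<in> L2S" and z: "\<And>T. T \<in> test_functions S ==> (LBINT z. hat F z * T z) = 0"
 shows "AE z in leb S. F z = 0"
proof -
 have I: "integrable lborel (hat F)" by (rule hat_integrable[OF F])
 have "AE z in lborel. z \<in> U --> hat F z = 0"
  by (rule AE_zero_if_orthogonal_to_tensors[OF I open_U], rule z, rule plane_test_function_tensor(1), assumption+)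
    (rule order_trans[OF _ U_subset])
 then show ?thesis unfolding AE_leb[OF S_borel]
  using AE_S_imp_U by eventually_elim (auto simp: indicator_def)
qed

lemma weak_grad_unique:
 assumes G: "is_weak_grad S u G" "is_weak_grad S u H"
 shows "AE z in leb S. G z = H z"
proof -
 note GL = is_weak_gradD(1)[OF G(1)] and HL = is_weak_gradD(1)[OF G(2)]
 have i: "integrable lborel (%z. hat F z * T z)" if F: "F \<in> L2S" and T: "T \<in> test_functions S" for F T
 proof -
  obtain R where R: "continuous_on UNIV T" "\<And>z. \<bar>T z\<bar> \<le> R" using plane_test_functionD[OF T] by metis
  show ?thesis
   by (rule integrable_mult_bounded[OF hat_integrable[OF F] _ R(2)])
     (use borel_measurable_continuous_onI[OF R(1)] in simp)
 qed
 have "AE z in leb S. fst (G z) - fst (H z) = 0"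
 proof (rule AE_zero_if_orthogonal_to_tests)
  show "(%z. fst (G z) - fst (H z)) \<in> L2S" by (intro L2_diff L2_fst GL HL)
  fix T assume T: "T \<in> test_functions S"
  show "(LBINT z. hat (%z. fst (G z) - fst (H z)) z * T z) = 0"
   using i[OF L2_fst[OF GL] T] i[OF L2_fst[OF HL] T] weak_grad_test(1)[OF G(1) T] weak_grad_test(1)[OF G(2) T]
   by (simp add: algebra_simps)
 qed
 moreover have "AE z in leb S. snd (G z) - snd (H z) = 0"
 proof (rule AE_zero_if_orthogonal_to_tests)
  show "(%z. snd (G z) - snd (H z)) \<in> L2S" by (intro L2_diff L2_snd GL HL)
  fix T assume T: "T \<in> test_functions S"
  show "(LBINT z. hat (%z. snd (G z) - snd (H z)) z * T z) = 0"
   using i[OF L2_snd[OF GL] T] i[OF L2_snd[OF HL] T] weak_grad_test(2)[OF G(1) T] weak_grad_test(2)[OF G(2) T]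
   by (simp add: algebra_simps)
 qed
 ultimately show ?thesis by eventually_elim (simp add: prod_eq_iff)
qed

section \<open>Dirichlet conditions at the bottom and the top\<close>

lemma hat_section_support: "y \<notin> {0<..<eps * h x} ==> hat f (x, y) = 0" "x \<notin> {-a..b} ==> hat f (x, y) = 0"
 by (auto simp: indicator_def mem_S)

text \<open>Weak differentiability is a local statement: inside the strip it yields absolute continuity on the vertical
 lines through a rectangle.\<close>

lemma vertical_ac_rectangle:
 assumes u: "u \<in> L2S" and G: "is_weak_grad S u G" and rs: "r < s"
  and sub: "{p<..<q} \<times> {r<..<s} \<subseteq> U"
 shows "AE x in lborel. x \<in> {p<..<q} -->
  (\<exists>c. AE y in lborel. y \<in> {r<..<s} --> hat u (x, y) = c + prim (%t. hat (gy G) (x, t)) y)"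
proof -
 note GL = is_weak_gradD(1)[OF G]
 obtain C where C: "AE z in lborel. fst z \<in> {p<..<q} --> snd z \<in> {r<..<s} -->
   hat u z = C (fst z) + prim (%t. hat (gy G) (fst z, t)) (snd z)"
 proof (rule weak_derivative_imp_ac_on_lines[OF hat_integrable[OF u] hat_integrable[OF L2_snd[OF GL]] rs open_greaterThanLessThan])
  fix \<eta> \<eta>' \<theta> \<theta>' assume c: "c1c {p<..<q} \<eta> \<eta>'" "c1c {r<..<s} \<theta> \<theta>'"
  note t = plane_test_function_tensor[OF c order_trans[OF sub U_subset]]
  show "(LBINT z. hat u z * tens \<eta> \<theta>' z) = - (LBINT z. hat (gy G) z * tens \<eta> \<theta> z)"
   using weak_grad_test(2)[OF G t(1)] unfolding t(3) .
 qed auto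
 show ?thesis using plane_AE_sections[OF C]
 proof (rule eventually_mono, intro impI)
  fix x assume *: "AE y in lborel. fst (x, y) \<in> {p<..<q} --> snd (x, y) \<in> {r<..<s} -->
   hat u (x, y) = C (fst (x, y)) + prim (%t. hat (gy G) (fst (x, y), t)) (snd (x, y))"
   and x: "x \<in> {p<..<q}"
  show "\<exists>c. AE y in lborel. y \<in> {r<..<s} --> hat u (x, y) = c + prim (%t. hat (gy G) (x, t)) y"
   by (rule exI[of _ "C x"], rule eventually_mono[OF *]) (use x in auto)
 qed
qed

text \<open>Countably many rational rectangles exhaust the strip, so almost every vertical section is absolutely
 continuous on all compact parts of its interval at once. With the limits zero at both ends its extension
 by zero is a primitive on the whole line.\<close>

lemma vanishes_bottom_top_imp_weak_dy:
 assumes u: "u \<in> L2S" and G: "is_weak_grad S u G" and van: "vanishes_bottom_top a b h eps u"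
 shows "weak_dy (hat u) (hat (gy G))"
proof -
 let ?g = "hat (gy G)"
 note GL = is_weak_gradD(1)[OF G]
 have gI: "integrable lborel ?g" by (rule hat_integrable[OF L2_snd[OF GL]])
 obtain u' where u': "AE z in leb S. u' z = u z"
  and lim: "AE x in leb {-a..b}. ((%y. u' (x, y)) \<longlongrightarrow> 0) (at_right 0) \<and> ((%y. u' (x, y)) \<longlongrightarrow> 0) (at_left (eps * h x))"
  using van unfolding vanishes_bottom_top_def by auto
 \<comment> \<open>countably many rectangles, so that the exceptional null sets can be united\<close>
 define J where "J = {(p, q, r, s). p \<in> \<rat> \<and> q \<in> \<rat> \<and> r \<in> \<rat> \<and> s \<in> \<rat> \<and> r < s \<and> {p<..<q} \<times> {r<..<s} \<subseteq> U}"
 have "J \<subseteq> \<rat> \<times> \<rat> \<times> \<rat> \<times> \<rat>" by (auto simp: J_def)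
 then have "countable J" by (rule countable_subset) (intro countable_SIGMA countable_rat)
 then have "AE x in lborel. \<forall>k\<in>J. case k of (p, q, r, s) => x \<in> {p<..<q} -->
   (\<exists>c. AE y in lborel. y \<in> {r<..<s} --> hat u (x, y) = c + prim (%t. ?g (x, t)) y)"
 proof (subst AE_ball_countable, assumption, intro ballI)
  fix k assume "k \<in> J"
  then show "AE x in lborel. case k of (p, q, r, s) => x \<in> {p<..<q} -->
   (\<exists>c. AE y in lborel. y \<in> {r<..<s} --> hat u (x, y) = c + prim (%t. ?g (x, t)) y)"
   using vertical_ac_rectangle[OF u G] by (auto simp: J_def)
 qed
 moreover have "AE x in lborel. AE y in lborel. (x, y) \<in> S --> u' (x, y) = u (x, y)"
  using plane_AE_sections[OF u'[unfolded AE_leb[OF S_borel]]] .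
 moreover have "AE x in lborel. x \<in> {-a..b} --> ((%y. u' (x, y)) \<longlongrightarrow> 0) (at_right 0) \<and> ((%y. u' (x, y)) \<longlongrightarrow> 0) (at_left (eps * h x))"
  using lim by (subst (asm) AE_leb) simp_all
 ultimately have "AE x in lborel. AE y in lborel. hat u (x, y) = prim (%t. ?g (x, t)) y"
  using AE_x_inside plane_Fubini(2)[OF gI]
 proof eventually_elim
  case (elim x)
  show ?case
  proof (cases "x \<in> {-a..b}")
   case False
   have "prim (%t. ?g (x, t)) y = 0" for y by (rule prim_eq_0) (rule hat_section_support(2)[OF False])
   then show ?thesis using hat_section_support(2)[OF False] by simp
  next
   case True
   then have x: "-a < x" "x < b" using elim(4) by auto
   show ?thesis
   proof (rule locally_ac_vanishing_eq_prim[OF elim(5) width_pos[of x], where u' = "%y. u' (x, y)"])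
    fix r s :: real assume rs: "r \<in> \<rat>" "s \<in> \<rat>" "0 < r" "r < s" "s < eps * h x"
    have "open {t. -a < t \<and> t < b \<and> s < eps * h t}"
     by (intro open_Collect_conj open_Collect_less continuous_intros h_cont)
    moreover have "x \<in> {t. -a < t \<and> t < b \<and> s < eps * h t}" using x rs by simp
    ultimately obtain d where d: "d > 0" "\<And>t. dist t x < d ==> t \<in> {t. -a < t \<and> t < b \<and> s < eps * h t}"
     unfolding open_dist by blast
    obtain p where p: "p \<in> \<rat>" "x - d < p" "p < x" using Rats_dense_in_real[of "x - d" x] d(1) by auto
    obtain q where q: "q \<in> \<rat>" "x < q" "q < x + d" using Rats_dense_in_real[of x "x + d"] d(1) by auto
    have "{p<..<q} \<times> {r<..<s} \<subseteq> U"
    proof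
     fix z assume z: "z \<in> {p<..<q} \<times> {r<..<s}"
     then have "dist (fst z) x < d" using p q by (auto simp: dist_real_def)
     from d(2)[OF this] z rs show "z \<in> U" by auto
    qed
    then have "(p, q, r, s) \<in> J" using p q rs by (simp add: J_def)
    from bspec[OF elim(1) this] p q
    show "\<exists>c. AE y in lborel. y \<in> {r<..<s} --> hat u (x, y) = c + prim (%t. ?g (x, t)) y" by simp
   next
    show "AE y in lborel. y \<in> {0<..<eps * h x} --> u' (x, y) = hat u (x, y)"
     using elim(2) by (rule eventually_mono) (use x in \<open>auto simp: mem_S indicator_def\<close>)
    show "((%y. u' (x, y)) \<longlongrightarrow> 0) (at_right 0)" "((%y. u' (x, y)) \<longlongrightarrow> 0) (at_left (eps * h x))"
     using elim(3) True by auto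
   qed (rule hat_section_support(1); assumption)+
  qed
 qed
 then have "AE z in lborel. hat u z = prim (%t. ?g (fst z, t)) (snd z)"
  by (rule AE_prim_sections[OF hat_integrable[OF u] gI])
 then show ?thesis
  by (subst weak_dy_iff_prim[OF hat_integrable[OF u] gI, of radius]) (use not_in_S_far in auto)
qed

lemma weak_dy_prim:
 assumes "u \<in> L2S" "g \<in> L2S"
 shows "weak_dy (hat u) (hat g) \<longleftrightarrow> (AE z in lborel. hat u z = prim (%t. hat g (fst z, t)) (snd z))"
 by (rule weak_dy_iff_prim[OF hat_integrable hat_integrable, OF assms, of radius]) (use not_in_S_far in auto)

text \<open>The section of the extension vanishes above the strip, so its primitive returns to zero there.\<close>

lemma weak_dy_sections:
 assumes u: "u \<in> L2S" and g: "g \<in> L2S" and w: "weak_dy (hat u) (hat g)"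
 shows "AE x in lborel. integrable lborel (%t. hat g (x, t)) \<and> (LBINT t. hat g (x, t)) = 0 \<and>
  (AE y in lborel. hat u (x, y) = prim (%t. hat g (x, t)) y)"
 using plane_AE_sections[OF w[unfolded weak_dy_prim[OF u g]]] plane_Fubini(2)[OF hat_integrable[OF g]]
proof eventually_elim
 case (elim x)
 then have ae: "AE y in lborel. hat u (x, y) = prim (%t. hat g (x, t)) y" by simp
 obtain y where y: "y > eps * h x" "hat u (x, y) = prim (%t. hat g (x, t)) y"
  using AE_interval_nonempty[OF ae, of "eps * h x" "eps * h x + 1"] by auto
 have "hat u (x, y) = 0" by (rule hat_section_support(1)) (use y in auto)
 moreover have "prim (%t. hat g (x, t)) y = (LBINT t. hat g (x, t))"
  by (rule prim_eq_total, rule hat_section_support(1)) (use y in auto)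
 ultimately show ?case using elim(2) ae y(2) by simp
qed

lemma weak_dy_imp_vanishes_bottom_top:
 assumes u: "u \<in> L2S" and g: "g \<in> L2S" and w: "weak_dy (hat u) (hat g)"
 shows "vanishes_bottom_top a b h eps u"
 unfolding vanishes_bottom_top_def
proof (intro exI conjI)
 let ?u' = "%z. prim (%t. hat g (fst z, t)) (snd z)"
 show "AE z in leb S. ?u' z = u z" unfolding AE_leb[OF S_borel]
  using w[unfolded weak_dy_prim[OF u g]] by (rule eventually_mono) auto
 have "AE x in lborel. ((%y. ?u' (x, y)) \<longlongrightarrow> 0) (at_right 0) \<and> ((%y. ?u' (x, y)) \<longlongrightarrow> 0) (at_left (eps * h x))"
  using weak_dy_sections[OF u g w]
 proof (rule eventually_mono)
  fix x assume *: "integrable lborel (%t. hat g (x, t)) \<and> (LBINT t. hat g (x, t)) = 0 \<and>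
   (AE y in lborel. hat u (x, y) = prim (%t. hat g (x, t)) y)"
  have P: "(prim (%t. hat g (x, t)) \<longlongrightarrow> prim (%t. hat g (x, t)) y0) (at y0 within A)" for y0 A
   by (rule tendsto_within_subset[OF isCont_prim[unfolded isCont_def]]) (use * in auto)
  have "prim (%t. hat g (x, t)) 0 = 0"
   by (rule prim_eq_0, rule hat_section_support(1)) auto
  moreover have "prim (%t. hat g (x, t)) (eps * h x) = (LBINT t. hat g (x, t))"
   by (rule prim_eq_total, rule hat_section_support(1)) auto
  ultimately show "((%y. ?u' (x, y)) \<longlongrightarrow> 0) (at_right 0) \<and> ((%y. ?u' (x, y)) \<longlongrightarrow> 0) (at_left (eps * h x))"
   using P[of 0 "{0<..}"] P[of "eps * h x" "{..<eps * h x}"] * by simp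
 qed
 then show "AE x in leb {-a..b}. ((%y. ?u' (x, y)) \<longlongrightarrow> 0) (at_right 0) \<and> ((%y. ?u' (x, y)) \<longlongrightarrow> 0) (at_left (eps * h x))"
  by (subst AE_leb) (auto elim: eventually_mono)
qed

end

section \<open>The zero extension is weakly differentiable along the strip\<close>

text \<open>A smooth truncation of the identity: it is constant above \<open>M - \<delta>\<close> and moves points of
 $(-\infty, M]$ down by at most $2\delta$. Composed with the profile it yields a continuously
 differentiable function, because the profile exceeds \<open>M - \<delta>\<close> near its maximum, the
 only point where it need not be differentiable.\<close>

definition flatten :: "real => real => real => real" where
 "flatten M \<delta> s = s - ((max 0 (s - (M - 2 * \<delta>)))^2 - (max 0 (s - (M - \<delta>)))^2) / (2 * \<delta>)"

definition flatten' :: "real => real => real => real" where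
 "flatten' M \<delta> s = 1 - (max 0 (s - (M - 2 * \<delta>)) - max 0 (s - (M - \<delta>))) / \<delta>"

lemma flatten_derivative:
 assumes "0 < \<delta>"
 shows "(flatten M \<delta> has_real_derivative flatten' M \<delta> s) (at s)"
proof -
 have "((%s. s - ((max 0 (s - (M - 2 * \<delta>)))^2 - (max 0 (s - (M - \<delta>)))^2) / (2 * \<delta>))
   has_real_derivative flatten' M \<delta> s) (at s)"
 proof (rule DERIV_cong)
  show "((%s. s - ((max 0 (s - (M - 2 * \<delta>)))^2 - (max 0 (s - (M - \<delta>)))^2) / (2 * \<delta>)) has_real_derivative
    1 - (2 * max 0 (s - (M - 2 * \<delta>)) - 2 * max 0 (s - (M - \<delta>))) / (2 * \<delta>)) (at s)"
   by (intro DERIV_diff DERIV_ident DERIV_cdivide has_real_derivative_max0_square)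
  show "1 - (2 * max 0 (s - (M - 2 * \<delta>)) - 2 * max 0 (s - (M - \<delta>))) / (2 * \<delta>) = flatten' M \<delta> s"
   using assms by (simp add: flatten'_def field_simps)
 qed
 then show ?thesis unfolding flatten_def[abs_def] .
qed

lemma continuous_on_flatten': "0 < \<delta> ==> continuous_on A (flatten' M \<delta>)"
 unfolding flatten'_def[abs_def] by (intro continuous_intros) auto

lemma flatten'_bounds: "0 < \<delta> ==> 0 \<le> flatten' M \<delta> s" "0 < \<delta> ==> flatten' M \<delta> s \<le> 1"
 by (auto simp: flatten'_def max_def field_simps)

lemma flatten'_eq_0: "0 < \<delta> ==> M - \<delta> \<le> s ==> flatten' M \<delta> s = 0"
 by (auto simp: flatten'_def max_def field_simps)

lemma flatten_const: "0 < \<delta> ==> M - \<delta> \<le> s ==> flatten M \<delta> s = M - 3 * \<delta> / 2"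
 by (auto simp: flatten_def max_def field_simps power2_eq_square)

lemma flatten_bounds:
 assumes "0 < \<delta>"
 shows "flatten M \<delta> s \<le> s" "s \<le> M ==> s - 2 * \<delta> \<le> flatten M \<delta> s"
proof -
 define p q where "p = max 0 (s - (M - 2 * \<delta>))" and "q = max 0 (s - (M - \<delta>))"
 have pq: "0 \<le> q" "q \<le> p" "p \<le> q + \<delta>" using assms by (auto simp: p_def q_def max_def)
 have "q^2 \<le> p^2" using pq by (intro power_mono) auto
 then show "flatten M \<delta> s \<le> s" using assms unfolding flatten_def p_def[symmetric] q_def[symmetric] by simp
 assume s: "s \<le> M"
 then have q1: "q \<le> \<delta>" using assms by (auto simp: q_def)
 have "p^2 - q^2 = (p - q) * (p + q)" by (simp add: power2_eq_square algebra_simps)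
 also have "... \<le> \<delta> * (3 * \<delta>)" using pq q1 assms by (intro mult_mono) auto
 also have "... \<le> 2 * \<delta> * (2 * \<delta>)" using assms by simp
 finally have "(p^2 - q^2) / (2 * \<delta>) \<le> 2 * \<delta>" using assms by (simp add: divide_le_eq)
 then show "s - 2 * \<delta> \<le> flatten M \<delta> s" unfolding flatten_def p_def[symmetric] q_def[symmetric] by simp
qed

context profile
begin

lemma flatten_profile:
 assumes \<delta>: "0 < \<delta>" and x: "x \<in> {-a<..<b}"
 shows "((%x. flatten M \<delta> (h x)) has_real_derivative flatten' M \<delta> (h x) * h' x) (at x)"
proof (cases "x = 0")
 case False
 then show ?thesis by (rule DERIV_chain2[OF flatten_derivative[OF \<delta>] h_deriv[OF x]])
next
 case True
 have "open {x. M - \<delta> < h x}" by (intro open_Collect_less continuous_intros h_cont)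
 moreover have "x \<in> {x. M - \<delta> < h x}" using True h_0 \<delta> by simp
 ultimately have ev: "\<forall>\<^sub>F y in nhds x. flatten M \<delta> (h y) = M - 3 * \<delta> / 2"
  unfolding eventually_nhds using flatten_const[OF \<delta>] by (intro exI[of _ "{x. M - \<delta> < h x}"]) auto
 have "flatten' M \<delta> (h x) = 0" by (rule flatten'_eq_0[OF \<delta>]) (use True h_0 \<delta> in simp)
 then show ?thesis using DERIV_cong_ev[OF refl ev refl, of 0] by simp
qed

lemma continuous_on_flatten_profile':
 assumes \<delta>: "0 < \<delta>"
 shows "continuous_on {-a<..<b} (%x. flatten' M \<delta> (h x) * h' x)"
proof -
 let ?W = "{-a<..<b} \<inter> {x. M - \<delta> < h x}" and ?V = "{-a<..<b} - {0}"
 have W: "open ?W" by (intro open_Int open_Collect_less continuous_intros h_cont open_greaterThanLessThan)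
 have V: "open ?V" by (simp add: open_Diff)
 have "continuous_on ?W (%x. flatten' M \<delta> (h x) * h' x)"
  by (rule continuous_on_eq[OF continuous_on_const[of _ 0]]) (use flatten'_eq_0[OF \<delta>] in auto)
 moreover have "continuous_on ?V (%x. flatten' M \<delta> (h x) * h' x)"
  by (intro continuous_on_mult h'_cont continuous_on_compose2[OF continuous_on_flatten'[OF \<delta>, of UNIV]]
    continuous_on_subset[OF h_cont]) auto
 ultimately have "continuous_on (?W \<union> ?V) (%x. flatten' M \<delta> (h x) * h' x)"
  by (rule continuous_on_open_Un[OF W V])
 moreover have "?W \<union> ?V = {-a<..<b}" using \<delta> h_0 by auto
 ultimately show ?thesis by simp
qed

lemma continuous_on_flatten_profile:
 assumes "0 < \<delta>"
 shows "continuous_on UNIV (%x. flatten M \<delta> (h x))"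
proof (rule continuous_on_compose2[OF _ h_cont])
 show "continuous_on UNIV (flatten M \<delta>)"
  by (intro continuous_at_imp_continuous_on ballI DERIV_isCont[OF flatten_derivative[OF assms]])
qed simp

end

context narrow_strip
begin

text \<open>A cutoff that is one at vertical distance more than \<open>3 / level n\<close> from the bottom and the top. It is built from the
 truncation \<open>cap n\<close> of the profile, to be differentiable across the maximum; \<open>delta n\<close> is such that the truncation
 lowers the upper boundary by at most \<open>1 / level n\<close>.\<close>

definition level :: "nat => real" where "level n = real (Suc n)"
definition delta :: "nat => real" where "delta n = 1 / (2 * eps * level n)"
definition cap :: "nat => real => real" where "cap n x = flatten M (delta n) (h x)"
definition cap' :: "nat => real => real" where "cap' n x = flatten' M (delta n) (h x) * h' x"
definition cutoff :: "nat => real \<times> real => real" where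
 "cutoff n z = step (level n * snd z - 1) * step (level n * (eps * cap n (fst z) - snd z) - 1)"
definition cutoff_x :: "nat => real \<times> real => real" where
 "cutoff_x n z = step (level n * snd z - 1) *
   (step' (level n * (eps * cap n (fst z) - snd z) - 1) * (level n * (eps * cap' n (fst z))))"
definition cutoff_y :: "nat => real \<times> real => real" where
 "cutoff_y n z = step' (level n * snd z - 1) * level n * step (level n * (eps * cap n (fst z) - snd z) - 1)
   - step (level n * snd z - 1) * (step' (level n * (eps * cap n (fst z) - snd z) - 1) * level n)"

lemma level_pos: "0 < level n" by (simp add: level_def)
lemma delta_pos: "0 < delta n" using level_pos eps_pos by (simp add: delta_def)

lemma cap_bounds: "eps * h x - 1 / level n \<le> eps * cap n x" "eps * cap n x \<le> eps * h x"
proof -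
 have "eps * (h x - 2 * delta n) \<le> eps * cap n x"
  unfolding cap_def using flatten_bounds(2)[OF delta_pos h_le] eps_pos by (intro mult_left_mono) auto
 moreover have "eps * (2 * delta n) = 1 / level n" using eps_pos level_pos[of n] by (simp add: delta_def)
 ultimately show "eps * h x - 1 / level n \<le> eps * cap n x" by (simp add: right_diff_distrib)
 show "eps * cap n x \<le> eps * h x"
  unfolding cap_def using flatten_bounds(1)[OF delta_pos] eps_pos by (intro mult_left_mono) auto
qed

lemma cutoff_bounds: "\<bar>cutoff n z\<bar> \<le> 1"
 unfolding cutoff_def abs_mult using step_bounds by (intro mult_le_one) (auto simp: abs_of_nonneg)

lemma cutoff_tendsto:
 assumes "z \<in> S"
 shows "(%n. cutoff n z) \<longlonglongrightarrow> 1"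
proof -
 define d where "d = min (snd z) (eps * h (fst z) - snd z)"
 have d: "d > 0" "d \<le> snd z" "d \<le> eps * h (fst z) - snd z" using assms by (auto simp: d_def mem_S)
 obtain n0 where n0: "3 / d < real n0" using reals_Archimedean2 by blast
 have "cutoff n z = 1" if "n \<ge> n0" for n
 proof -
  have "3 / d < level n" using n0 that by (simp add: level_def)
  then have 3: "3 < level n * d" using d(1) by (simp add: divide_less_eq)
  have "level n * d \<le> level n * snd z" using d level_pos[of n] by (intro mult_left_mono) auto
  then have "step (level n * snd z - 1) = 1" using 3 by (intro step_eq_1) linarith
  moreover have "level n * d \<le> level n * (eps * h (fst z) - snd z)" using d level_pos[of n] by (intro mult_left_mono) auto
  moreover have "level n * (eps * h (fst z) - snd z) - 1 \<le> level n * (eps * cap n (fst z) - snd z)"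
  proof -
   have "level n * (eps * h (fst z) - 1 / level n - snd z) \<le> level n * (eps * cap n (fst z) - snd z)"
    using cap_bounds(1)[of "fst z" n] level_pos[of n] by (intro mult_left_mono) auto
   then show ?thesis using level_pos[of n] by (simp add: algebra_simps)
  qed
  ultimately show ?thesis using 3 unfolding cutoff_def by (simp add: step_eq_1)
 qed
 then show ?thesis by (intro tendsto_eventually eventually_sequentiallyI[of n0])
qed

text \<open>The derivative of the cutoff along the strip lives in a layer of width $O(1/n)$ below the
 upper boundary.\<close>

lemma cutoff_x_bound:
 "\<bar>cutoff_x n z\<bar> \<le> 2 * eps * level n * \<bar>h' (fst z)\<bar> * indicator {eps * h (fst z) - 3 / level n <..< eps * h (fst z)} (snd z)"
proof (cases "snd z \<in> {eps * h (fst z) - 3 / level n <..< eps * h (fst z)}")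
 case True
 have "\<bar>flatten' M (delta n) (h (fst z))\<bar> * \<bar>h' (fst z)\<bar> \<le> 1 * \<bar>h' (fst z)\<bar>"
  using flatten'_bounds[OF delta_pos, of M n "h (fst z)"] by (intro mult_right_mono) auto
 then have c: "\<bar>cap' n (fst z)\<bar> \<le> \<bar>h' (fst z)\<bar>" by (simp add: cap'_def abs_mult)
 have "\<bar>cutoff_x n z\<bar> = \<bar>step (level n * snd z - 1)\<bar> * (\<bar>step' (level n * (eps * cap n (fst z) - snd z) - 1)\<bar> * (level n * (eps * \<bar>cap' n (fst z)\<bar>)))"
  using level_pos[of n] eps_pos by (simp add: cutoff_x_def abs_mult)
 also have "... \<le> 1 * (2 * (level n * (eps * \<bar>h' (fst z)\<bar>)))"
  using step_bounds[of "level n * snd z - 1"] step'_bounds[of "level n * (eps * cap n (fst z) - snd z) - 1"]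
   c level_pos[of n] eps_pos
  by (intro mult_mono) (auto simp: abs_of_nonneg)
 finally show ?thesis using True by (simp add: mult_ac)
next
 case False
 have "level n * (eps * cap n (fst z) - snd z) - 1 \<le> 0 \<or> 1 \<le> level n * (eps * cap n (fst z) - snd z) - 1"
 proof (cases "snd z \<ge> eps * h (fst z)")
  case True
  then have "eps * cap n (fst z) - snd z \<le> 0" using cap_bounds(2)[of n "fst z"] by simp
  then have "level n * (eps * cap n (fst z) - snd z) \<le> 0" using level_pos[of n] by (simp add: mult_nonneg_nonpos)
  then show ?thesis by simp
 next
  case F2: False
  then have "snd z \<le> eps * h (fst z) - 3 / level n" using False by auto
  then have "2 / level n \<le> eps * cap n (fst z) - snd z"
   using cap_bounds(1)[of "fst z" n] by (simp add: diff_divide_distrib)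
  then have "2 \<le> level n * (eps * cap n (fst z) - snd z)" using level_pos[of n] by (simp add: pos_divide_le_eq mult.commute)
  then show ?thesis by simp
 qed
 then show ?thesis using step'_eq_0 False by (simp add: cutoff_x_def)
qed

text \<open>The cutoff uses the truncated profile, which is continuously differentiable also across the maximum, and
 vanishes near the lower and the upper boundary. The support is therefore a compact subset of the interior.\<close>

lemma cutoff_test_function:
 assumes \<eta>: "c1c {-a<..<b} \<eta> \<eta>'" and \<theta>: "c1c UNIV \<theta> \<theta>'"
 shows "(%z. tens \<eta> \<theta> z * cutoff n z) \<in> test_functions S"
  "frechet_derivative (%z. tens \<eta> \<theta> z * cutoff n z) (at z) (1, 0)
    = \<eta>' (fst z) * \<theta> (snd z) * cutoff n z + \<eta> (fst z) * \<theta> (snd z) * cutoff_x n z"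
proof -
 let ?V = "{z :: real \<times> real. -a < fst z \<and> fst z < b}"
 let ?T = "%z. tens \<eta> \<theta> z * cutoff n z"
 let ?Tx = "%z. tens \<eta>' \<theta> z * cutoff n z + \<eta> (fst z) * \<theta> (snd z) * cutoff_x n z"
 let ?Ty = "%z. tens \<eta> \<theta>' z * cutoff n z + \<eta> (fst z) * \<theta> (snd z) * cutoff_y n z"
 obtain c d where cd: "{c..d} \<subseteq> {-a<..<b}" "\<And>x. x \<notin> {c..d} ==> \<eta> x = 0" "\<And>x. x \<notin> {c..d} ==> \<eta>' x = 0"
  using c1c_support[OF \<eta>] by metis
 have fstd: "(fst has_derivative fst) (at z)" and sndd: "(snd has_derivative snd) (at z)" for z :: "real \<times> real"
  by (rule bounded_linear_imp_has_derivative, rule bounded_linear_fst)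
    (rule bounded_linear_imp_has_derivative, rule bounded_linear_snd)
 have chain: "((%z. f (g z)) has_derivative (%v. D * g' v)) (at z)"
  if "(g has_derivative g') (at z)" "(f has_real_derivative D) (at (g z))" for f D g g' and z :: "real \<times> real"
  using has_derivative_compose[OF that(1) that(2)[unfolded has_field_derivative_def]] .
 have D: "(?T has_derivative (%v. fst v * ?Tx z + snd v * ?Ty z)) (at z)" if z: "z \<in> ?V" for z
 proof -
  have h: "((%z. cap n (fst z)) has_derivative (%v. cap' n (fst z) * fst v)) (at z)"
   by (rule chain[OF fstd]) (use flatten_profile[OF delta_pos, of "fst z" n] z in \<open>simp add: cap_def[abs_def] cap'_def\<close>)
  have 1: "((%z. level n * (eps * cap n (fst z) - snd z) - 1) has_derivative
    (%v. level n * (eps * (cap' n (fst z) * fst v) - snd v))) (at z)"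
   by (rule derivative_eq_intros h sndd refl)+ simp
  have 2: "((%z. level n * snd z - 1) has_derivative (%v. level n * snd v)) (at z)"
   by (rule derivative_eq_intros sndd refl)+ simp
  note 3 = has_derivative_mult[OF chain[OF 2 step_derivative] chain[OF 1 step_derivative]]
  note 4 = has_derivative_mult[OF chain[OF fstd c1cD(1)[OF \<eta>]] chain[OF sndd c1cD(1)[OF \<theta>]], of z]
  show ?thesis
   using has_derivative_eq_rhs[OF has_derivative_mult[OF 4 3]]
   unfolding cutoff_def[abs_def] cutoff_x_def cutoff_y_def
   by (rule has_derivative_eq_rhs) (auto simp: algebra_simps)
 qed
 have V: "open ?V" by (intro open_Collect_conj open_Collect_less continuous_intros)
 have cc: "continuous_on A (%z. cap n (fst z))" for A :: "(real \<times> real) set"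
  by (rule continuous_on_compose2[OF continuous_on_flatten_profile[OF delta_pos[of n]], of A fst, folded cap_def])
    (auto intro: continuous_intros)
 have cc': "continuous_on ?V (%z. cap' n (fst z))"
  unfolding cap'_def
  by (rule continuous_on_compose2[OF continuous_on_flatten_profile'[OF delta_pos[of n]] continuous_on_fst[OF continuous_on_id]]) auto
 note cont = continuous_on_compose2[OF continuous_on_step[of UNIV]] continuous_on_compose2[OF continuous_on_step'[of UNIV]]
  continuous_on_compose2[OF c1cD(2)[OF \<eta>]] continuous_on_compose2[OF c1cD(3)[OF \<eta>]]
  continuous_on_compose2[OF c1cD(2)[OF \<theta>]] continuous_on_compose2[OF c1cD(3)[OF \<theta>]]
 have cTx: "continuous_on ?V ?Tx" and cTy: "continuous_on ?V ?Ty"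
  unfolding cutoff_def cutoff_x_def cutoff_y_def by (intro continuous_intros cont cc cc'; simp)+
 define K where "K = ({c..d} \<times> {1 / level n..eps * M}) \<inter> {z. snd z \<le> eps * cap n (fst z) - 1 / level n}"
 have "closed {z :: real \<times> real. snd z \<le> eps * cap n (fst z) - 1 / level n}"
  by (intro closed_Collect_le continuous_intros cc)
 then have K: "compact K" unfolding K_def by (intro compact_Int_closed compact_Times compact_Icc)
 have inv: "0 < 1 / level n" using level_pos[of n] by simp
 have KU: "K \<subseteq> U"
 proof
  fix z assume "z \<in> K"
  then have "fst z \<in> {c..d}" "1 / level n \<le> snd z" "snd z \<le> eps * cap n (fst z) - 1 / level n"
   by (auto simp: K_def)
  moreover from this have "0 < snd z" "snd z < eps * h (fst z)" using inv cap_bounds(2)[of n "fst z"] by linarith+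
  ultimately show "z \<in> U" using cd(1) by auto
 qed
 have zero: "?T z = 0 \<and> ?Tx z = 0 \<and> ?Ty z = 0" if z: "z \<notin> K" for z
 proof -
  consider "fst z \<notin> {c..d}" | "snd z < 1 / level n" | "snd z > eps * cap n (fst z) - 1 / level n"
   | "snd z > eps * M" using z by (cases z) (auto simp: K_def not_le)
  then show ?thesis
  proof cases
   case 1 then show ?thesis using cd by simp
  next
   case 2
   then have "level n * snd z - 1 \<le> 0" using level_pos[of n] by (simp add: pos_less_divide_eq mult.commute)
   then show ?thesis using step_eq_0 step'_eq_0 by (simp add: cutoff_def cutoff_x_def cutoff_y_def)
  next
   case 3
   then have "eps * cap n (fst z) - snd z \<le> 1 / level n" by simp
   then have "level n * (eps * cap n (fst z) - snd z) - 1 \<le> 0"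
    using level_pos[of n] by (simp add: pos_le_divide_eq mult.commute)
   then show ?thesis using step_eq_0 step'_eq_0 by (simp add: cutoff_def cutoff_x_def cutoff_y_def)
  next
   case 4
   then have "eps * cap n (fst z) - snd z \<le> 0" using cap_bounds(2)[of n "fst z"] width_le[of "fst z"] by simp
   then have "level n * (eps * cap n (fst z) - snd z) \<le> 0" using level_pos[of n] by (simp add: mult_nonneg_nonpos)
   then have "level n * (eps * cap n (fst z) - snd z) - 1 \<le> 0" by simp
   then show ?thesis using step_eq_0 step'_eq_0 by (simp add: cutoff_def cutoff_x_def cutoff_y_def)
  qed
 qed
 have KV: "K \<subseteq> ?V" and KS: "K \<subseteq> interior S" using KU U_subset by auto
 show "?T \<in> test_functions S"
  by (rule plane_test_functionI(1)[OF V D cTx cTy K KV KS]) (use zero in blast)+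
 show "frechet_derivative ?T (at z) (1, 0) = ?Tx z"
  by (rule plane_test_functionI(2)[OF V D cTx cTy K KV KS]) (use zero in blast)+
qed

lemma h'_L2: "h' \<in> L2 (leb {-a..b})"
 unfolding L2_def using h'_meas h'_sq
 by (simp add: leb_integral(2,3) set_integrable_def)

lemma h'_strip_L2: "(%z. h' (fst z)) \<in> L2S"
proof -
 note [measurable] = h'_meas
 have "(%z :: real \<times> real. h' (fst z)) \<in> borel_measurable (borel \<Otimes>\<^sub>M borel)" by measurable
 then have m: "(%z :: real \<times> real. h' (fst z)) \<in> borel_measurable borel" by (simp add: borel_prod)
 have I: "integrable lborel (%x. indicator {-a..b} x * (h' x)^2)"
  using h'_sq by (simp add: set_integrable_def)
 have "integrable lborel (%z. (hat (%z. h' (fst z)) z)^2)"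
 proof (rule integrable_dominated)
  show "integrable lborel (%z. (indicator {-a..b} (fst z) * (h' (fst z))^2) * indicator {0<..<eps * M} (snd z))"
   using integrable_plane_tensor[OF I integrable_indicator_interval[of 0 "eps * M"]] .
  show "(%z. (hat (%z. h' (fst z)) z)^2) \<in> borel_measurable lborel" using m S_borel by simp
  have "(hat (%z. h' (fst z)) z)^2 \<le> (indicator {-a..b} (fst z) * (h' (fst z))^2) * indicator {0<..<eps * M} (snd z)" for z
   using width_le[of "fst z"] by (cases z) (auto simp: indicator_def mem_S)
  then show "AE z in lborel. norm ((hat (%z. h' (fst z)) z)^2)
    \<le> norm ((indicator {-a..b} (fst z) * (h' (fst z))^2) * indicator {0<..<eps * M} (snd z))"
   by (simp add: abs_of_nonneg)
 qed
 then show ?thesis unfolding hat_L2 using m S_borel by (simp add: L2_def)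
qed

lemma cap_measurable: "cap n \<in> borel_measurable borel" "cap' n \<in> borel_measurable borel"
proof -
 show "cap n \<in> borel_measurable borel" unfolding cap_def[abs_def]
  by (rule borel_measurable_continuous_onI[OF continuous_on_flatten_profile[OF delta_pos]])
 have [measurable]: "flatten' M (delta n) \<in> borel_measurable borel"
  by (rule borel_measurable_continuous_onI[OF continuous_on_flatten'[OF delta_pos]])
 note [measurable] = h_measurable h'_meas
 show "cap' n \<in> borel_measurable borel" unfolding cap'_def[abs_def] by measurable
qed

lemma cutoff_measurable: "cutoff n \<in> borel_measurable borel" "cutoff_x n \<in> borel_measurable borel"
proof -
 have [measurable]: "step \<in> borel_measurable borel" "step' \<in> borel_measurable borel"
  by (rule borel_measurable_continuous_onI[OF continuous_on_step] borel_measurable_continuous_onI[OF continuous_on_step'])+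
 note [measurable] = cap_measurable
 have "cutoff n \<in> borel_measurable (borel \<Otimes>\<^sub>M borel)" "cutoff_x n \<in> borel_measurable (borel \<Otimes>\<^sub>M borel)"
  unfolding cutoff_def[abs_def] cutoff_x_def[abs_def] by measurable
 then show "cutoff n \<in> borel_measurable borel" "cutoff_x n \<in> borel_measurable borel" by (simp_all add: borel_prod)
qed

text \<open>The contribution of the layer to the integration by parts. Since \<open>u\<close> vanishes on the upper
 boundary, it is bounded in the layer by the integral of $|\partial_y u|$ across the layer;
 the width of the layer compensates the size of the derivative of the cutoff, and what remains is
 the integral of $|h'\,\partial_y u|$ over a shrinking set.\<close>

lemma layer_integral_tendsto_0:
 assumes u: "u \<in> L2S" and g: "g \<in> L2S" and w: "weak_dy (hat u) (hat g)"
  and m: "\<eta> \<in> borel_measurable borel" "\<theta> \<in> borel_measurable borel"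
  and K: "\<And>x. \<bar>\<eta> x\<bar> \<le> K" "\<And>y. \<bar>\<theta> y\<bar> \<le> K"
 shows "(%n. LBINT z. hat u z * (tens \<eta> \<theta> z * cutoff_x n z)) \<longlonglongrightarrow> 0"
proof -
 define lay where "lay n z = (indicator {eps * h (fst z) - 3 / level n<..} (snd z) :: real)" for n and z :: "real \<times> real"
 define B where "B n = (LBINT z. \<bar>h' (fst z) * hat g z\<bar> * lay n z)" for n
 have K0: "0 \<le> K" using K(1)[of 0] by linarith
 note [measurable] = h_measurable h'_meas m
 have [measurable]: "hat u \<in> borel_measurable (borel \<Otimes>\<^sub>M borel)" "hat g \<in> borel_measurable (borel \<Otimes>\<^sub>M borel)"
  using hat_measurable[OF u] hat_measurable[OF g] by (simp_all add: borel_prod)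
 have [measurable]: "cutoff_x n \<in> borel_measurable (borel \<Otimes>\<^sub>M borel)" for n
  using cutoff_measurable(2)[of n] by (simp add: borel_prod)
 have [measurable]: "lay n \<in> borel_measurable (borel \<Otimes>\<^sub>M borel)" for n
 proof -
  have "lay n = (%z. if eps * h (fst z) - 3 / level n < snd z then 1 else 0)"
   by (auto simp: lay_def fun_eq_iff indicator_def)
  then show ?thesis by simp
 qed
 have W: "integrable lborel (%z. \<bar>h' (fst z) * hat g z\<bar>)"
 proof -
  have "(%z. \<bar>hat (%z. h' (fst z)) z * hat g z\<bar>) = (%z. \<bar>h' (fst z) * hat g z\<bar>)"
   by (auto simp: fun_eq_iff indicator_def)
  then show ?thesis using integrable_abs[OF integrable_mult_L2[OF h'_strip_L2[unfolded hat_L2] g[unfolded hat_L2]]] by simp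
 qed
 have Wn: "integrable lborel (%z. \<bar>h' (fst z) * hat g z\<bar> * lay n z)" for n
 proof (rule integrable_mult_bounded[OF W, of _ 1])
  have "lay n \<in> borel_measurable (borel \<Otimes>\<^sub>M borel)" by measurable
  then show "lay n \<in> borel_measurable lborel" by (simp add: borel_prod)
 qed (auto simp: lay_def indicator_def)
 have Blim: "B \<longlonglongrightarrow> 0"
 proof -
  have "(%n. LBINT z. \<bar>h' (fst z) * hat g z\<bar> * lay n z) \<longlonglongrightarrow> (LBINT z :: real \<times> real. 0)"
  proof (rule integral_dominated_convergence[OF _ _ W])
   show "AE z in lborel. (%n. \<bar>h' (fst z) * hat g z\<bar> * lay n z) \<longlonglongrightarrow> 0"
   proof (rule AE_I2)
    fix z
    show "(%n. \<bar>h' (fst z) * hat g z\<bar> * lay n z) \<longlonglongrightarrow> 0"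
    proof (cases "z \<in> S")
     case True
     define d where "d = eps * h (fst z) - snd z"
     have d: "d > 0" using True by (simp add: d_def mem_S)
     obtain n0 where n0: "3 / d < real n0" using reals_Archimedean2 by blast
     have "\<bar>h' (fst z) * hat g z\<bar> * lay n z = 0" if "n \<ge> n0" for n
     proof -
      have "3 / d < level n" using n0 that by (simp add: level_def)
      then have "3 / level n < d" using d level_pos[of n] by (simp add: divide_less_eq mult.commute)
      then show ?thesis by (simp add: lay_def d_def)
     qed
     then show ?thesis by (intro tendsto_eventually eventually_sequentiallyI[of n0])
    qed simp
   qed
   show "AE z in lborel. norm (\<bar>h' (fst z) * hat g z\<bar> * lay n z) \<le> \<bar>h' (fst z) * hat g z\<bar>" for n
    by (auto simp: lay_def indicator_def)
  qed (use borel_measurable_integrable[OF Wn] in simp_all)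
  then show ?thesis unfolding B_def[abs_def] by simp
 qed
 have bound: "\<bar>LBINT z. hat u z * (tens \<eta> \<theta> z * cutoff_x n z)\<bar> \<le> 6 * eps * K^2 * B n" for n
 proof (cases "integrable lborel (%z. hat u z * (tens \<eta> \<theta> z * cutoff_x n z))")
  case False
  have "0 \<le> B n" unfolding B_def by (intro integral_nonneg_AE) (auto simp: lay_def)
  then show ?thesis using not_integrable_integral_eq[OF False] eps_pos by simp
 next
  case True
  let ?F = "%z. ennreal (norm (hat u z * (tens \<eta> \<theta> z * cutoff_x n z)))"
  have Fm: "?F \<in> borel_measurable (lborel \<Otimes>\<^sub>M lborel)"
  proof -
   have "?F \<in> borel_measurable (borel \<Otimes>\<^sub>M borel)" by measurable
   then show ?thesis by (simp add: lborel_prod borel_prod)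
  qed
  have "ennreal (norm (LBINT z. hat u z * (tens \<eta> \<theta> z * cutoff_x n z))) \<le> (\<integral>\<^sup>+z. ?F z \<partial>lborel)"
   by (rule integral_norm_bound_ennreal[OF True])
  also have "... = (\<integral>\<^sup>+x. \<integral>\<^sup>+y. ?F (x, y) \<partial>lborel \<partial>lborel)"
   using lborel.nn_integral_fst[OF Fm] by (simp add: lborel_prod)
  also have "... \<le> (\<integral>\<^sup>+x. ennreal (6 * eps * K^2 * (LBINT y. \<bar>h' x * hat g (x, y)\<bar> * lay n (x, y))) \<partial>lborel)"
  proof (rule nn_integral_mono_AE, use weak_dy_sections[OF u g w] in \<open>rule eventually_mono\<close>)
   fix x assume *: "integrable lborel (%t. hat g (x, t)) \<and> (LBINT t. hat g (x, t)) = 0 \<and>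
    (AE y in lborel. hat u (x, y) = prim (%t. hat g (x, t)) y)"
   define q where "q = (LBINT t. \<bar>hat g (x, t)\<bar> * lay n (x, t))"
   have gi: "integrable lborel (%t. hat g (x, t))" using * by simp
   have q0: "0 \<le> q" unfolding q_def by (intro integral_nonneg_AE) (auto simp: lay_def)
   have P: "\<bar>prim (%t. hat g (x, t)) y\<bar> \<le> q" if y: "eps * h x - 3 / level n < y" for y
   proof -
    have i1: "integrable lborel (%t. indicator {..y} t * hat g (x, t))" "integrable lborel (%t. indicator {y<..} t * hat g (x, t))"
     by (rule integrable_indicator_mult[OF gi]; simp)+
    have "(LBINT t. hat g (x, t)) = (LBINT t. indicator {..y} t * hat g (x, t) + indicator {y<..} t * hat g (x, t))"
     by (rule integral_cong_fun) (auto simp: indicator_def)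
    then have "prim (%t. hat g (x, t)) y = - (LBINT t. indicator {y<..} t * hat g (x, t))"
     using * i1 by (simp add: prim_def)
    then have "\<bar>prim (%t. hat g (x, t)) y\<bar> \<le> (LBINT t. \<bar>indicator {y<..} t * hat g (x, t)\<bar>)"
     using integral_abs_bound[of lborel "%t. indicator {y<..} t * hat g (x, t)"] by simp
    also have "... \<le> q" unfolding q_def
    proof (rule integral_mono)
     show "integrable lborel (%t. \<bar>indicator {y<..} t * hat g (x, t)\<bar>)" using i1(2) by simp
     have "integrable lborel (%t. indicator {eps * h x - 3 / level n<..} t * \<bar>hat g (x, t)\<bar>)"
      by (rule integrable_indicator_mult) (use gi in simp_all)
     then show "integrable lborel (%t. \<bar>hat g (x, t)\<bar> * lay n (x, t))"
      by (simp add: lay_def mult.commute)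
    qed (use y in \<open>auto simp: lay_def indicator_def\<close>)
    finally show ?thesis .
   qed
   define c where "c = q * (K^2 * (2 * eps * level n * \<bar>h' x\<bar>))"
   have c0: "0 \<le> c" using q0 eps_pos level_pos[of n] by (simp add: c_def)
   have "(\<integral>\<^sup>+y. ?F (x, y) \<partial>lborel) \<le> (\<integral>\<^sup>+y. ennreal c * indicator {eps * h x - 3 / level n<..<eps * h x} y \<partial>lborel)"
   proof (rule nn_integral_mono_AE)
    have "AE y in lborel. hat u (x, y) = prim (%t. hat g (x, t)) y" using * by simp
    then show "AE y in lborel. ?F (x, y) \<le> ennreal c * indicator {eps * h x - 3 / level n<..<eps * h x} y"
    proof (rule eventually_mono)
     fix y assume e: "hat u (x, y) = prim (%t. hat g (x, t)) y"
     show "?F (x, y) \<le> ennreal c * indicator {eps * h x - 3 / level n<..<eps * h x} y"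
     proof (cases "y \<in> {eps * h x - 3 / level n<..<eps * h x}")
      case True
      have "norm (hat u (x, y) * (\<eta> x * \<theta> y * cutoff_x n (x, y))) = \<bar>hat u (x, y)\<bar> * (\<bar>\<eta> x\<bar> * \<bar>\<theta> y\<bar> * \<bar>cutoff_x n (x, y)\<bar>)"
       by (simp add: abs_mult)
      also have "... \<le> q * (K * K * (2 * eps * level n * \<bar>h' x\<bar>))"
      proof -
       have 1: "\<bar>hat u (x, y)\<bar> \<le> q" using P[of y] e True by simp
       have 2: "\<bar>cutoff_x n (x, y)\<bar> \<le> 2 * eps * level n * \<bar>h' x\<bar>"
        using cutoff_x_bound[of n "(x, y)"] True by simp
       have 3: "\<bar>\<eta> x\<bar> * \<bar>\<theta> y\<bar> \<le> K * K" by (rule mult_mono) (use K K0 in simp_all)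
       have 4: "\<bar>\<eta> x\<bar> * \<bar>\<theta> y\<bar> * \<bar>cutoff_x n (x, y)\<bar> \<le> K * K * (2 * eps * level n * \<bar>h' x\<bar>)"
        by (rule mult_mono[OF 3 2]) (use K0 in simp_all)
       show ?thesis by (rule mult_mono[OF 1 4]) (use q0 in simp_all)
      qed
      finally have "norm (hat u (x, y) * (\<eta> x * \<theta> y * cutoff_x n (x, y))) \<le> c" by (simp add: c_def power2_eq_square)
      then show ?thesis using True by (simp add: ennreal_leI)
     next
      case False
      then have "cutoff_x n (x, y) = 0" using cutoff_x_bound[of n "(x, y)"] by simp
      then show ?thesis by simp
     qed
    qed
   qed
   also have "... = ennreal c * ennreal (3 / level n)"
    using level_pos[of n] by (simp add: nn_integral_cmult_indicator)
   also have "... = ennreal (c * (3 / level n))"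
    using c0 level_pos[of n] by (intro ennreal_mult[symmetric]) auto
   also have "c * (3 / level n) = 6 * eps * K^2 * (\<bar>h' x\<bar> * q)"
    using level_pos[of n] by (simp add: c_def field_simps)
   also have "\<bar>h' x\<bar> * q = (LBINT y. \<bar>h' x * hat g (x, y)\<bar> * lay n (x, y))"
    unfolding q_def by (simp add: abs_mult mult.assoc)
   finally show "(\<integral>\<^sup>+y. ?F (x, y) \<partial>lborel) \<le> ennreal (6 * eps * K^2 * (LBINT y. \<bar>h' x * hat g (x, y)\<bar> * lay n (x, y)))" .
  qed
  also have "... = ennreal (LBINT x. 6 * eps * K^2 * (LBINT y. \<bar>h' x * hat g (x, y)\<bar> * lay n (x, y)))"
  proof (rule nn_integral_eq_integral)
   show "integrable lborel (%x. 6 * eps * K^2 * (LBINT y. \<bar>h' x * hat g (x, y)\<bar> * lay n (x, y)))"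
    using plane_Fubini(3)[OF Wn[of n]] by simp
   show "AE x in lborel. 0 \<le> 6 * eps * K^2 * (LBINT y. \<bar>h' x * hat g (x, y)\<bar> * lay n (x, y))"
    using eps_pos by (intro AE_I2 mult_nonneg_nonneg integral_nonneg_AE) (auto simp: lay_def)
  qed
  also have "(LBINT x. 6 * eps * K^2 * (LBINT y. \<bar>h' x * hat g (x, y)\<bar> * lay n (x, y))) = 6 * eps * K^2 * B n"
   unfolding B_def using plane_Fubini(1)[OF Wn[of n]] by simp
  finally have "norm (LBINT z. hat u z * (tens \<eta> \<theta> z * cutoff_x n z)) \<le> 6 * eps * K^2 * B n"
  proof (subst (asm) ennreal_le_iff)
   have "0 \<le> B n" unfolding B_def by (intro integral_nonneg_AE) (auto simp: lay_def)
   then show "0 \<le> 6 * eps * K^2 * B n" using eps_pos by simp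
  qed
  then show ?thesis by simp
 qed
 show ?thesis
 proof (rule Lim_null_comparison)
  show "\<forall>\<^sub>F n in sequentially. norm (LBINT z. hat u z * (tens \<eta> \<theta> z * cutoff_x n z)) \<le> 6 * eps * K^2 * B n"
   using bound by simp
  show "(%n. 6 * eps * K^2 * B n) \<longlonglongrightarrow> 0" by (rule tendsto_mult_right_zero[OF Blim])
 qed
qed

text \<open>Test with a product cut off near the curved boundary and let the cutoff tend to one. The only term
 that is not handled by dominated convergence contains the derivative of the cutoff, and it is carried by the layer.\<close>

lemma weak_dx_zero_extension:
 assumes u: "u \<in> L2S" and G: "is_weak_grad S u G" and w: "weak_dy (hat u) (hat (gy G))"
  and \<eta>: "c1c {-a<..<b} \<eta> \<eta>'" and \<theta>: "c1c UNIV \<theta> \<theta>'"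
 shows "(LBINT z. hat u z * tens \<eta>' \<theta> z) = - (LBINT z. hat (gx G) z * tens \<eta> \<theta> z)"
proof -
 note GL = is_weak_gradD(1)[OF G]
 obtain K1 where K1: "\<And>x. \<bar>\<eta> x\<bar> \<le> K1" "\<And>x. \<bar>\<eta>' x\<bar> \<le> K1" "0 \<le> K1" using c1c_bounded[OF \<eta>] by metis
 obtain K2 where K2: "\<And>x. \<bar>\<theta> x\<bar> \<le> K2" using c1c_bounded[OF \<theta>] by metis
 define K where "K = max K1 K2"
 have K: "\<bar>\<eta> x\<bar> \<le> K" "\<bar>\<eta>' x\<bar> \<le> K" "\<bar>\<theta> x\<bar> \<le> K" for x
  using K1(1,2)[of x] K2[of x] by (auto simp: K_def)
 note m = c1cD(4)[OF \<eta>] c1cD(5)[OF \<eta>] c1cD(4)[OF \<theta>]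
 have DCT: "(%n. LBINT z. hat f z * (\<eta>0 (fst z) * \<theta> (snd z)) * cutoff n z) \<longlonglongrightarrow> (LBINT z. hat f z * (\<eta>0 (fst z) * \<theta> (snd z)))"
  and int: "integrable lborel (%z. hat f z * (\<eta>0 (fst z) * \<theta> (snd z)) * cutoff n z)"
  if f: "f \<in> L2S" and e: "\<eta>0 \<in> borel_measurable borel" "\<And>x. \<bar>\<eta>0 x\<bar> \<le> K" for f \<eta>0 n
 proof -
  have I: "integrable lborel (%z. hat f z * (\<eta>0 (fst z) * \<theta> (snd z)))"
   by (rule integrable_mult_tensor[OF hat_integrable[OF f] e(1) m(3) e(2) K(3)])
  show J: "integrable lborel (%z. hat f z * (\<eta>0 (fst z) * \<theta> (snd z)) * cutoff n z)" for n
   by (rule integrable_mult_bounded[OF I _ cutoff_bounds]) (use cutoff_measurable in simp)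
  show "(%n. LBINT z. hat f z * (\<eta>0 (fst z) * \<theta> (snd z)) * cutoff n z) \<longlonglongrightarrow> (LBINT z. hat f z * (\<eta>0 (fst z) * \<theta> (snd z)))"
  proof (rule integral_dominated_convergence[OF _ _ integrable_abs[OF I]])
   show "AE z in lborel. (%n. hat f z * (\<eta>0 (fst z) * \<theta> (snd z)) * cutoff n z) \<longlonglongrightarrow> hat f z * (\<eta>0 (fst z) * \<theta> (snd z))"
   proof (rule AE_I2)
    fix z
    show "(%n. hat f z * (\<eta>0 (fst z) * \<theta> (snd z)) * cutoff n z) \<longlonglongrightarrow> hat f z * (\<eta>0 (fst z) * \<theta> (snd z))"
    proof (cases "z \<in> S")
     case True
     from tendsto_mult[OF tendsto_const cutoff_tendsto[OF True]] show ?thesis by fastforce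
    qed simp
   qed
   show "AE z in lborel. norm (hat f z * (\<eta>0 (fst z) * \<theta> (snd z)) * cutoff n z) \<le> \<bar>hat f z * (\<eta>0 (fst z) * \<theta> (snd z))\<bar>" for n
    using mult_left_mono[OF cutoff_bounds, of "\<bar>hat f _ * (\<eta>0 (fst _) * \<theta> (snd _))\<bar>" n]
    by (auto simp: abs_mult intro: mult_left_le cutoff_bounds)
  qed (use borel_measurable_integrable[OF I] borel_measurable_integrable[OF J] in simp_all)
 qed
 have eq: "(LBINT z. hat u z * tens \<eta>' \<theta> z * cutoff n z) + (LBINT z. hat u z * (tens \<eta> \<theta> z * cutoff_x n z))
   = - (LBINT z. hat (gx G) z * tens \<eta> \<theta> z * cutoff n z)" for n
 proof -
  let ?T = "%z. tens \<eta> \<theta> z * cutoff n z"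
  note t = cutoff_test_function[OF \<eta> \<theta>, of n]
  obtain R where R: "continuous_on UNIV (%z. frechet_derivative ?T (at z) (1, 0))"
   "\<And>z. \<bar>frechet_derivative ?T (at z) (1, 0)\<bar> \<le> R"
   by (rule plane_test_functionD[OF t(1)]) (rule that; assumption)
  have "integrable lborel (%z. hat u z * frechet_derivative ?T (at z) (1, 0))"
   by (rule integrable_mult_bounded[OF hat_integrable[OF u] _ R(2)])
     (use borel_measurable_continuous_onI[OF R(1)] in simp)
  then have I: "integrable lborel (%z. hat u z * (tens \<eta>' \<theta> z * cutoff n z + \<eta> (fst z) * \<theta> (snd z) * cutoff_x n z))"
   unfolding t(2) .
  note J = int[OF u m(2) K(2), of n]
  have "integrable lborel (%z. hat u z * (tens \<eta>' \<theta> z * cutoff n z + \<eta> (fst z) * \<theta> (snd z) * cutoff_x n z)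
    - hat u z * tens \<eta>' \<theta> z * cutoff n z)" by (rule Bochner_Integration.integrable_diff[OF I J])
  then have L: "integrable lborel (%z. hat u z * (tens \<eta> \<theta> z * cutoff_x n z))"
   by (simp add: algebra_simps)
  have "(LBINT z. hat u z * tens \<eta>' \<theta> z * cutoff n z + hat u z * (tens \<eta> \<theta> z * cutoff_x n z))
   = (LBINT z. hat u z * frechet_derivative ?T (at z) (1, 0))"
   unfolding t(2) by (rule integral_cong_fun) (simp_all add: algebra_simps)
  also have "... = - (LBINT z. hat (gx G) z * ?T z)" by (rule weak_grad_test(1)[OF G t(1)])
  finally show ?thesis using J L by (simp add: mult.assoc)
 qed
 have "(%n. (LBINT z. hat u z * tens \<eta>' \<theta> z * cutoff n z) + (LBINT z. hat u z * (tens \<eta> \<theta> z * cutoff_x n z)))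
   \<longlonglongrightarrow> (LBINT z. hat u z * tens \<eta>' \<theta> z) + 0"
  by (intro tendsto_add DCT u m K layer_integral_tendsto_0[OF u L2_snd[OF GL] w m(1,3) K(1,3)])
 moreover have "(%n. - (LBINT z. hat (gx G) z * tens \<eta> \<theta> z * cutoff n z))
   \<longlonglongrightarrow> - (LBINT z. hat (gx G) z * tens \<eta> \<theta> z)"
  by (intro tendsto_minus DCT L2_fst GL m K)
 ultimately show ?thesis unfolding eq using LIMSEQ_unique by fastforce
qed

end

lemma ac_on_const: "ac_on a b (%_. c) (%_. 0)"
 by (rule ac_onI) (simp_all add: set_integrable_def set_lebesgue_integral_def)

context narrow_strip
begin

lemma hat_far: "radius < \<bar>fst z\<bar> \<or> radius < \<bar>snd z\<bar> ==> hat f z = 0"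
 using not_in_S_far[of "fst z" "snd z"] by (cases z) auto

lemma horizontal_sections:
 assumes u: "u \<in> L2S" and G: "is_weak_grad S u G" and w: "weak_dy (hat u) (hat (gy G))"
 shows "AE y in lborel. integrable lborel (%t. hat (gx G) (t, y)) \<and>
  (\<exists>v. ac_on (-a) b v (%t. hat (gx G) (t, y)) \<and> (AE x in lborel. x \<in> {-a<..<b} --> hat u (x, y) = v x))"
proof -
 note GL = is_weak_gradD(1)[OF G]
 let ?g = "hat (gx G)"
 have gI: "integrable lborel (swap ?g)" by (rule swap_integrable[OF L2_fst[OF GL]])
 have ab: "-a < b" using a_pos b_pos by simp
 obtain C where C: "AE z in lborel. fst z \<in> UNIV --> snd z \<in> {-a<..<b} -->
   swap (hat u) z = C (fst z) + prim (%t. swap ?g (fst z, t)) (snd z)"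
 proof (rule weak_derivative_imp_ac_on_lines[OF swap_integrable[OF u] gI ab open_UNIV])
  fix \<eta> \<eta>' \<theta> \<theta>' assume \<eta>U: "c1c UNIV \<eta> \<eta>'" and \<theta>: "c1c {-a<..<b} \<theta> \<theta>'"
  note [measurable] = c1cD(4)[OF \<eta>U] c1cD(4)[OF \<theta>] c1cD(5)[OF \<theta>]
  have sw: "(LBINT z. swap F z * tens \<eta> k z) = (LBINT z. F z * tens k \<eta> z)"
   if F: "F \<in> borel_measurable borel" and [measurable]: "k \<in> borel_measurable borel" for F k
  proof -
   have "(tens k \<eta>) \<in> borel_measurable (borel \<Otimes>\<^sub>M borel)" by measurable
   then have "(%z. F z * tens k \<eta> z) \<in> borel_measurable borel" using F by (simp add: borel_prod)
   from integral_plane_swap[OF this] show ?thesis by (simp add: mult_ac)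
  qed
  show "(LBINT z. swap (hat u) z * tens \<eta> \<theta>' z) = - (LBINT z. swap ?g z * tens \<eta> \<theta> z)"
   using sw[OF hat_measurable[OF u], of \<theta>'] sw[OF hat_measurable[OF L2_fst[OF GL]], of \<theta>]
    weak_dx_zero_extension[OF u G w \<theta> \<eta>U] c1cD(4,5)[OF \<theta>] by simp
 qed auto
 show ?thesis using plane_AE_sections[OF C] plane_Fubini(2)[OF gI]
 proof eventually_elim
  case (elim y)
  have i: "integrable lborel (%t. ?g (t, y))" using elim(2) by simp
  have "ac_on (-a) b (%x. C y + prim (%t. ?g (t, y)) x) (%t. ?g (t, y))"
   by (rule ac_onI[OF ac_on_integrable[OF ac_on_prim[OF i]]]) (use ac_on_eq[OF ac_on_prim[OF i]] in simp)
  then show ?case using i elim(1) by auto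
 qed
qed

section \<open>Dirichlet conditions at the sides\<close>

lemma swap_prim_iff:
 assumes "u \<in> L2S" "g \<in> L2S"
 shows "weak_dy (swap (hat u)) (swap (hat g)) \<longleftrightarrow>
  (AE z in lborel. swap (hat u) z = prim (%t. hat g (t, fst z)) (snd z))"
proof -
 have "weak_dy (swap (hat u)) (swap (hat g)) \<longleftrightarrow>
   (AE z in lborel. swap (hat u) z = prim (%t. swap (hat g) (fst z, t)) (snd z))"
 proof (rule weak_dy_iff_prim[OF swap_integrable swap_integrable, OF assms, of radius])
  fix x y :: real assume "radius < \<bar>x\<bar> \<or> radius < \<bar>y\<bar>"
  then have "hat f (y, x) = 0" for f by (intro hat_far) auto
  then show "swap (hat u) (x, y) = 0 \<and> swap (hat g) (x, y) = 0" by simp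
 qed
 then show ?thesis by simp
qed

lemma ac_on_tendsto_ends:
 assumes "ac_on p q v v'" "p < q"
 shows "(v \<longlongrightarrow> v p) (at_right p)" "(v \<longlongrightarrow> v q) (at_left q)"
proof -
 have c: "continuous_on {p..q} v" by (rule ac_on_imp_continuous[OF assms(1)])
 show "(v \<longlongrightarrow> v p) (at_right p)" "(v \<longlongrightarrow> v q) (at_left q)"
  using continuous_on_Icc_at_rightD[OF c assms(2)] continuous_on_Icc_at_leftD[OF c assms(2)] .
qed

text \<open>Since the horizontal sections of the zero extension are already absolutely continuous inside $(-a,b)$,
 limits zero at the two ends allow test functions that do not vanish there.\<close>

lemma vanishes_sides_imp_weak_dx:
 assumes u: "u \<in> L2S" and G: "is_weak_grad S u G" and w: "weak_dy (hat u) (hat (gy G))"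
  and van: "vanishes_sides a b h eps u"
 shows "weak_dy (swap (hat u)) (swap (hat (gx G)))"
proof -
 let ?g = "hat (gx G)"
 note GL = is_weak_gradD(1)[OF G]
 have ab: "-a < b" using a_pos b_pos by simp
 obtain u' where u': "AE z in leb S. u' z = u z"
  and l1: "AE y in leb {0<..<eps * h (-a)}. ((%x. u' (x, y)) \<longlongrightarrow> 0) (at_right (-a))"
  and l2: "AE y in leb {0<..<eps * h b}. ((%x. u' (x, y)) \<longlongrightarrow> 0) (at_left b)"
  using van unfolding vanishes_sides_def by auto
 have u'': "AE z in lborel. z \<in> S --> u' z = u z" using u' unfolding AE_leb[OF S_borel] .
 have "AE y in lborel. AE x in lborel. (x, y) \<in> S --> u' (x, y) = u (x, y)"
  using plane_AE_sections[OF AE_plane_swap[OF u'']] by simp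
 moreover have "AE y in lborel. y \<in> {0<..<eps * h (-a)} --> ((%x. u' (x, y)) \<longlongrightarrow> 0) (at_right (-a))"
  using l1 by (subst (asm) AE_leb) auto
 moreover have "AE y in lborel. y \<in> {0<..<eps * h b} --> ((%x. u' (x, y)) \<longlongrightarrow> 0) (at_left b)"
  using l2 by (subst (asm) AE_leb) auto
 ultimately have "AE y in lborel. AE x in lborel. swap (hat u) (y, x) = prim (%t. swap ?g (y, t)) x"
  using horizontal_sections[OF u G w] AE_lborel_singleton[of 0]
   AE_lborel_singleton[of "eps * h (-a)"] AE_lborel_singleton[of "eps * h b"]
 proof eventually_elim
  case (elim y)
  then obtain v where i: "integrable lborel (%t. ?g (t, y))" and v: "ac_on (-a) b v (%t. ?g (t, y))"
   "AE x in lborel. x \<in> {-a<..<b} --> hat u (x, y) = v x" by auto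
  note ends = ac_on_tendsto_ends[OF v(1) ab]
  \<comment> \<open>near a side the section either stays inside the strip or is zero\<close>
  have end_zero: "v t = 0" if t: "y \<noteq> eps * h t" "at t within {-a<..<b} \<noteq> bot" "(v \<longlongrightarrow> v t) (at t within {-a<..<b})"
   "0 < y ==> y < eps * h t ==> ((%x. u' (x, y)) \<longlongrightarrow> 0) (at t within {-a<..<b})" for t
  proof -
   have agree: "v t = 0" if W: "open W" "t \<in> W" and k: "(k \<longlongrightarrow> 0) (at t within {-a<..<b})"
    "AE x in lborel. x \<in> {-a<..<b} \<inter> W --> v x = k x" for k :: line_fun and W
   proof -
    have e: "at t within {-a<..<b} \<inter> W = at t within {-a<..<b}" by (rule at_within_nhd[OF W(2,1)]) auto
    show ?thesis by (rule AE_limits_agree[OF k(2) open_Int[OF open_greaterThanLessThan W(1)], of t, unfolded e, OF t(2,3) k(1)])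
   qed
   have out: "v t = 0" if W: "open W" "t \<in> W" "\<And>x. x \<in> W ==> (x, y) \<notin> S" for W
    by (rule agree[OF W(1,2) tendsto_const], use v(2) in \<open>rule eventually_mono\<close>) (use W(3) in force)
   consider "y \<le> 0" | "0 < y" "y < eps * h t" | "eps * h t < y" using t(1) by fastforce
   then show ?thesis
   proof cases
    case 1 then show ?thesis by (intro out[of UNIV]) (auto simp: mem_S)
   next
    case 2
    show ?thesis
    proof (rule agree[OF _ _ t(4)[OF 2]])
     show "open {x. y < eps * h x}" by (intro open_Collect_less continuous_intros h_cont)
     show "AE x in lborel. x \<in> {-a<..<b} \<inter> {x. y < eps * h x} --> v x = u' (x, y)"
      using v(2) elim(1) by eventually_elim (use 2 in \<open>auto simp: mem_S indicator_def\<close>)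
    qed (use 2 in simp)
   next
    case 3
    have "open {x. eps * h x < y}" by (intro open_Collect_less continuous_intros h_cont)
    then show ?thesis by (rule out) (use 3 in \<open>auto simp: mem_S\<close>)
   qed
  qed
  have va: "v (-a) = 0" and vb: "v b = 0"
   using end_zero[of "-a"] end_zero[of b] elim(2,3,6,7) ends eps_pos h_pos
   by (simp_all add: at_within_open_interval[OF ab])
  have pa: "prim (%t. ?g (t, y)) (-a) = 0"
  proof -
   show ?thesis unfolding prim_def
   proof (rule integral_eq_zero_AE, use AE_lborel_singleton[of "-a"] in \<open>rule eventually_mono\<close>)
    fix t assume "t \<noteq> -a"
    then show "indicator {..-a} t * ?g (t, y) = 0"
     by (auto simp: indicator_def mem_S)
   qed
  qed
  have vp: "v x = prim (%t. ?g (t, y)) x" if "x \<in> {-a..b}" for x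
   using ac_on_eq[OF v(1) that] ac_on_eq[OF ac_on_prim[OF i, of "-a" b] that] va pa by simp
  have pb: "prim (%t. ?g (t, y)) x = 0" if "b \<le> x" for x
  proof -
   have "prim (%t. ?g (t, y)) x = (LBINT t. ?g (t, y))" "prim (%t. ?g (t, y)) b = (LBINT t. ?g (t, y))"
    by (rule prim_eq_total; rule hat_section_support(2); use that in simp)+
   then show ?thesis using vp[of b] vb ab by simp
  qed
  show ?case using v(2) AE_lborel_singleton[of "-a"] AE_lborel_singleton[of b]
  proof eventually_elim
   case (elim x)
   consider "x < -a" | "x \<in> {-a<..<b}" | "b < x" using elim by fastforce
   then show ?case
   proof cases
    case 1
    have "prim (%t. ?g (t, y)) x = 0" by (rule prim_eq_0, rule hat_section_support(2)) (use 1 in auto)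
    then show ?thesis using 1 by (simp add: hat_section_support(2))
   next
    case 2 then show ?thesis using elim vp[of x] by simp
   next
    case 3 then show ?thesis using pb[of x] by (simp add: hat_section_support(2))
   qed
  qed
 qed
 then have "AE z in lborel. swap (hat u) z = prim (%t. swap ?g (fst z, t)) (snd z)"
  by (rule AE_prim_sections[OF swap_integrable[OF u] swap_integrable[OF L2_fst[OF GL]]])
 then show ?thesis by (simp add: swap_prim_iff[OF u L2_fst[OF GL]])
qed

lemma weak_dx_sections:
 assumes u: "u \<in> L2S" and g: "g \<in> L2S" and w: "weak_dy (swap (hat u)) (swap (hat g))"
 shows "AE y in lborel. integrable lborel (%t. hat g (t, y)) \<and> prim (%t. hat g (t, y)) (-a) = 0 \<and>
  prim (%t. hat g (t, y)) b = 0 \<and> (AE x in lborel. hat u (x, y) = prim (%t. hat g (t, y)) x)"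
 using plane_AE_sections[OF w[unfolded swap_prim_iff[OF u g]]] plane_Fubini(2)[OF swap_integrable[OF g]]
proof eventually_elim
 case (elim y)
 then have ae: "AE x in lborel. hat u (x, y) = prim (%t. hat g (t, y)) x" and i: "integrable lborel (%t. hat g (t, y))"
  by simp_all
 have P: "(prim (%t. hat g (t, y)) \<longlongrightarrow> prim (%t. hat g (t, y)) x0) (at x0 within A)" for x0 A
  by (rule tendsto_within_subset[OF isCont_prim[unfolded isCont_def]]) (use i in auto)
 have l: "AE x in lborel. x \<in> {-a - 1<..<-a} --> 0 = prim (%t. hat g (t, y)) x"
  using ae by (rule eventually_mono) (auto simp: hat_section_support(2))
 have "0 = prim (%t. hat g (t, y)) (-a)" by (rule AE_limits_agree_left[OF l _ tendsto_const P]) simp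
 moreover have r: "AE x in lborel. x \<in> {b<..<b + 1} --> 0 = prim (%t. hat g (t, y)) x"
  using ae by (rule eventually_mono) (auto simp: hat_section_support(2))
 have "0 = prim (%t. hat g (t, y)) b" by (rule AE_limits_agree_right[OF r _ tendsto_const P]) simp
 ultimately show ?case using ae i by simp
qed

lemma weak_dx_imp_vanishes_sides:
 assumes u: "u \<in> L2S" and g: "g \<in> L2S" and w: "weak_dy (swap (hat u)) (swap (hat g))"
 shows "vanishes_sides a b h eps u"
proof -
 let ?u' = "%z. prim (%t. hat g (t, snd z)) (fst z)"
 have p: "AE z in lborel. swap (hat u) z = prim (%t. hat g (t, fst z)) (snd z)"
  using w by (simp add: swap_prim_iff[OF u g])
 have 1: "AE z in leb S. ?u' z = u z" unfolding AE_leb[OF S_borel]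
  using AE_plane_swap[OF p] by (rule eventually_mono) auto
 have lim: "((%x. ?u' (x, y)) \<longlongrightarrow> 0) (at_right (-a))" "((%x. ?u' (x, y)) \<longlongrightarrow> 0) (at_left b)"
  if "integrable lborel (%t. hat g (t, y)) \<and> prim (%t. hat g (t, y)) (-a) = 0 \<and>
   prim (%t. hat g (t, y)) b = 0 \<and> (AE x in lborel. hat u (x, y) = prim (%t. hat g (t, y)) x)" for y
 proof -
  have P: "(prim (%t. hat g (t, y)) \<longlongrightarrow> prim (%t. hat g (t, y)) x0) (at x0 within A)" for x0 A
   by (rule tendsto_within_subset[OF isCont_prim[unfolded isCont_def]]) (use that in auto)
  show "((%x. ?u' (x, y)) \<longlongrightarrow> 0) (at_right (-a))" "((%x. ?u' (x, y)) \<longlongrightarrow> 0) (at_left b)"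
   using P[of "-a" "{-a<..}"] P[of b "{..<b}"] that by simp_all
 qed
 have 2: "AE y in leb {0<..<eps * h (-a)}. ((%x. ?u' (x, y)) \<longlongrightarrow> 0) (at_right (-a))"
  unfolding AE_leb[OF borel_open[OF open_greaterThanLessThan]]
  using weak_dx_sections[OF u g w] by (rule eventually_mono) (rule impI, rule lim(1))
 have 3: "AE y in leb {0<..<eps * h b}. ((%x. ?u' (x, y)) \<longlongrightarrow> 0) (at_left b)"
  unfolding AE_leb[OF borel_open[OF open_greaterThanLessThan]]
  using weak_dx_sections[OF u g w] by (rule eventually_mono) (rule impI, rule lim(2))
 show ?thesis unfolding vanishes_sides_def by (intro exI[of _ ?u'] conjI 1 2 3)
qed

section \<open>The form domain\<close>

text \<open>The boundary conditions in a form that passes to $L^2$ limits of functions and gradients: integration by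
 parts holds against functions that need not vanish on the part of the boundary in question.\<close>

definition dirichlet_identities :: "bdry_cond => (real \<times> real => real) => (real \<times> real => real \<times> real) => bool" where
 "dirichlet_identities bc u G \<longleftrightarrow> (\<forall>\<eta> \<eta>' \<theta> \<theta>'. c1c UNIV \<eta> \<eta>' --> c1c UNIV \<theta> \<theta>' -->
   innerS u (tens \<eta> \<theta>') = - innerS (gy G) (tens \<eta> \<theta>) \<and>
   (bc = Dir --> innerS u (tens \<eta>' \<theta>) = - innerS (gx G) (tens \<eta> \<theta>)))"

lemma l2_inner_S: "innerS f g = (LBINT z. hat f z * g z)" for f g :: plane_fun
 by (simp add: l2_inner_def LINT_S mult.assoc)

lemma dirichlet_identities_iff:
 assumes u: "u \<in> L2S" and G: "G \<in> L2S"
 shows "dirichlet_identities bc u G \<longleftrightarrow> weak_dy (hat u) (hat (gy G)) \<and>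
  (bc = Dir --> weak_dy (swap (hat u)) (swap (hat (gx G))))"
proof -
 have sw: "(LBINT z. swap (hat f) z * tens \<eta> k z) = (LBINT z. hat f z * tens k \<eta> z)"
  if f: "f \<in> L2S" and [measurable]: "\<eta> \<in> borel_measurable borel" "k \<in> borel_measurable borel" for f k \<eta>
 proof -
  have "(tens k \<eta>) \<in> borel_measurable (borel \<Otimes>\<^sub>M borel)" by measurable
  then have "(%z. hat f z * tens k \<eta> z) \<in> borel_measurable borel"
   using hat_measurable[OF f] by (simp add: borel_prod)
  from integral_plane_swap[OF this] show ?thesis by (simp add: mult_ac)
 qed
 have eqv: "(LBINT z. swap (hat u) z * tens \<eta> \<theta>' z) = - (LBINT z. swap (hat (gx G)) z * tens \<eta> \<theta> z)
   \<longleftrightarrow> (LBINT z. hat u z * tens \<theta>' \<eta> z) = - (LBINT z. hat (gx G) z * tens \<theta> \<eta> z)"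
  if "c1c UNIV \<eta> \<eta>'" "c1c UNIV \<theta> \<theta>'" for \<eta> \<eta>' \<theta> \<theta>'
  unfolding sw[OF u c1cD(4)[OF that(1)] c1cD(5)[OF that(2)]] sw[OF L2_fst[OF G] c1cD(4)[OF that(1)] c1cD(4)[OF that(2)]] ..
 have "weak_dy (swap (hat u)) (swap (hat (gx G))) \<longleftrightarrow> (\<forall>\<theta> \<theta>' \<eta> \<eta>'. c1c UNIV \<theta> \<theta>' --> c1c UNIV \<eta> \<eta>' -->
   (LBINT z. hat u z * tens \<eta>' \<theta> z) = - (LBINT z. hat (gx G) z * tens \<eta> \<theta> z))"
  unfolding weak_dy_def using eqv by blast
 then show ?thesis unfolding dirichlet_identities_def l2_inner_S weak_dy_def by blast
qed

lemma strip_domainD: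
 assumes "u \<in> strip_domain bc a b h eps"
 shows "u \<in> H1 S" "u \<in> L2S"
  and "is_weak_grad S u G ==> dirichlet_identities bc u G"
proof -
 show H: "u \<in> H1 S" using assms by (cases bc) auto
 then show L: "u \<in> L2S" by (rule H1_L2)
 assume G: "is_weak_grad S u G"
 have "vanishes_bottom_top a b h eps u" using assms by (cases bc) auto
 then have w: "weak_dy (hat u) (hat (gy G))" by (rule vanishes_bottom_top_imp_weak_dy[OF L G])
 moreover have "weak_dy (swap (hat u)) (swap (hat (gx G)))" if "bc = Dir"
  by (rule vanishes_sides_imp_weak_dx[OF L G w]) (use assms that in simp)
 ultimately show "dirichlet_identities bc u G"
  by (simp add: dirichlet_identities_iff[OF L is_weak_gradD(1)[OF G]])
qed

lemma strip_domainI: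
 assumes L: "u \<in> L2S" and G: "is_weak_grad S u G" and d: "dirichlet_identities bc u G"
 shows "u \<in> strip_domain bc a b h eps"
proof -
 note GL = is_weak_gradD(1)[OF G]
 have "u \<in> H1 S" by (rule H1I[OF L G])
 moreover have "vanishes_bottom_top a b h eps u"
  by (rule weak_dy_imp_vanishes_bottom_top[OF L L2_snd[OF GL]]) (use d in \<open>simp add: dirichlet_identities_iff[OF L GL]\<close>)
 moreover have "vanishes_sides a b h eps u" if "bc = Dir"
  by (rule weak_dx_imp_vanishes_sides[OF L L2_fst[OF GL]]) (use d that in \<open>simp add: dirichlet_identities_iff[OF L GL]\<close>)
 ultimately show ?thesis by (cases bc) auto
qed

lemma test_tensor_L2:
 assumes "c1c UNIV \<eta> \<eta>'" "c1c UNIV \<theta> \<theta>'"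
 shows "(tens \<eta> \<theta>) \<in> L2S" "(tens \<eta>' \<theta>) \<in> L2S"
  "(tens \<eta> \<theta>') \<in> L2S"
proof -
 have *: "(tens p q) \<in> L2S"
  if "continuous_on UNIV p" "continuous_on UNIV q" "\<And>x. \<bar>p x\<bar> \<le> K" "\<And>x. \<bar>q x\<bar> \<le> L" for p q :: line_fun and K L
 proof (rule bounded_cont_L2)
  show "continuous_on UNIV (%z :: real \<times> real. p (fst z) * q (snd z))"
   by (intro continuous_on_mult continuous_on_compose2[OF that(1)] continuous_on_compose2[OF that(2)] continuous_intros) auto
  show "\<bar>p (fst z) * q (snd z)\<bar> \<le> K * L" for z :: "real \<times> real"
   unfolding abs_mult by (intro mult_mono that abs_ge_zero order_trans[OF abs_ge_zero that(3)])
 qed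
 obtain K where K: "\<And>x. \<bar>\<eta> x\<bar> \<le> K" "\<And>x. \<bar>\<eta>' x\<bar> \<le> K" using c1c_bounded[OF assms(1)] by metis
 obtain L where L: "\<And>x. \<bar>\<theta> x\<bar> \<le> L" "\<And>x. \<bar>\<theta>' x\<bar> \<le> L" using c1c_bounded[OF assms(2)] by metis
 note c = c1cD(2,3)[OF assms(1)] c1cD(2,3)[OF assms(2)]
 show "(tens \<eta> \<theta>) \<in> L2S" "(tens \<eta>' \<theta>) \<in> L2S"
  "(tens \<eta> \<theta>') \<in> L2S"
  by (rule *[OF c(1) c(3) K(1) L(1)] *[OF c(2) c(3) K(2) L(1)] *[OF c(1) c(4) K(1) L(2)])+
qed

lemma dirichlet_identities_lincomb:
 assumes L: "u \<in> L2S" "v \<in> L2S" "G \<in> L2S" "H \<in> L2S"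
  and d: "dirichlet_identities bc u G" "dirichlet_identities bc v H"
 shows "dirichlet_identities bc (%z. u z + t * v z) (%z. G z + t *\<^sub>R H z)"
 unfolding dirichlet_identities_def
proof (intro allI impI)
 fix \<eta> \<eta>' \<theta> \<theta>' assume c: "c1c UNIV \<eta> \<eta>'" "c1c UNIV \<theta> \<theta>'"
 note T = test_tensor_L2[OF c]
 have lin: "innerS (%z. p z + t * q z) T = innerS p T + t * innerS q T"
  if "p \<in> L2S" "q \<in> L2S" "T \<in> L2S" for p q T :: plane_fun
  using l2_inner_add_left[OF that(1) L2_scale_real[OF that(2), of t] that(3)]
   l2_inner_scale_real_right[of "leb S" T t q] by (simp add: l2_inner_commute)
 show "innerS (%z. u z + t * v z) (tens \<eta> \<theta>')
   = - innerS (%z. snd (G z + t *\<^sub>R H z)) (tens \<eta> \<theta>) \<and>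
   (bc = Dir --> innerS (%z. u z + t * v z) (tens \<eta>' \<theta>)
   = - innerS (%z. fst (G z + t *\<^sub>R H z)) (tens \<eta> \<theta>))"
  using d c unfolding dirichlet_identities_def
  by (simp add: lin[OF L(1,2) T(3)] lin[OF L(1,2) T(2)] lin[OF L2_snd[OF L(3)] L2_snd[OF L(4)] T(1)]
    lin[OF L2_fst[OF L(3)] L2_fst[OF L(4)] T(1)])
qed

lemma strip_domain_lincomb:
 assumes "u \<in> strip_domain bc a b h eps" "v \<in> strip_domain bc a b h eps"
 shows "(%z. u z + t * v z) \<in> strip_domain bc a b h eps"
proof -
 note u = strip_domainD[OF assms(1)] and v = strip_domainD[OF assms(2)]
 note gu = H1_weak_grad[OF u(1)] and gv = H1_weak_grad[OF v(1)]
 show ?thesis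
  by (rule strip_domainI[OF L2_add[OF u(2) L2_scale_real[OF v(2)]] is_weak_grad_lincomb[OF S_borel u(2) v(2) gu gv]
     dirichlet_identities_lincomb[OF u(2) v(2) is_weak_gradD(1)[OF gu] is_weak_gradD(1)[OF gv] u(3)[OF gu] v(3)[OF gv]]])
qed

text \<open>Every condition that defines the domain has been expressed by integral identities that are continuous in
 the function and its gradient.\<close>

lemma strip_domain_limit:
 fixes u :: "nat => real \<times> real => real"
 assumes u: "\<And>n. u n \<in> strip_domain bc a b h eps" and G: "\<And>n. is_weak_grad S (u n) (G n)"
  and v: "v \<in> L2S" and H: "H \<in> L2S"
  and lim: "(%n. normS (%z. u n z - v z)) \<longlonglongrightarrow> 0" "(%n. normS (%z. G n z - H z)) \<longlonglongrightarrow> 0"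
 shows "v \<in> strip_domain bc a b h eps" "is_weak_grad S v H"
proof -
 have uL: "u n \<in> L2S" for n by (rule strip_domainD(2)[OF u])
 note GL = is_weak_gradD(1)[OF G]
 show W: "is_weak_grad S v H" by (rule is_weak_grad_limit[OF S_borel uL v G H lim])
 have B: "(1, 0) \<in> (Basis :: (real \<times> real) set)" "(0, 1) \<in> (Basis :: (real \<times> real) set)" by (auto simp: Basis_prod_def)
 have l1: "(%n. normS (%z. fst (G n z) - fst (H z))) \<longlonglongrightarrow> 0"
  using l2_norm_component_tendsto[OF GL H B(1) lim(2)] by (simp add: inner_prod_def)
 have l2: "(%n. normS (%z. snd (G n z) - snd (H z))) \<longlonglongrightarrow> 0"
  using l2_norm_component_tendsto[OF GL H B(2) lim(2)] by (simp add: inner_prod_def)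
 have "dirichlet_identities bc v H" unfolding dirichlet_identities_def
 proof (intro allI impI)
  fix \<eta> \<eta>' \<theta> \<theta>' assume c: "c1c UNIV \<eta> \<eta>'" "c1c UNIV \<theta> \<theta>'"
  note T = test_tensor_L2[OF c]
  note d = strip_domainD(3)[OF u G, unfolded dirichlet_identities_def, rule_format, OF c]
  note L1 = l2_inner_tendsto[OF uL v T(3) lim(1)] and L2 = l2_inner_tendsto[OF uL v T(2) lim(1)]
  note L3 = tendsto_minus[OF l2_inner_tendsto[OF L2_snd[OF GL] L2_snd[OF H] T(1) l2]]
   and L4 = tendsto_minus[OF l2_inner_tendsto[OF L2_fst[OF GL] L2_fst[OF H] T(1) l1]]
  show "innerS v (tens \<eta> \<theta>') = - innerS (gy H) (tens \<eta> \<theta>) \<and>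
   (bc = Dir --> innerS v (tens \<eta>' \<theta>) = - innerS (gx H) (tens \<eta> \<theta>))"
  proof (intro conjI impI)
   show "innerS v (tens \<eta> \<theta>') = - innerS (gy H) (tens \<eta> \<theta>)"
    by (rule LIMSEQ_unique[OF L1]) (use L3 d in simp)
   show "innerS v (tens \<eta>' \<theta>) = - innerS (gx H) (tens \<eta> \<theta>)"
    if "bc = Dir" by (rule LIMSEQ_unique[OF L2]) (use L4 d that in simp)
  qed
 qed
 then show "v \<in> strip_domain bc a b h eps" by (rule strip_domainI[OF v W])
qed

text \<open>Fubini turns the weak differentiability of the zero extension along the strip into absolute continuity on
 horizontal lines; a line of fixed height may meet the strip in several intervals, and the extension covers
 them all.\<close>

lemma domain_sections:
 assumes u: "u \<in> strip_domain bc a b h eps" and G: "is_weak_grad S u G"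
 shows "AE y in lborel. \<exists>v. ac_on (-a) b v (%t. hat (gx G) (t, y)) \<and>
  (AE x in lborel. x \<in> {-a<..<b} --> hat u (x, y) = v x) \<and> (bc = Dir --> v (-a) = 0 \<and> v b = 0)"
proof -
 note L = strip_domainD(2)[OF u] and GL = is_weak_gradD(1)[OF G]
 note w = strip_domainD(3)[OF u G, unfolded dirichlet_identities_iff[OF L GL]]
 show ?thesis
 proof (cases bc)
  case DirNeu
  show ?thesis using horizontal_sections[OF L G conjunct1[OF w]] by (rule eventually_mono) (auto simp: DirNeu)
 next
  case Dir
  have "weak_dy (swap (hat u)) (swap (hat (gx G)))" using w Dir by simp
  from weak_dx_sections[OF L L2_fst[OF GL] this] show ?thesis
  proof (rule eventually_mono)
   fix y assume *: "integrable lborel (%t. hat (gx G) (t, y)) \<and> prim (%t. hat (gx G) (t, y)) (-a) = 0 \<and>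
    prim (%t. hat (gx G) (t, y)) b = 0 \<and> (AE x in lborel. hat u (x, y) = prim (%t. hat (gx G) (t, y)) x)"
   then have "ac_on (-a) b (prim (%t. hat (gx G) (t, y))) (%t. hat (gx G) (t, y))"
    by (intro ac_on_prim) simp
   moreover from * have "AE x in lborel. hat u (x, y) = prim (%t. hat (gx G) (t, y)) x" by simp
   then have "AE x in lborel. x \<in> {-a<..<b} --> hat u (x, y) = prim (%t. hat (gx G) (t, y)) x"
    by (rule eventually_mono) simp
   ultimately show "\<exists>v. ac_on (-a) b v (%t. hat (gx G) (t, y)) \<and>
    (AE x in lborel. x \<in> {-a<..<b} --> hat u (x, y) = v x) \<and> (bc = Dir --> v (-a) = 0 \<and> v b = 0)"
    using * by blast
  qed
 qed
qed

end

section \<open>The second eigenvalue of the transversal problem\<close>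

lemma ac_on_add:
 assumes f: "ac_on a b f f'" and g: "ac_on a b g g'"
 shows "ac_on a b (%x. f x + g x) (%x. f' x + g' x)"
proof (rule ac_onI)
 show "set_integrable lborel {a..b} (%x. f' x + g' x)"
  by (rule set_integral_add(1)[OF ac_on_integrable[OF f] ac_on_integrable[OF g]])
 fix x assume x: "x \<in> {a..b}"
 have "set_integrable lborel {a..x} f'" "set_integrable lborel {a..x} g'"
  using ac_on_integrable[OF ac_on_subinterval[OF f, of a x]] ac_on_integrable[OF ac_on_subinterval[OF g, of a x]] x by auto
 then show "f x + g x = f a + g a + (LINT t:{a..x}|lborel. f' t + g' t)"
  using ac_on_eq[OF f x] ac_on_eq[OF g x] by (simp add: set_integral_add)
qed

lemma ac_on_cmult:
 assumes f: "ac_on a b f f'"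
 shows "ac_on a b (%x. c * f x) (%x. c * f' x)"
 using ac_on_mult[OF ac_on_const[of a b c] f] by simp

lemma ac_on_smooth:
 fixes f f' :: line_fun
 assumes d: "\<And>x. x \<in> {a..b} ==> (f has_real_derivative f' x) (at x)" and c: "continuous_on {a..b} f'"
 shows "ac_on a b f f'"
proof (rule ac_on_derivative[of "{}"])
 show "continuous_on {a..b} f" by (intro continuous_at_imp_continuous_on ballI DERIV_isCont[OF d])
 show "set_integrable lborel {a..b} f'" by (rule borel_integrable_atLeastAtMost'[OF c])
qed (use d in auto)

text \<open>The first eigenvalue. The logarithmic derivative of a positive solution of $w'' = -k^2 w$ with
 \<open>k\<close> slightly below $\pi/(B-A)$ completes the square and has no singularity on the closed interval.\<close>

lemma wirtinger:
 assumes v: "ac_on A B v v'" and AB: "A < B" and ends: "v A = 0" "v B = 0"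
  and sq: "set_integrable lborel {A..B} (%y. (v' y)^2)"
 shows "(pi / (B - A))^2 * (LINT y:{A..B}|lborel. (v y)^2) \<le> (LINT y:{A..B}|lborel. (v' y)^2)"
proof -
 let ?J = "%f. LINT y:{A..B}|lborel. f y" and ?L = "B - A"
 have vv: "set_integrable lborel {A..B} (%y. (v y)^2)" by (rule set_integrable_continuous_square[OF v])
 have main: "k^2 * ?J (%y. (v y)^2) \<le> ?J (%y. (v' y)^2)" if k: "0 < k" "k < pi / ?L" for k
 proof -
  have kL: "k * ?L < pi" using k AB by (simp add: less_divide_eq)
  define t where "t y = k * (y - A) + (pi - k * ?L) / 2" for y
  define p where "p y = k * (cos (t y) / sin (t y))" for y
  define p' where "p' y = - (k^2) - (p y)^2" for y
  have spos: "0 < sin (t y)" if "y \<in> {A..B}" for y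
  proof (rule sin_gt_zero)
   show "0 < t y" using that k kL by (auto simp: t_def intro!: add_nonneg_pos)
   have "k * (y - A) \<le> k * ?L" using that k by simp
   then show "t y < pi" using kL by (simp add: t_def field_simps)
  qed
  have td: "(t has_real_derivative k) (at y)" for y unfolding t_def by (auto intro!: derivative_eq_intros)
  have tc: "continuous_on {A..B} t" using td by (meson DERIV_isCont continuous_at_imp_continuous_on)
  have ac: "ac_on A B p p'"
  proof (rule ac_on_smooth)
   fix y assume "y \<in> {A..B}"
   then have s: "sin (t y) \<noteq> 0" using spos by force
   have "((%y. k * (cos (t y) / sin (t y))) has_real_derivative
     k * ((- sin (t y) * k * sin (t y) - cos (t y) * (cos (t y) * k)) / (sin (t y) * sin (t y)))) (at y)"
    using s by (auto intro!: derivative_eq_intros td simp: algebra_simps)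
   moreover have "k * ((- sin (t y) * k * sin (t y) - cos (t y) * (cos (t y) * k)) / (sin (t y) * sin (t y))) = p' y"
    using s by (simp add: p'_def p_def field_simps power2_eq_square)
   ultimately show "(p has_real_derivative p' y) (at y)" unfolding p_def[abs_def] by simp
  next
   show "continuous_on {A..B} p'"
    unfolding p'_def p_def using spos tc by (intro continuous_intros) force+
  qed
  note bp = ac_on_integral_by_parts[OF ac ac_on_mult[OF v v] less_imp_le[OF AB]]
  have "0 = ?J (%y. p y * (v y * v' y + v' y * v y) + p' y * (v y * v y))"
   using bp(2) ends by simp
  also have "... \<le> ?J (%y. (v' y)^2 - k^2 * (v y)^2)"
  proof (rule set_integral_mono[OF bp(1)])
   show "set_integrable lborel {A..B} (%y. (v' y)^2 - k^2 * (v y)^2)"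
    using sq vv by (intro set_integral_diff(1) set_integrable_mult_right) auto
   fix y
   have "0 \<le> (v' y - p y * v y)^2" by simp
   then show "p y * (v y * v' y + v' y * v y) + p' y * (v y * v y) \<le> (v' y)^2 - k^2 * (v y)^2"
    by (simp add: p'_def power2_eq_square algebra_simps)
  qed
  also have "... = ?J (%y. (v' y)^2) - k^2 * ?J (%y. (v y)^2)"
   using sq vv by (simp add: set_integral_diff)
  finally show ?thesis by simp
 qed
 show ?thesis
 proof (rule field_le_mult_one_interval)
  fix z :: real assume z: "0 < z" "z < 1"
  have "sqrt z * (pi / ?L) < 1 * (pi / ?L)" using z AB by (intro mult_strict_right_mono) auto
  then have *: "(sqrt z * (pi / ?L))^2 * ?J (%y. (v y)^2) \<le> ?J (%y. (v' y)^2)"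
   using z AB by (intro main) auto
  have "(sqrt z * (pi / ?L))^2 = z * (pi / ?L)^2" using z by (simp only: power_mult_distrib real_sqrt_pow2)
  then show "z * ((pi / ?L)^2 * ?J (%y. (v y)^2)) \<le> ?J (%y. (v' y)^2)" using * by (simp only: mult.assoc)
 qed
qed

text \<open>The spectral gap. Subtracting a multiple $te$ of the first eigenfunction makes \<open>v\<close> vanish also at the
 midpoint, and the first eigenvalue on each half is $4k^2$ with $k = \pi/L$. If \<open>v\<close> is orthogonal to \<open>e\<close>,
 then so are the derivatives, and $\|v'\|^2 + t^2k^2\|e\|^2 \ge 4k^2(\|v\|^2 + t^2\|e\|^2)$.\<close>

lemma wirtinger_gap:
 assumes v: "ac_on 0 L v v'" and L: "0 < L" and ends: "v 0 = 0" "v L = 0"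
  and sq: "set_integrable lborel {0..L} (%y. (v' y)^2)"
  and orth: "(LINT y:{0..L}|lborel. v y * sin (pi * y / L)) = 0"
 shows "4 * (pi / L)^2 * (LINT y:{0..L}|lborel. (v y)^2) \<le> (LINT y:{0..L}|lborel. (v' y)^2)"
proof -
 let ?J = "%f. LINT y:{0..L}|lborel. f y"
 define k t where "k = pi / L" and "t = v (L / 2)"
 have k: "k * L = pi" using L by (simp add: k_def)
 define e e' where "e y = sin (k * y)" and "e' y = k * cos (k * y)" for y
 have eac: "ac_on 0 L e e'" and e'ac: "ac_on 0 L e' (%y. - (k^2 * e y))"
  unfolding e_def e'_def by (rule ac_on_smooth; auto intro!: derivative_eq_intros continuous_intros simp: power2_eq_square)+
 note c = ac_on_imp_continuous[OF v] ac_on_imp_continuous[OF eac] ac_on_imp_continuous[OF e'ac]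
 have cint: "set_integrable lborel {0..L} f" if "continuous_on {0..L} f" for f :: line_fun
  by (rule borel_integrable_atLeastAtMost'[OF that])
 note i = cint[OF continuous_on_power[OF c(1), of 2]] cint[OF continuous_on_mult[OF c(1,2)]]
  cint[OF continuous_on_power[OF c(2), of 2]] cint[OF continuous_on_power[OF c(3), of 2]]
 have v'e': "set_integrable lborel {0..L} (%y. v' y * e' y)"
  using ac_on_abs_integrable_mult[OF e'ac ac_on_integrable[OF v]] by (simp add: mult.commute)
 define V E where "V = ?J (%y. (v y)^2)" and "E = ?J (%y. (e y)^2)"
 have ve: "?J (%y. v y * e y) = 0" using orth by (simp add: e_def k_def)
 have "?J (%y. v y * - (k^2 * e y) + v' y * e' y) = 0"
  using ac_on_integral_by_parts(2)[OF v e'ac less_imp_le[OF L]] ends by simp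
 moreover have "?J (%y. v y * - (k^2 * e y) + v' y * e' y) = ?J (%y. (- (k^2)) * (v y * e y) + v' y * e' y)"
  by (simp add: mult_ac)
 ultimately have v'e'0: "?J (%y. v' y * e' y) = 0" using i(2) v'e' ve by (simp add: set_integral_add del: mult_minus_left)
 have "?J (%y. e y * - (k^2 * e y) + e' y * e' y) = 0"
  using ac_on_integral_by_parts(2)[OF eac e'ac less_imp_le[OF L]] by (simp add: e_def k)
 moreover have "?J (%y. e y * - (k^2 * e y) + e' y * e' y) = ?J (%y. (- (k^2)) * (e y)^2 + (e' y)^2)"
  by (simp add: power2_eq_square mult_ac)
 ultimately have e'2: "?J (%y. (e' y)^2) = k^2 * E" using i(3,4) by (simp add: set_integral_add E_def del: mult_minus_left)
 define w w' where "w y = v y + (- t) * e y" and "w' y = v' y + (- t) * e' y" for y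
 have w: "ac_on 0 L w w'" unfolding w_def w'_def by (rule ac_on_add[OF v ac_on_cmult[OF eac]])
 have we: "(w y)^2 = (v y)^2 + (- 2 * t) * (v y * e y) + t^2 * (e y)^2"
  and w'e: "(w' y)^2 = (v' y)^2 + (- 2 * t) * (v' y * e' y) + t^2 * (e' y)^2" for y
  by (simp_all add: w_def w'_def power2_eq_square algebra_simps)
 have wi: "set_integrable lborel {0..L} (%y. (w y)^2)" "set_integrable lborel {0..L} (%y. (w' y)^2)"
  unfolding we w'e using sq v'e' i by (intro set_integral_add(1) set_integrable_mult_right; simp)+
 have w0: "w 0 = 0" "w (L / 2) = 0" "w L = 0"
  using L ends k by (simp_all add: w_def e_def t_def k_def)
 have split: "?J f = (LINT y:{0..L/2}|lborel. f y) + (LINT y:{L/2..L}|lborel. f y)"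
  if f: "set_integrable lborel {0..L} f" for f :: line_fun
 proof -
  have I: "integrable lborel (%y. indicator {0..L} y * f y)" using f by (simp add: set_integrable_def)
  have "ac_on 0 L (prim (%y. indicator {0..L} y * f y)) f" by (rule ac_on_cong[OF ac_on_prim[OF I]]) auto
  note inc = ac_on_increment[OF this]
  show ?thesis using inc[of 0 L] inc[of 0 "L / 2"] inc[of "L / 2" L] L by simp
 qed
 have half: "(2 * k)^2 * (LINT y:{A..B}|lborel. (w y)^2) \<le> (LINT y:{A..B}|lborel. (w' y)^2)"
  if "0 \<le> A" "B \<le> L" "B - A = L / 2" "w A = 0" "w B = 0" for A B
 proof -
  have "pi / (B - A) = 2 * k" unfolding that(3) by (simp add: k_def)
  moreover have "set_integrable lborel {A..B} (%y. (w' y)^2)"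
   by (rule set_integrable_subset[OF wi(2)]) (use that in auto)
  ultimately show ?thesis using wirtinger[of A B w w'] ac_on_subinterval[OF w, of A B] that L by simp
 qed
 have "(2 * k)^2 * ?J (%y. (w y)^2) \<le> ?J (%y. (w' y)^2)"
  unfolding split[OF wi(1)] split[OF wi(2)] distrib_left using half[of 0 "L / 2"] half[of "L / 2" L] w0 L by simp
 moreover have "?J (%y. (w y)^2) = V + t^2 * E"
  unfolding we V_def E_def using i ve by (simp add: set_integral_add set_integral_diff)
 moreover have "?J (%y. (w' y)^2) = ?J (%y. (v' y)^2) + t^2 * (k^2 * E)"
  unfolding w'e e'2[symmetric] using i sq v'e' v'e'0 by (simp add: set_integral_add set_integral_diff)
 moreover have "0 \<le> k^2 * (t^2 * E)"
  unfolding E_def set_lebesgue_integral_def by (intro mult_nonneg_nonneg integral_nonneg_AE) auto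
 ultimately show ?thesis unfolding k_def[symmetric] V_def[symmetric] by (simp add: power_mult_distrib algebra_simps)
qed

section \<open>The one-dimensional form\<close>

context narrow_strip
begin

abbreviation "I \<equiv> {-a..b}"
abbreviation "normI \<equiv> l2_norm (leb I)"
abbreviation "innerI \<equiv> l2_inner (leb I)"
abbreviation "L2I \<equiv> L2 (leb I)"
abbreviation "V \<equiv> potential h h' M eps"
abbreviation "dom1 bc \<equiv> interval_domain bc a b"
abbreviation "q \<equiv> interval_form a b h h' M eps"

lemma ab_less: "-a < b" using a_pos b_pos by simp

lemma LINT_I: "(LINT x|leb I. f x) = (LINT x:I|lborel. f x)" for f :: line_fun
 by (simp add: leb_integral(1) set_lebesgue_integral_def)

lemma integrable_I: "integrable (leb I) f \<longleftrightarrow> set_integrable lborel I f" for f :: line_fun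
 by (simp add: leb_integral(2) set_integrable_def)

lemma AE_I_iff: "(AE x in leb I. P x) \<longleftrightarrow> (AE x in lborel. x \<in> I --> P x)"
 by (rule AE_leb) simp

lemma measurable_I: "f \<in> borel_measurable borel ==> f \<in> borel_measurable (leb I)" for f :: line_fun
 by (simp add: leb_integral(3))

lemma V_measurable: "V \<in> borel_measurable borel"
proof -
 note [measurable] = h_measurable h'_meas
 show ?thesis unfolding potential_def[abs_def] by measurable
qed

lemma V_lower: "x \<in> I ==> pi^2 / eps^2 * (c0 * \<bar>x\<bar> powr m) \<le> V x"
proof -
 assume "x \<in> I"
 then have "pi^2 / eps^2 * (c0 * \<bar>x\<bar> powr m) \<le> pi^2 / eps^2 * (1 / (h x)^2 - 1 / M^2)"
  by (intro mult_left_mono growth) auto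
 moreover have "0 \<le> (pi^2 / 3 + 1 / 4) * ((h' x)^2 / (h x)^2)" by simp
 ultimately show ?thesis unfolding potential_def by linarith
qed

lemma V_nonneg: "x \<in> I ==> 0 \<le> V x"
proof -
 assume x: "x \<in> I"
 have "0 \<le> pi^2 / eps^2 * (c0 * \<bar>x\<bar> powr m)" using c0_pos by simp
 with V_lower[OF x] show ?thesis by linarith
qed

text \<open>The first term of the potential is bounded; the integrability of the second is square integrability of $h'$, with \<open>h\<close> bounded
 below.\<close>

lemma V_integrable: "integrable (leb I) V"
proof (rule integrable_dominated)
 have "set_integrable lborel I (%x. 1 :: real)" by (intro borel_integrable_atLeastAtMost' continuous_intros)
 then show "integrable (leb I) (%x. pi^2 / eps^2 * (1 / l^2) * 1 + (pi^2 / 3 + 1 / 4) / l^2 * (h' x)^2)"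
  using h'_sq unfolding integrable_I by (intro set_integral_add(1) set_integrable_mult_right)
 have "V x \<le> pi^2 / eps^2 * (1 / l^2) * 1 + (pi^2 / 3 + 1 / 4) / l^2 * (h' x)^2" for x
 proof -
  have l2: "l^2 \<le> (h x)^2" using h_ge[of x] l_pos by (intro power_mono) auto
  have pos: "0 < (h x)^2 * l^2" using h_pos[of x] l_pos by simp
  have "0 \<le> 1 / M^2" by simp
  moreover have "1 / (h x)^2 \<le> 1 / l^2" using l2 pos by (intro divide_left_mono) auto
  ultimately have "1 / (h x)^2 - 1 / M^2 \<le> 1 / l^2" by linarith
  then have "pi^2 / eps^2 * (1 / (h x)^2 - 1 / M^2) \<le> pi^2 / eps^2 * (1 / l^2)"
   by (intro mult_left_mono) auto
  moreover have "(h' x)^2 / (h x)^2 \<le> (h' x)^2 / l^2" using l2 pos by (intro divide_left_mono) auto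
  then have "(pi^2 / 3 + 1 / 4) * ((h' x)^2 / (h x)^2) \<le> (pi^2 / 3 + 1 / 4) * ((h' x)^2 / l^2)"
   by (intro mult_left_mono) auto
  ultimately show ?thesis by (simp add: potential_def)
 qed
 then show "AE x in leb I. norm (V x) \<le> norm (pi^2 / eps^2 * (1 / l^2) * 1 + (pi^2 / 3 + 1 / 4) / l^2 * (h' x)^2)"
  unfolding AE_I_iff using V_nonneg by (intro AE_I2 impI) (simp add: abs_of_nonneg order_trans[OF _ abs_ge_self])
qed (rule measurable_I[OF V_measurable])

definition vint :: "real" where "vint = (LINT x|leb I. V x)"

text \<open>Elements of the form domain are classes of functions. Integration by parts and pointwise bounds need the
 absolutely continuous representative \<open>v\<close> and its derivative \<open>g\<close>, which also carry the boundary values.\<close>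

definition rep1 :: "bdry_cond => (real => real) => (real => real) => (real => real) => bool" where
 "rep1 bc \<xi> v g \<longleftrightarrow> ac_on (-a) b v g \<and> g \<in> L2I \<and> \<xi> \<in> borel_measurable (leb I) \<and>
   (AE x in leb I. \<xi> x = v x) \<and> (bc = Dir --> v (-a) = 0 \<and> v b = 0)"

lemma rep1_exists:
 assumes d: "\<xi> \<in> dom1 bc" and G: "is_weak_grad I \<xi> G"
 shows "\<exists>v. rep1 bc \<xi> v G"
proof -
 have H: "\<xi> \<in> H1 I" using d by (cases bc) auto
 obtain v where v: "ac_on (-a) b v G" "AE x in leb I. \<xi> x = v x"
  by (rule weak_grad_interval_imp_ac[OF ab_less H1_L2[OF H] G])
 have "v (-a) = 0 \<and> v b = 0" if bc: "bc = Dir"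
 proof -
  obtain c where c: "AE x in leb I. c x = \<xi> x" "continuous_on I c" "c (-a) = 0" "c b = 0"
   using d bc by auto
  have "AE x in lborel. x \<in> {-a<..<b} --> c x = v x"
   using c(1) v(2) unfolding AE_I_iff by eventually_elim auto
  then show ?thesis
   using AE_limits_agree_right[OF _ ab_less continuous_on_Icc_at_rightD[OF c(2) ab_less] ac_on_tendsto_ends(1)[OF v(1) ab_less]]
    AE_limits_agree_left[OF _ ab_less continuous_on_Icc_at_leftD[OF c(2) ab_less] ac_on_tendsto_ends(2)[OF v(1) ab_less]]
    c(3,4) by simp
 qed
 then show ?thesis using v L2_D(1)[OF H1_L2[OF H]] is_weak_gradD(1)[OF G] unfolding rep1_def by blast
qed

lemma is_weak_grad_cong_AE:
 assumes "is_weak_grad I v G" "\<xi> \<in> borel_measurable (leb I)" "v \<in> borel_measurable (leb I)" "AE x in leb I. \<xi> x = v x"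
 shows "is_weak_grad I \<xi> G"
 unfolding is_weak_grad_interval_iff
proof (intro conjI allI impI)
 show "G \<in> L2I" by (rule is_weak_gradD(1)[OF assms(1)])
 fix \<eta> \<eta>' assume \<eta>: "c1c {-a<..<b} \<eta> \<eta>'"
 have "(LINT x|leb I. \<xi> x * \<eta>' x) = (LINT x|leb I. v x * \<eta>' x)"
 proof (rule integral_cong_AE)
  show "AE x in leb I. \<xi> x * \<eta>' x = v x * \<eta>' x" using assms(4) by (rule eventually_mono) simp
 qed (use assms(2,3) measurable_I[OF c1cD(5)[OF \<eta>]] in auto)
 also have "... = - (LINT x|leb I. G x * \<eta> x)" using assms(1) \<eta> by (simp add: is_weak_grad_interval_iff)
 finally show "(LINT x|leb I. \<xi> x * \<eta>' x) = - (LINT x|leb I. G x * \<eta> x)" .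
qed

lemma rep1D:
 assumes r: "rep1 bc \<xi> v g"
 shows "ac_on (-a) b v g" "g \<in> L2I" "\<xi> \<in> borel_measurable (leb I)" "AE x in leb I. \<xi> x = v x"
  "bc = Dir ==> v (-a) = 0" "bc = Dir ==> v b = 0"
  "v \<in> L2I" "\<xi> \<in> L2I" "is_weak_grad I \<xi> g" "\<xi> \<in> dom1 bc"
proof -
 show r': "ac_on (-a) b v g" "g \<in> L2I" "\<xi> \<in> borel_measurable (leb I)" "AE x in leb I. \<xi> x = v x"
  and e: "bc = Dir ==> v (-a) = 0" "bc = Dir ==> v b = 0" using r unfolding rep1_def by blast+
 show vL: "v \<in> L2I" by (rule ac_on_imp_weak_grad(1)[OF ab_less r'(1,2)])
 show L: "\<xi> \<in> L2I" by (rule L2_cong_AE[OF vL r'(3,4)])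
 show G: "is_weak_grad I \<xi> g"
  by (rule is_weak_grad_cong_AE[OF ac_on_imp_weak_grad(2)[OF ab_less r'(1,2)] r'(3) L2_D(1)[OF vL] r'(4)])
 have H: "\<xi> \<in> H1 I" by (rule H1I[OF L G])
 have ae: "AE x in leb I. v x = \<xi> x" using r'(4) by (rule eventually_mono) simp
 show "\<xi> \<in> dom1 bc"
  using H e ae ac_on_imp_continuous[OF r'(1)] by (cases bc) auto
qed

lemma rep1_lincomb:
 assumes "rep1 bc \<xi> v g" "rep1 bc \<zeta> w k"
 shows "rep1 bc (%x. \<xi> x + t * \<zeta> x) (%x. v x + t * w x) (%x. g x + t * k x)"
proof -
 note A = rep1D[OF assms(1)] and B = rep1D[OF assms(2)]
 have "AE x in leb I. \<xi> x + t * \<zeta> x = v x + t * w x" using A(4) B(4) by eventually_elim simp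
 then show ?thesis unfolding rep1_def
  using ac_on_add[OF A(1) ac_on_cmult[OF B(1), of t]] L2_add[OF A(2) L2_scale_real[OF B(2), of t]]
   A(3) B(3) A(5,6) B(5,6) by auto
qed

lemma rep1_sup:
 assumes r: "rep1 bc \<xi> v g" and x: "x \<in> I"
 shows "(v x)^2 \<le> (normI \<xi>)^2 / (a + b) + 2 * (normI \<xi> * normI g)"
proof -
 note A = rep1D[OF r]
 have n: "normI \<xi> = normI v"
  by (rule l2_norm_cong_AE[OF A(4,3) L2_D(1)[OF A(7)]])
 have "(v x)^2 \<le> (LINT t:I|lborel. (v t)^2) / (b - (-a)) + 2 * (LINT t:I|lborel. \<bar>v t * g t\<bar>)"
  by (rule ac_on_sup_bound[OF A(1) ab_less x])
 also have "(LINT t:I|lborel. (v t)^2) = (normI v)^2"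
  by (simp add: l2_norm_power2 l2_inner_self LINT_I)
 also have "(LINT t:I|lborel. \<bar>v t * g t\<bar>) \<le> normI v * normI g"
  using integral_mult_le_l2[OF A(7,2)] by (simp add: LINT_I l2_norm_def l2_inner_self)
 finally show ?thesis unfolding n by (simp add: add.commute)
qed

lemma V_mult_integrable:
 assumes "rep1 bc \<xi> v g" "rep1 bc' \<zeta> w k"
 shows "integrable (leb I) (%x. V x * (\<xi> x * \<zeta> x))"
  and "(LINT x|leb I. V x * (\<xi> x * \<zeta> x)) = (LINT x|leb I. V x * (v x * w x))"
proof -
 note A = rep1D[OF assms(1)] and B = rep1D[OF assms(2)]
 have c: "continuous_on I (%x. v x * w x)"
  by (intro continuous_on_mult ac_on_imp_continuous[OF A(1)] ac_on_imp_continuous[OF B(1)])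
 have "bounded ((%x. v x * w x) ` I)" by (intro compact_imp_bounded compact_continuous_image c) auto
 then obtain K where K: "\<And>x. x \<in> I ==> \<bar>v x * w x\<bar> \<le> K" unfolding bounded_iff by fastforce
 have m: "(%x. V x * (v x * w x)) \<in> borel_measurable (leb I)"
  using measurable_I[OF V_measurable] L2_D(1)[OF A(7)] L2_D(1)[OF B(7)] by simp
 have i: "integrable (leb I) (%x. V x * (v x * w x))"
 proof (rule integrable_dominated[OF _ m])
  show "integrable (leb I) (%x. K * V x)" using V_integrable by simp
  have "\<bar>V x\<bar> * \<bar>v x * w x\<bar> \<le> \<bar>K\<bar> * \<bar>V x\<bar>" if "x \<in> I" for x
   using mult_left_mono[OF order_trans[OF K[OF that] abs_ge_self], of "\<bar>V x\<bar>"] by (simp add: mult.commute)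
  then show "AE x in leb I. norm (V x * (v x * w x)) \<le> norm (K * V x)"
   unfolding AE_I_iff by (auto simp: abs_mult)
 qed
 have m': "(%x. V x * (\<xi> x * \<zeta> x)) \<in> borel_measurable (leb I)"
  using measurable_I[OF V_measurable] A(3) B(3) by simp
 have ae: "AE x in leb I. V x * (\<xi> x * \<zeta> x) = V x * (v x * w x)" using A(4) B(4) by eventually_elim simp
 show "integrable (leb I) (%x. V x * (\<xi> x * \<zeta> x))" using integrable_cong_AE[OF m' m ae] i by simp
 show "(LINT x|leb I. V x * (\<xi> x * \<zeta> x)) = (LINT x|leb I. V x * (v x * w x))"
  by (rule integral_cong_AE[OF m' m ae])
qed

lemma interval_form_eq:
 assumes "rep1 bc \<xi> v g" "rep1 bc' \<zeta> w k"
 shows "q \<xi> \<zeta> = innerI g k + (LINT x|leb I. V x * (\<xi> x * \<zeta> x))"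
proof -
 note A = rep1D[OF assms(1)] and B = rep1D[OF assms(2)]
 note i = V_mult_integrable(1)[OF assms]
 have H: "\<xi> \<in> H1 I" "\<zeta> \<in> H1 I" by (rule H1I[OF A(8,9)], rule H1I[OF B(8,9)])
 note W = H1_weak_grad[OF H(1)] H1_weak_grad[OF H(2)]
 have "q \<xi> \<zeta> = (LINT x|leb I. g x * k x + V x * (\<xi> x * \<zeta> x))"
  unfolding interval_form_def
 proof (rule integral_cong_AE)
  show "AE x in leb I. weak_grad I \<xi> x * weak_grad I \<zeta> x + V x * (\<xi> x * \<zeta> x) = g x * k x + V x * (\<xi> x * \<zeta> x)"
   using weak_grad_unique_interval[OF W(1) A(9)] weak_grad_unique_interval[OF W(2) B(9)] by eventually_elim simp
 qed (use borel_measurable_integrable[OF i] L2_D(1)[OF A(2)] L2_D(1)[OF B(2)]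
    L2_D(1)[OF is_weak_gradD(1)[OF W(1)]] L2_D(1)[OF is_weak_gradD(1)[OF W(2)]] in simp_all)
 also have "... = (LINT x|leb I. g x * k x) + (LINT x|leb I. V x * (\<xi> x * \<zeta> x))"
  using integrable_mult_L2[OF A(2) B(2)] i by simp
 finally show ?thesis by (simp add: l2_inner_def)
qed

lemma interval_form_ge:
 assumes r: "rep1 bc \<xi> v g"
 shows "(normI g)^2 \<le> q \<xi> \<xi>" "(LINT x|leb I. V x * (v x * v x)) \<le> q \<xi> \<xi>"
  "q \<xi> \<xi> = (normI g)^2 + (LINT x|leb I. V x * (v x * v x))"
proof -
 show e: "q \<xi> \<xi> = (normI g)^2 + (LINT x|leb I. V x * (v x * v x))"
  using interval_form_eq[OF r r] V_mult_integrable(2)[OF r r] by (simp add: l2_norm_power2)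
 have "0 \<le> (LINT x|leb I. V x * (v x * v x))"
  by (rule integral_nonneg_AE) (use V_nonneg in \<open>simp add: AE_I_iff\<close>)
 then show "(normI g)^2 \<le> q \<xi> \<xi>" "(LINT x|leb I. V x * (v x * v x)) \<le> q \<xi> \<xi>" using e by simp_all
qed

text \<open>The scaled lower bound of the one-dimensional operator. A function \<open>p\<close> with
 $-p' - p^2 \ge c\rho^{-2}$ on $(-\rho,\rho)$ and $-p'-p^2 = O(\rho^{-2})$ everywhere completes the square in
 $\int (v' - pv)^2 \ge 0$; outside $(-\rho,\rho)$ the potential, of size $\rho^m/\varepsilon^2 = \rho^{-2}$, absorbs the error.
 Since \<open>p\<close> is a nonpositive tent that ends before \<open>b\<close>, the boundary terms have the right sign whether or not it
 reaches beyond \<open>-a\<close>.\<close>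

lemma interval_form_scaled_lower_bound:
 assumes r: "rep1 bc \<xi> v g" and \<rho>: "0 < \<rho>" "3 * \<rho> \<le> b" "\<rho>^2 * \<rho> powr m = eps^2"
 shows "(normI \<xi>)^2 \<le> (16 + 4 / (pi^2 * c0)) * \<rho>^2 * q \<xi> \<xi>"
proof -
 note A = rep1D[OF r]
 let ?J = "%f. LINT x:I|lborel. f x"
 define c where "c = pi^2 * c0"
 have c: "0 < c" using c0_pos by (simp add: c_def)
 \<comment> \<open>$\kappa\le1/8$ keeps $p^2\le4\kappa^2/\rho^2$ below half of $-p'=\kappa/\rho^2$; $\kappa\le c/2$ lets the potential absorb the rising part\<close>
 define \<kappa> where "\<kappa> = 1 / (8 + 2 / c)"
 have \<kappa>: "0 < \<kappa>" "\<kappa> \<le> 1 / 8" "\<kappa> \<le> c / 2" using c by (auto simp: \<kappa>_def field_simps add_pos_pos)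
 define p where "p x = - (\<kappa> / \<rho>^2 * max 0 (min (x + \<rho>) (3 * \<rho> - x)))" for x
 define p' where "p' x = (if x \<in> {-\<rho><..<\<rho>} then - (\<kappa> / \<rho>^2) else if x \<in> {\<rho><..<3 * \<rho>} then \<kappa> / \<rho>^2 else 0)" for x
 have pac: "ac_on (-a) b p p'"
 proof (rule ac_on_derivative[of "{-\<rho>, \<rho>, 3 * \<rho>}"])
  show "continuous_on I p" unfolding p_def by (intro continuous_intros)
  have "p' = (%x. - (\<kappa> / \<rho>^2) * indicator {-\<rho><..<\<rho>} x + \<kappa> / \<rho>^2 * indicator {\<rho><..<3 * \<rho>} x)"
   using \<rho>(1) by (auto simp: p'_def fun_eq_iff)
  then have "integrable lborel p'" using integrable_indicator_interval by simp
  then show "set_integrable lborel I p'" using integrable_indicator_mult[of p' I] by (simp add: set_integrable_def)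
  fix x assume x: "x \<in> {-a<..<b} - {-\<rho>, \<rho>, 3 * \<rho>}"
  have lin: "(p has_real_derivative D) (at x)"
   if "\<And>y. y \<in> X ==> p y = B + D * y" "x \<in> X" "open X" for D B X
  proof (rule has_field_derivative_transform_within_open[OF _ that(3,2)])
   show "((%y. B + D * y) has_real_derivative D) (at x)" by (auto intro!: derivative_eq_intros)
  qed (use that(1) in simp)
  consider "x \<in> {..<-\<rho>}" | "x \<in> {-\<rho><..<\<rho>}" | "x \<in> {\<rho><..<3 * \<rho>}" | "x \<in> {3 * \<rho><..}" using x by fastforce
  then show "(p has_real_derivative p' x) (at x)"
  proof cases
   case 1 then show ?thesis using lin[of "{..<-\<rho>}" 0 0] \<rho>(1) by (auto simp: p_def p'_def)
  next
   case 2
   then have "(p has_real_derivative - (\<kappa> / \<rho>^2)) (at x)"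
    by (intro lin[of "{-\<rho><..<\<rho>}" "- (\<kappa> / \<rho>^2 * \<rho>)"]) (auto simp: p_def distrib_left)
   with 2 show ?thesis by (simp add: p'_def)
  next
   case 3
   then have "(p has_real_derivative \<kappa> / \<rho>^2) (at x)"
    by (intro lin[of "{\<rho><..<3 * \<rho>}" "- (\<kappa> / \<rho>^2 * (3 * \<rho>))"]) (auto simp: p_def right_diff_distrib)
   with 3 show ?thesis by (simp add: p'_def)
  next
   case 4 then show ?thesis using lin[of "{3 * \<rho><..}" 0 0] \<rho>(1) by (auto simp: p_def p'_def)
  qed
 qed simp
 have p0: "p x \<le> 0" "p b = 0" and p2: "(p x)^2 \<le> 4 * \<kappa>^2 / \<rho>^2" for x
 proof -
  have m: "0 \<le> max 0 (min (x + \<rho>) (3 * \<rho> - x))" "max 0 (min (x + \<rho>) (3 * \<rho> - x)) \<le> 2 * \<rho>" using \<rho>(1) by auto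
  show "p x \<le> 0" using m(1) \<kappa> by (simp add: p_def)
  show "p b = 0" using \<rho>(2) by (simp add: p_def)
  have "(p x)^2 = (\<kappa> / \<rho>^2)^2 * (max 0 (min (x + \<rho>) (3 * \<rho> - x)))^2" unfolding p_def power2_minus power_mult_distrib ..
  also have "... \<le> (\<kappa> / \<rho>^2)^2 * (2 * \<rho>)^2" using m by (intro mult_left_mono power_mono) auto
  also have "... = 4 * \<kappa>^2 / \<rho>^2" using \<rho>(1) by (simp add: power2_eq_square field_simps)
  finally show "(p x)^2 \<le> 4 * \<kappa>^2 / \<rho>^2" .
 qed
 have key: "\<kappa> / (2 * \<rho>^2) \<le> V x - p' x - (p x)^2" if x: "x \<in> I" for x
 proof (cases "x \<in> {-\<rho><..<\<rho>}")
  case True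
  have "4 * \<kappa>^2 \<le> \<kappa> / 2" using mult_left_mono[OF \<kappa>(2), of \<kappa>] \<kappa>(1) by (simp add: power2_eq_square)
  then have "4 * \<kappa>^2 / \<rho>^2 \<le> \<kappa> / 2 / \<rho>^2" by (rule divide_right_mono) simp
  moreover have "\<kappa> / \<rho>^2 - \<kappa> / 2 / \<rho>^2 = \<kappa> / (2 * \<rho>^2)" using \<rho>(1) by (simp add: field_simps)
  ultimately show ?thesis using True p2[of x] V_nonneg[OF x] by (simp add: p'_def)
 next
  case False
  have "\<rho> powr m \<le> \<bar>x\<bar> powr m" using False \<rho>(1) m_ge_1 by (intro powr_mono2) auto
  then have "c / eps^2 * \<rho> powr m \<le> c / eps^2 * \<bar>x\<bar> powr m" using c by (intro mult_left_mono) auto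
  also have "... \<le> V x" using V_lower[OF x] by (simp add: c_def mult_ac)
  finally have "c / eps^2 * \<rho> powr m \<le> V x" .
  moreover have "c / eps^2 * \<rho> powr m = c / \<rho>^2" using \<rho>(1) eps_pos \<rho>(3)[symmetric] by (simp add: field_simps)
  ultimately have Vx: "c / \<rho>^2 \<le> V x" by simp
  have "4 * \<kappa>^2 \<le> \<kappa> / 2" using mult_left_mono[OF \<kappa>(2), of \<kappa>] \<kappa>(1) by (simp add: power2_eq_square)
  then have "\<kappa> / 2 + \<kappa> + 4 * \<kappa>^2 \<le> c" using \<kappa>(3) by linarith
  then have "(\<kappa> / 2 + \<kappa> + 4 * \<kappa>^2) / \<rho>^2 \<le> c / \<rho>^2" by (rule divide_right_mono) simp
  moreover have "(\<kappa> / 2 + \<kappa> + 4 * \<kappa>^2) / \<rho>^2 = \<kappa> / (2 * \<rho>^2) + \<kappa> / \<rho>^2 + 4 * \<kappa>^2 / \<rho>^2" by (simp add: add_divide_distrib)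
  moreover have "p' x \<le> \<kappa> / \<rho>^2" using False \<kappa>(1) by (simp add: p'_def)
  ultimately show ?thesis using Vx p2[of x] by linarith
 qed
 have vv: "ac_on (-a) b (%x. v x * v x) (%x. v x * g x + g x * v x)" by (rule ac_on_mult[OF A(1) A(1)])
 note bp = ac_on_integral_by_parts[OF pac vv less_imp_le[OF ab_less]]
 have gi: "set_integrable lborel I (%x. (g x)^2)" using L2_D(2)[OF A(2)] by (simp add: integrable_I)
 have vi: "set_integrable lborel I (%x. (v x)^2)" by (rule set_integrable_continuous_square[OF A(1)])
 have r': "rep1 bc v v g" using r L2_D(1)[OF A(7)] by (simp add: rep1_def)
 have Vi: "set_integrable lborel I (%x. V x * (v x * v x))" using V_mult_integrable(1)[OF r' r'] by (simp add: integrable_I)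
 have "\<kappa> / (2 * \<rho>^2) * ?J (%x. (v x)^2) = ?J (%x. \<kappa> / (2 * \<rho>^2) * (v x)^2)" by simp
 also have "... \<le> ?J (%x. ((g x)^2 + V x * (v x * v x)) - (p x * (v x * g x + g x * v x) + p' x * (v x * v x)))"
 proof (rule set_integral_mono)
  show "set_integrable lborel I (%x. \<kappa> / (2 * \<rho>^2) * (v x)^2)" using vi by simp
  show "set_integrable lborel I (%x. ((g x)^2 + V x * (v x * v x)) - (p x * (v x * g x + g x * v x) + p' x * (v x * v x)))"
   by (intro set_integral_diff(1) set_integral_add(1) gi Vi bp(1))
  fix x assume "x \<in> I"
  have "\<kappa> / (2 * \<rho>^2) * (v x)^2 \<le> (V x - p' x - (p x)^2) * (v x)^2" by (rule mult_right_mono[OF key[OF \<open>x \<in> I\<close>]]) simp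
  moreover have "0 \<le> (g x - p x * v x)^2" by simp
  ultimately show "\<kappa> / (2 * \<rho>^2) * (v x)^2 \<le> ((g x)^2 + V x * (v x * v x)) - (p x * (v x * g x + g x * v x) + p' x * (v x * v x))"
   by (simp add: power2_eq_square algebra_simps)
 qed
 also have "... = q \<xi> \<xi> + p (-a) * (v (-a) * v (-a))"
  using bp(2) gi Vi bp(1) p0(2) interval_form_ge(3)[OF r]
  by (simp add: set_integral_diff set_integral_add l2_norm_power2 l2_inner_self LINT_I)
 also have "... \<le> q \<xi> \<xi>" using p0(1)[of "-a"] by (simp add: mult_nonpos_nonneg)
 finally have "\<kappa> / (2 * \<rho>^2) * (normI v)^2 \<le> q \<xi> \<xi>" by (simp add: l2_norm_power2 l2_inner_self LINT_I)
 then have "2 * \<rho>^2 / \<kappa> * (\<kappa> / (2 * \<rho>^2) * (normI v)^2) \<le> 2 * \<rho>^2 / \<kappa> * q \<xi> \<xi>"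
  using \<kappa>(1) by (intro mult_left_mono) auto
 moreover have "2 * \<rho>^2 / \<kappa> = (16 + 4 / (pi^2 * c0)) * \<rho>^2" by (simp add: \<kappa>_def c_def algebra_simps)
 moreover have "2 * \<rho>^2 / \<kappa> * (\<kappa> / (2 * \<rho>^2)) = 1" using \<kappa>(1) \<rho>(1) by simp
 ultimately show ?thesis
  using l2_norm_cong_AE[OF A(4,3) L2_D(1)[OF A(7)]] by (simp only: mult.assoc[symmetric] mult_1)
qed

text \<open>Convergence in $L^2$ together with the derivatives implies convergence in the form norm,
 uniformly on the interval and hence of the boundary values.\<close>

lemma interval_form_le:
 assumes r: "rep1 bc \<xi> v g"
 shows "q \<xi> \<xi> \<le> (normI g)^2 + vint * ((normI \<xi>)^2 / (a + b) + 2 * (normI \<xi> * normI g))"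
proof -
 define K where "K = (normI \<xi>)^2 / (a + b) + 2 * (normI \<xi> * normI g)"
 have "rep1 bc v v g" using r rep1D(7)[OF r] unfolding rep1_def by (auto intro: L2_D(1))
 then have i: "integrable (leb I) (%x. V x * (v x * v x))" by (rule V_mult_integrable(1)[OF _ \<open>rep1 bc v v g\<close>])
 have "(LINT x|leb I. V x * (v x * v x)) \<le> (LINT x|leb I. V x * K)"
 proof (rule integral_mono_AE[OF i])
  show "integrable (leb I) (%x. V x * K)" using V_integrable by simp
  show "AE x in leb I. V x * (v x * v x) \<le> V x * K" unfolding AE_I_iff
  proof (intro AE_I2 impI)
   fix x assume "x \<in> I"
   then show "V x * (v x * v x) \<le> V x * K"
    using rep1_sup[OF r, of x] V_nonneg[of x] unfolding K_def power2_eq_square by (intro mult_left_mono) auto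
  qed
 qed
 then show ?thesis using interval_form_ge(3)[OF r] by (simp add: vint_def K_def)
qed

lemma L2_Cauchy_of_bound:
 fixes f :: "nat => 'a => 'b::euclidean_space"
 assumes C: "\<And>i j. (l2_norm N (%x. f i x - f j x))^2 \<le> C * B i j"
  and B: "\<And>e. e > 0 ==> \<exists>n0. \<forall>i\<ge>n0. \<forall>j\<ge>n0. B i j < (e :: real)" and "C > 0" and e: "e > 0"
 shows "\<exists>n0. \<forall>i\<ge>n0. \<forall>j\<ge>n0. l2_norm N (%x. f i x - f j x) < e"
proof -
 obtain n0 where n0: "\<And>i j. i \<ge> n0 ==> j \<ge> n0 ==> B i j < e^2 / C"
  using B[of "e^2 / C"] e \<open>C > 0\<close> by auto
 have "l2_norm N (%x. f i x - f j x) < e" if "i \<ge> n0" "j \<ge> n0" for i j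
 proof (rule power2_less_imp_less)
  have "C * B i j < C * (e^2 / C)" using n0[OF that] \<open>C > 0\<close> by (intro mult_strict_left_mono) auto
  then show "(l2_norm N (%x. f i x - f j x))^2 < e^2" using C[of i j] \<open>C > 0\<close> by simp
 qed (use e in simp)
 then show ?thesis by blast
qed

text \<open>Closedness: energies control the derivatives, and a uniform Sobolev bound then controls the representatives
 pointwise. This gives the limit its boundary values and lets the merely integrable potential pass to the limit.\<close>

lemma interval_coercive_form:
 assumes \<rho>: "0 < \<rho>" "3 * \<rho> \<le> b" "\<rho>^2 * \<rho> powr m = eps^2"
 shows "coercive_form (leb I) (dom1 bc) q (1 / ((16 + 4 / (pi^2 * c0)) * \<rho>^2))"
proof -
 define C where "C = (16 + 4 / (pi^2 * c0)) * \<rho>^2"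
 have C: "0 < C" using \<rho> c0_pos by (simp add: C_def add_pos_pos)
 have rep: "\<exists>v g. rep1 bc \<xi> v g" if "\<xi> \<in> dom1 bc" for \<xi>
 proof -
  have "\<xi> \<in> H1 I" using that by (cases bc) auto
  then show ?thesis using rep1_exists[OF that H1_weak_grad] by blast
 qed
 have coer: "(normI \<xi>)^2 \<le> C * q \<xi> \<xi>" if "\<xi> \<in> dom1 bc" for \<xi>
  using rep[OF that] interval_form_scaled_lower_bound[OF _ \<rho>] unfolding C_def by blast
 show ?thesis unfolding C_def[symmetric]
 proof
  show "dom1 bc \<subseteq> L2I" using rep rep1D(8) by blast
  show "(%x. 0) \<in> dom1 bc"
  proof (rule rep1D(10))
   show "rep1 bc (%x. 0) (%x. 0) (%x. 0)" by (simp add: rep1_def ac_on_const L2_zero)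
  qed
  show "(%x. u x + t * v x) \<in> dom1 bc" if "u \<in> dom1 bc" "v \<in> dom1 bc" for u v t
   using rep[OF that(1)] rep[OF that(2)] rep1_lincomb rep1D(10) by blast
  show "q u v = q v u" if "u \<in> dom1 bc" "v \<in> dom1 bc" for u v
   by (simp add: interval_form_def mult.commute)
  show "q (%x. u x + t * v x) w = q u w + t * q v w" if uvw: "u \<in> dom1 bc" "v \<in> dom1 bc" "w \<in> dom1 bc" for u v w t
  proof -
   obtain u0 gu where u: "rep1 bc u u0 gu" using rep[OF uvw(1)] by blast
   obtain v0 gv where v: "rep1 bc v v0 gv" using rep[OF uvw(2)] by blast
   obtain w0 gw where w: "rep1 bc w w0 gw" using rep[OF uvw(3)] by blast
   have 1: "innerI (%x. gu x + t * gv x) gw = innerI gu gw + t * innerI gv gw"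
    using l2_inner_add_left[OF rep1D(2)[OF u] L2_scale_real[OF rep1D(2)[OF v], of t] rep1D(2)[OF w]]
     l2_inner_scale_real_right[of "leb I" gw t gv] by (simp add: l2_inner_commute)
   have "(LINT x|leb I. V x * ((u x + t * v x) * w x)) = (LINT x|leb I. V x * (u x * w x) + t * (V x * (v x * w x)))"
    by (simp add: algebra_simps)
   also have "... = (LINT x|leb I. V x * (u x * w x)) + t * (LINT x|leb I. V x * (v x * w x))"
    using V_mult_integrable(1)[OF u w] V_mult_integrable(1)[OF v w] by simp
   finally show ?thesis
    using 1 interval_form_eq[OF rep1_lincomb[OF u v, of t] w] interval_form_eq[OF u w] interval_form_eq[OF v w]
    by (simp add: algebra_simps)
  qed
  show "0 < 1 / C" using C by simp
  show "1 / C * (normI u)^2 \<le> q u u" if "u \<in> dom1 bc" for u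
   using coer[OF that] C by (simp add: pos_divide_le_eq mult.commute)
 next
  fix U :: "nat => real => real"
  assume U: "\<And>n. U n \<in> dom1 bc"
   and Cau: "\<And>e. e > 0 ==> \<exists>n0. \<forall>i\<ge>n0. \<forall>j\<ge>n0. q (%x. U i x - U j x) (%x. U i x - U j x) < e"
  obtain v g where r: "\<And>n. rep1 bc (U n) (v n) (g n)" using rep[OF U] by metis
  have rd: "rep1 bc (%x. U i x - U j x) (%x. v i x - v j x) (%x. g i x - g j x)" for i j
   using rep1_lincomb[OF r[of i] r[of j], of "-1"] by simp
  have "\<exists>u0\<in>L2I. (%n. normI (%x. U n x - u0 x)) \<longlonglongrightarrow> 0"
   by (rule L2_complete[OF rep1D(8)[OF r] L2_Cauchy_of_bound[OF coer[OF rep1D(10)[OF rd]] Cau C]])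
  then obtain u0 where u0: "u0 \<in> L2I" "(%n. normI (%x. U n x - u0 x)) \<longlonglongrightarrow> 0" by auto
  have "\<exists>g0\<in>L2I. (%n. normI (%x. g n x - g0 x)) \<longlonglongrightarrow> 0"
  proof (rule L2_complete[OF rep1D(2)[OF r] L2_Cauchy_of_bound[OF _ Cau]])
   show "(normI (%x. g i x - g j x))^2 \<le> 1 * q (%x. U i x - U j x) (%x. U i x - U j x)" for i j
    using interval_form_ge(1)[OF rd] by simp
  qed auto
  then obtain g0 where g0: "g0 \<in> L2I" "(%n. normI (%x. g n x - g0 x)) \<longlonglongrightarrow> 0" by auto
  have W: "is_weak_grad I u0 g0"
   by (rule is_weak_grad_limit[OF _ rep1D(8)[OF r] u0(1) rep1D(9)[OF r] g0(1) u0(2) g0(2)]) simp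
  obtain v0 where v0: "ac_on (-a) b v0 g0" "AE x in leb I. u0 x = v0 x"
   by (rule weak_grad_interval_imp_ac[OF ab_less u0(1) W])
  have r0: "rep1 DirNeu u0 v0 g0" using v0 g0(1) L2_D(1)[OF u0(1)] by (simp add: rep1_def)
  have rn: "rep1 DirNeu (%x. U n x - u0 x) (%x. v n x - v0 x) (%x. g n x - g0 x)" for n
  proof -
   have "rep1 DirNeu (U n) (v n) (g n)" using r[of n] by (simp add: rep1_def)
   from rep1_lincomb[OF this r0, of "-1"] show ?thesis by simp
  qed
  let ?S = "%n. (normI (%x. U n x - u0 x))^2 / (a + b) +
    2 * (normI (%x. U n x - u0 x) * normI (%x. g n x - g0 x))"
  have "?S \<longlonglongrightarrow> 0^2 / (a + b) + 2 * (0 * 0)"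
   by (intro tendsto_intros u0(2) g0(2)) (use a_pos b_pos in auto)
  then have S: "?S \<longlonglongrightarrow> 0" by simp
  have ends: "v0 x = 0" if x: "x \<in> I" and z: "\<And>n. v n x = 0" for x
  proof -
   have "(%n. v n x - v0 x) \<longlonglongrightarrow> 0"
    by (rule tendsto_zero_of_square_le[OF rep1_sup[OF rn x] S])
   then show ?thesis using z by (simp add: LIMSEQ_const_iff)
  qed
  have "rep1 bc u0 v0 g0"
   unfolding rep1_def using r0 ends[of "-a"] ends[of b] rep1D(5,6)[OF r] ab_less by (auto simp: rep1_def)
  then have "u0 \<in> dom1 bc" by (rule rep1D(10))
  moreover have "(%n. q (%x. U n x - u0 x) (%x. U n x - u0 x)) \<longlonglongrightarrow> 0"
  proof (rule tendsto_sandwich[OF _ _ tendsto_const])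
   show "\<forall>\<^sub>F n in sequentially. 0 \<le> q (%x. U n x - u0 x) (%x. U n x - u0 x)"
    using order_trans[OF zero_le_power2 interval_form_ge(1)[OF rn]] by simp
   show "\<forall>\<^sub>F n in sequentially. q (%x. U n x - u0 x) (%x. U n x - u0 x) \<le> (normI (%x. g n x - g0 x))^2 + vint * ?S n"
    using interval_form_le[OF rn] by simp
   have "(%n. (normI (%x. g n x - g0 x))^2 + vint * ?S n) \<longlonglongrightarrow> 0^2 + vint * 0"
    by (intro tendsto_intros g0(2) S)
   then show "(%n. (normI (%x. g n x - g0 x))^2 + vint * ?S n) \<longlonglongrightarrow> 0" by simp
  qed
  ultimately show "\<exists>u0\<in>dom1 bc. (%n. q (%x. U n x - u0 x) (%x. U n x - u0 x)) \<longlonglongrightarrow> 0" by blast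
 qed
qed

end

section \<open>The first transversal mode\<close>

text \<open>The four integrals of the first mode over a section of width \<open>w\<close>. The second factor in the
 third one is, up to $h'/h$, the derivative of the mode along the strip; its norm is the
 constant in the potential.\<close>

lemma mode_integrals:
 fixes w :: real
 assumes w: "0 < w"
 defines "c \<equiv> sqrt (2 / w)" and "t \<equiv> %y. pi * y / w"
 shows "(LINT y:{0..w}|lborel. (c * sin (t y))^2) = 1"
  and "(LINT y:{0..w}|lborel. (c * sin (t y)) * (- (c * (sin (t y) / 2 + t y * cos (t y))))) = 0"
  and "(LINT y:{0..w}|lborel. (- (c * (sin (t y) / 2 + t y * cos (t y))))^2) = pi^2 / 3 + 1 / 4"
  and "(LINT y:{0..w}|lborel. (c * (pi / w * cos (t y)))^2) = (pi / w)^2"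
proof -
 have c2: "c * c = 2 / w" using w by (simp add: c_def)
 have FTC: "(LINT y:{0..w}|lborel. f y) = F w - F 0"
  if "\<And>y. (F has_real_derivative f y) (at y)" "continuous_on UNIV f" for F f
 proof -
  have "ac_on 0 w F f" by (rule ac_on_smooth[OF that(1)]) (rule continuous_on_subset[OF that(2)], simp)
  from ac_on_eq[OF this, of w] w show ?thesis by simp
 qed
 have td: "(t has_real_derivative pi / w) (at y)" for y
  unfolding t_def using w by (auto intro!: derivative_eq_intros)
 have tc: "continuous_on A t" for A using td by (meson DERIV_isCont continuous_at_imp_continuous_on)
 have ts: "sin (t w) = 0" "cos (t w) = -1" "t w = pi" "t 0 = 0" using w by (simp_all add: t_def)
 have sq: "(cos z)^2 = 1 - (sin z)^2" for z :: real by (simp add: cos_squared_eq)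
 have scale: "K * (w / pi) * (pi / w * X) = K * X" for K X using w by simp
 have main: "(LINT y:{0..w}|lborel. f y) = K * (w / pi) * (P pi - P 0)"
  if f: "\<And>y. f y = K * p (t y)" and p: "\<And>s. (P has_real_derivative p s) (at s)" "continuous_on UNIV p" for f p P K
 proof -
  have "(LINT y:{0..w}|lborel. f y) = K * (w / pi) * P (t w) - K * (w / pi) * P (t 0)"
  proof (rule FTC)
   show "((%y. K * (w / pi) * P (t y)) has_real_derivative f y) (at y)" for y
    using DERIV_cmult[OF DERIV_chain2[OF p(1) td], of "K * (w / pi)" y] w by (simp add: f field_simps)
   show "continuous_on UNIV f"
    unfolding f[abs_def] by (intro continuous_intros continuous_on_compose2[OF p(2)] tc) auto
  qed
  then show ?thesis by (simp only: ts right_diff_distrib)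
 qed
 have a: "(c * sin (t y))^2 = 2 / w * (sin (t y))^2" for y
  by (simp add: power_mult_distrib power2_eq_square[of c] c2)
 have "(LINT y:{0..w}|lborel. (c * sin (t y))^2) = 2 / w * (w / pi) * (pi / 2 - sin pi * cos pi / 2 - (0 / 2 - sin 0 * cos 0 / 2))"
  by (rule main[where p = "%s. (sin s)^2" and P = "%s. s / 2 - sin s * cos s / 2", OF a])
    (auto intro!: derivative_eq_intros continuous_intros simp: sq power2_eq_square[symmetric] field_simps)
 then show "(LINT y:{0..w}|lborel. (c * sin (t y))^2) = 1" using w by simp
 have b: "(c * sin (t y)) * (- (c * (sin (t y) / 2 + t y * cos (t y)))) = 2 / w * (- (sin (t y) * (sin (t y) / 2 + t y * cos (t y))))" for y
  unfolding c2[symmetric] by (simp add: mult_ac)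
 have "(LINT y:{0..w}|lborel. (c * sin (t y)) * (- (c * (sin (t y) / 2 + t y * cos (t y)))))
   = 2 / w * (w / pi) * (- (pi * (sin pi)^2 / 2) - - (0 * (sin 0)^2 / 2))"
  by (rule main[where p = "%s. - (sin s * (sin s / 2 + s * cos s))" and P = "%s. - (s * (sin s)^2 / 2)", OF b])
    (auto intro!: derivative_eq_intros continuous_intros simp: power2_eq_square algebra_simps)
 then show "(LINT y:{0..w}|lborel. (c * sin (t y)) * (- (c * (sin (t y) / 2 + t y * cos (t y))))) = 0" by simp
 have d: "(- (c * (sin (t y) / 2 + t y * cos (t y))))^2 = 2 / w * (sin (t y) / 2 + t y * cos (t y))^2" for y
  by (simp add: power_mult_distrib power2_eq_square[of c] c2)
 define P where "P s = s ^ 3 / 6 + s / 8 + s^2 * (sin s * cos s) / 2 - sin s * cos s / 8" for s :: real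
 have "(LINT y:{0..w}|lborel. (- (c * (sin (t y) / 2 + t y * cos (t y))))^2) = 2 / w * (w / pi) * (P pi - P 0)"
 proof (rule main[where p = "%s. (sin s / 2 + s * cos s)^2", OF d])
  fix s
  have "(P has_real_derivative (3 * s^2 / 6 + 1 / 8 + (2 * s * (sin s * cos s) + s^2 * (cos s * cos s - sin s * sin s)) / 2
    - (cos s * cos s - sin s * sin s) / 8)) (at s)"
   unfolding P_def by (auto intro!: derivative_eq_intros simp: power2_eq_square field_simps)
  moreover have "3 * s^2 / 6 + 1 / 8 + (2 * s * (sin s * cos s) + s^2 * (cos s * cos s - sin s * sin s)) / 2
    - (cos s * cos s - sin s * sin s) / 8 = (sin s / 2 + s * cos s)^2"
  proof -
   have "3 * s^2 / 6 + 1 / 8 + (2 * s * (D * C) + s^2 * (C * C - D * D)) / 2 - (C * C - D * D) / 8 - (D / 2 + s * C)^2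
    = (s^2 / 2 + 1 / 8) * (1 - (D^2 + C^2))" for C D by (simp add: power2_eq_square field_simps)
   from this[of "sin s" "cos s"] show ?thesis by simp
  qed
  ultimately show "(P has_real_derivative (sin s / 2 + s * cos s)^2) (at s)" by simp
 qed (intro continuous_intros, auto)
 also have "... = pi^2 / 3 + 1 / 4"
  using w by (simp add: P_def field_simps power2_eq_square power3_eq_cube)
 finally show "(LINT y:{0..w}|lborel. (- (c * (sin (t y) / 2 + t y * cos (t y))))^2) = pi^2 / 3 + 1 / 4" .
 have e: "(c * (pi / w * cos (t y)))^2 = 2 / w * (pi / w)^2 * (cos (t y))^2" for y
  unfolding power_mult_distrib power2_eq_square[of c] c2 by simp
 have "(LINT y:{0..w}|lborel. (c * (pi / w * cos (t y)))^2) = 2 / w * (pi / w)^2 * (w / pi) * (pi / 2 + sin pi * cos pi / 2 - (0 / 2 + sin 0 * cos 0 / 2))"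
  by (rule main[where p = "%s. (cos s)^2" and P = "%s. s / 2 + sin s * cos s / 2", OF e])
    (auto intro!: derivative_eq_intros continuous_intros simp: sq power2_eq_square[symmetric] field_simps)
 then show "(LINT y:{0..w}|lborel. (c * (pi / w * cos (t y)))^2) = (pi / w)^2" using w by simp
qed

context narrow_strip
begin

text \<open>\<open>phi\<close> is the normalized first mode of the section and \<open>phi_y\<close> its transversal derivative. The derivative along the
 strip factors into $h'/h$ and the continuous function \<open>rho\<close>; this separates the only unbounded factor.\<close>

definition phi :: plane_fun where
 "phi z = sqrt (2 / (eps * h (fst z))) * sin (pi * snd z / (eps * h (fst z)))"
definition phi_y :: plane_fun where
 "phi_y z = sqrt (2 / (eps * h (fst z))) * (pi / (eps * h (fst z)) * cos (pi * snd z / (eps * h (fst z))))"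
definition rho :: plane_fun where
 "rho z = - (sqrt (2 / (eps * h (fst z))) *
   (sin (pi * snd z / (eps * h (fst z))) / 2 + pi * snd z / (eps * h (fst z)) * cos (pi * snd z / (eps * h (fst z)))))"
definition phi_x :: plane_fun where "phi_x z = h' (fst z) / h (fst z) * rho z"
abbreviation "kap \<equiv> pi^2 / 3 + 1 / 4 :: real"

lemma mode_lift_eq: "lift \<xi> = (%z. \<xi> (fst z) * phi z)"
 by (auto simp: mode_lift_def phi_def mult.assoc)

lemma h_fst_continuous: "continuous_on A (%z :: real \<times> real. h (fst z))"
 by (rule continuous_on_subset[OF h_fst_cont]) simp

lemma phi_continuous: "continuous_on A phi" "continuous_on A phi_y" "continuous_on A rho"
proof -
 have *: "eps \<noteq> 0" "h (fst z) \<noteq> 0" for z :: "real \<times> real" using eps_pos h_pos[of "fst z"] by auto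
 show "continuous_on A phi" "continuous_on A phi_y" "continuous_on A rho"
  unfolding phi_def phi_y_def rho_def using * by (intro continuous_intros h_fst_continuous; simp)+
qed

lemma bounded_on_S:
 assumes "continuous_on UNIV F"
 shows "\<exists>K. \<forall>z\<in>S. \<bar>F z :: real\<bar> \<le> K"
proof -
 have "bounded (F ` cbox (-a, 0) (b, eps * M))"
  by (intro compact_imp_bounded compact_continuous_image continuous_on_subset[OF assms]) auto
 then show ?thesis using S_subset_cbox unfolding bounded_iff by fastforce
qed

lemma fiber_hat: "x \<in> I ==> hat F (x, y) = indicator {0<..<eps * h x} y * F (x, y)"
 by (auto simp: indicator_def mem_S)

lemma section_continuous: "continuous_on UNIV F ==> continuous_on A (%y. F (x, y))" for F :: plane_fun and x :: real
 by (rule continuous_on_compose2[of UNIV F]) (auto intro: continuous_intros)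

lemma fiber_integral:
 assumes c: "continuous_on UNIV F" and x: "x \<in> I"
 shows "(LBINT y. hat F (x, y)) = (LINT y:{0..eps * h x}|lborel. F (x, y))"
  and "integrable lborel (%y. hat F (x, y))"
proof -
 have c': "continuous_on A (%y. F (x, y))" for A by (rule section_continuous[OF c])
 have i: "set_integrable lborel {0..eps * h x} (%y. F (x, y))" by (rule borel_integrable_atLeastAtMost'[OF c'])
 have "set_integrable lborel {0<..<eps * h x} (%y. F (x, y))" by (rule set_integrable_subset[OF i]) auto
 then show I: "integrable lborel (%y. hat F (x, y))" by (simp add: set_integrable_def fiber_hat[OF x])
 show "(LBINT y. hat F (x, y)) = (LINT y:{0..eps * h x}|lborel. F (x, y))"
  unfolding set_lebesgue_integral_def
 proof (rule integral_cong_AE)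
  show "AE y in lborel. hat F (x, y) = indicator {0..eps * h x} y *\<^sub>R F (x, y)"
   using AE_lborel_singleton[of 0] AE_lborel_singleton[of "eps * h x"]
   proof eventually_elim
    case (elim y) then show ?case by (cases "y \<in> {0<..<eps * h x}") (auto simp: fiber_hat[OF x])
   qed
  show "(%y. indicator {0..eps * h x} y *\<^sub>R F (x, y)) \<in> borel_measurable lborel"
   using i by (auto simp: set_integrable_def)
 qed (use I in simp)
qed

lemma fiber_L2_continuous:
 assumes "continuous_on UNIV F" "x \<in> I"
 shows "(%y. hat F (x, y)) \<in> L2 lborel" "(LBINT y. (hat F (x, y))^2) = (LINT y:{0..eps * h x}|lborel. (F (x, y))^2)"
proof -
 have c: "continuous_on UNIV (%z. (F z)^2)" by (intro continuous_intros assms(1))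
 have e: "(hat F z)^2 = hat (%z. (F z)^2) z" for z by (simp add: indicator_def)
 show "(%y. hat F (x, y)) \<in> L2 lborel"
  using fiber_integral(2)[OF assms] fiber_integral(2)[OF c assms(2)] by (simp add: L2_def e)
 show "(LBINT y. (hat F (x, y))^2) = (LINT y:{0..eps * h x}|lborel. (F (x, y))^2)"
  unfolding e by (rule fiber_integral(1)[OF c assms(2)])
qed

lemma phi_fiber:
 assumes x: "x \<in> I"
 shows "(LBINT y. (hat phi (x, y))^2) = 1" "(LBINT y. hat phi (x, y) * rho (x, y)) = 0"
  "(LBINT y. (hat rho (x, y))^2) = kap" "(LBINT y. (hat phi_y (x, y))^2) = (pi / (eps * h x))^2"
  "(%y. hat phi (x, y)) \<in> L2 lborel" "(%y. hat rho (x, y)) \<in> L2 lborel" "(%y. hat phi_y (x, y)) \<in> L2 lborel"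
proof -
 note m = mode_integrals[OF width_pos[of x]]
 note c = phi_continuous[of UNIV]
 show "(LBINT y. (hat phi (x, y))^2) = 1" "(LBINT y. (hat rho (x, y))^2) = kap"
  "(LBINT y. (hat phi_y (x, y))^2) = (pi / (eps * h x))^2"
  unfolding fiber_L2_continuous(2)[OF c(1) x] fiber_L2_continuous(2)[OF c(2) x] fiber_L2_continuous(2)[OF c(3) x]
  using m(1,3,4) by (simp_all add: phi_def rho_def phi_y_def)
 have "(LBINT y. hat phi (x, y) * rho (x, y)) = (LBINT y. hat (%z. phi z * rho z) (x, y))"
  by (simp add: mult.assoc)
 also have "... = 0"
  unfolding fiber_integral(1)[OF continuous_on_mult[OF c(1,3)] x] using m(2) by (simp add: phi_def rho_def)
 finally show "(LBINT y. hat phi (x, y) * rho (x, y)) = 0" .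
 show "(%y. hat phi (x, y)) \<in> L2 lborel" "(%y. hat rho (x, y)) \<in> L2 lborel" "(%y. hat phi_y (x, y)) \<in> L2 lborel"
  by (rule fiber_L2_continuous(1)[OF c(1) x] fiber_L2_continuous(1)[OF c(2) x] fiber_L2_continuous(1)[OF c(3) x])+
qed

lemma phi_ac: "ac_on (-a) b (%x. phi (x, y)) (%x. phi_x (x, y))"
proof (rule ac_on_derivative[of "{0}"])
 have cx: "continuous_on A (%x. F (x, y))" if "continuous_on UNIV F" for F :: plane_fun and A
  by (rule continuous_on_compose2[OF that]) (auto intro: continuous_intros)
 show "continuous_on I (%x. phi (x, y))" by (rule cx[OF phi_continuous(1)])
 show "set_integrable lborel I (%x. phi_x (x, y))"
 proof -
  have c: "continuous_on UNIV (%x. rho (x, y) / h x)"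
   by (intro continuous_on_divide cx[OF phi_continuous(3)] h_cont) (use h_pos in \<open>auto simp: less_le\<close>)
  have "(%x. rho (x, y) / h x) \<in> L2I"
   by (rule L2_interval_bounded_measurable, rule continuous_on_subset[OF c]) simp
  from integrable_mult_L2[OF h'_L2 this] show ?thesis
   by (simp add: integrable_I phi_x_def)
 qed
 fix x assume x: "x \<in> {-a<..<b} - {0}"
 define w s p where "w x = eps * h x" and "s x = sqrt (2 / w x)" and "p x = pi * y / w x" for x
 have w: "0 < w x" unfolding w_def by (rule width_pos)
 have "(w has_real_derivative eps * h' x) (at x)"
  unfolding w_def by (rule DERIV_cmult[OF h_deriv]) (use x in auto)
 moreover have e: "eps * h' x / w x = h' x / h x" using eps_pos by (simp add: w_def)
 ultimately have dw: "(w has_real_derivative h' x / h x * w x) (at x)" using w by (simp add: field_simps)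
 have dq: "((%x. K / w x) has_real_derivative - (h' x / h x * (K / w x))) (at x)" for K
  using DERIV_divide[OF DERIV_const[of K] dw] w by (simp add: field_simps)
 have s2: "s x * s x = 2 / w x" using w by (simp add: s_def)
 have s0: "0 < s x" using w by (simp add: s_def)
 have "(s has_real_derivative inverse (s x) / 2 * - (h' x / h x * (2 / w x))) (at x)"
  unfolding s_def by (rule DERIV_chain2[OF DERIV_real_sqrt dq]) (use w in simp)
 moreover have "inverse (s x) / 2 * - (h' x / h x * (2 / w x)) = - (h' x / h x * (s x / 2))"
  unfolding s2[symmetric] using s0 by (simp add: field_simps)
 ultimately have ds: "(s has_real_derivative - (h' x / h x * (s x / 2))) (at x)" by simp
 have "((%x. sin (p x)) has_real_derivative cos (p x) * - (h' x / h x * p x)) (at x)"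
  unfolding p_def by (rule DERIV_chain2[OF DERIV_sin dq])
 from DERIV_mult[OF ds this]
 show "((%x. phi (x, y)) has_real_derivative phi_x (x, y)) (at x)"
  unfolding phi_def phi_x_def rho_def fst_conv snd_conv w_def[symmetric] unfolding p_def[symmetric] s_def[symmetric]
  by (simp add: algebra_simps)
qed simp

lemma phi_y_derivative:
 "((%y. phi (x, y)) has_real_derivative phi_y (x, y)) (at y)"
 "((%y. phi_y (x, y)) has_real_derivative - ((pi / (eps * h x))^2 * phi (x, y))) (at y)"
 unfolding phi_def phi_y_def using eps_pos h_pos[of x]
 by (auto intro!: derivative_eq_intros simp: power2_eq_square)

section \<open>Weighted functions on the strip\<close>

lemma AE_fst:
 assumes "AE x in lborel. P (x :: real)"
 shows "AE z in (lborel :: (real \<times> real) measure). P (fst z)"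
proof -
 obtain N where N: "N \<in> null_sets lborel" "{x. \<not> P x} \<subseteq> N"
  using assms by (auto elim!: AE_E simp: null_sets_def)
 have "AE z in (lborel :: (real \<times> real) measure). fst z \<notin> N"
 proof (rule plane_AE_of_sections)
  have "N \<times> (UNIV :: real set) \<in> sets (borel \<Otimes>\<^sub>M borel)" using N(1) by (intro pair_measureI) auto
  moreover have "{z :: real \<times> real. fst z \<notin> N} = - (N \<times> UNIV)" by auto
  ultimately show "{z :: real \<times> real. fst z \<notin> N} \<in> sets borel" by (simp only: borel_prod) (rule borel_comp)
  have "AE x in lborel. x \<notin> N" by (rule AE_not_in[OF N(1)])
  then show "AE x in lborel. AE y in (lborel :: real measure). fst (x, y) \<notin> N" by (rule eventually_mono) simp
 qed
 then show ?thesis by (rule eventually_mono) (use N(2) in auto)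
qed

lemma L2_weight:
 fixes p :: line_fun and k :: plane_fun
 assumes p: "p \<in> L2I" and k: "k \<in> borel_measurable borel" and K: "\<And>z. z \<in> S ==> \<bar>k z\<bar> \<le> K"
 shows "(%z. p (fst z) * k z) \<in> L2S"
proof -
 let ?p = "%x. indicator I x * p x"
 have pL: "?p \<in> L2 lborel" using p by (simp add: L2_leb_iff)
 have pm[measurable]: "?p \<in> borel_measurable borel" using L2_D(1)[OF pL] by simp
 have e: "hat (%z. p (fst z) * k z) z = ?p (fst z) * hat k z" for z by (auto simp: indicator_def mem_S)
 have "(%z :: real \<times> real. ?p (fst z)) \<in> borel_measurable (borel \<Otimes>\<^sub>M borel)" by measurable
 then have m: "(%z. ?p (fst z) * hat k z) \<in> borel_measurable borel" using k S_borel by (simp add: borel_prod)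
 have I: "integrable lborel (%x. (?p x)^2)" using L2_D(2)[OF pL] by simp
 have "integrable lborel (%z. (?p (fst z) * hat k z)^2)"
 proof (rule integrable_dominated)
  show "integrable lborel (%z. K^2 * ((?p (fst z))^2 * indicator {0<..<eps * M} (snd z)))"
   using integrable_plane_tensor[OF I integrable_indicator_interval[of 0 "eps * M"]] by simp
  show "(%z. (?p (fst z) * hat k z)^2) \<in> borel_measurable lborel" using m by simp
  have "(?p (fst z) * hat k z)^2 \<le> K^2 * ((?p (fst z))^2 * indicator {0<..<eps * M} (snd z))" for z
  proof (cases "z \<in> S")
   case True
   then have "snd z \<in> {0<..<eps * M}" using width_le[of "fst z"] by (auto simp: mem_S)
   moreover have "(k z)^2 \<le> K^2" using K[OF True] by (simp add: abs_le_square_iff[symmetric] order_trans[OF _ abs_ge_self])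
   then have "(?p (fst z))^2 * (k z)^2 \<le> (?p (fst z))^2 * K^2" by (intro mult_left_mono) auto
   ultimately show ?thesis using True by (simp add: power_mult_distrib mult.commute)
  qed simp
  then show "AE z in lborel. norm ((?p (fst z) * hat k z)^2) \<le> norm (K^2 * ((?p (fst z))^2 * indicator {0<..<eps * M} (snd z)))"
   by (simp add: abs_of_nonneg)
 qed
 then show ?thesis unfolding hat_L2 e using m by (simp add: L2_def)
qed

lemma L2_pair:
 fixes p r :: plane_fun
 assumes "p \<in> L2S" "r \<in> L2S"
 shows "(%z. (p z, r z)) \<in> L2S"
proof -
 have m: "(%z. (p z, r z)) \<in> borel_measurable (leb S)"
  using L2_D(1)[OF assms(1)] L2_D(1)[OF assms(2)] unfolding borel_prod[symmetric] by (rule measurable_Pair)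
 have "(norm (p z, r z))^2 = (norm (p z))^2 + (norm (r z))^2" for z by (simp add: norm_Pair)
 then have "integrable (leb S) (%z. (norm (p z, r z))^2)"
  using L2_D(2)[OF assms(1)] L2_D(2)[OF assms(2)] by simp
 with m show ?thesis by (simp add: L2_def)
qed

lemma fiber_L2:
 fixes f :: plane_fun
 assumes "f \<in> L2S"
 shows "AE x in lborel. (%y. hat f (x, y)) \<in> L2 lborel" "integrable lborel (%x. LBINT y. (hat f (x, y))^2)"
  "(LBINT x. LBINT y. (hat f (x, y))^2) = (normS f)^2"
proof -
 have I: "integrable lborel (%z. (hat f z)^2)" using L2_D(2)[OF assms[unfolded hat_L2]] by simp
 have e: "hat (%z. f z * f z) z = (hat f z)^2" for z by (simp add: indicator_def power2_eq_square)
 show "integrable lborel (%x. LBINT y. (hat f (x, y))^2)" by (rule plane_Fubini(3)[OF I])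
 show "(LBINT x. LBINT y. (hat f (x, y))^2) = (normS f)^2"
  using plane_Fubini(1)[OF I] by (simp add: l2_norm_power2 l2_inner_def LINT_S e)
 have m: "hat f \<in> borel_measurable (borel \<Otimes>\<^sub>M borel)" using hat_measurable[OF assms] by (simp add: borel_prod)
 have "(%y. hat f (x, y)) \<in> borel_measurable borel" for x
  using measurable_compose[OF measurable_Pair1' m, of x] by simp
 with plane_Fubini(2)[OF I] show "AE x in lborel. (%y. hat f (x, y)) \<in> L2 lborel"
  by (auto simp: L2_def)
qed

text \<open>The uniform bound for the sections of a function by its norm and the norm of its derivative along the strip:
 the one-dimensional Sobolev inequality on almost every horizontal line.\<close>

lemma section_norm_bound:
 assumes u: "u \<in> strip_domain bc a b h eps" and G: "is_weak_grad S u G"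
 shows "AE x in lborel. x \<in> I --> (LBINT y. (hat u (x, y))^2) \<le>
  (normS u)^2 / (a + b) + 2 * (normS u * normS (gx G))"
proof -
 note L = strip_domainD(2)[OF u] and GL = is_weak_gradD(1)[OF G]
 let ?g = "hat (gx G)"
 have I2: "integrable lborel (%z. (hat u z)^2)" using L2_D(2)[OF L[unfolded hat_L2]] by simp
 have Ig: "integrable lborel (%z. \<bar>hat u z * ?g z\<bar>)"
  using integrable_mult_L2[OF L[unfolded hat_L2] L2_fst[OF GL, unfolded hat_L2]] by (rule integrable_abs)
 have s1: "integrable lborel (%z. (swap (hat u) z)^2)" using I2 integrable_plane_swap[of "%z. (hat u z)^2"] by blast
 have s2: "integrable lborel (%z. \<bar>swap (hat u) z * swap ?g z\<bar>)" using Ig integrable_plane_swap[of "%z. \<bar>hat u z * ?g z\<bar>"] by blast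
 define r where "r y = (LBINT t. (hat u (t, y))^2) / (a + b) + 2 * (LBINT t. \<bar>hat u (t, y) * ?g (t, y)\<bar>)" for y
 have rI: "integrable lborel r"
  unfolding r_def using plane_Fubini(3)[OF s1] plane_Fubini(3)[OF s2] by simp
 have rtot: "(LBINT y. r y) \<le> (normS u)^2 / (a + b) + 2 * (normS u * normS (gx G))"
 proof -
  have "(LBINT y. r y) = (LBINT y. LBINT t. (hat u (t, y))^2) / (a + b) + 2 * (LBINT y. LBINT t. \<bar>hat u (t, y) * ?g (t, y)\<bar>)"
   unfolding r_def using plane_Fubini(3)[OF s1] plane_Fubini(3)[OF s2] by simp
  also have "(LBINT y. LBINT t. (hat u (t, y))^2) = (LBINT z. (hat u z)^2)"
   using plane_Fubini(1)[OF s1] integral_plane_swap[of "%z. (hat u z)^2"] borel_measurable_integrable[OF I2] by simp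
  also have "... = (normS u)^2"
   using fiber_L2(3)[OF L] plane_Fubini(1)[OF I2] by simp
  also have "(LBINT y. LBINT t. \<bar>hat u (t, y) * ?g (t, y)\<bar>) = (LBINT z. \<bar>hat u z * ?g z\<bar>)"
   using plane_Fubini(1)[OF s2] integral_plane_swap[of "%z. \<bar>hat u z * ?g z\<bar>"] borel_measurable_integrable[OF Ig] by simp
  also have "... \<le> normS u * normS (gx G)"
  proof -
   have "(LBINT z. \<bar>hat u z * ?g z\<bar>) = (LINT z|leb S. \<bar>u z * fst (G z)\<bar>)"
    unfolding LINT_S by (rule integral_cong_fun) (auto simp: indicator_def)
   also have "... \<le> normS u * normS (gx G)"
    using integral_mult_le_l2[OF L L2_fst[OF GL]] by (simp add: l2_norm_def l2_inner_self)
   finally show ?thesis .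
  qed
  finally show ?thesis by simp
 qed
 have pt: "AE z in lborel. fst z \<in> {-a<..<b} --> (hat u z)^2 \<le> r (snd z)"
 proof -
  have "AE y in lborel. AE x in lborel. x \<in> {-a<..<b} --> (hat u (x, y))^2 \<le> r y"
   using domain_sections[OF u G]
  proof (rule eventually_mono)
   fix y assume "\<exists>v. ac_on (-a) b v (%t. ?g (t, y)) \<and>
    (AE x in lborel. x \<in> {-a<..<b} --> hat u (x, y) = v x) \<and> (bc = Dir --> v (-a) = 0 \<and> v b = 0)"
   then obtain v where v: "ac_on (-a) b v (%t. ?g (t, y))" "AE x in lborel. x \<in> {-a<..<b} --> hat u (x, y) = v x" by auto
   have ae: "AE t in lborel. indicator I t * v t = hat u (t, y)"
    using v(2) AE_x_inside
   proof eventually_elim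
    case (elim t) then show ?case by (cases "t \<in> I") (auto simp: hat_section_support(2))
   qed
   have vc: "continuous_on I v" by (rule ac_on_imp_continuous[OF v(1)])
   have vm: "(%t. indicator I t * v t) \<in> borel_measurable borel"
    using borel_measurable_continuous_on_indicator[OF _ vc] by simp
   have "hat u \<in> borel_measurable (borel \<Otimes>\<^sub>M borel)" "?g \<in> borel_measurable (borel \<Otimes>\<^sub>M borel)"
    using hat_measurable[OF L] hat_measurable[OF L2_fst[OF GL]] by (simp_all add: borel_prod)
   then have um[measurable]: "(%t. hat u (t, y)) \<in> borel_measurable borel" "(%t. ?g (t, y)) \<in> borel_measurable borel"
    using measurable_compose[OF measurable_Pair2', of y borel] by simp_all
   have 1: "(LINT t:I|lborel. (v t)^2) = (LBINT t. (hat u (t, y))^2)"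
   proof -
    have "(LINT t:I|lborel. (v t)^2) = (LBINT t. (indicator I t * v t)^2)"
     unfolding set_lebesgue_integral_def by (rule integral_cong_fun) (auto simp: indicator_def)
    also have "... = (LBINT t. (hat u (t, y))^2)"
     by (rule integral_cong_AE) (use vm um(1) ae in \<open>auto elim: eventually_mono\<close>)
    finally show ?thesis .
   qed
   have 2: "(LINT t:I|lborel. \<bar>v t * ?g (t, y)\<bar>) = (LBINT t. \<bar>hat u (t, y) * ?g (t, y)\<bar>)"
   proof -
    have "(LINT t:I|lborel. \<bar>v t * ?g (t, y)\<bar>) = (LBINT t. \<bar>(indicator I t * v t) * ?g (t, y)\<bar>)"
     unfolding set_lebesgue_integral_def by (rule integral_cong_fun) (auto simp: indicator_def)
    also have "... = (LBINT t. \<bar>hat u (t, y) * ?g (t, y)\<bar>)"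
    proof (rule integral_cong_AE)
     show "AE t in lborel. \<bar>(indicator I t * v t) * ?g (t, y)\<bar> = \<bar>hat u (t, y) * ?g (t, y)\<bar>"
      using ae by (rule eventually_mono) simp
    qed (use vm um in simp_all)
    finally show ?thesis .
   qed
   show "AE x in lborel. x \<in> {-a<..<b} --> (hat u (x, y))^2 \<le> r y"
    using v(2)
   proof (rule eventually_mono, intro impI)
    fix x assume *: "x \<in> {-a<..<b} --> hat u (x, y) = v x" "x \<in> {-a<..<b}"
    have "(v x)^2 \<le> r y"
     using ac_on_sup_bound[OF v(1) ab_less, of x] *(2) unfolding r_def 1 2 by (simp add: add.commute)
    with * show "(hat u (x, y))^2 \<le> r y" by simp
   qed
  qed
  then have "AE z in lborel. snd z \<in> {-a<..<b} --> (hat u (snd z, fst z))^2 \<le> r (fst z)"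
  proof (rule plane_AE_of_sections[rotated, of "%z. snd z \<in> {-a<..<b} --> (hat u (snd z, fst z))^2 \<le> r (fst z)", unfolded fst_conv snd_conv])
   have [measurable]: "swap (hat u) \<in> borel_measurable (borel \<Otimes>\<^sub>M borel)"
    using borel_measurable_swap[OF hat_measurable[OF L]] by (simp add: borel_prod)
   have [measurable]: "r \<in> borel_measurable borel" using borel_measurable_integrable[OF rI] by simp
   have "{z \<in> space (borel \<Otimes>\<^sub>M borel). snd z \<in> {-a<..<b} --> (swap (hat u) z)^2 \<le> r (fst z)} \<in> sets (borel \<Otimes>\<^sub>M borel)" by measurable
   then show "{z. snd z \<in> {-a<..<b} --> (hat u (snd z, fst z))^2 \<le> r (fst z)} \<in> sets borel" unfolding borel_prod by simp
  qed
  from AE_plane_swap[OF this] show ?thesis by simp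
 qed
 show ?thesis using plane_AE_sections[OF pt] plane_Fubini(2)[OF I2] AE_x_inside
 proof eventually_elim
  case (elim x)
  show ?case
  proof
   assume "x \<in> I"
   then have x: "x \<in> {-a<..<b}" using elim(3) by blast
   have "(LBINT y. (hat u (x, y))^2) \<le> (LBINT y. r y)"
    by (rule integral_mono_AE[OF elim(2) rI]) (use elim(1) x in auto)
   with rtot show "(LBINT y. (hat u (x, y))^2) \<le> (normS u)^2 / (a + b) + 2 * (normS u * normS (gx G))" by linarith
  qed
 qed
qed

end

context narrow_strip
begin

section \<open>Transversal pairings\<close>

definition pair :: "(real \<times> real => real) => (real \<times> real => real) => real => real" where
 "pair f k x = (LBINT y. hat f (x, y) * k (x, y))"

abbreviation hh :: line_fun where "hh x \<equiv> h' x / h x"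

lemma strip_Fubini:
 assumes f: "f \<in> L2S" and k: "k \<in> L2S"
 shows "innerS f k = (LBINT x. pair f k x)"
  and "innerS f k = (LBINT y. LBINT x. hat f (x, y) * k (x, y))"
  and "AE x in lborel. integrable lborel (%y. hat f (x, y) * k (x, y))"
  and "AE y in lborel. integrable lborel (%x. hat f (x, y) * k (x, y))"
  and "integrable lborel (pair f k)"
  and "integrable lborel (%y. LBINT x. hat f (x, y) * k (x, y))"
proof -
 have I: "integrable lborel (%z. hat f z * k z)"
  using integrable_mult_L2[OF f k] unfolding leb_integral(2)[OF S_borel] by (simp add: mult.assoc)
 have s: "integrable lborel (swap (%z. hat f z * k z))" using integrable_plane_swap[of "%z. hat f z * k z"] I by blast
 show "innerS f k = (LBINT x. pair f k x)" unfolding l2_inner_S pair_def by (rule plane_Fubini(1)[OF I])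
 have "(LBINT z. swap (%z. hat f z * k z) z) = innerS f k"
  unfolding l2_inner_S using integral_plane_swap[of "%z. hat f z * k z"] borel_measurable_integrable[OF I] by simp
 then show "innerS f k = (LBINT y. LBINT x. hat f (x, y) * k (x, y))"
  using plane_Fubini(1)[OF s] by simp
 show "AE x in lborel. integrable lborel (%y. hat f (x, y) * k (x, y))" by (rule plane_Fubini(2)[OF I])
 show "AE y in lborel. integrable lborel (%x. hat f (x, y) * k (x, y))" using plane_Fubini(2)[OF s] by simp
 show "integrable lborel (pair f k)" unfolding pair_def[abs_def] by (rule plane_Fubini(3)[OF I])
 show "integrable lborel (%y. LBINT x. hat f (x, y) * k (x, y))" using plane_Fubini(3)[OF s] by simp
qed

lemma continuous_L2: "continuous_on UNIV k ==> k \<in> L2S" for k :: plane_fun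
proof -
 assume k: "continuous_on UNIV k"
 then obtain K where "\<forall>z\<in>S. \<bar>k z\<bar> \<le> K" using bounded_on_S by blast
 then show ?thesis
  by (intro L2_bounded_on[OF S_borel S_bounded]) (use borel_measurable_continuous_onI[OF k] S_borel in auto)
qed

lemma pair_measurable:
 assumes "f \<in> L2S" "continuous_on UNIV k"
 shows "pair f k \<in> borel_measurable borel"
 using borel_measurable_integrable[OF strip_Fubini(5)[OF assms(1) continuous_L2[OF assms(2)]]] by simp

lemma pair_outside: "x \<notin> I ==> pair f k x = 0"
 unfolding pair_def by (simp only: hat_section_support(2) not_False_eq_True mult_zero_left Bochner_Integration.integral_zero)

lemma pair_lincomb:
 assumes f: "f \<in> L2S" and g: "g \<in> L2S" and k: "continuous_on UNIV k"
 shows "AE x in lborel. pair (%z. f z + t * g z) k x = pair f k x + t * pair g k x"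
 using strip_Fubini(3)[OF f continuous_L2[OF k]] strip_Fubini(3)[OF g continuous_L2[OF k]]
proof eventually_elim
 case (elim x)
 have "pair (%z. f z + t * g z) k x = (LBINT y. hat f (x, y) * k (x, y) + t * (hat g (x, y) * k (x, y)))"
  unfolding pair_def by (simp add: algebra_simps)
 then show ?case using elim by (simp add: pair_def)
qed

lemma pair_weight: "pair (%z. p (fst z) * j z) k x = p x * pair j k x"
proof -
 have "pair (%z. p (fst z) * j z) k x = (LBINT y. p x * (hat j (x, y) * k (x, y)))"
  unfolding pair_def by (simp add: mult_ac)
 then show ?thesis by (simp add: pair_def)
qed

lemma pair_modes:
 assumes x: "x \<in> I"
 shows "pair phi phi x = 1" "pair phi rho x = 0" "pair rho phi x = 0" "pair rho rho x = kap"
  "pair phi_y phi_y x = (pi / (eps * h x))^2"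
proof -
 have e: "pair k k x = (LBINT y. (hat k (x, y))^2)" for k
  unfolding pair_def by (rule integral_cong_fun) (auto simp: indicator_def power2_eq_square)
 show "pair phi phi x = 1" "pair rho rho x = kap" "pair phi_y phi_y x = (pi / (eps * h x))^2"
  unfolding e by (rule phi_fiber[OF x])+
 show "pair phi rho x = 0" using phi_fiber(2)[OF x] by (simp add: pair_def)
 then show "pair rho phi x = 0" by (simp add: pair_def mult_ac)
qed

text \<open>A function that depends on $x$ only through a weight comes out of the integral over the section.\<close>

lemma inner_weight:
 assumes f: "f \<in> L2S" and p: "p \<in> L2I" and k: "continuous_on UNIV k"
 shows "(%z. p (fst z) * k z) \<in> L2S" "innerS f (%z. p (fst z) * k z) = innerI p (pair f k)"
proof -
 obtain K where "\<And>z. z \<in> S ==> \<bar>k z\<bar> \<le> K" using bounded_on_S[OF k] by blast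
 then show L: "(%z. p (fst z) * k z) \<in> L2S"
  by (rule L2_weight[OF p borel_measurable_continuous_onI[OF k]])
 have "pair f (%z. p (fst z) * k z) x = p x * pair f k x" for x
  using pair_weight[of p f k x] by (simp add: pair_def mult_ac)
 then have "innerS f (%z. p (fst z) * k z) = (LBINT x. p x * pair f k x)"
  using strip_Fubini(1)[OF f L] by simp
 also have "... = innerI p (pair f k)"
  unfolding l2_inner_def LINT_I set_lebesgue_integral_def
  by (rule integral_cong_fun) (use pair_outside[of _ f k] in \<open>auto simp: indicator_def\<close>)
 finally show "innerS f (%z. p (fst z) * k z) = innerI p (pair f k)" .
qed

lemma pair_le:
 assumes f: "f \<in> L2S" and k: "continuous_on UNIV k" and C: "\<And>x. x \<in> I ==> pair k k x \<le> C"
 shows "AE x in lborel. x \<in> I --> (pair f k x)^2 \<le> C * (LBINT y. (hat f (x, y))^2)"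
 using fiber_L2(1)[OF f]
proof eventually_elim
 case (elim x)
 show ?case
 proof
  assume x: "x \<in> I"
  have kL: "(%y. hat k (x, y)) \<in> L2 lborel" by (rule fiber_L2_continuous(1)[OF k x])
  have e: "pair f k x = l2_inner lborel (%y. hat f (x, y)) (%y. hat k (x, y))"
   unfolding pair_def l2_inner_def by (rule integral_cong_fun) (auto simp: indicator_def)
  have e2: "pair k k x = (l2_norm lborel (%y. hat k (x, y)))^2"
   unfolding pair_def l2_norm_power2 l2_inner_def by (rule integral_cong_fun) (auto simp: indicator_def)
  have e3: "(LBINT y. (hat f (x, y))^2) = (l2_norm lborel (%y. hat f (x, y)))^2"
   unfolding l2_norm_power2 l2_inner_self by simp
  have "\<bar>pair f k x\<bar>^2 \<le> (l2_norm lborel (%y. hat f (x, y)) * l2_norm lborel (%y. hat k (x, y)))^2"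
   unfolding e by (rule power_mono[OF l2_Cauchy_Schwarz[OF elim kL]]) simp
  then have "(pair f k x)^2 \<le> (LBINT y. (hat f (x, y))^2) * pair k k x" by (simp only: power2_abs power_mult_distrib[of "l2_norm lborel (%y. hat f (x, y))"] e2 e3)
  also have "... \<le> (LBINT y. (hat f (x, y))^2) * C" by (rule mult_left_mono[OF C[OF x]]) simp
  finally show "(pair f k x)^2 \<le> C * (LBINT y. (hat f (x, y))^2)" by (simp add: mult.commute)
 qed
qed

lemma pair_L2:
 assumes f: "f \<in> L2S" and k: "continuous_on UNIV k" and C: "\<And>x. x \<in> I ==> pair k k x \<le> C"
 shows "pair f k \<in> L2I" "(normI (pair f k))^2 \<le> C * (normS f)^2"
proof -
 note m = pair_measurable[OF f k]
 have ae: "AE x in lborel. (pair f k x)^2 \<le> C * (LBINT y. (hat f (x, y))^2)"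
 proof -
  have "AE x in lborel. x \<in> I --> (pair f k x)^2 \<le> C * (LBINT y. (hat f (x, y))^2)" by (rule pair_le[OF f k C])
  then show ?thesis
  proof eventually_elim
   case (elim x)
   show ?case
   proof (cases "x \<in> I")
    case False
    then have "hat f (x, y) = 0" for y by (rule hat_section_support(2))
    then show ?thesis by (simp only: pair_outside[OF False] zero_power2 Bochner_Integration.integral_zero mult_zero_right order_refl)
   qed (use elim in blast)
  qed
 qed
 have i: "integrable lborel (%x. C * (LBINT y. (hat f (x, y))^2))" using fiber_L2(2)[OF f] by simp
 have I: "integrable lborel (%x. (pair f k x)^2)"
  by (rule integrable_dominated[OF i]) (use m ae in \<open>auto elim!: eventually_mono\<close>)
 have e: "indicator I x * pair f k x = pair f k x" for x by (cases "x \<in> I") (auto simp: pair_outside)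
 show "pair f k \<in> L2I" using m I by (simp add: L2_leb_iff e) (simp add: L2_def)
 have "(normI (pair f k))^2 = (LBINT x. (pair f k x)^2)"
  unfolding l2_norm_power2 l2_inner_self LINT_I set_lebesgue_integral_def
  by (rule integral_cong_fun) (use pair_outside[of _ f k] in \<open>auto simp: indicator_def\<close>)
 also have "... \<le> (LBINT x. C * (LBINT y. (hat f (x, y))^2))" by (rule integral_mono_AE[OF I i ae])
 also have "... = C * (normS f)^2" using fiber_L2(3)[OF f] by simp
 finally show "(normI (pair f k))^2 \<le> C * (normS f)^2" .
qed

lemma weight_L2:
 assumes p: "p \<in> borel_measurable (leb I)" and K: "AE x in leb I. \<bar>p x\<bar> \<le> K" "0 \<le> K"
 shows "(%x. p x * hh x) \<in> L2I" "normI (%x. p x * hh x) \<le> K / l * normI h'"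
proof -
 have m: "(%x. p x * hh x) \<in> borel_measurable (leb I)"
  using p measurable_I[OF h'_meas] measurable_I[OF h_measurable] by measurable
 have i: "integrable (leb I) (%x. (K / l)^2 * (h' x)^2)" using L2_D(2)[OF h'_L2] by simp
 have ae: "AE x in leb I. (p x * hh x)^2 \<le> (K / l)^2 * (h' x)^2"
  using K(1)
 proof eventually_elim
  case (elim x)
  have "\<bar>p x * hh x\<bar> \<le> K * (\<bar>h' x\<bar> / l)"
   unfolding abs_mult abs_divide using elim K(2) h_ge[of x] l_pos h_pos[of x] by (intro mult_mono divide_left_mono) auto
  then have "\<bar>p x * hh x\<bar>^2 \<le> (K * (\<bar>h' x\<bar> / l))^2" by (rule power_mono) simp
  then show ?case by (simp add: power_mult_distrib power_divide)
 qed
 have I: "integrable (leb I) (%x. (p x * hh x)^2)"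
  by (rule integrable_dominated[OF i]) (use m ae in \<open>auto elim!: eventually_mono\<close>)
 show "(%x. p x * hh x) \<in> L2I" using m I by (simp add: L2_def)
 have "(normI (%x. p x * hh x))^2 \<le> (LINT x|leb I. (K / l)^2 * (h' x)^2)"
  unfolding l2_norm_power2 l2_inner_self real_norm_def power2_abs by (rule integral_mono_AE[OF I i ae])
 also have "... = (K / l * normI h')^2" by (simp add: power_mult_distrib power_divide l2_norm_power2 l2_inner_self)
 finally show "normI (%x. p x * hh x) \<le> K / l * normI h'"
  by (rule power2_le_imp_le) (use K(2) l_pos in \<open>simp add: l2_norm_nonneg\<close>)
qed

lemma continuous_weight_L2:
 assumes "continuous_on I v"
 shows "(%x. v x * hh x) \<in> L2I"
proof -
 have "bounded (v ` I)" by (intro compact_imp_bounded compact_continuous_image assms) auto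
 then obtain K where K: "\<And>x. x \<in> I ==> \<bar>v x\<bar> \<le> K" unfolding bounded_iff by fastforce
 have "0 \<le> K" using K[of b] a_pos b_pos by force
 then show ?thesis
  by (intro weight_L2(1)[of _ K] L2_D(1)[OF L2_interval_bounded_measurable[OF assms]]) (use K in \<open>auto simp: AE_I_iff\<close>)
qed

section \<open>The first mode component of a function in the form domain\<close>

text \<open>On almost every horizontal line the function is absolutely continuous, and so is its product
 with the mode; integration by parts there, followed by Fubini, differentiates the component.\<close>

lemma pair_phi_by_parts:
 assumes u: "u \<in> strip_domain bc a b h eps" and G: "is_weak_grad S u G"
  and \<eta>: "c1c (if bc = Dir then UNIV else {-a<..<b}) \<eta> \<eta>'"
 shows "(LINT x|leb I. pair u phi x * \<eta>' x) =
  - (LINT x|leb I. (pair (gx G) phi x + hh x * pair u rho x) * \<eta> x)"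
proof -
 note L = strip_domainD(2)[OF u] and gL = L2_fst[OF is_weak_gradD(1)[OF G]]
 let ?g = "%z. fst (G z)"
 note c = phi_continuous[of UNIV]
 have \<eta>c: "continuous_on I \<eta>" "continuous_on I \<eta>'" using c1cD(2,3)[OF \<eta>] by (auto intro: continuous_on_subset)
 have \<eta>L: "\<eta> \<in> L2I" "\<eta>' \<in> L2I" by (intro L2_interval_bounded_measurable \<eta>c)+
 have \<eta>h: "(%x. \<eta> x * hh x) \<in> L2I" by (rule continuous_weight_L2[OF \<eta>c(1)])
 let ?k1 = "%z. \<eta>' (fst z) * phi z" and ?k2 = "%z. \<eta> (fst z) * phi z" and ?k3 = "%z. (\<eta> (fst z) * hh (fst z)) * rho z"
 note w1 = inner_weight[OF L \<eta>L(2) c(1)] and w2 = inner_weight[OF gL \<eta>L(1) c(1)] and w3 = inner_weight[OF L \<eta>h c(3)]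
 have "innerS u ?k1 + innerS u ?k3 + innerS ?g ?k2 =
  (LBINT y. (LBINT x. hat u (x, y) * ?k1 (x, y)) + (LBINT x. hat u (x, y) * ?k3 (x, y)) + (LBINT x. hat ?g (x, y) * ?k2 (x, y)))"
  unfolding strip_Fubini(2)[OF L w1(1)] strip_Fubini(2)[OF L w3(1)] strip_Fubini(2)[OF gL w2(1)]
  using strip_Fubini(6)[OF L w1(1)] strip_Fubini(6)[OF L w3(1)] strip_Fubini(6)[OF gL w2(1)] by simp
 also have "... = (LBINT y :: real. 0)"
 proof (rule integral_cong_AE)
  show "(%y. (LBINT x. hat u (x, y) * ?k1 (x, y)) + (LBINT x. hat u (x, y) * ?k3 (x, y)) + (LBINT x. hat ?g (x, y) * ?k2 (x, y))) \<in> borel_measurable lborel"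
   using strip_Fubini(6)[OF L w1(1)] strip_Fubini(6)[OF L w3(1)] strip_Fubini(6)[OF gL w2(1)]
   by (intro borel_measurable_add borel_measurable_integrable)
  show "AE y in lborel. (LBINT x. hat u (x, y) * ?k1 (x, y)) + (LBINT x. hat u (x, y) * ?k3 (x, y)) + (LBINT x. hat ?g (x, y) * ?k2 (x, y)) = 0"
   using domain_sections[OF u G] strip_Fubini(4)[OF L w1(1)] strip_Fubini(4)[OF L w3(1)] strip_Fubini(4)[OF gL w2(1)]
  proof eventually_elim
   case (elim y)
   then obtain v where v: "ac_on (-a) b v (%t. hat ?g (t, y))" "AE x in lborel. x \<in> {-a<..<b} --> hat u (x, y) = v x"
    "bc = Dir ==> v (-a) = 0 \<and> v b = 0" by auto
   have p: "ac_on (-a) b (%x. phi (x, y) * \<eta> x) (%x. phi (x, y) * \<eta>' x + phi_x (x, y) * \<eta> x)"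
    by (rule ac_on_mult[OF phi_ac c1c_ac_on[OF \<eta>]])
   have ends: "v b * \<eta> b = 0 \<and> v (-a) * \<eta> (-a) = 0"
   proof (cases bc)
    case Dir with v(3) show ?thesis by simp
   next
    case DirNeu
    then have "\<eta> b = 0" "\<eta> (-a) = 0" using c1c_zero_outside(1)[OF \<eta>, of b] c1c_zero_outside(1)[OF \<eta>, of "-a"] by auto
    then show ?thesis by simp
   qed
   have ab': "-a \<le> b" using a_pos b_pos by simp
   have "(LBINT x. hat u (x, y) * ?k1 (x, y)) + (LBINT x. hat u (x, y) * ?k3 (x, y)) + (LBINT x. hat ?g (x, y) * ?k2 (x, y))
    = (LBINT x. hat u (x, y) * ?k1 (x, y) + hat u (x, y) * ?k3 (x, y) + hat ?g (x, y) * ?k2 (x, y))"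
    using elim by simp
   also have "... = (LINT x:I|lborel. v x * (phi (x, y) * \<eta>' x + phi_x (x, y) * \<eta> x) + hat ?g (x, y) * (phi (x, y) * \<eta> x))"
    unfolding set_lebesgue_integral_def
   proof (rule integral_cong_AE)
    show "AE x in lborel. hat u (x, y) * ?k1 (x, y) + hat u (x, y) * ?k3 (x, y) + hat ?g (x, y) * ?k2 (x, y)
     = indicator I x *\<^sub>R (v x * (phi (x, y) * \<eta>' x + phi_x (x, y) * \<eta> x) + hat ?g (x, y) * (phi (x, y) * \<eta> x))"
     using v(2) AE_x_inside
    proof eventually_elim
     case (elim x)
     show ?case
     proof (cases "x \<in> I")
      case True
      then have "hat u (x, y) = v x" using elim by blast
      with True show ?thesis by (simp add: phi_x_def algebra_simps)
     qed (auto simp: mem_S)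
    qed
    show "(%x. hat u (x, y) * ?k1 (x, y) + hat u (x, y) * ?k3 (x, y) + hat ?g (x, y) * ?k2 (x, y)) \<in> borel_measurable lborel"
     using elim by (intro borel_measurable_integrable Bochner_Integration.integrable_add) simp_all
    show "(%x. indicator I x *\<^sub>R (v x * (phi (x, y) * \<eta>' x + phi_x (x, y) * \<eta> x) + hat ?g (x, y) * (phi (x, y) * \<eta> x))) \<in> borel_measurable lborel"
     using ac_on_integral_by_parts(1)[OF v(1) p ab'] unfolding set_integrable_def by (rule borel_measurable_integrable)
   qed
   also have "... = 0" using ac_on_integral_by_parts(2)[OF v(1) p ab'] ends by (auto simp: algebra_simps)
   finally show ?case .
  qed
 qed simp
 finally have "innerI \<eta>' (pair u phi) + innerI (%x. \<eta> x * hh x) (pair u rho) + innerI \<eta> (pair ?g phi) = 0"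
  by (simp only: w1(2) w2(2) w3(2) Bochner_Integration.integral_zero)
 moreover have "innerI (%x. \<eta> x * hh x) (pair u rho) + innerI \<eta> (pair ?g phi)
   = (LINT x|leb I. (pair ?g phi x + hh x * pair u rho x) * \<eta> x)"
 proof -
  have r: "pair u rho \<in> L2I" by (rule pair_L2(1)[OF L c(3), of kap]) (simp add: pair_modes)
  have p: "pair ?g phi \<in> L2I" by (rule pair_L2(1)[OF gL c(1), of 1]) (simp add: pair_modes)
  show ?thesis unfolding l2_inner_def
   using integrable_mult_L2[OF \<eta>h r] integrable_mult_L2[OF \<eta>L(1) p]
   by (subst Bochner_Integration.integral_add[symmetric]) (auto intro!: integral_cong_fun simp: algebra_simps)
 qed
 ultimately show ?thesis by (simp add: l2_inner_def mult.commute)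
qed

text \<open>The Dirichlet conditions at the ends are detected by test functions that do not vanish there.\<close>

lemma rep1I:
 assumes \<xi>: "\<xi> \<in> L2I" and g: "g \<in> L2I"
  and w: "\<And>\<eta> \<eta>'. c1c (if bc = Dir then UNIV else {-a<..<b}) \<eta> \<eta>' ==> (LINT x|leb I. \<xi> x * \<eta>' x) = - (LINT x|leb I. g x * \<eta> x)"
 shows "\<exists>v. rep1 bc \<xi> v g"
proof -
 have G: "is_weak_grad I \<xi> g" unfolding is_weak_grad_interval_iff
 proof (intro conjI allI impI g)
  fix \<eta> \<eta>' assume "c1c {-a<..<b} \<eta> \<eta>'"
  then show "(LINT x|leb I. \<xi> x * \<eta>' x) = - (LINT x|leb I. g x * \<eta> x)" by (intro w) (rule c1c_mono, auto)
 qed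
 obtain v where v: "ac_on (-a) b v g" "AE x in leb I. \<xi> x = v x" using weak_grad_interval_imp_ac[OF ab_less \<xi> G] .
 have vL: "v \<in> L2I" by (rule ac_on_imp_weak_grad(1)[OF ab_less v(1) g])
 have ab': "-a \<le> b" using a_pos b_pos by simp
 have e: "v b * \<eta> b = v (-a) * \<eta> (-a)" if \<eta>: "c1c UNIV \<eta> \<eta>'" and bc: "bc = Dir" for \<eta> \<eta>'
 proof -
  have \<eta>c: "\<eta> \<in> L2I" "\<eta>' \<in> L2I"
   using c1cD(2,3)[OF \<eta>] by (auto intro!: L2_interval_bounded_measurable intro: continuous_on_subset)
  have "(LINT x|leb I. v x * \<eta>' x) = (LINT x|leb I. \<xi> x * \<eta>' x)"
   by (rule integral_cong_AE) (use v(2) L2_D(1)[OF \<xi>] L2_D(1)[OF vL] L2_D(1)[OF \<eta>c(2)] in \<open>auto elim: eventually_mono\<close>)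
  then have "(LINT x|leb I. v x * \<eta>' x + g x * \<eta> x) = 0"
   using w[of \<eta> \<eta>'] \<eta> bc integrable_mult_L2[OF vL \<eta>c(2)] integrable_mult_L2[OF g \<eta>c(1)] by simp
  then show ?thesis using ac_on_integral_by_parts(2)[OF v(1) c1c_ac_on[OF \<eta>] ab'] by (simp add: LINT_I)
 qed
 have "v b = 0 \<and> v (-a) = 0" if bc: "bc = Dir"
 proof
  have lim: "(%n. v b * bump c d n b) \<longlonglongrightarrow> v b * indicator {c<..<d} b" "(%n. v (-a) * bump c d n (-a)) \<longlonglongrightarrow> v (-a) * indicator {c<..<d} (-a)" for c d
   by (intro tendsto_intros bump_tendsto)+
  have "v b * indicator {c<..<d} b = v (-a) * indicator {c<..<d} (-a)" for c d
   using LIMSEQ_unique[OF lim(1)[of c d]] lim(2)[of c d] e[OF c1c_mono[OF c1c_bump] bc, of c d] by simp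
  from this[of 0 "b + 1"] this[of "- a - 1" 0] show "v b = 0" "v (-a) = 0" using a_pos b_pos by auto
 qed
 then show ?thesis using v g L2_D(1)[OF \<xi>] unfolding rep1_def by auto
qed

text \<open>Differentiating $\int u\,\phi\,dy$ produces $\int \partial_x u\,\phi\,dy$ and the term with $\partial_x\phi$, which is
 $h'/h$ times a continuous function.\<close>

lemma mode_rep1:
 assumes u: "u \<in> strip_domain bc a b h eps" and G: "is_weak_grad S u G"
 shows "\<exists>v. rep1 bc (pair u phi) v (%x. pair (gx G) phi x + hh x * pair u rho x)"
proof (rule rep1I)
 note L = strip_domainD(2)[OF u] and gL = L2_fst[OF is_weak_gradD(1)[OF G]]
 note c = phi_continuous[of UNIV]
 show "pair u phi \<in> L2I" by (rule pair_L2(1)[OF L c(1), of 1]) (simp add: pair_modes)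
 have p: "pair (gx G) phi \<in> L2I" by (rule pair_L2(1)[OF gL c(1), of 1]) (simp add: pair_modes)
 define K where "K = (normS u)^2 / (a + b) + 2 * (normS u * normS (gx G))"
 have pr: "AE x in lborel. x \<in> I --> (pair u rho x)^2 \<le> kap * (LBINT y. (hat u (x, y))^2)"
  by (rule pair_le[OF L c(3)]) (simp add: pair_modes)
 have "AE x in leb I. \<bar>pair u rho x\<bar> \<le> sqrt (kap * K)"
  unfolding AE_I_iff using section_norm_bound[OF u G] pr
 proof (eventually_elim, intro impI)
  fix x assume *: "x \<in> I --> (LBINT y. (hat u (x, y))^2) \<le> (normS u)^2 / (a + b) + 2 * (normS u * normS (gx G))"
   "x \<in> I --> (pair u rho x)^2 \<le> kap * (LBINT y. (hat u (x, y))^2)" and x: "x \<in> I"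
  have "(pair u rho x)^2 \<le> kap * (LBINT y. (hat u (x, y))^2)" using * x by blast
  also have "... \<le> kap * K" using * x unfolding K_def by (intro mult_left_mono) auto
  finally show "\<bar>pair u rho x\<bar> \<le> sqrt (kap * K)" using real_sqrt_le_mono by fastforce
 qed
 moreover have "0 \<le> sqrt (kap * K)" unfolding K_def using a_pos b_pos by (simp add: l2_norm_nonneg)
 ultimately have "(%x. pair u rho x * hh x) \<in> L2I"
  by (rule weight_L2(1)[OF measurable_I[OF pair_measurable[OF L c(3)]]])
 from L2_add[OF p this] show "(%x. pair (gx G) phi x + hh x * pair u rho x) \<in> L2I"
  by (simp add: mult.commute)
qed (rule pair_phi_by_parts[OF u G])

end

context narrow_strip
begin

section \<open>Lifting functions of the interval to the strip\<close>

lemma interior_inside: "z \<in> interior S ==> -a < fst z \<and> fst z < b"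
proof -
 assume "z \<in> interior S"
 then obtain e where e: "e > 0" "ball z e \<subseteq> S" unfolding mem_interior by blast
 have "(fst z + s, snd z) \<in> S" if "\<bar>s\<bar> < e" for s
  using e(2) that by (auto simp: subset_iff mem_ball dist_prod_def dist_real_def)
 from this[of "e / 2"] this[of "- e / 2"] e(1) show ?thesis by (auto simp: mem_S)
qed

definition lift_grad :: "(real => real) => (real => real) => real \<times> real => real \<times> real" where
 "lift_grad v g z = (g (fst z) * phi z + (v (fst z) * hh (fst z)) * rho z, v (fst z) * phi_y z)"

lemma rep1_weights:
 assumes "rep1 bc \<xi> v g"
 shows "g \<in> L2I" "(%x. v x * hh x) \<in> L2I" "v \<in> L2I" "\<xi> \<in> L2I"
 using rep1D(2,7,8)[OF assms] continuous_weight_L2[OF ac_on_imp_continuous[OF rep1D(1)[OF assms]]] by auto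

lemma inner_rep1:
 assumes r: "rep1 bc \<xi> v g" and p: "p \<in> L2I"
 shows "innerI \<xi> p = innerI v p"
 unfolding l2_inner_def
 by (rule integral_cong_AE) (use rep1D(3,4)[OF r] L2_D(1)[OF rep1D(7)[OF r]] L2_D(1)[OF p] in \<open>auto elim: eventually_mono\<close>)

lemma lift_grad_L2:
 assumes r: "rep1 bc \<xi> v g"
 shows "(%z. fst (lift_grad v g z)) \<in> L2S" "(%z. snd (lift_grad v g z)) \<in> L2S"
  and "lift_grad v g \<in> L2S"
proof -
 note W = rep1_weights[OF r] and c = phi_continuous[of UNIV]
 note i = inner_weight(1)[OF L2_zero]
 show 1: "(%z. fst (lift_grad v g z)) \<in> L2S" and 2: "(%z. snd (lift_grad v g z)) \<in> L2S"
  unfolding lift_grad_def fst_conv snd_conv by (rule L2_add[OF i[OF W(1) c(1)] i[OF W(2) c(3)]], rule i[OF W(3) c(2)])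
 show "lift_grad v g \<in> L2S" using L2_pair[OF 1 2] by simp
qed

lemma inner_lift:
 assumes r: "rep1 bc \<xi> v g" and f: "f \<in> L2S"
 shows "lift \<xi> \<in> L2S" "innerS f (lift \<xi>) = innerI \<xi> (pair f phi)"
  "innerS f (%z. fst (lift_grad v g z)) = innerI g (pair f phi) + innerI (%x. v x * hh x) (pair f rho)"
  "innerS f (%z. snd (lift_grad v g z)) = innerI v (pair f phi_y)"
proof -
 note W = rep1_weights[OF r] and c = phi_continuous[of UNIV]
 show "lift \<xi> \<in> L2S" "innerS f (lift \<xi>) = innerI \<xi> (pair f phi)"
  unfolding mode_lift_eq by (rule inner_weight[OF f W(4) c(1)])+
 show "innerS f (%z. fst (lift_grad v g z)) = innerI g (pair f phi) + innerI (%x. v x * hh x) (pair f rho)"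
  unfolding lift_grad_def fst_conv inner_weight(2)[OF f W(1) c(1), symmetric] inner_weight(2)[OF f W(2) c(3), symmetric]
  by (rule l2_inner_add_right[OF inner_weight(1)[OF f W(1) c(1)] inner_weight(1)[OF f W(2) c(3)] f])
 show "innerS f (%z. snd (lift_grad v g z)) = innerI v (pair f phi_y)"
  unfolding lift_grad_def snd_conv by (rule inner_weight(2)[OF f W(3) c(2)])
qed

text \<open>A test function vanishes near the curved boundary, so the mode may be differentiated there as
 the smooth function on the whole plane.\<close>

lemma lift_weak_grad:
 assumes r: "rep1 bc \<xi> v g"
 shows "is_weak_grad S (lift \<xi>) (lift_grad v g)"
 unfolding is_weak_grad_plane_iff
proof (intro conjI ballI lift_grad_L2(3)[OF r])
 fix T assume T: "T \<in> test_functions S"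
 let ?Tx = "%z. frechet_derivative T (at z) (1, 0)" and ?Ty = "%z. frechet_derivative T (at z) (0, 1)"
 obtain R where Td: "\<And>x y. ((%x. T (x, y)) has_real_derivative ?Tx (x, y)) (at x)"
   "\<And>x y. ((%y. T (x, y)) has_real_derivative ?Ty (x, y)) (at y)"
  and Tc: "continuous_on UNIV T" "continuous_on UNIV ?Tx" "continuous_on UNIV ?Ty"
  and T0: "\<And>z. z \<notin> interior S ==> T z = 0 \<and> ?Tx z = 0 \<and> ?Ty z = 0"
  and "\<And>z. \<bar>T z\<bar> \<le> R" "\<And>z. \<bar>?Tx z\<bar> \<le> R" "\<And>z. \<bar>?Ty z\<bar> \<le> R"
  by (rule plane_test_functionD[OF T]) (rule that; assumption)
 note W = rep1_weights[OF r] and c = phi_continuous[of UNIV] and A = rep1D[OF r]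
 note TL = continuous_L2[OF Tc(1)] continuous_L2[OF Tc(2)] continuous_L2[OF Tc(3)]
 have out: "z \<notin> S ==> T z = 0 \<and> ?Tx z = 0 \<and> ?Ty z = 0" for z using T0 interior_subset[of S] by blast
 have hatT: "hat T z = T z" "hat ?Tx z = ?Tx z" "hat ?Ty z = ?Ty z" for z
  using out[of z] by (cases "z \<in> S"; simp)+
 have ab': "-a \<le> b" using a_pos b_pos by simp
 have pL: "pair ?Tx phi \<in> L2I" "pair ?Ty phi \<in> L2I" "pair T phi \<in> L2I"
  by (rule pair_L2(1)[OF TL(2) c(1), of 1] pair_L2(1)[OF TL(3) c(1), of 1] pair_L2(1)[OF TL(1) c(1), of 1], simp add: pair_modes)+
 let ?kv = "%z. v (fst z) * phi z" and ?kr = "%z. (v (fst z) * hh (fst z)) * rho z" and ?kg = "%z. g (fst z) * phi z"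
 note w1 = inner_weight[OF TL(2) W(3) c(1)] and w2 = inner_weight[OF TL(1) W(1) c(1)] and w3 = inner_weight[OF TL(1) W(2) c(3)]
 have "innerS ?Tx ?kv + innerS T ?kr + innerS T ?kg =
  (LBINT y. (LBINT x. hat ?Tx (x, y) * ?kv (x, y)) + (LBINT x. hat T (x, y) * ?kr (x, y)) + (LBINT x. hat T (x, y) * ?kg (x, y)))"
  unfolding strip_Fubini(2)[OF TL(2) w1(1)] strip_Fubini(2)[OF TL(1) w2(1)] strip_Fubini(2)[OF TL(1) w3(1)]
  using strip_Fubini(6)[OF TL(2) w1(1)] strip_Fubini(6)[OF TL(1) w2(1)] strip_Fubini(6)[OF TL(1) w3(1)] by simp
 also have "... = 0"
 proof (rule integral_eq_zero_AE)
  show "AE y in lborel. (LBINT x. hat ?Tx (x, y) * ?kv (x, y)) + (LBINT x. hat T (x, y) * ?kr (x, y)) + (LBINT x. hat T (x, y) * ?kg (x, y)) = 0"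
   using strip_Fubini(4)[OF TL(2) w1(1)] strip_Fubini(4)[OF TL(1) w2(1)] strip_Fubini(4)[OF TL(1) w3(1)]
  proof eventually_elim
   case (elim y)
   have p: "ac_on (-a) b (%x. v x * phi (x, y)) (%x. v x * phi_x (x, y) + g x * phi (x, y))"
    by (rule ac_on_mult[OF A(1) phi_ac])
   have t: "ac_on (-a) b (%x. T (x, y)) (%x. ?Tx (x, y))"
    by (rule ac_on_smooth[OF Td(1)]) (rule continuous_on_compose2[OF Tc(2)], auto intro: continuous_intros)
   have z: "T (b, y) = 0" "T (-a, y) = 0" using T0[of "(b, y)"] T0[of "(-a, y)"] interior_inside by fastforce+
   have "(LBINT x. hat ?Tx (x, y) * ?kv (x, y)) + (LBINT x. hat T (x, y) * ?kr (x, y)) + (LBINT x. hat T (x, y) * ?kg (x, y))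
    = (LBINT x. hat ?Tx (x, y) * ?kv (x, y) + hat T (x, y) * ?kr (x, y) + hat T (x, y) * ?kg (x, y))"
    using elim by simp
   also have "... = (LINT x:I|lborel. (v x * phi (x, y)) * ?Tx (x, y) + (v x * phi_x (x, y) + g x * phi (x, y)) * T (x, y))"
    unfolding set_lebesgue_integral_def hatT
   proof (rule integral_cong_fun[OF refl])
    fix x
    have "T (x, y) = 0 \<and> ?Tx (x, y) = 0" if "x \<notin> I" using out[of "(x, y)"] that by (auto simp: mem_S)
    then show "?Tx (x, y) * ?kv (x, y) + T (x, y) * ?kr (x, y) + T (x, y) * ?kg (x, y)
     = indicator I x *\<^sub>R ((v x * phi (x, y)) * ?Tx (x, y) + (v x * phi_x (x, y) + g x * phi (x, y)) * T (x, y))"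
     by (cases "x \<in> I") (simp_all add: phi_x_def algebra_simps)
   qed
   also have "... = 0" using ac_on_integral_by_parts(2)[OF p t ab'] z by simp
   finally show ?case .
  qed
 qed
 finally have X: "innerI v (pair ?Tx phi) + innerI (%x. v x * hh x) (pair T rho) + innerI g (pair T phi) = 0"
  by (simp only: w1(2) w2(2) w3(2))
 have "(LINT z|leb S. lift \<xi> z * ?Tx z) = innerS ?Tx (lift \<xi>)"
  "(LINT z|leb S. fst (lift_grad v g z) * T z) = innerS T (%z. fst (lift_grad v g z))"
  "(LINT z|leb S. lift \<xi> z * ?Ty z) = innerS ?Ty (lift \<xi>)"
  "(LINT z|leb S. snd (lift_grad v g z) * T z) = innerS T (%z. snd (lift_grad v g z))"
  by (simp_all add: l2_inner_def mult.commute)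
 note eqs = this[unfolded inner_lift(2)[OF r TL(2)] inner_lift(2)[OF r TL(3)] inner_lift(3,4)[OF r TL(1)] inner_rep1[OF r pL(1)] inner_rep1[OF r pL(2)]]
 show "(LINT z|leb S. lift \<xi> z * ?Tx z) = - (LINT z|leb S. fst (lift_grad v g z) * T z)"
  unfolding eqs using X by simp
 have "pair ?Ty phi x = - pair T phi_y x" if x: "x \<in> I" for x
 proof -
  let ?w = "eps * h x"
  have s: "ac_on 0 ?w (%y. phi (x, y)) (%y. phi_y (x, y))" "ac_on 0 ?w (%y. T (x, y)) (%y. ?Ty (x, y))"
   by (rule ac_on_smooth[OF phi_y_derivative(1) section_continuous[OF c(2)]], rule ac_on_smooth[OF Td(2) section_continuous[OF Tc(3)]])
  have e: "(LBINT y. f (x, y) * k (x, y)) = (LINT y:{0..?w}|lborel. k (x, y) * f (x, y))"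
   if "\<And>z. z \<notin> S ==> f z = 0" for f k :: plane_fun
   unfolding set_lebesgue_integral_def
  proof (rule integral_cong_fun[OF refl])
   show "f (x, y) * k (x, y) = indicator {0..?w} y *\<^sub>R (k (x, y) * f (x, y))" for y
    using that[of "(x, y)"] by (cases "y \<in> {0..?w}") (auto simp: mem_S)
  qed
  have i: "set_integrable lborel {0..?w} (%y. phi (x, y) * ?Ty (x, y))" "set_integrable lborel {0..?w} (%y. phi_y (x, y) * T (x, y))"
   by (intro borel_integrable_atLeastAtMost' continuous_on_mult section_continuous[OF c(1)] section_continuous[OF c(2)]
     section_continuous[OF Tc(1)] section_continuous[OF Tc(3)])+
  have z: "T (x, ?w) = 0" "T (x, 0) = 0" using out[of "(x, ?w)"] out[of "(x, 0)"] by (auto simp: mem_S)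
  have "pair ?Ty phi x + pair T phi_y x = (LINT y:{0..?w}|lborel. phi (x, y) * ?Ty (x, y) + phi_y (x, y) * T (x, y))"
   unfolding pair_def hatT set_integral_add(2)[OF i] using e[of ?Ty phi] e[of T phi_y] out by simp
  also have "... = 0" using ac_on_integral_by_parts(2)[OF s] width_pos[of x] z by simp
  finally show ?thesis by simp
 qed
 then have "innerI v (pair ?Ty phi) = innerI v (%x. - pair T phi_y x)"
  unfolding l2_inner_def by (intro integral_cong_fun) auto
 then have "innerI v (pair ?Ty phi) = - innerI v (pair T phi_y)"
  by (simp add: l2_inner_def)
 then show "(LINT z|leb S. lift \<xi> z * ?Ty z) = - (LINT z|leb S. snd (lift_grad v g z) * T z)"
  unfolding eqs .
qed

text \<open>The lift vanishes at the bottom and the top because the sine does, and at the sides if the function on the interval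
 does.\<close>

lemma lift_in_domain:
 assumes r: "rep1 bc \<xi> v g"
 shows "lift \<xi> \<in> strip_domain bc a b h eps"
proof -
 note A = rep1D[OF r] and c = phi_continuous[of UNIV]
 have "lift \<xi> \<in> H1 S" by (rule H1I[OF inner_lift(1)[OF r L2_zero] lift_weak_grad[OF r]])
 moreover have "vanishes_bottom_top a b h eps (lift \<xi>)"
  unfolding vanishes_bottom_top_def
 proof (intro exI[of _ "lift \<xi>"] conjI AE_I2 refl)
  fix x
  have "isCont (%y. \<xi> x * phi (x, y)) y" for y
   by (intro continuous_intros continuous_on_interior[OF section_continuous[OF c(1), of UNIV]]) simp
  then have l: "((%y. \<xi> x * phi (x, y)) \<longlongrightarrow> \<xi> x * phi (x, y)) (at y)" for y by (simp add: isCont_def)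
  have z: "phi (x, 0) = 0" "phi (x, eps * h x) = 0" using eps_pos h_pos[of x] by (simp_all add: phi_def)
  show "((%y. lift \<xi> (x, y)) \<longlongrightarrow> 0) (at_right 0)" "((%y. lift \<xi> (x, y)) \<longlongrightarrow> 0) (at_left (eps * h x))"
   using l[of 0] l[of "eps * h x"] by (auto simp: mode_lift_eq z filterlim_at_split)
 qed
 moreover have "vanishes_sides a b h eps (lift \<xi>)" if bc: "bc = Dir"
  unfolding vanishes_sides_def
 proof (intro exI[of _ "%z. v (fst z) * phi z"] conjI)
  have "AE z in (lborel :: (real \<times> real) measure). fst z \<in> I --> \<xi> (fst z) = v (fst z)"
   by (rule AE_fst) (use A(4) in \<open>simp add: AE_I_iff\<close>)
  then show "AE z in leb S. v (fst z) * phi z = lift \<xi> z"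
   unfolding AE_leb[OF S_borel] by (rule eventually_mono) (auto simp: mem_S mode_lift_eq)
  have "((%x. v x * phi (x, y)) \<longlongrightarrow> v t * phi (t, y)) (at t within I)" if "t \<in> I" for t y
   using ac_on_imp_continuous[OF ac_on_mult[OF A(1) phi_ac], of y] that by (auto simp: continuous_on)
  from this[of "-a"] this[of b]
  show "AE y in leb {0<..<eps * h (-a)}. ((%x. v (fst (x, y)) * phi (x, y)) \<longlongrightarrow> 0) (at_right (-a))"
   "AE y in leb {0<..<eps * h b}. ((%x. v (fst (x, y)) * phi (x, y)) \<longlongrightarrow> 0) (at_left b)"
   using A(5,6)[OF bc] ab_less by (simp_all add: at_within_Icc_at_right at_within_Icc_at_left)
 qed
 ultimately show ?thesis by (cases bc) auto
qed

section \<open>The form of the strip on the mode space and its complement\<close>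

abbreviation "K \<equiv> pi^2 / (M^2 * eps^2)"
abbreviation "A \<equiv> strip_form a b h M eps"
abbreviation "dom2 bc \<equiv> strip_domain bc a b h eps"

lemma strip_form_eq:
 assumes u: "u \<in> dom2 bc" "is_weak_grad S u G" and v: "v \<in> dom2 bc" "is_weak_grad S v H"
 shows "A u v = innerS (gx G) (gx H) + innerS (gy G) (gy H) - K * innerS u v"
proof -
 note uL = strip_domainD(1,2)[OF u(1)] and vL = strip_domainD(1,2)[OF v(1)]
 note GL = is_weak_gradD(1)[OF u(2)] and HL = is_weak_gradD(1)[OF v(2)]
 note WL = is_weak_gradD(1)[OF H1_weak_grad[OF uL(1)]] is_weak_gradD(1)[OF H1_weak_grad[OF vL(1)]]
 note i = integrable_mult_L2[OF L2_fst[OF GL] L2_fst[OF HL]] integrable_mult_L2[OF L2_snd[OF GL] L2_snd[OF HL]] integrable_mult_L2[OF uL(2) vL(2)]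
 have "A u v = (LINT z|leb S. (fst (G z) * fst (H z) + snd (G z) * snd (H z)) - K * (u z * v z))"
  unfolding strip_form_def
 proof (rule integral_cong_AE)
  show "AE z in leb S. weak_grad S u z \<bullet> weak_grad S v z - K * (u z * v z)
   = (fst (G z) * fst (H z) + snd (G z) * snd (H z)) - K * (u z * v z)"
   using weak_grad_unique[OF H1_weak_grad[OF uL(1)] u(2)] weak_grad_unique[OF H1_weak_grad[OF vL(1)] v(2)]
   by eventually_elim (simp add: inner_prod_def)
  show "(%z. weak_grad S u z \<bullet> weak_grad S v z - K * (u z * v z)) \<in> borel_measurable (leb S)"
   using borel_measurable_integrable[OF integrable_inner_L2[OF WL]] borel_measurable_integrable[OF i(3)] by measurable
  show "(%z. (fst (G z) * fst (H z) + snd (G z) * snd (H z)) - K * (u z * v z)) \<in> borel_measurable (leb S)"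
   using i[THEN borel_measurable_integrable] by measurable
 qed
 then show ?thesis using i by (simp add: l2_inner_def)
qed

lemma strip_form_lift:
 assumes u: "u \<in> dom2 bc" "is_weak_grad S u G" and r: "rep1 bc \<xi> v g"
 shows "A u (lift \<xi>) = innerI g (pair (gx G) phi) + innerI (%x. v x * hh x) (pair (gx G) rho)
  + innerI v (pair (gy G) phi_y) - K * innerI \<xi> (pair u phi)"
 using strip_form_eq[OF u lift_in_domain[OF r] lift_weak_grad[OF r]]
  inner_lift(3)[OF r L2_fst[OF is_weak_gradD(1)[OF u(2)]]] inner_lift(4)[OF r L2_snd[OF is_weak_gradD(1)[OF u(2)]]]
  inner_lift(2)[OF r strip_domainD(2)[OF u(1)]] by simp

lemma pair_lift:
 assumes r: "rep1 bc \<xi> v g"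
 shows "x \<in> I ==> pair (lift \<xi>) phi x = \<xi> x"
  "AE x in lborel. x \<in> I --> pair (gx (lift_grad v g)) phi x = g x"
  "AE x in lborel. x \<in> I --> pair (gx (lift_grad v g)) rho x = kap * (v x * hh x)"
  "x \<in> I ==> pair (gy (lift_grad v g)) phi_y x = (pi / (eps * h x))^2 * v x"
proof -
 note W = rep1_weights[OF r] and c = phi_continuous[of UNIV]
 note i = inner_weight(1)[OF L2_zero W(1) c(1)] inner_weight(1)[OF L2_zero W(2) c(3)]
 have *: "AE x in lborel. pair (gx (lift_grad v g)) k x = g x * pair phi k x + v x * hh x * pair rho k x"
  if k: "continuous_on UNIV k" for k
  using pair_lincomb[OF i k, of 1] unfolding pair_weight[of g] pair_weight[of "%x. v x * hh x"] by (simp add: lift_grad_def)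
 show "AE x in lborel. x \<in> I --> pair (gx (lift_grad v g)) phi x = g x"
  using *[OF c(1)] by (rule eventually_mono) (auto simp: pair_modes)
 show "AE x in lborel. x \<in> I --> pair (gx (lift_grad v g)) rho x = kap * (v x * hh x)"
  using *[OF c(3)] by (rule eventually_mono) (auto simp: pair_modes)
 show "x \<in> I ==> pair (lift \<xi>) phi x = \<xi> x" "x \<in> I ==> pair (gy (lift_grad v g)) phi_y x = (pi / (eps * h x))^2 * v x"
  unfolding mode_lift_eq pair_weight lift_grad_def snd_conv by (simp_all add: pair_modes)
qed

text \<open>The one-dimensional form is the restriction of the form of the strip to the mode space. The
 constant $\pi^2/3+1/4$ is the squared norm of the derivative of the mode, relative to $h'/h$.\<close>

lemma strip_form_lift_lift:
 assumes r: "rep1 bc \<xi> v g" and s: "rep1 bc \<zeta> w k"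
 shows "A (lift \<xi>) (lift \<zeta>) = q \<xi> \<zeta>"
proof -
 note W = rep1_weights[OF r] and X = rep1_weights[OF s]
 note dL = lift_grad_L2[OF r]
 note lL = inner_lift(1)[OF r L2_zero] and c = phi_continuous[of UNIV]
 have m: "(%x. f x) \<in> borel_measurable (leb I)" if "f \<in> L2I" for f :: line_fun using L2_D(1)[OF that] .
 have pm: "pair f j \<in> borel_measurable (leb I)" if "f \<in> L2S" "continuous_on UNIV j" for f j
  by (rule measurable_I[OF pair_measurable[OF that]])
 have 1: "innerI k (pair (gx (lift_grad v g)) phi) = innerI k g"
  unfolding l2_inner_def
  by (rule integral_cong_AE) (use m[OF X(1)] m[OF W(1)] pm[OF dL(1) c(1)] pair_lift(2)[OF r] in \<open>auto simp: AE_I_iff elim!: eventually_mono\<close>)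
 define vh wh where "vh x = v x * hh x" and "wh x = w x * hh x" for x
 note W2 = W(2)[folded vh_def] and X2 = X(2)[folded wh_def]
 have 2: "innerI (%x. w x * hh x) (pair (gx (lift_grad v g)) rho) = (LINT x|leb I. kap * (wh x * vh x))"
  unfolding l2_inner_def wh_def[symmetric]
  by (rule integral_cong_AE) (use m[OF X2] m[OF W2] pm[OF dL(1) c(3)] pair_lift(3)[OF r, folded vh_def] in \<open>auto simp: AE_I_iff elim!: eventually_mono\<close>)
 define i1 i2 i3 where "i1 x = kap * (wh x * vh x)" and "i2 x = V x * (v x * w x)" and "i3 x = v x * w x" for x
 have int: "integrable (leb I) i1" "integrable (leb I) i2" "integrable (leb I) i3"
  unfolding i1_def[abs_def] i2_def[abs_def] i3_def[abs_def]
  using integrable_mult_L2[OF X2 W2] integrable_mult_L2[OF W(3) X(3)]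
   V_mult_integrable(1)[of bc v v g bc w w k] r s rep1D(7)[OF r, THEN L2_D(1)] rep1D(7)[OF s, THEN L2_D(1)]
  by (auto simp: rep1_def)
 have 3: "innerI w (pair (gy (lift_grad v g)) phi_y) = (LINT x|leb I. i2 x - i1 x + K * i3 x)"
  unfolding l2_inner_def
 proof (rule integral_cong_fun[OF refl])
  fix x assume "x \<in> space (leb I)"
  then have x: "x \<in> I" by simp
  have "(pi / (eps * h x))^2 = V x - kap * (hh x)^2 + K"
   by (simp add: potential_def power_divide power_mult_distrib diff_divide_distrib right_diff_distrib mult.commute)
  then show "w x \<bullet> pair (gy (lift_grad v g)) phi_y x = i2 x - i1 x + K * i3 x"
   unfolding pair_lift(4)[OF r x] i1_def i2_def i3_def vh_def wh_def by (simp add: power2_eq_square) (simp add: algebra_simps)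
 qed
 have 4: "innerI \<zeta> (pair (lift \<xi>) phi) = (LINT x|leb I. i3 x)"
  unfolding l2_inner_def
  by (rule integral_cong_AE) (use m[OF X(4)] m[OF W(3)] m[OF X(3)] pm[OF lL c(1)] rep1D(4)[OF r] rep1D(4)[OF s] pair_lift(1)[OF r]
    in \<open>auto simp: AE_I_iff i3_def elim!: eventually_elim2\<close>)
 show ?thesis
  unfolding strip_form_lift[OF lift_in_domain[OF r] lift_weak_grad[OF r] s] 1 2 3 4 i1_def[symmetric]
   interval_form_eq[OF r s] V_mult_integrable(2)[OF r s] i2_def[symmetric]
  using int by (simp add: l2_inner_commute)
qed

end

context profile
begin

text \<open>Reciprocal spectral constants in the scaling of $\rho$: \<open>low\<close> for the one-dimensional form, \<open>gap\<close> for the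
 complement of the mode space. \<open>sob c\<close> is the constant of the Sobolev bound for a function
 of norm at most $c\rho E$ whose derivative has norm at most \<open>E\<close>, and \<open>cross\<close> combines them into the constant of the coupling.\<close>

definition low :: real where "low = sqrt (16 + 4 / (pi^2 * c0))"
definition gap :: real where "gap = M / pi"
definition sob :: line_fun where "sob c = sqrt (c^2 / (a + b) + 2 * \<bar>c\<bar>)"
definition cross :: real where
 "cross = sqrt (pi^2 / 3 + 1 / 4) * l2_norm (leb {-a..b}) h' / l * (sob gap + sob low)"

end

context narrow_strip
begin

section \<open>The complement of the mode space\<close>

text \<open>If the mode component vanishes then so does its derivative, which expresses the pairing of
 $\partial_x u$ with the mode by a pairing of \<open>u\<close> itself.\<close>

lemma complement_pair_x:
 assumes u: "u \<in> dom2 bc" and G: "is_weak_grad S u G" and z: "AE x in lborel. pair u phi x = 0"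
 shows "AE x in leb I. pair (gx G) phi x = - (pair u rho x * hh x)"
proof -
 obtain v where r: "rep1 bc (pair u phi) v (%x. pair (gx G) phi x + hh x * pair u rho x)" using mode_rep1[OF u G] by blast
 have "is_weak_grad I (pair u phi) (%_. 0)"
  by (rule is_weak_grad_cong_AE[OF is_weak_grad_zero rep1D(3)[OF r]]) (use z in \<open>auto simp: AE_I_iff elim: eventually_mono\<close>)
 from weak_grad_unique_interval[OF rep1D(9)[OF r] this] show ?thesis by (rule eventually_mono) (simp add: algebra_simps)
qed

text \<open>On a vertical section orthogonal to the first mode the derivative is orthogonal to the derivative of the mode,
 and the second eigenvalue of the section bounds the quotient of the norms.\<close>

lemma complement_sections:
 assumes u: "u \<in> dom2 bc" and G: "is_weak_grad S u G" and z: "AE x in lborel. pair u phi x = 0"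
 shows "AE x in lborel. x \<in> I --> pair (gy G) phi_y x = 0 \<and>
  4 * (pi / (eps * h x))^2 * (LBINT y. (hat u (x, y))^2) \<le> (LBINT y. (hat (gy G) (x, y))^2)"
proof -
 note L = strip_domainD(2)[OF u] and GL = is_weak_gradD(1)[OF G]
 note c = phi_continuous[of UNIV]
 have wd: "weak_dy (hat u) (hat (gy G))" using strip_domainD(3)[OF u G] unfolding dirichlet_identities_iff[OF L GL] by blast
 have um: "(%y. hat u (x, y)) \<in> borel_measurable borel" for x
 proof -
  have "hat u \<in> borel_measurable (borel \<Otimes>\<^sub>M borel)" using hat_measurable[OF L] by (simp add: borel_prod)
  from measurable_compose[OF measurable_Pair1' this, of x] show ?thesis by simp
 qed
 show ?thesis using z weak_dy_sections[OF L L2_snd[OF GL] wd] fiber_L2(1)[OF L2_snd[OF GL]]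
 proof (eventually_elim, intro impI)
  fix x assume z: "pair u phi x = 0" and x: "x \<in> I"
   and s: "integrable lborel (%t. hat (gy G) (x, t)) \<and> (LBINT t. hat (gy G) (x, t)) = 0 \<and>
    (AE y in lborel. hat u (x, y) = prim (%t. hat (gy G) (x, t)) y)"
   and sq: "(%y. hat (gy G) (x, y)) \<in> L2 lborel"
  define w where "w = eps * h x"
  define g where "g = (%t. hat (gy G) (x, t))"
  have w: "0 < w" unfolding w_def by (rule width_pos)
  have P: "ac_on 0 w (prim g) g" by (rule ac_on_prim) (use s in \<open>simp add: g_def\<close>)
  have g0: "g t = 0" if "t \<notin> {0<..<w}" for t unfolding g_def by (rule hat_section_support(1)) (use that in \<open>simp add: w_def\<close>)
  have ends: "prim g 0 = 0" "prim g w = 0"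
   using prim_eq_0[of 0 g] prim_eq_total[of w g] g0 s by (auto simp: g_def)
  have e: "(LBINT y. F y (hat u (x, y))) = (LINT y:{0..w}|lborel. F y (prim g y))"
   if F: "\<And>y. F y 0 = 0" "(%y. F y (hat u (x, y))) \<in> borel_measurable borel" "continuous_on {0..w} (%y. F y (prim g y))" for F :: "real => real => real"
   unfolding set_lebesgue_integral_def
  proof (rule integral_cong_AE)
   have "AE y in lborel. hat u (x, y) = prim g y" using s by (simp add: g_def)
   then show "AE y in lborel. F y (hat u (x, y)) = indicator {0..w} y *\<^sub>R F y (prim g y)"
   proof eventually_elim
    case (elim y)
    have "hat u (x, y) = 0" if "y \<notin> {0..w}" by (rule hat_section_support(1)) (use that in \<open>auto simp: w_def\<close>)
    with elim F(1) show ?case by (cases "y \<in> {0..w}") (auto simp del: mult_eq_0_iff)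
   qed
   show "(%y. indicator {0..w} y *\<^sub>R F y (prim g y)) \<in> borel_measurable lborel"
    using borel_measurable_continuous_on_indicator[OF _ F(3)] by simp
  qed (use F(2) in simp)
  have Pc: "continuous_on {0..w} (prim g)" by (rule ac_on_imp_continuous[OF P])
  have ge: "(LBINT y. f y) = (LINT y:{0..w}|lborel. f y)" if "\<And>y. g y = 0 ==> f y = 0" for f :: line_fun
   unfolding set_lebesgue_integral_def
  proof (rule integral_cong_fun[OF refl])
   show "f y = indicator {0..w} y *\<^sub>R f y" for y using that[of y] g0[of y] by (cases "y \<in> {0..w}") auto
  qed
  have orth: "(LINT y:{0..w}|lborel. prim g y * phi (x, y)) = 0"
   using z e[of "%y s. s * phi (x, y)"] um[of x] borel_measurable_continuous_onI[OF section_continuous[OF c(1), of UNIV x]]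
    continuous_on_mult[OF Pc section_continuous[OF c(1)]] by (simp add: pair_def)
  have "prim g y * phi (x, y) = sqrt (2 / w) * (prim g y * sin (pi * y / w))" for y
   by (simp add: phi_def w_def)
  then have "sqrt (2 / w) * (LINT y:{0..w}|lborel. prim g y * sin (pi * y / w)) = 0"
   using orth by (simp only: set_integral_mult_right)
  then have orth': "(LINT y:{0..w}|lborel. prim g y * sin (pi * y / w)) = 0" using w by simp
  have gs: "set_integrable lborel {0..w} (%y. (g y)^2)"
   using L2_D(2)[OF sq] integrable_indicator_mult[of "%y. (g y)^2" "{0..w}"] by (simp add: set_integrable_def g_def)
  have u2: "(LBINT y. (hat u (x, y))^2) = (LINT y:{0..w}|lborel. (prim g y)^2)"
   by (rule e[of "%y s. s^2"]) (use um[of x] Pc in \<open>auto intro: continuous_intros\<close>)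
  have g2: "(LBINT y. (hat (gy G) (x, y))^2) = (LINT y:{0..w}|lborel. (g y)^2)"
   using ge[of "%y. (g y)^2"] unfolding g_def by simp
  have "4 * (pi / w)^2 * (LINT y:{0..w}|lborel. (prim g y)^2) \<le> (LINT y:{0..w}|lborel. (g y)^2)"
   by (rule wirtinger_gap[OF P w ends gs orth'])
  moreover have "pair (gy G) phi_y x = 0"
  proof -
   have pe: "pair (gy G) phi_y x = (LINT y:{0..w}|lborel. g y * phi_y (x, y))"
    using ge[of "%y. g y * phi_y (x, y)"] unfolding pair_def g_def by simp
   have ay: "ac_on 0 w (%y. phi_y (x, y)) (%y. - ((pi / w)^2 * phi (x, y)))"
    unfolding w_def by (rule ac_on_smooth[OF phi_y_derivative(2)]) (intro continuous_intros section_continuous[OF c(1)])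
   define t where "t = - ((pi / w)^2)"
   have i1: "set_integrable lborel {0..w} (%y. t * (prim g y * phi (x, y)))"
    by (intro borel_integrable_atLeastAtMost' continuous_intros Pc section_continuous[OF c(1)])
   have i2: "set_integrable lborel {0..w} (%y. g y * phi_y (x, y))"
    using ac_on_abs_integrable_mult[OF ay ac_on_integrable[OF P]] by (simp add: mult.commute)
   have "0 = (LINT y:{0..w}|lborel. t * (prim g y * phi (x, y)) + g y * phi_y (x, y))"
    using ac_on_integral_by_parts(2)[OF P ay] w ends by (simp add: t_def mult_ac)
   also have "... = t * (LINT y:{0..w}|lborel. prim g y * phi (x, y)) + (LINT y:{0..w}|lborel. g y * phi_y (x, y))"
    unfolding set_integral_add(2)[OF i1 i2] by simp
   finally show ?thesis using orth pe by simp
  qed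
  ultimately show "pair (gy G) phi_y x = 0 \<and>
   4 * (pi / (eps * h x))^2 * (LBINT y. (hat u (x, y))^2) \<le> (LBINT y. (hat (gy G) (x, y))^2)"
   unfolding u2 g2 w_def by simp
 qed
qed

lemma strip_form_self:
 assumes "u \<in> dom2 bc" "is_weak_grad S u G"
 shows "A u u = (normS (gx G))^2 + (normS (gy G))^2 - K * (normS u)^2"
 using strip_form_eq[OF assms assms] by (simp add: l2_norm_power2)

text \<open>Sections have length at most $\varepsilon M$, so the second eigenvalue is at least $4K$ while the form subtracts
 only \<open>K\<close>.\<close>

lemma complement_gap:
 assumes u: "u \<in> dom2 bc" and G: "is_weak_grad S u G" and z: "AE x in lborel. pair u phi x = 0"
 shows "0 \<le> A u u" "normS (gx G) \<le> sqrt (A u u)" "normS u \<le> gap * eps * sqrt (A u u)"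
proof -
 note L = strip_domainD(2)[OF u] and gL = L2_snd[OF is_weak_gradD(1)[OF G]]
 have Kp: "0 < K" using M_pos eps_pos by simp
 have "4 * K * (normS u)^2 = (LBINT x. 4 * K * (LBINT y. (hat u (x, y))^2))"
  using fiber_L2(3)[OF L] by simp
 also have "... \<le> (LBINT x. LBINT y. (hat (gy G) (x, y))^2)"
 proof (rule integral_mono_AE[OF _ fiber_L2(2)[OF gL]])
  show "integrable lborel (%x. 4 * K * (LBINT y. (hat u (x, y))^2))" using fiber_L2(2)[OF L] by simp
  show "AE x in lborel. 4 * K * (LBINT y. (hat u (x, y))^2) \<le> (LBINT y. (hat (gy G) (x, y))^2)"
   using complement_sections[OF u G z]
  proof eventually_elim
   case (elim x)
   show ?case
   proof (cases "x \<in> I")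
    case True
    have "K = (pi / (eps * M))^2" by (simp add: power_divide power_mult_distrib mult.commute)
    also have "... \<le> (pi / (eps * h x))^2"
     using width_le[of x] width_pos[of x] by (intro power_mono divide_left_mono) auto
    finally have "4 * K * (LBINT y. (hat u (x, y))^2) \<le> 4 * (pi / (eps * h x))^2 * (LBINT y. (hat u (x, y))^2)"
     by (intro mult_right_mono) auto
    then show ?thesis using elim True by linarith
   next
    case False
    then have "hat u (x, y) = 0" "hat (gy G) (x, y) = 0" for y by (rule hat_section_support(2))+
    then show ?thesis by (simp only: zero_power2 Bochner_Integration.integral_zero mult_zero_right order_refl)
   qed
  qed
 qed
 also have "... = (normS (gy G))^2" by (rule fiber_L2(3)[OF gL])
 finally have *: "(normS (gx G))^2 + K * (normS u)^2 \<le> A u u"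
 proof -
  have "s + k * n \<le> s + t - k * n" if "4 * k * n \<le> t" "0 \<le> k * n" for s t k n :: real using that by linarith
  from this[of K] Kp show "4 * K * (normS u)^2 \<le> (normS (gy G))^2 ==> ?thesis"
   unfolding strip_form_self[OF u G] by simp
 qed
 have "0 \<le> K * (normS u)^2" using Kp by simp
 then have 1: "(normS (gx G))^2 \<le> A u u" and 2: "K * (normS u)^2 \<le> A u u"
  using * zero_le_power2[of "normS (gx G)"] by linarith+
 show 0: "0 \<le> A u u" using order_trans[OF zero_le_power2 1] .
 show "normS (gx G) \<le> sqrt (A u u)" by (rule real_le_rsqrt[OF 1])
 have g: "0 < gap * eps" using M_pos eps_pos by (simp add: gap_def)
 have "(gap * eps)^2 * K = 1"
  using M_pos eps_pos by (simp add: gap_def power_divide power_mult_distrib)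
 then have "(normS u)^2 = (gap * eps)^2 * (K * (normS u)^2)" by (simp only: mult.assoc[symmetric] mult_1)
 also have "... \<le> (gap * eps)^2 * A u u" by (rule mult_left_mono[OF 2]) simp
 also have "... = (gap * eps * sqrt (A u u))^2" using 0 by (simp add: power_mult_distrib)
 finally show "normS u \<le> gap * eps * sqrt (A u u)"
  by (rule power2_le_imp_le) (use 0 g in simp)
qed

text \<open>A uniform bound for the sections is paired with $h'/h$ in $L^2$.\<close>

lemma pair_rho_bound:
 assumes f: "f \<in> L2S" and B: "AE x in lborel. x \<in> I --> (LBINT y. (hat f (x, y))^2) \<le> B^2" and B0: "0 \<le> B"
 shows "(%x. pair f rho x * hh x) \<in> L2I"
  "normI (%x. pair f rho x * hh x) \<le> sqrt kap * B / l * normI h'"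
proof -
 note c = phi_continuous[of UNIV]
 have pr: "AE x in lborel. x \<in> I --> (pair f rho x)^2 \<le> kap * (LBINT y. (hat f (x, y))^2)"
  by (rule pair_le[OF f c(3)]) (simp add: pair_modes)
 have "AE x in leb I. \<bar>pair f rho x\<bar> \<le> sqrt kap * B" unfolding AE_I_iff using pr B
 proof (eventually_elim, intro impI)
  fix x assume *: "x \<in> I --> (pair f rho x)^2 \<le> kap * (LBINT y. (hat f (x, y))^2)" "x \<in> I --> (LBINT y. (hat f (x, y))^2) \<le> B^2" "x \<in> I"
  have "kap * (LBINT y. (hat f (x, y))^2) \<le> kap * B^2" using * by (intro mult_left_mono) auto
  then have "\<bar>pair f rho x\<bar>^2 \<le> (sqrt kap * B)^2" using * by (simp add: power_mult_distrib)
  then show "\<bar>pair f rho x\<bar> \<le> sqrt kap * B" by (rule power2_le_imp_le) (use B0 in simp)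
 qed
 from weight_L2[OF measurable_I[OF pair_measurable[OF f c(3)]] this] B0
 show "(%x. pair f rho x * hh x) \<in> L2I"
  "normI (%x. pair f rho x * hh x) \<le> sqrt kap * B / l * normI h'" by simp_all
qed

end

text \<open>The length $\rho=\varepsilon^{2/(m+2)}$ of the region where low-energy functions live.\<close>

locale scaled_strip = narrow_strip +
 fixes \<rho> :: real
 assumes rho_pos: "0 < \<rho>" and rho_1: "\<rho> \<le> 1" and rho_b: "3 * \<rho> \<le> b"
  and rho_eq: "\<rho>^2 * \<rho> powr m = eps^2" and rho_cross: "cross * sqrt \<rho> \<le> 1 / 2"
begin

lemma eps_le: "eps \<le> \<rho> * sqrt \<rho>" "eps \<le> \<rho>"
proof -
 have "\<rho> powr m \<le> \<rho> powr 1" by (rule powr_mono'[OF m_ge_1]) (use rho_pos rho_1 in auto)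
 then have "\<rho>^2 * \<rho> powr m \<le> \<rho>^2 * \<rho>" using rho_pos by simp
 then have "eps^2 \<le> (\<rho> * sqrt \<rho>)^2" unfolding rho_eq using rho_pos by (simp add: power_mult_distrib)
 then show 1: "eps \<le> \<rho> * sqrt \<rho>" by (rule power2_le_imp_le) (use rho_pos in simp)
 have "\<rho> * sqrt \<rho> \<le> \<rho> * 1" using rho_pos rho_1 by (intro mult_left_mono) auto
 with 1 show "eps \<le> \<rho>" by simp
qed

lemma consts_pos: "0 < low" "0 < gap" "0 \<le> sob c" "0 \<le> cross"
proof -
 show 1: "0 < low" "0 < gap" using c0_pos M_pos by (simp_all add: low_def gap_def add_pos_pos)
 show *: "0 \<le> sob c" for c using a_pos b_pos by (simp add: sob_def)
 show "0 \<le> cross" unfolding cross_def using l_pos by (intro mult_nonneg_nonneg divide_nonneg_pos add_nonneg_nonneg * ) (auto simp: l2_norm_nonneg)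
qed

lemma mode_norm_le:
 assumes r: "rep1 bc \<xi> v g"
 shows "0 \<le> q \<xi> \<xi>" "normI \<xi> \<le> low * \<rho> * sqrt (q \<xi> \<xi>)" "normI g \<le> sqrt (q \<xi> \<xi>)"
proof -
 show q0: "0 \<le> q \<xi> \<xi>" using order_trans[OF zero_le_power2 interval_form_ge(1)[OF r]] .
 show "normI g \<le> sqrt (q \<xi> \<xi>)" by (rule real_le_rsqrt[OF interval_form_ge(1)[OF r]])
 have "(normI \<xi>)^2 \<le> (low * \<rho> * sqrt (q \<xi> \<xi>))^2"
  using interval_form_scaled_lower_bound[OF r rho_pos rho_b rho_eq] q0 c0_pos by (simp add: low_def power_mult_distrib)
 then show "normI \<xi> \<le> low * \<rho> * sqrt (q \<xi> \<xi>)"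
  by (rule power2_le_imp_le) (use q0 rho_pos consts_pos(1) in simp)
qed

text \<open>The Sobolev bound for the square of the supremum, when the norm \<open>n\<close> is smaller than the energy \<open>E\<close> by the factor \<open>\<rho>\<close>
 and the derivative is bounded by \<open>E\<close>: both terms gain one power of \<open>\<rho>\<close>.\<close>

lemma sobolev_scaled:
 assumes n: "0 \<le> n" "n \<le> c * \<rho> * E" and k: "0 \<le> k" "k \<le> E"
 shows "n^2 / (a + b) + 2 * (n * k) \<le> (sob c * sqrt \<rho> * E)^2"
proof -
 have E: "0 \<le> E" using k by linarith
 have c: "0 \<le> c * (\<rho> * E)" using n by (simp add: mult.assoc)
 have "n^2 \<le> (c * \<rho> * E)^2" using n by (intro power_mono)
 also have "... = (\<rho> * \<rho>) * (c^2 * E^2)" by (simp add: power_mult_distrib power2_eq_square)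
 also have "... \<le> (\<rho> * 1) * (c^2 * E^2)" using rho_pos rho_1 by (intro mult_right_mono mult_left_mono) auto
 finally have "n^2 / (a + b) \<le> (\<rho> * 1) * (c^2 * E^2) / (a + b)" using a_pos b_pos by (intro divide_right_mono) auto
 moreover have "n * k \<le> (c * \<rho> * E) * E" using n k by (intro mult_mono) auto
 ultimately have "n^2 / (a + b) + 2 * (n * k) \<le> (c^2 / (a + b) + 2 * c) * \<rho> * E^2"
  by (simp add: algebra_simps power2_eq_square[of E])
 also have "... \<le> (sob c)^2 * \<rho> * E^2"
  unfolding sob_def using rho_pos a_pos b_pos by (intro mult_right_mono) auto
 finally show ?thesis using rho_pos by (simp add: power_mult_distrib)
qed

text \<open>The coupling gains the factor \<open>sqrt \<rho>\<close>: it contains one factor without derivative, which the Sobolev inequality bounds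
 pointwise by a small multiple of the energy, while $h'$ is only square integrable.\<close>

lemma cross_le:
 assumes u: "u \<in> dom2 bc" and z: "AE x in lborel. pair u phi x = 0" and r: "rep1 bc \<xi> v g"
 shows "\<bar>A u (lift \<xi>)\<bar> \<le> cross * sqrt \<rho> * (sqrt (q \<xi> \<xi>) * sqrt (A u u))"
proof -
 define G where "G = weak_grad S u"
 have G: "is_weak_grad S u G" unfolding G_def by (rule H1_weak_grad[OF strip_domainD(1)[OF u]])
 note L = strip_domainD(2)[OF u] and gL = L2_fst[OF is_weak_gradD(1)[OF G]] L2_snd[OF is_weak_gradD(1)[OF G]]
 note c = phi_continuous[of UNIV] and W = rep1_weights[OF r]
 note gp = complement_gap[OF u G z] and mp = mode_norm_le[OF r]
 define X Y where "X = sqrt (q \<xi> \<xi>)" and "Y = sqrt (A u u)"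
 have XY: "0 \<le> X" "0 \<le> Y" unfolding X_def Y_def using gp(1) mp(1) by auto
 define N where "N = normI h' / l"
 have N: "0 \<le> N" unfolding N_def using l_pos by (simp add: l2_norm_nonneg)
 have "gap * eps * Y \<le> gap * \<rho> * Y" using eps_le(2) consts_pos(2) XY by (intro mult_right_mono mult_left_mono) auto
 then have nu: "normS u \<le> gap * \<rho> * Y" using gp(3) unfolding Y_def by linarith
 have "AE x in lborel. x \<in> I --> (LBINT y. (hat u (x, y))^2) \<le> (sob gap * sqrt \<rho> * Y)^2"
  using section_norm_bound[OF u G] sobolev_scaled[OF l2_norm_nonneg nu l2_norm_nonneg gp(2)[folded Y_def]]
  by (auto elim!: eventually_mono intro: order_trans)
 from pair_rho_bound[OF L this] have 1: "(%x. pair u rho x * hh x) \<in> L2I"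
  "normI (%x. pair u rho x * hh x) \<le> sqrt kap * (sob gap * sqrt \<rho> * Y) * N"
  using consts_pos(3)[of gap] rho_pos XY by (simp_all add: N_def)
 have vb: "\<bar>v x\<bar> \<le> sob low * sqrt \<rho> * X" if x: "x \<in> I" for x
 proof -
  have "\<bar>v x\<bar>^2 \<le> (sob low * sqrt \<rho> * X)^2"
   using order_trans[OF rep1_sup[OF r x] sobolev_scaled[OF l2_norm_nonneg mp(2) l2_norm_nonneg mp(3)]] by (simp add: X_def)
  then show ?thesis by (rule power2_le_imp_le) (use consts_pos(3) rho_pos XY in simp)
 qed
 have 2: "normI (%x. v x * hh x) \<le> sob low * sqrt \<rho> * X * N"
  using weight_L2(2)[OF L2_D(1)[OF W(3)], of "sob low * sqrt \<rho> * X"] vb consts_pos(3)[of low] rho_pos XY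
  by (simp add: AE_I_iff N_def)
 have p: "pair (gx G) phi \<in> L2I" by (rule pair_L2(1)[OF gL(1) c(1), of 1]) (simp add: pair_modes)
 have pr: "pair (gx G) rho \<in> L2I" "(normI (pair (gx G) rho))^2 \<le> kap * (normS (gx G))^2"
  by (rule pair_L2[OF gL(1) c(3), of kap], simp add: pair_modes)+
 have "(normI (pair (gx G) rho))^2 \<le> (sqrt kap * normS (gx G))^2" using pr(2) by (simp add: power_mult_distrib)
 then have "normI (pair (gx G) rho) \<le> sqrt kap * normS (gx G)"
  by (rule power2_le_imp_le) (simp add: l2_norm_nonneg)
 also have "... \<le> sqrt kap * Y" using gp(2) unfolding Y_def by (intro mult_left_mono) auto
 finally have 3: "normI (pair (gx G) rho) \<le> sqrt kap * Y" .
 have t1: "\<bar>innerI g (pair (gx G) phi)\<bar> \<le> X * (sqrt kap * (sob gap * sqrt \<rho> * Y) * N)"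
 proof -
  define f where "f x = pair u rho x * hh x" for x
  have "innerI g (pair (gx G) phi) = - innerI g f"
   unfolding l2_inner_def Bochner_Integration.integral_minus[symmetric]
   by (rule integral_cong_AE) (use complement_pair_x[OF u G z, folded f_def] L2_D(1)[OF W(1)] L2_D(1)[OF p] L2_D(1)[OF 1(1)[folded f_def]] in \<open>auto elim!: eventually_mono\<close>)
  then have "\<bar>innerI g (pair (gx G) phi)\<bar> \<le> normI g * normI (%x. pair u rho x * hh x)"
   using l2_Cauchy_Schwarz[OF W(1) 1(1)[folded f_def]] unfolding f_def[symmetric] by simp
  also have "... \<le> X * (sqrt kap * (sob gap * sqrt \<rho> * Y) * N)"
   using mp(3) 1(2) XY unfolding X_def by (intro mult_mono) (auto simp: l2_norm_nonneg)
  finally show ?thesis .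
 qed
 have t2: "\<bar>innerI (%x. v x * hh x) (pair (gx G) rho)\<bar> \<le> (sob low * sqrt \<rho> * X * N) * (sqrt kap * Y)"
  by (rule order_trans[OF l2_Cauchy_Schwarz[OF W(2) pr(1)]])
    (rule mult_mono[OF 2 3], use consts_pos(3)[of low] rho_pos XY N in \<open>auto simp: l2_norm_nonneg\<close>)
 have t3: "innerI v (pair (gy G) phi_y) = 0"
  unfolding l2_inner_def
  by (rule integral_eq_zero_AE) (use complement_sections[OF u G z] in \<open>auto simp: AE_I_iff elim!: eventually_mono\<close>)
 have t4: "innerI \<xi> (pair u phi) = 0"
  unfolding l2_inner_def by (rule integral_eq_zero_AE) (use z in \<open>auto simp: AE_I_iff elim!: eventually_mono\<close>)
 have "\<bar>A u (lift \<xi>)\<bar> \<le> X * (sqrt kap * (sob gap * sqrt \<rho> * Y) * N) + (sob low * sqrt \<rho> * X * N) * (sqrt kap * Y)"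
  unfolding strip_form_lift[OF u G r] t3 t4 using t1 t2 by linarith
 also have "... = cross * sqrt \<rho> * (X * Y)" by (simp add: cross_def N_def algebra_simps add_divide_distrib)
 finally show ?thesis unfolding X_def Y_def .
qed

end

context narrow_strip
begin

lemma strip_form_commute: "A u v = A v u"
 by (simp add: strip_form_def inner_commute mult.commute)

lemma strip_form_lincomb:
 assumes u: "u \<in> dom2 bc" and v: "v \<in> dom2 bc" and w: "w \<in> dom2 bc"
 shows "A (%z. u z + t * v z) w = A u w + t * A v w"
proof -
 note U = strip_domainD(1,2)[OF u] and X = strip_domainD(1,2)[OF v] and W = strip_domainD(1,2)[OF w]
 define G H J where "G = weak_grad S u" and "H = weak_grad S v" and "J = weak_grad S w"
 have g: "is_weak_grad S u G" "is_weak_grad S v H" "is_weak_grad S w J"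
  unfolding G_def H_def J_def by (intro H1_weak_grad U X W)+
 note L = g[THEN is_weak_gradD(1)]
 have lin: "innerS (%z. p z + t * r z) f = innerS p f + t * innerS r f"
  if "p \<in> L2S" "r \<in> L2S" "f \<in> L2S" for p r f :: plane_fun
  using l2_inner_add_left[OF that(1) L2_scale_real[OF that(2), of t] that(3)] l2_inner_scale_real_right[of "leb S" f t r]
  by (simp add: l2_inner_commute)
 show ?thesis
  unfolding strip_form_eq[OF strip_domain_lincomb[OF u v] is_weak_grad_lincomb[OF S_borel U(2) X(2) g(1,2)] w g(3)]
   strip_form_eq[OF u g(1) w g(3)] strip_form_eq[OF v g(2) w g(3)]
  by (simp add: lin U X W L2_fst L2_snd L algebra_simps)
qed

lemma lift_inner_lift:
 assumes "rep1 bc \<xi> v g" "rep1 bc \<zeta> w k"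
 shows "innerS (lift \<xi>) (lift \<zeta>) = innerI \<xi> \<zeta>"
proof -
 have "innerS (lift \<xi>) (lift \<zeta>) = innerI \<zeta> (pair (lift \<xi>) phi)"
  by (rule inner_lift(2)[OF assms(2) inner_lift(1)[OF assms(1) L2_zero]])
 also have "... = innerI \<zeta> \<xi>"
  unfolding l2_inner_def by (rule integral_cong_fun) (use pair_lift(1)[OF assms(1)] in auto)
 finally show ?thesis by (simp add: l2_inner_commute)
qed

lemma lift_norm: "rep1 bc \<xi> v g ==> normS (lift \<xi>) = normI \<xi>"
 by (simp add: l2_norm_def lift_inner_lift)

definition rest :: "(real \<times> real => real) => real \<times> real => real" where
 "rest w z = w z - lift (pair w phi) z"

lemma rest:
 assumes w: "w \<in> dom2 bc"
 obtains v g where "rep1 bc (pair w phi) v g" "rest w \<in> dom2 bc" "AE x in lborel. pair (rest w) phi x = 0"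
proof -
 obtain v g where r: "rep1 bc (pair w phi) v g" using mode_rep1[OF w H1_weak_grad[OF strip_domainD(1)[OF w]]] by blast
 have "rest w \<in> dom2 bc"
  using strip_domain_lincomb[OF w lift_in_domain[OF r], of "-1"] by (simp add: rest_def[abs_def])
 moreover have "AE x in lborel. pair (rest w) phi x = 0"
  using pair_lincomb[OF strip_domainD(2)[OF w] inner_lift(1)[OF r L2_zero] phi_continuous(1), of "-1"]
 proof eventually_elim
  case (elim x)
  then show ?case using pair_lift(1)[OF r, of x] by (cases "x \<in> I") (auto simp: rest_def[abs_def] pair_outside)
 qed
 ultimately show ?thesis using r that by blast
qed

end

lemma am_gm_coupling:
 fixes X Y c d :: real
 assumes "\<bar>c\<bar> \<le> d * (X * Y)" "d \<le> 1 / 2" "0 \<le> X" "0 \<le> Y"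
 shows "(X^2 + Y^2) / 2 \<le> X^2 + 2 * c + Y^2"
proof -
 have "d * (X * Y) \<le> 1 / 2 * (X * Y)" using assms by (intro mult_right_mono) auto
 moreover have "0 \<le> (X - Y)^2" by simp
 ultimately show ?thesis using assms(1) by (simp add: power2_eq_square algebra_simps)
qed

context scaled_strip
begin

section \<open>The operators are boundedly invertible\<close>

text \<open>The weak coupling of the mode space and its complement makes the form of the strip equivalent to the sum of
 its diagonal parts.\<close>

lemma strip_form_lower:
 assumes w: "w \<in> dom2 bc"
 shows "(q (pair w phi) (pair w phi) + A (rest w) (rest w)) / 2 \<le> A w w"
  "(normS w)^2 \<le> 4 * (low^2 + gap^2) * \<rho>^2 * A w w"
proof -
 define \<xi> u where "\<xi> = pair w phi" and "u = rest w"
 obtain v g where r: "rep1 bc \<xi> v g" and u: "u \<in> dom2 bc" and z: "AE x in lborel. pair u phi x = 0"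
  using rest[OF w, folded \<xi>_def u_def] .
 define f where "f = lift \<xi>"
 have f: "f \<in> dom2 bc" unfolding f_def by (rule lift_in_domain[OF r])
 have weq: "w = (%z. u z + 1 * f z)" by (simp add: rest_def u_def f_def \<xi>_def)
 have G: "is_weak_grad S u (weak_grad S u)" by (rule H1_weak_grad[OF strip_domainD(1)[OF u]])
 note gp = complement_gap[OF u G z] and mp = mode_norm_le[OF r]
 define X Y where "X = sqrt (q \<xi> \<xi>)" and "Y = sqrt (A u u)"
 have XY: "0 \<le> X" "0 \<le> Y" "q \<xi> \<xi> = X^2" "A u u = Y^2" using gp(1) mp(1) by (auto simp: X_def Y_def)
 have Aw: "A w k = A u k + A f k" if "k \<in> dom2 bc" for k
  using strip_form_lincomb[OF u f that, of 1] unfolding weq[symmetric] by simp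
 have e: "A w w = X^2 + 2 * A u f + Y^2"
  using Aw[OF w] Aw[OF u] Aw[OF f] strip_form_commute[of u w] strip_form_commute[of f w] strip_form_commute[of f u]
   strip_form_lift_lift[OF r r, folded f_def] XY(3,4) by linarith
 have 1: "(q \<xi> \<xi> + A u u) / 2 \<le> A w w"
  unfolding XY(3,4) e by (rule am_gm_coupling[OF cross_le[OF u z r, folded X_def Y_def f_def] rho_cross XY(1,2)])
 then show "(q (pair w phi) (pair w phi) + A (rest w) (rest w)) / 2 \<le> A w w" by (simp add: \<xi>_def u_def)
 have "normS w \<le> normS u + normS f"
  using l2_norm_add[OF strip_domainD(2)[OF u] strip_domainD(2)[OF f]] weq by simp
 also have "... \<le> \<rho> * (gap * Y) + \<rho> * (low * X)"
 proof -
  have "gap * eps * Y \<le> gap * \<rho> * Y" using eps_le(2) consts_pos(2) XY by (intro mult_right_mono mult_left_mono) auto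
  then show ?thesis using gp(3) mp(2) unfolding f_def lift_norm[OF r] X_def[symmetric] Y_def[symmetric] by (simp add: mult_ac)
 qed
 finally have "(normS w)^2 \<le> (\<rho> * (gap * Y + low * X))^2"
  by (intro power_mono) (auto simp: algebra_simps l2_norm_nonneg)
 also have "... = \<rho>^2 * (gap * Y + low * X)^2" by (simp add: power_mult_distrib)
 also have "... \<le> \<rho>^2 * (2 * ((low^2 + gap^2) * (X^2 + Y^2)))"
 proof (rule mult_left_mono)
  have "0 \<le> (gap * Y - low * X)^2" "0 \<le> (low * Y)^2" "0 \<le> (gap * X)^2" by simp_all
  then show "(gap * Y + low * X)^2 \<le> 2 * ((low^2 + gap^2) * (X^2 + Y^2))"
   by (simp add: power2_eq_square algebra_simps)
 qed simp
 also have "... = 4 * (low^2 + gap^2) * \<rho>^2 * ((q \<xi> \<xi> + A u u) / 2)" unfolding XY(3,4) by (simp add: field_simps)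
 also have "... \<le> 4 * (low^2 + gap^2) * \<rho>^2 * A w w" by (intro mult_left_mono 1) simp
 finally show "(normS w)^2 \<le> 4 * (low^2 + gap^2) * \<rho>^2 * A w w" .
qed

lemma grad_norm:
 assumes u: "u \<in> dom2 bc" and G: "is_weak_grad S u G"
 shows "(normS G)^2 = A u u + K * (normS u)^2"
proof -
 note GL = is_weak_gradD(1)[OF G]
 have "(normS G)^2 = innerS (gx G) (gx G) + innerS (gy G) (gy G)"
  unfolding l2_norm_power2 l2_inner_def inner_prod_def inner_real_def
  by (rule Bochner_Integration.integral_add) (intro integrable_mult_L2 L2_fst L2_snd GL)+
 then show ?thesis unfolding strip_form_eq[OF u G u G] by (simp add: l2_norm_power2)
qed

text \<open>Closedness: by coercivity a Cauchy sequence of the form converges in $L^2$ together with its gradients, and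
 the domain is closed under such limits.\<close>

lemma strip_coercive_form:
 "coercive_form (leb S) (dom2 bc) A (1 / (4 * (low^2 + gap^2) * \<rho>^2))"
proof -
 define C where "C = 4 * (low^2 + gap^2) * \<rho>^2"
 have C: "0 < C" using rho_pos consts_pos by (simp add: C_def add_pos_pos)
 note coer = strip_form_lower(2)[folded C_def]
 have Kp: "0 < K" using M_pos eps_pos by simp
 have diff: "(%z. u z - v z) \<in> dom2 bc" if "u \<in> dom2 bc" "v \<in> dom2 bc" for u v
  using strip_domain_lincomb[OF that, of "-1"] by simp
 show ?thesis unfolding C_def[symmetric]
 proof
  show "dom2 bc \<subseteq> L2S" using strip_domainD(2) by blast
  show "(%x. 0) \<in> dom2 bc"
   by (rule strip_domainI[OF L2_zero is_weak_grad_zero]) (simp add: dirichlet_identities_def l2_inner_def)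
  show "(%x. u x + t * v x) \<in> dom2 bc" if "u \<in> dom2 bc" "v \<in> dom2 bc" for u v t
   by (rule strip_domain_lincomb[OF that])
  show "A u v = A v u" for u v by (rule strip_form_commute)
  show "A (%x. u x + t * v x) w = A u w + t * A v w" if "u \<in> dom2 bc" "v \<in> dom2 bc" "w \<in> dom2 bc" for u v w t
   by (rule strip_form_lincomb[OF that])
  show "0 < 1 / C" using C by simp
  show "1 / C * (normS u)^2 \<le> A u u" if "u \<in> dom2 bc" for u
   using coer[OF that] C by (simp add: pos_divide_le_eq mult.commute)
 next
  fix U :: "nat => real \<times> real => real"
  assume U: "\<And>n. U n \<in> dom2 bc"
   and Cau: "\<And>e. e > 0 ==> \<exists>n0. \<forall>i\<ge>n0. \<forall>j\<ge>n0. A (%x. U i x - U j x) (%x. U i x - U j x) < e"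
  have UL: "U n \<in> L2S" for n by (rule strip_domainD(2)[OF U])
  define G where "G n = weak_grad S (U n)" for n
  have G: "is_weak_grad S (U n) (G n)" for n unfolding G_def by (rule H1_weak_grad[OF strip_domainD(1)[OF U]])
  have gd: "is_weak_grad S (%x. u x - v x) (%x. F x - H x)"
   if "u \<in> L2S" "v \<in> L2S" "is_weak_grad S u F" "is_weak_grad S v H" for u v F H
   using is_weak_grad_lincomb[OF S_borel that, of "-1"] by simp
  have "\<exists>u0\<in>L2S. (%n. normS (%x. U n x - u0 x)) \<longlonglongrightarrow> 0"
   by (rule L2_complete[OF UL L2_Cauchy_of_bound[OF coer[OF diff[OF U U]] Cau C]])
  then obtain u0 where u0: "u0 \<in> L2S" "(%n. normS (%x. U n x - u0 x)) \<longlonglongrightarrow> 0" by auto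
  have "\<exists>G0\<in>L2S. (%n. normS (%x. G n x - G0 x)) \<longlonglongrightarrow> 0"
  proof (rule L2_complete[OF is_weak_gradD(1)[OF G] L2_Cauchy_of_bound[OF _ Cau]])
   show "(normS (%x. G i x - G j x))^2 \<le> (1 + K * C) * A (%x. U i x - U j x) (%x. U i x - U j x)" for i j
    using grad_norm[OF diff[OF U U] gd[OF UL UL G G]] mult_left_mono[OF coer[OF diff[OF U[of i] U[of j]]] less_imp_le[OF Kp]]
    by (simp only: distrib_right mult_1 mult.assoc)
   show "0 < 1 + K * C" using Kp C by (simp only: add_pos_pos mult_pos_pos zero_less_one)
  qed auto
  then obtain G0 where G0: "G0 \<in> L2S" "(%n. normS (%x. G n x - G0 x)) \<longlonglongrightarrow> 0" by auto
  note lim = strip_domain_limit[OF U G u0(1) G0(1) u0(2) G0(2)]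
  have e: "A (%x. U n x - u0 x) (%x. U n x - u0 x) = (normS (%x. G n x - G0 x))^2 - K * (normS (%x. U n x - u0 x))^2" for n
   using grad_norm[OF diff[OF U lim(1)] gd[OF UL u0(1) G lim(2)]] by simp
  have "(%n. A (%x. U n x - u0 x) (%x. U n x - u0 x)) \<longlonglongrightarrow> 0^2 - K * 0^2"
   unfolding e by (intro tendsto_intros u0(2) G0(2))
  then show "\<exists>v\<in>dom2 bc. (%n. A (%x. U n x - v x) (%x. U n x - v x)) \<longlonglongrightarrow> 0" using lim(1) by auto
 qed
qed

lemma strip_invertible: "boundedly_invertible (leb S) (strip_operator bc a b h M eps)"
 unfolding strip_operator_def by (rule coercive_form.boundedly_invertible[OF strip_coercive_form])

lemma interval_invertible: "boundedly_invertible (leb I) (interval_operator bc a b h h' M eps)"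
 unfolding interval_operator_def
 by (rule coercive_form.boundedly_invertible[OF interval_coercive_form[OF rho_pos rho_b rho_eq]])

section \<open>Comparison of the resolvents\<close>

text \<open>The orthogonal projection onto the mode space is the pairing with the mode, because lifting is an isometry; a
 function chosen by the orthogonality conditions must have the same inner products.\<close>

lemma mode_component:
 assumes f: "f \<in> L2S"
 defines "\<xi> \<equiv> mode_component a b h eps f"
 shows "\<xi> \<in> L2I" "\<eta> \<in> L2I ==> innerS f (lift \<eta>) = innerI \<xi> \<eta>"
proof -
 note c = phi_continuous[of UNIV]
 have L: "lift \<eta> \<in> L2S" if "\<eta> \<in> L2I" for \<eta>
  unfolding mode_lift_eq by (rule inner_weight(1)[OF L2_zero that c(1)])
 have e: "innerS g (lift \<eta>) = innerI \<eta> (pair g phi)" if "g \<in> L2S" "\<eta> \<in> L2I" for g \<eta>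
  unfolding mode_lift_eq by (rule inner_weight(2)[OF that c(1)])
 have ll: "innerS (lift \<zeta>) (lift \<eta>) = innerI \<zeta> \<eta>"
  if "\<zeta> \<in> L2I" "\<eta> \<in> L2I" for \<zeta> \<eta>
 proof -
  have "innerI \<eta> (pair (lift \<zeta>) phi) = innerI \<eta> \<zeta>"
   unfolding l2_inner_def mode_lift_eq pair_weight by (rule integral_cong_fun) (simp_all add: pair_modes)
  then show ?thesis using e[OF L[OF that(1)] that(2)] by (simp add: l2_inner_commute)
 qed
 let ?P = "%\<xi>. \<xi> \<in> L2I \<and> (%p. f p - lift \<xi> p) \<in> orth_compl (leb S) (mode_space a b h eps)"
 have iff: "?P \<xi> \<longleftrightarrow> \<xi> \<in> L2I \<and> (\<forall>\<eta>\<in>L2I. innerS f (lift \<eta>) = innerI \<xi> \<eta>)" for \<xi>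
  unfolding orth_compl_def mode_space_def
  by (auto simp: l2_inner_diff_left[OF f L L] ll L2_diff[OF f L])
 have pL: "pair f phi \<in> L2I" by (rule pair_L2(1)[OF f c(1), of 1]) (simp add: pair_modes)
 have "?P (pair f phi)" unfolding iff using pL e[OF f] by (simp add: l2_inner_commute)
 from someI[of ?P, OF this] have "?P \<xi>" unfolding \<xi>_def mode_component_def .
 then show "\<xi> \<in> L2I" "\<eta> \<in> L2I ==> innerS f (lift \<eta>) = innerI \<xi> \<eta>"
  unfolding iff by auto
qed

lemma op_inverse_solves:
 assumes "boundedly_invertible N (form_operator N D B)" "f \<in> L2 N"
 shows "op_inverse (form_operator N D B) f \<in> D" "v \<in> D ==> B (op_inverse (form_operator N D B) f) v = l2_inner N f v"
proof -
 have "(op_inverse (form_operator N D B) f, f) \<in> form_operator N D B"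
 proof -
  obtain u where "(u, f) \<in> form_operator N D B" using assms by (auto simp: boundedly_invertible_def)
  then show ?thesis unfolding op_inverse_def by (rule someI[of "%u. (u, f) \<in> form_operator N D B"])
 qed
 then show "op_inverse (form_operator N D B) f \<in> D" "v \<in> D ==> B (op_inverse (form_operator N D B) f) v = l2_inner N f v"
  by (auto simp: form_operator_def)
qed

text \<open>Let \<open>w\<close> solve the problem in the strip and \<open>x\<close> the one on the interval. Testing the equation of \<open>w\<close> with its two components
 bounds their energies \<open>X\<close> and \<open>Y\<close>; the complement feels the source only through its small norm and through the
 coupling. Testing the difference of the two equations with the difference \<open>e\<close> of the solutions leaves only
 the coupling of \<open>e\<close> with the complement.\<close>

lemma resolvent_difference:
 assumes F: "F \<in> L2S"
 shows "normS (%p. op_inverse (strip_operator bc a b h M eps) F p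
   - oplus_zero a b h eps (op_inverse (interval_operator bc a b h h' M eps)) F p)
  \<le> (low * cross + gap) * (gap + 2 * cross * (low + gap)) * \<rho> ^ 3 * normS F"
proof -
 define n where "n = normS F"
 have n: "0 \<le> n" by (simp add: n_def l2_norm_nonneg)
 interpret Q: coercive_form "leb I" "dom1 bc" q "1 / ((16 + 4 / (pi^2 * c0)) * \<rho>^2)"
  by (rule interval_coercive_form[OF rho_pos rho_b rho_eq])
 define w where "w = op_inverse (strip_operator bc a b h M eps) F"
 define F0 where "F0 = mode_component a b h eps F"
 define x0 where "x0 = op_inverse (interval_operator bc a b h h' M eps) F0"
 note F0 = mode_component[OF F, folded F0_def]
 have W: "w \<in> dom2 bc" "k \<in> dom2 bc ==> A w k = innerS F k" for k
  using op_inverse_solves[OF strip_invertible[of bc, unfolded strip_operator_def] F] unfolding w_def strip_operator_def .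
 have X0: "x0 \<in> dom1 bc" "k \<in> dom1 bc ==> q x0 k = innerI F0 k" for k
  using op_inverse_solves[OF interval_invertible[of bc, unfolded interval_operator_def] F0(1)] unfolding x0_def interval_operator_def .
 define \<xi> u where "\<xi> = pair w phi" and "u = rest w"
 obtain v g where r: "rep1 bc \<xi> v g" and u: "u \<in> dom2 bc" and z: "AE x in lborel. pair u phi x = 0"
  using rest[OF W(1), folded \<xi>_def u_def] .
 define f where "f = lift \<xi>"
 have f: "f \<in> dom2 bc" unfolding f_def by (rule lift_in_domain[OF r])
 have weq: "w = (%z. u z + 1 * f z)" by (simp add: rest_def u_def f_def \<xi>_def)
 have Aw: "A w k = A u k + A f k" if "k \<in> dom2 bc" for k
  using strip_form_lincomb[OF u f that, of 1] unfolding weq[symmetric] by simp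
 have G: "is_weak_grad S u (weak_grad S u)" by (rule H1_weak_grad[OF strip_domainD(1)[OF u]])
 note gp = complement_gap[OF u G z] and mp = mode_norm_le[OF r]
 define X Y where "X = sqrt (q \<xi> \<xi>)" and "Y = sqrt (A u u)"
 have XY: "0 \<le> X" "0 \<le> Y" "q \<xi> \<xi> = X^2" "A u u = Y^2" using gp(1) mp(1) by (auto simp: X_def Y_def)
 define d where "d = cross * sqrt \<rho>"
 have d: "0 \<le> d" "d \<le> 1 / 2" using consts_pos(4) rho_pos rho_cross by (auto simp: d_def)
 have cr: "\<bar>A u f\<bar> \<le> d * (X * Y)" using cross_le[OF u z r] by (simp add: X_def Y_def f_def d_def)
 have cancel: "s \<le> k" if "s^2 \<le> k * s" "0 \<le> s" "0 \<le> k" for s k :: real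
  using that by (cases "s = 0") (auto simp: power2_eq_square mult_le_cancel_right)
 \<comment> \<open>test with the mode part, respectively with the complement\<close>
 have Xle: "X \<le> n * (low * \<rho>) + d * Y"
 proof (rule cancel)
  have "X^2 + A u f = innerS F f"
   using Aw[OF f] W(2)[OF f] strip_form_lift_lift[OF r r, folded f_def] XY by simp
  also have "... \<le> n * normI \<xi>"
   using l2_Cauchy_Schwarz[OF F strip_domainD(2)[OF f]] lift_norm[OF r] by (simp add: f_def n_def)
  also have "... \<le> n * (low * \<rho> * X)" using mp(2) n unfolding X_def by (intro mult_left_mono)
  finally show "X^2 \<le> (n * (low * \<rho>) + d * Y) * X" using cr by (simp add: algebra_simps)
 qed (use XY n d consts_pos rho_pos in simp_all)
 have Yle: "Y \<le> n * (gap * eps) + d * X"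
 proof (rule cancel)
  have "Y^2 + A u f = innerS F u" using Aw[OF u] W(2)[OF u] XY by (simp add: strip_form_commute[of f])
  also have "... \<le> n * normS u" using l2_Cauchy_Schwarz[OF F strip_domainD(2)[OF u]] by (simp add: n_def)
  also have "... \<le> n * (gap * eps * Y)" using gp(3) n unfolding Y_def by (intro mult_left_mono)
  finally show "Y^2 \<le> (n * (gap * eps) + d * X) * Y" using cr by (simp add: algebra_simps)
 qed (use XY n d consts_pos eps_pos in simp_all)
 have nn: "0 \<le> n * (low * \<rho>)" "0 \<le> n * (gap * \<rho>)" using n consts_pos rho_pos by auto
 have "X \<le> 2 * (low + gap) * \<rho> * n"
 proof -
  have "d * Y \<le> 1 / 2 * Y" "d * X \<le> 1 / 2 * X" using d XY by (intro mult_right_mono; simp)+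
  moreover have "n * (gap * eps) \<le> n * (gap * \<rho>)" using n consts_pos(2) eps_le(2) by (intro mult_left_mono) auto
  ultimately have "X \<le> 2 * (n * (low * \<rho>)) + 2 * (n * (gap * \<rho>))" using Xle Yle nn by linarith
  then show ?thesis by (simp add: algebra_simps)
 qed
 then have "d * X \<le> d * (2 * (low + gap) * \<rho> * n)" using d by (intro mult_left_mono)
 moreover have "n * (gap * eps) \<le> n * (gap * (\<rho> * sqrt \<rho>))" using n consts_pos(2) eps_le(1) by (intro mult_left_mono) auto
 ultimately have "Y \<le> n * (gap * (\<rho> * sqrt \<rho>)) + d * (2 * (low + gap) * \<rho> * n)" using Yle by linarith
 also have "... = (gap + 2 * cross * (low + gap)) * (\<rho> * sqrt \<rho>) * n" by (simp add: d_def algebra_simps)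
 finally have Y: "Y \<le> (gap + 2 * cross * (low + gap)) * (\<rho> * sqrt \<rho>) * n" .
 define e where "e = (%x. \<xi> x - x0 x)"
 have ed: "e \<in> dom1 bc" unfolding e_def by (rule Q.D_diff[OF rep1D(10)[OF r] X0(1)])
 then have "e \<in> H1 I" by (cases bc) auto
 then obtain ve ge where er: "rep1 bc e ve ge" using rep1_exists[OF ed H1_weak_grad] by blast
 define k where "k = lift e"
 have kd: "k \<in> dom2 bc" unfolding k_def by (rule lift_in_domain[OF er])
 \<comment> \<open>both solutions see the same source in the direction of the mode, so the sources cancel\<close>
 have "q e e = q \<xi> e - q x0 e" using Q.B_lincomb[OF rep1D(10)[OF r] X0(1) ed, of "-1"] by (simp add: e_def)
 also have "q x0 e = A w k"
  unfolding X0(2)[OF ed] W(2)[OF kd] unfolding k_def by (rule F0(2)[symmetric, OF rep1D(8)[OF er]])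
 also have "... = A u k + q \<xi> e" using Aw[OF kd] strip_form_lift_lift[OF r er] by (simp add: f_def k_def)
 finally have "q e e = - A u k" by simp
 then have "(sqrt (q e e))^2 \<le> (d * Y) * sqrt (q e e)"
  using cross_le[OF u z er, folded k_def Y_def d_def] mode_norm_le(1)[OF er] by (simp add: mult_ac)
 then have "sqrt (q e e) \<le> d * Y" by (rule cancel) (use d XY mode_norm_le(1)[OF er] in simp_all)
 then have "low * \<rho> * sqrt (q e e) \<le> low * \<rho> * (d * Y)" using consts_pos rho_pos by (intro mult_left_mono) auto
 then have ne: "normS k \<le> low * \<rho> * (d * Y)" using mode_norm_le(2)[OF er] lift_norm[OF er] by (simp add: k_def)
 have "gap * eps * Y \<le> gap * (\<rho> * sqrt \<rho>) * Y" using eps_le(1) consts_pos(2) XY by (intro mult_right_mono mult_left_mono) auto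
 then have nu: "normS u \<le> gap * (\<rho> * sqrt \<rho>) * Y" using gp(3) by (simp add: Y_def)
 have "normS (%p. w p - lift x0 p) = normS (%p. u p + k p)"
  unfolding weq f_def k_def e_def mode_lift_eq by (simp add: algebra_simps)
 also have "... \<le> normS u + normS k" by (rule l2_norm_add[OF strip_domainD(2)[OF u] strip_domainD(2)[OF kd]])
 also have "... \<le> (low * cross + gap) * (\<rho> * sqrt \<rho>) * Y" using nu ne by (simp add: d_def algebra_simps)
 also have "... \<le> (low * cross + gap) * (\<rho> * sqrt \<rho>) * ((gap + 2 * cross * (low + gap)) * (\<rho> * sqrt \<rho>) * n)"
  using consts_pos rho_pos by (intro mult_left_mono Y) auto
 also have "... = (low * cross + gap) * (gap + 2 * cross * (low + gap)) * (\<rho> * \<rho> * (sqrt \<rho> * sqrt \<rho>)) * n" by (simp only: mult_ac)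
 also have "\<rho> * \<rho> * (sqrt \<rho> * sqrt \<rho>) = \<rho> ^ 3" using rho_pos by (simp add: power3_eq_cube)
 finally show ?thesis unfolding w_def x0_def F0_def n_def oplus_zero_def .
qed

end

section \<open>Profiles given on the interval only\<close>

text \<open>All objects depend only on the values of the profile and its derivative on the interval.\<close>

context
 fixes a b \<epsilon> :: real and h H :: line_fun
 assumes a: "0 < a" and b: "0 < b" and eq: "\<forall>x\<in>{-a..b}. H x = h x"
begin

lemma strip_cong: "strip a b H \<epsilon> = strip a b h \<epsilon>"
 using eq by (auto simp: strip_def)

lemma strip_operator_cong: "strip_operator bc a b H M \<epsilon> = strip_operator bc a b h M \<epsilon>"
proof -
 have ends: "H (-a) = h (-a)" "H b = h b" using eq a b by auto
 have "vanishes_bottom_top a b H \<epsilon> u = vanishes_bottom_top a b h \<epsilon> u" for u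
  unfolding vanishes_bottom_top_def strip_cong by (intro arg_cong[where f = Ex] ext arg_cong2[where f = conj] refl AE_cong) (simp add: eq)
 moreover have "vanishes_sides a b H \<epsilon> u = vanishes_sides a b h \<epsilon> u" for u
  unfolding vanishes_sides_def strip_cong ends ..
 ultimately have "strip_domain bc a b H \<epsilon> = strip_domain bc a b h \<epsilon>" by (cases bc) (simp_all add: strip_cong)
 then show ?thesis by (simp add: strip_operator_def strip_form_def[abs_def] strip_cong)
qed

lemma interval_operator_cong:
 assumes eq': "\<forall>x\<in>{-a..b}. H' x = h' x"
 shows "interval_operator bc a b H H' M \<epsilon> = interval_operator bc a b h h' M \<epsilon>"
proof -
 have "interval_form a b H H' M \<epsilon> u v = interval_form a b h h' M \<epsilon> u v" for u v
  unfolding interval_form_def by (rule integral_cong_fun) (simp_all add: potential_def eq eq')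
 then have "interval_form a b H H' M \<epsilon> = interval_form a b h h' M \<epsilon>" by (intro ext)
 then show ?thesis by (simp add: interval_operator_def)
qed

lemma mode_lift_cong: "p \<in> strip a b h \<epsilon> ==> mode_lift H \<epsilon> \<xi> p = mode_lift h \<epsilon> \<xi> p"
 by (auto simp: strip_def mode_lift_def eq)

lemma mode_component_cong: "mode_component a b H \<epsilon> f = mode_component a b h \<epsilon> f"
proof -
 let ?N = "leb (strip a b h \<epsilon>)"
 have sp: "space ?N = strip a b h \<epsilon>" by (simp add: space_restrict_space)
 have L: "u \<in> L2 ?N \<longleftrightarrow> v \<in> L2 ?N" if "\<And>p. p \<in> space ?N ==> u p = v p" for u v :: plane_fun
  unfolding L2_def mem_Collect_eq using that
  by (intro arg_cong2[where f = conj] measurable_cong Bochner_Integration.integrable_cong) auto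
 have I: "l2_inner ?N u (mode_lift H \<epsilon> \<eta>) = l2_inner ?N v (mode_lift h \<epsilon> \<eta>)" if "\<And>p. p \<in> space ?N ==> u p = v p" for u v \<eta>
  unfolding l2_inner_def using that by (intro integral_cong_fun) (auto simp: sp mode_lift_cong)
 have "(%p. f p - mode_lift H \<epsilon> \<xi> p) \<in> orth_compl ?N (mode_space a b H \<epsilon>) \<longleftrightarrow>
   (%p. f p - mode_lift h \<epsilon> \<xi> p) \<in> orth_compl ?N (mode_space a b h \<epsilon>)" for \<xi>
 proof -
  have d: "f p - mode_lift H \<epsilon> \<xi> p = f p - mode_lift h \<epsilon> \<xi> p" if "p \<in> space ?N" for p using that by (simp add: sp mode_lift_cong)
  show ?thesis unfolding orth_compl_def mode_space_def by (simp add: L[OF d] I[OF d])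
 qed
 then show ?thesis unfolding mode_component_def strip_cong by simp
qed

end

text \<open>Near the maximum the expansion bounds $M-h$ from below by half of its leading term.\<close>

lemma expansion_lower_bound:
 fixes h p :: line_fun
 assumes e: "(%x. h x - (M - c * p x powr m)) \<in> O[F](%x. p x powr (m + 1))" and c: "c > 0"
  and F: "F \<le> at (0 :: real)" and p: "\<forall>\<^sub>F x in F. p x = \<bar>x\<bar>"
 shows "\<forall>\<^sub>F x in F. c / 2 * \<bar>x\<bar> powr m \<le> M - h x"
proof -
 obtain C where C: "C > 0" "\<forall>\<^sub>F x in F. norm (h x - (M - c * p x powr m)) \<le> C * norm (p x powr (m + 1))"
  using landau_o.bigE[OF e] by blast
 have "\<forall>\<^sub>F x in at (0 :: real). \<bar>x\<bar> < c / (2 * C)"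
  unfolding eventually_at using c C by (intro exI[of _ "c / (2 * C)"]) (auto simp: dist_real_def)
 then have "\<forall>\<^sub>F x in F. \<bar>x\<bar> < c / (2 * C)" by (rule filter_leD[OF F])
 then show ?thesis using C(2) p
 proof eventually_elim
  case (elim x)
  have "C * \<bar>x\<bar> \<le> c / 2" using elim(1) C(1) by (simp add: field_simps)
  then have "C * \<bar>x\<bar> * \<bar>x\<bar> powr m \<le> c / 2 * \<bar>x\<bar> powr m" by (intro mult_right_mono) auto
  moreover have "\<bar>x\<bar> powr (m + 1) = \<bar>x\<bar> * \<bar>x\<bar> powr m" by (simp add: powr_add)
  ultimately show ?case using elim(2,3) by (auto simp: mult.assoc abs_le_iff)
 qed
qed

text \<open>The profile is continued by its end values. The growth condition near zero comes from the expansion, and away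
 from zero from compactness and the strict maximum. Finiteness of the one-dimensional form for the constant function
 gives square integrability of $h'$.\<close>

lemma profile_exists:
 fixes a b M c_plus c_minus m :: real and h h' :: line_fun
 assumes a: "a > 0" and b: "b > 0"
  and hc: "continuous_on {-a..b} h" and hp: "\<forall>x\<in>{-a..b}. h x > 0"
  and max: "\<forall>x\<in>{-a..b} - {0}. h x < h 0"
  and C1: "\<forall>x\<in>{-a..b} - {0}. (h has_real_derivative h' x) (at x within {-a..b})"
   "continuous_on ({-a..b} - {0}) h'"
  and M: "M > 0" and cp: "c_plus > 0" "c_minus > 0" and m: "m \<ge> 1"
  and ex: "(%x. h x - (M - c_plus * x powr m)) \<in> O[at_right 0](%x. x powr (m + 1))"
   "(%x. h x - (M - c_minus * \<bar>x\<bar> powr m)) \<in> O[at_left 0](%x. \<bar>x\<bar> powr (m + 1))"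
  and fin: "\<forall>\<epsilon>>0. \<forall>\<xi>\<in>H1 {-a..b}. integrable (leb {-a..b}) (%x. potential h h' M \<epsilon> x * (\<xi> x)^2)"
 obtains l c0 H H' where "profile a b M l m c0 H H'"
  "\<forall>x\<in>{-a..b}. H x = h x" "\<forall>x\<in>{-a..b}. H' x = h' x"
proof -
 let ?I = "{-a..b}"
 define cl where "cl x = max (-a) (min b x)" for x
 define H where "H x = h (cl x)" for x
 define H' where "H' x = indicator (?I - {0}) x * h' x + indicator {0} x * h' 0" for x
 have cl: "cl x \<in> ?I" "x \<in> ?I ==> cl x = x" for x using a b by (auto simp: cl_def)
 have Heq: "H x = h x" "H' x = h' x" if "x \<in> ?I" for x using that cl(2) by (auto simp: H_def H'_def indicator_def)
 have Hc: "continuous_on UNIV H" unfolding H_def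
  by (rule continuous_on_compose2[OF hc]) (use cl(1) in \<open>auto simp: cl_def intro!: continuous_intros\<close>)
 have m0: "H' \<in> borel_measurable borel"
 proof -
  have "(%x. indicator (?I - {0}) x * h' x) \<in> borel_measurable borel"
   using borel_measurable_continuous_on_indicator[OF _ C1(2)] by simp
  then show ?thesis unfolding H'_def by (rule borel_measurable_add) simp
 qed
 obtain xl where xl: "xl \<in> ?I" "\<And>y. y \<in> ?I ==> h xl \<le> h y"
  using continuous_attains_inf[OF compact_Icc _ hc] a b by auto
 have lp: "h xl > 0" using hp xl(1) by blast
 obtain C where C: "\<forall>\<^sub>F x in at_right 0. norm (h x - (M - c_plus * x powr m)) \<le> C * norm (x powr (m + 1))"
  using landau_o.bigE[OF ex(1)] by blast
 \<comment> \<open>the constant of the expansion is the value of the continuous profile at zero\<close>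
 have hM: "h 0 = M"
 proof -
  have id: "((%x. x) \<longlongrightarrow> 0) (at_right (0 :: real))" by (rule tendsto_ident_at)
  have ev: "\<forall>\<^sub>F x in at_right (0 :: real). 0 \<le> x" using eventually_at_right_less[of 0] by (rule eventually_mono) simp
  have p: "((%x. x powr r) \<longlongrightarrow> 0) (at_right (0 :: real))" if "r > 0" for r
   by (rule tendsto_zero_powrI[OF id tendsto_const ev that])
  have "((%x. h x - (M - c_plus * x powr m)) \<longlongrightarrow> 0) (at_right 0)"
  proof (rule Lim_null_comparison[OF C])
   have "((%x. C * x powr (m + 1)) \<longlongrightarrow> C * 0) (at_right 0)" by (intro tendsto_intros p) (use m in simp)
   then show "((%x. C * norm (x powr (m + 1))) \<longlongrightarrow> 0) (at_right 0)" by simp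
  qed
  moreover have "((%x. M - c_plus * x powr m) \<longlongrightarrow> M - c_plus * 0) (at_right 0)" by (intro tendsto_intros p) (use m in simp)
  ultimately have "((%x. (h x - (M - c_plus * x powr m)) + (M - c_plus * x powr m)) \<longlongrightarrow> 0 + (M - c_plus * 0)) (at_right 0)"
   by (rule tendsto_add)
  then have l1: "(h \<longlongrightarrow> M) (at_right 0)" by simp
  have "isCont H 0" using Hc by (simp add: continuous_on_eq_continuous_at)
  then have "(H \<longlongrightarrow> h 0) (at_right 0)" using Heq(1)[of 0] a b by (auto simp: isCont_def filterlim_at_split)
  moreover have "\<forall>\<^sub>F x in at_right 0. H x = h x"
   unfolding eventually_at_right_field using b a Heq(1) by (intro exI[of _ b]) auto
  ultimately have "(h \<longlongrightarrow> h 0) (at_right 0)" by (simp add: tendsto_cong)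
  from tendsto_unique[OF _ this l1] show ?thesis by simp
 qed
 have hM': "h x < M" if "x \<in> ?I" "x \<noteq> 0" for x using max hM that by auto
 have hle: "h x \<le> M" if "x \<in> ?I" for x using hM hM'[OF that] by (cases "x = 0") auto
 have "\<exists>c>0. \<forall>x\<in>?I. c * \<bar>x\<bar> powr m \<le> M - h x"
 proof -
  have e1: "\<forall>\<^sub>F x in at_right 0. c_plus / 2 * \<bar>x\<bar> powr m \<le> M - h x"
   by (rule expansion_lower_bound[OF ex(1) cp(1) at_le[OF subset_UNIV]])
    (use eventually_at_right_less[of "0 :: real"] in \<open>auto elim: eventually_mono\<close>)
  have e2: "\<forall>\<^sub>F x in at_left 0. c_minus / 2 * \<bar>x\<bar> powr m \<le> M - h x"
   by (rule expansion_lower_bound[OF ex(2) cp(2) at_le[OF subset_UNIV]]) simp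
  obtain d1 where d1: "d1 > 0" "\<And>x. 0 < x ==> x < d1 ==> c_plus / 2 * \<bar>x\<bar> powr m \<le> M - h x"
   using e1 unfolding eventually_at_right_field by blast
  obtain d2 where d2: "d2 < 0" "\<And>x. d2 < x ==> x < 0 ==> c_minus / 2 * \<bar>x\<bar> powr m \<le> M - h x"
   using e2 unfolding eventually_at_left_field by blast
  \<comment> \<open>also at most \<open>b\<close>, so that the complement of $(-d,d)$ in the interval is not empty\<close>
  define d where "d = min (min d1 (- d2)) b"
  have d: "0 < d" "d \<le> d1" "d \<le> - d2" "d \<le> b" using d1 d2 b by (auto simp: d_def)
  let ?J = "?I - {-d<..<d}"
  have Jc: "compact ?J" by (rule compact_diff) auto
  have "b \<in> ?J" using d a b by auto
  then have "?J \<noteq> {}" by blast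
  then obtain xm where xm: "xm \<in> ?J" "\<And>y. y \<in> ?J ==> h y \<le> h xm"
   using continuous_attains_sup[OF Jc _ continuous_on_subset[OF hc]] by blast
  define \<mu> where "\<mu> = M - h xm"
  have \<mu>: "0 < \<mu>" using hM'[of xm] xm(1) d(1) by (auto simp: \<mu>_def)
  define c where "c = min (min (c_plus / 2) (c_minus / 2)) (\<mu> / (a + b) powr m)"
  have ab: "0 < (a + b) powr m" using a b by simp
  have c: "0 < c" "c \<le> c_plus / 2" "c \<le> c_minus / 2" "c \<le> \<mu> / (a + b) powr m"
   unfolding c_def using cp \<mu> ab by (simp, linarith+)
  have "c * \<bar>x\<bar> powr m \<le> M - h x" if x: "x \<in> ?I" for x
  proof (cases "x \<in> ?J")
   case True
   have "c * \<bar>x\<bar> powr m \<le> \<mu> / (a + b) powr m * (a + b) powr m"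
    using x a b m c \<mu> ab by (intro mult_mono powr_mono2) auto
   also have "... \<le> M - h x" using xm(2)[OF True] ab by (simp add: \<mu>_def)
   finally show ?thesis .
  next
   case False
   then have s: "-d < x" "x < d" using x by auto
   have le: "c * \<bar>x\<bar> powr m \<le> k * \<bar>x\<bar> powr m" if "c \<le> k" for k using that by (rule mult_right_mono) simp
   consider "x = 0" | "x > 0" | "x < 0" by linarith
   then show ?thesis
   proof cases
    case 1 then show ?thesis using hle[OF x] m by simp
   next
    case 2
    have "x < d1" using s d by linarith
    from d1(2)[OF 2 this] show ?thesis by (rule order_trans[OF le[OF c(2)]])
   next
    case 3
    have "d2 < x" using s d by linarith
    from d2(2)[OF this 3] show ?thesis by (rule order_trans[OF le[OF c(3)]])
   qed
  qed
  then show ?thesis using c(1) by blast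
 qed
 then obtain c where c: "c > 0" "\<And>x. x \<in> ?I ==> c * \<bar>x\<bar> powr m \<le> M - h x" by blast
 have growth: "c / M ^ 3 * \<bar>x\<bar> powr m \<le> 1 / (h x)^2 - 1 / M^2" if x: "x \<in> ?I" for x
 proof -
  have hx: "0 < h x" "h x \<le> M" using hp hle x by auto
  have "c / M ^ 3 * \<bar>x\<bar> powr m \<le> (M - h x) / M ^ 3" using c(2)[OF x] M by (simp add: divide_right_mono)
  also have "... = (M - h x) * M / (M^2 * M^2)" using M by (simp add: power2_eq_square power3_eq_cube)
  also have "... \<le> (M - h x) * (M + h x) / ((h x)^2 * M^2)"
   using hx M by (intro frac_le mult_mono power_mono) auto
  also have "... = 1 / (h x)^2 - 1 / M^2" using hx M by (simp add: field_simps power2_eq_square)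
  finally show ?thesis .
 qed
 have sq: "set_integrable lborel ?I (%x. (H' x)^2)"
 proof -
  have ab: "-a < b" using a b by simp
  have one: "(%_. 1) \<in> H1 ?I" by (rule H1I[OF ac_on_imp_weak_grad[OF ab ac_on_const L2_zero]])
  have V: "set_integrable lborel ?I (potential h h' M 1)"
   using fin[rule_format, of 1, OF _ one] by (simp add: set_integrable_def leb_integral(2))
  have hne: "h x \<noteq> 0" if "x \<in> ?I" for x using hp that by force
  define k :: real where "k = pi^2 / 3 + 1 / 4"
  have U: "set_integrable lborel ?I (%x. pi^2 / 1^2 * (1 / (h x)^2 - 1 / M^2))"
   by (intro borel_integrable_atLeastAtMost' continuous_intros hc) (use hne M in auto)
  have D: "set_integrable lborel ?I (%x. k * ((h' x)^2 / (h x)^2))"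
   using set_integral_diff(1)[OF V U] by (simp add: potential_def k_def)
  have kp: "0 < k" by (simp add: k_def add_pos_pos)
  have "integrable lborel (%x. indicator ?I x * (H' x)^2)"
  proof (rule integrable_dominated)
   show "integrable lborel (%x. M^2 / k * (indicator ?I x *\<^sub>R (k * ((h' x)^2 / (h x)^2))))"
    using D unfolding set_integrable_def by (rule integrable_mult_right)
   show "(%x. indicator ?I x * (H' x)^2) \<in> borel_measurable lborel" using m0 by simp
   have "norm (indicator ?I x * (H' x)^2) \<le> norm (M^2 / k * (indicator ?I x *\<^sub>R (k * ((h' x)^2 / (h x)^2))))" for x
   proof (cases "x \<in> ?I")
    case True
    have "(h x)^2 \<le> M^2" using hp hle True by (intro power_mono) (auto simp: less_imp_le)
    then have "(h' x)^2 \<le> M^2 * ((h' x)^2 / (h x)^2)"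
     using hne[OF True] mult_right_mono[of _ _ "(h' x)^2"] by (simp add: field_simps)
    moreover have "M^2 / k * (k * ((h' x)^2 / (h x)^2)) = M^2 * ((h' x)^2 / (h x)^2)"
     using kp by simp
    ultimately show ?thesis using True Heq(2)[OF True] kp by simp
   qed simp
   then show "AE x in lborel. norm (indicator ?I x * (H' x)^2) \<le> norm (M^2 / k * (indicator ?I x *\<^sub>R (k * ((h' x)^2 / (h x)^2))))"
    by simp
  qed
  then show ?thesis by (simp add: set_integrable_def)
 qed
 have "profile a b M (h xl) m (c / M ^ 3) H H'"
 proof
  show "(H has_real_derivative H' x) (at x)" if x: "x \<in> {-a<..<b}" "x \<noteq> 0" for x
  proof -
   have "(h has_real_derivative h' x) (at x within ?I)" using C1(1) x by auto
   then have "(h has_real_derivative H' x) (at x)" using x Heq(2)[of x] by (simp add: at_within_Icc_at)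
   then show ?thesis
    by (rule has_field_derivative_transform_within_open[OF _ open_greaterThanLessThan x(1)]) (simp add: Heq(1))
  qed
  have "continuous_on ({-a<..<b} - {0}) h'" by (rule continuous_on_subset[OF C1(2)]) auto
  then show "continuous_on ({-a<..<b} - {0}) H'" by (subst continuous_on_cong[OF refl Heq(2)]) auto
  show "h xl \<le> H x" "H x \<le> M" for x unfolding H_def using xl(2) hle cl(1) by auto
  show "H 0 = M" using Heq(1)[of 0] hM a b by simp
  show "0 < c / M ^ 3" using c(1) M by simp
  show "c / M ^ 3 * \<bar>x\<bar> powr m \<le> 1 / (H x)^2 - 1 / M^2" if "x \<in> ?I" for x using growth[OF that] Heq(1)[OF that] by simp
 qed (fact a b Hc lp m0 sq m)+
 then show ?thesis using that Heq by blast
qed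

lemma op_norm_le:
 assumes "\<And>f. f \<in> L2 N ==> l2_norm N (T f) \<le> C * l2_norm N f" and C: "0 \<le> C"
 shows "\<bar>op_norm N T\<bar> \<le> C"
proof -
 let ?D = "{f \<in> L2 N. l2_norm N f \<le> 1}"
 have le: "l2_norm N (T f) \<le> C" if "f \<in> ?D" for f
 proof -
  have "C * l2_norm N f \<le> C * 1" using that C by (intro mult_left_mono) auto
  then show ?thesis using assms(1)[of f] that by auto
 qed
 have z: "(%_. 0) \<in> ?D" by (simp add: L2_zero l2_norm_def l2_inner_def)
 have bdd: "bdd_above ((%f. l2_norm N (T f)) ` ?D)" using le by (auto simp: bdd_above_def)
 have "op_norm N T \<le> C" unfolding op_norm_def by (rule cSUP_least) (use z le in auto)
 moreover have "0 \<le> op_norm N T" unfolding op_norm_def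
  using cSUP_upper[OF z bdd] l2_norm_nonneg[of N "T (%_. 0)"] by linarith
 ultimately show ?thesis by simp
qed

theorem theorem2p2:
 fixes a b M c_plus c_minus m \<alpha> :: real and h h' :: "real \<Rightarrow> real" and bc :: bdry_cond
 assumes "a > 0" and "b > 0"
  and "continuous_on {-a..b} h" and "\<forall>x\<in>{-a..b}. h x > 0"
  and max_at_0: "\<forall>x\<in>{-a..b} - {0}. h x < h 0"
  and C1: "\<forall>x\<in>{-a..b} - {0}. (h has_real_derivative h' x) (at x within {-a..b})"
   "continuous_on ({-a..b} - {0}) h'"
  and "M > 0" and "c_plus > 0" and "c_minus > 0" and "m \<ge> 1"
  and expansion:
   "(\<lambda>x. h x - (M - c_plus * x powr m)) \<in> O[at_right 0](\<lambda>x. x powr (m + 1))"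
   "(\<lambda>x. h x - (M - c_minus * \<bar>x\<bar> powr m)) \<in> O[at_left 0](\<lambda>x. \<bar>x\<bar> powr (m + 1))"
  and form_finite_on_H1: "\<forall>\<epsilon>>0. \<forall>\<xi>\<in>H1 {-a..b}.
   integrable (leb {-a..b}) (\<lambda>x. potential h h' M \<epsilon> x * (\<xi> x)\<^sup>2)"
  and "\<alpha> = 2 / (m + 2)"
 shows "(\<forall>\<^sub>F \<epsilon> in at_right 0.
      boundedly_invertible (leb (strip a b h \<epsilon>)) (strip_operator bc a b h M \<epsilon>) \<and>
      boundedly_invertible (leb {-a..b}) (interval_operator bc a b h h' M \<epsilon>)) \<and>
     (\<lambda>\<epsilon>. op_norm (leb (strip a b h \<epsilon>))
      (\<lambda>f p. op_inverse (strip_operator bc a b h M \<epsilon>) f p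
         - oplus_zero a b h \<epsilon> (op_inverse (interval_operator bc a b h h' M \<epsilon>)) f p))
      \<in> O[at_right 0](\<lambda>\<epsilon>. \<epsilon> powr (3 * \<alpha>))"
proof -
 obtain l c0 H H' where P: "profile a b M l m c0 H H'" and eq: "\<forall>x\<in>{-a..b}. H x = h x" "\<forall>x\<in>{-a..b}. H' x = h' x"
  using profile_exists[OF assms(1-14)] .
 interpret profile a b M l m c0 H H' by (rule P)
 have \<alpha>: "0 < \<alpha>" "\<alpha> * (2 + m) = 2" using \<open>m \<ge> 1\<close> unfolding \<open>\<alpha> = 2 / (m + 2)\<close> by (simp_all add: field_simps)
 define C where "C = (low * cross + gap) * (gap + 2 * cross * (low + gap))"
 have ev: "\<forall>\<^sub>F \<epsilon> in at_right (0 :: real). 0 < \<epsilon>" by (rule eventually_at_right_less)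
 have "((%\<epsilon>. \<epsilon> powr \<alpha>) \<longlongrightarrow> 0) (at_right (0 :: real))"
  by (rule tendsto_zero_powrI[OF tendsto_ident_at tendsto_const _ \<alpha>(1)]) (use ev in \<open>auto elim: eventually_mono\<close>)
 then have small: "\<forall>\<^sub>F \<epsilon> in at_right (0 :: real). \<epsilon> powr \<alpha> < r" if "r > 0" for r
  using that by (rule order_tendstoD(2))
 have e1: "\<forall>\<^sub>F \<epsilon> in at_right (0 :: real). \<epsilon> powr \<alpha> < 1 \<and> \<epsilon> powr \<alpha> < b / 3"
  using b_pos by (intro eventually_conj small) auto
 have "((%\<epsilon>. cross * sqrt (\<epsilon> powr \<alpha>)) \<longlongrightarrow> cross * sqrt 0) (at_right (0 :: real))"
  by (intro tendsto_intros) fact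
 then have e2: "\<forall>\<^sub>F \<epsilon> in at_right (0 :: real). cross * sqrt (\<epsilon> powr \<alpha>) < 1 / 2" by (rule order_tendstoD(2)) simp
 have scaled: "\<forall>\<^sub>F \<epsilon> in at_right 0. scaled_strip a b M l m c0 H H' \<epsilon> (\<epsilon> powr \<alpha>)"
  using ev e1 e2
 proof eventually_elim
  case (elim \<epsilon>)
  have "(\<epsilon> powr \<alpha>)^2 = \<epsilon> powr (\<alpha> * 2)" by (simp add: powr_powr[symmetric])
  moreover have "(\<epsilon> powr \<alpha>) powr m = \<epsilon> powr (\<alpha> * m)" by (rule powr_powr)
  ultimately have "(\<epsilon> powr \<alpha>)^2 * (\<epsilon> powr \<alpha>) powr m = \<epsilon> powr (\<alpha> * (2 + m))"
   by (simp only: powr_add[symmetric] distrib_left)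
  also have "... = \<epsilon>^2" unfolding \<alpha>(2) using elim(1) by simp
  finally show ?case using elim by unfold_locales auto
 qed
 have inv: "\<forall>\<^sub>F \<epsilon> in at_right 0.
   boundedly_invertible (leb (strip a b h \<epsilon>)) (strip_operator bc a b h M \<epsilon>) \<and>
   boundedly_invertible (leb {-a..b}) (interval_operator bc a b h h' M \<epsilon>)"
  using scaled
 proof eventually_elim
  case (elim \<epsilon>)
  then interpret s: scaled_strip a b M l m c0 H H' \<epsilon> "\<epsilon> powr \<alpha>" .
  show ?case
   using s.strip_invertible[of bc] s.interval_invertible[of bc]
   unfolding strip_cong[OF a_pos b_pos eq(1)] strip_operator_cong[OF a_pos b_pos eq(1)] interval_operator_cong[OF a_pos b_pos eq] by simp
 qed
 have "(%\<epsilon>. op_norm (leb (strip a b h \<epsilon>)) (%f p. op_inverse (strip_operator bc a b h M \<epsilon>) f p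
   - oplus_zero a b h \<epsilon> (op_inverse (interval_operator bc a b h h' M \<epsilon>)) f p)) \<in> O[at_right 0](%\<epsilon>. \<epsilon> powr (3 * \<alpha>))"
 proof (rule bigoI)
  show "\<forall>\<^sub>F \<epsilon> in at_right 0. norm (op_norm (leb (strip a b h \<epsilon>)) (%f p. op_inverse (strip_operator bc a b h M \<epsilon>) f p
   - oplus_zero a b h \<epsilon> (op_inverse (interval_operator bc a b h h' M \<epsilon>)) f p)) \<le> C * norm (\<epsilon> powr (3 * \<alpha>))"
   using scaled ev
  proof eventually_elim
   case (elim \<epsilon>)
   then interpret s: scaled_strip a b M l m c0 H H' \<epsilon> "\<epsilon> powr \<alpha>" by simp
   note cong = strip_cong[OF a_pos b_pos eq(1)] strip_operator_cong[OF a_pos b_pos eq(1)] interval_operator_cong[OF a_pos b_pos eq]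
   have C: "0 \<le> C" unfolding C_def using s.consts_pos by simp
   have p3: "(\<epsilon> powr \<alpha>) ^ 3 = \<epsilon> powr (3 * \<alpha>)" using elim(2) by (simp add: mult.commute[of 3] powr_powr[symmetric])
   have "l2_norm (leb (strip a b h \<epsilon>)) (%p. op_inverse (strip_operator bc a b h M \<epsilon>) f p
     - oplus_zero a b h \<epsilon> (op_inverse (interval_operator bc a b h h' M \<epsilon>)) f p) \<le> C * \<epsilon> powr (3 * \<alpha>) * l2_norm (leb (strip a b h \<epsilon>)) f"
    if f: "f \<in> L2 (leb (strip a b h \<epsilon>))" for f
   proof -
    have "l2_norm (leb (strip a b h \<epsilon>)) (%p. op_inverse (strip_operator bc a b h M \<epsilon>) f p
      - oplus_zero a b h \<epsilon> (op_inverse (interval_operator bc a b h h' M \<epsilon>)) f p)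
     = l2_norm (leb (strip a b h \<epsilon>)) (%p. op_inverse (strip_operator bc a b h M \<epsilon>) f p
      - oplus_zero a b H \<epsilon> (op_inverse (interval_operator bc a b h h' M \<epsilon>)) f p)"
     unfolding l2_norm_def l2_inner_def oplus_zero_def mode_component_cong[OF a_pos b_pos eq(1)]
     by (intro arg_cong[where f = sqrt] integral_cong_fun) (simp_all add: space_restrict_space mode_lift_cong[OF a_pos b_pos eq(1)])
    then show ?thesis
     using s.resolvent_difference[of f bc, unfolded cong p3 C_def[symmetric]] f by simp
   qed
   from op_norm_le[OF this] C show ?case by simp
  qed
 qed
 with inv show ?thesis by blast
qed

end
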